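(* Let $d_1,d_2\ge 1$ and let $(\mathbf X_i,\mathbf Y_i)$, $i=1,2,\ldots$, be independent copies of a random vector $(\mathbf X,\mathbf Y)$, where $\mathbf X=(X^{(1)},\ldots,X^{(d_1)})$ takes values in $[0,1]^{d_1}$ and $\mathbf Y$ takes values in $\mathbb R^{d_2}$ (row vectors). Assume that the distribution function $C(\mathbf u)=\mathbf P(\mathbf X\le \mathbf u)$ of $\mathbf X$ is a copula with a density $c$, i.e. $C(\mathbf u)=\int_{\mathbf 0}^{\mathbf u}c(\mathbf v)\,d\mathbf v$ for $\mathbf u\in[0,1]^{d_1}$. For $\mathbf u\in[0,1]^{d_1}$ put $$\mathbf Q_n(\mathbf u)=\sum_{j=1}^n \mathbf Y_j\,\mathbf 1(\mathbf X_j\le \mathbf u),\qquad \mathbf m(\mathbf u)=\mathbf E(\mathbf Y\mid \mathbf X=\mathbf u),\qquad \mathbf f(\mathbf u)=\int_{\mathbf 0}^{\mathbf u}\mathbf m(\mathbf v)c(\mathbf v)\,d\mathbf v,$$ $$\sigma^2(\mathbf u)=\mathbf E\{(\mathbf Y-\mathbf m(\mathbf X))^T(\mathbf Y-\mathbf m(\mathbf X))\mid \mathbf X=\mathbf u\}.$$ If $\mathbf E\|\mathbf Y\|^2<\infty$, then, as $n\to\infty$, $$\widetilde{\mathbf Q}_n=\frac{\mathbf Q_n-n\mathbf f}{\sqrt n}\Rightarrow \mathbf Q,$$ where $\mathbf Q$ is a centered $\mathbb R^{d_2}$-valued Gaussian field on $[0,1]^{d_1}$ with covariance $$K(\mathbf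 u_1,\mathbf u_2)=\mathbf E\,\mathbf Q^T(\mathbf u_1)\mathbf Q(\mathbf u_2)=\int_{\mathbf 0}^{\min(\mathbf u_1,\mathbf u_2)}\sigma^2(\mathbf v)c(\mathbf v)\,d\mathbf v+\int_{\mathbf 0}^{\min(\mathbf u_1,\mathbf u_2)}\mathbf m^T(\mathbf v)\mathbf m(\mathbf v)c(\mathbf v)\,d\mathbf v-\int_{\mathbf 0}^{\mathbf u_1}\mathbf m^T(\mathbf v)c(\mathbf v)\,d\mathbf v\int_{\mathbf 0}^{\mathbf u_2}\mathbf m(\mathbf v)c(\mathbf v)\,d\mathbf v,$$ for $\mathbf u_1,\mathbf u_2\in[0,1]^{d_1}$.
   Context: Vectors are row vectors; $\|\cdot\|$ is the Euclidean norm. The inequality $\mathbf x\le\mathbf u$ between vectors in $[0,1]^{d_1}$ and $\min(\mathbf u_1,\mathbf u_2)$ are taken coordinatewise, and $\int_{\mathbf 0}^{\mathbf u}$ denotes the integral over the box $\{\mathbf v\in[0,1]^{d_1}:\mathbf v\le\mathbf u\}$. A copula is a distribution function on $[0,1]^{d_1}$ with marginals uniform on $[0,1]$. The symbol $\Rightarrow$ denotes weak convergence of random fields in the uniform topology, i.e. with respect to the supremum metric on bounded functions $[0,1]^{d_1}\to\mathbb R^{d_2}$: $\mathbf E^*g(\widetilde{\mathbf Q}_n)\to\mathbf E g(\mathbf Q)$ for every bounded functional $g$ that is continuous in the supremum norm ($\mathbf E^*$ is outer expectation, used because of possible non-measurability). The limit field is understood to have almost surely continuous trajectories. *)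

theory Defs
  imports "HOL-Probability.Probability"
begin

text \<open>
  On \<open>real ^ 'n\<close> the library order is coordinatewise and \<open>1\<close> is the all-ones vector, so
  \<open>{0..1}\<close> is the unit cube and, for \<open>u\<close> in it, \<open>{0..u}\<close> is the box of all points
  \<open>v\<close> of the cube with \<open>v \<le> u\<close>. Row vectors are elements of \<open>real ^ 'n\<close>.
\<close>

text \<open>The matrix \<open>x\<^sup>T y\<close> for row vectors \<open>x\<close> and \<open>y\<close>.\<close>
definition outer :: "real ^ 'm \<Rightarrow> real ^ 'n \<Rightarrow> real ^ 'n ^ 'm" where
  "outer x y = (\<chi> i j. x $ i * y $ j)"

definition vmin :: "real ^ 'n \<Rightarrow> real ^ 'n \<Rightarrow> real ^ 'n" where
  "vmin u v = (\<chi> i. min (u $ i) (v $ i))"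

definition joint_cdf :: "'a measure \<Rightarrow> ('a \<Rightarrow> real ^ 'n) \<Rightarrow> real ^ 'n \<Rightarrow> real" where
  "joint_cdf M X u = measure M {\<omega> \<in> space M. X \<omega> \<le> u}"

definition is_copula :: "(real ^ 'n \<Rightarrow> real) \<Rightarrow> bool" where
  "is_copula C \<longleftrightarrow> (\<exists>\<mu> :: (real ^ 'n) measure.
     prob_space \<mu> \<and> sets \<mu> = sets borel \<and> measure \<mu> {0..1} = 1 \<and>
     (\<forall>u \<in> {0..1}. C u = measure \<mu> {v. v \<le> u}) \<and>
     (\<forall>i. distr \<mu> borel (\<lambda>v. v $ i) = uniform_measure lborel {0..1}))"

definition has_copula_density :: "(real ^ 'n \<Rightarrow> real) \<Rightarrow> (real ^ 'n \<Rightarrow> real) \<Rightarrow> bool" where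
  "has_copula_density C c \<longleftrightarrow>
     c \<in> borel_measurable borel \<and> (\<forall>v \<in> {0..1}. 0 \<le> c v) \<and>
     (\<forall>u \<in> {0..1}. C u = (LINT v:{0..u}|lborel. c v))"

text \<open>\<open>h\<close> is a version of the function \<open>x \<mapsto> E (Z | X = x)\<close>.\<close>
definition cond_exp_version ::
    "'a measure \<Rightarrow> ('a \<Rightarrow> 'b :: topological_space) \<Rightarrow> ('a \<Rightarrow> real) \<Rightarrow> ('b \<Rightarrow> real) \<Rightarrow> bool" where
  "cond_exp_version M X Z h \<longleftrightarrow>
     h \<in> borel_measurable borel \<and>
     (AE \<omega> in M. real_cond_exp M (vimage_algebra (space M) X borel) Z \<omega> = h (X \<omega>))"

definition cond_mean_version ::
    "'a measure \<Rightarrow> ('a \<Rightarrow> real ^ 'm) \<Rightarrow> ('a \<Rightarrow> real ^ 'n) \<Rightarrow> (real ^ 'm \<Rightarrow> real ^ 'n) \<Rightarrow> bool" where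
  "cond_mean_version M X Y m \<longleftrightarrow> (\<forall>k. cond_exp_version M X (\<lambda>\<omega>. Y \<omega> $ k) (\<lambda>u. m u $ k))"

definition cond_cov_version ::
    "'a measure \<Rightarrow> ('a \<Rightarrow> real ^ 'm) \<Rightarrow> ('a \<Rightarrow> real ^ 'n) \<Rightarrow> (real ^ 'm \<Rightarrow> real ^ 'n) \<Rightarrow>
     (real ^ 'm \<Rightarrow> real ^ 'n ^ 'n) \<Rightarrow> bool" where
  "cond_cov_version M X Y m \<sigma>2 \<longleftrightarrow>
     (\<forall>k l. cond_exp_version M X (\<lambda>\<omega>. outer (Y \<omega> - m (X \<omega>)) (Y \<omega> - m (X \<omega>)) $ k $ l)
                              (\<lambda>u. \<sigma>2 u $ k $ l))"

definition Qsum ::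
    "(nat \<Rightarrow> 'a \<Rightarrow> real ^ 'm) \<Rightarrow> (nat \<Rightarrow> 'a \<Rightarrow> real ^ 'n) \<Rightarrow> nat \<Rightarrow> real ^ 'm \<Rightarrow> 'a \<Rightarrow> real ^ 'n" where
  "Qsum Xs Ys n u \<omega> = (\<Sum>j = 1..n. indicat_real {x. x \<le> u} (Xs j \<omega>) *\<^sub>R Ys j \<omega>)"

definition fmean :: "(real ^ 'm \<Rightarrow> real) \<Rightarrow> (real ^ 'm \<Rightarrow> real ^ 'n) \<Rightarrow> real ^ 'm \<Rightarrow> real ^ 'n" where
  "fmean c m u = (LINT v:{0..u}|lborel. c v *\<^sub>R m v)"

definition Qtilde ::
    "(nat \<Rightarrow> 'a \<Rightarrow> real ^ 'm) \<Rightarrow> (nat \<Rightarrow> 'a \<Rightarrow> real ^ 'n) \<Rightarrow> (real ^ 'm \<Rightarrow> real) \<Rightarrow>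
     (real ^ 'm \<Rightarrow> real ^ 'n) \<Rightarrow> nat \<Rightarrow> real ^ 'm \<Rightarrow> 'a \<Rightarrow> real ^ 'n" where
  "Qtilde Xs Ys c m n u \<omega> = (Qsum Xs Ys n u \<omega> - real n *\<^sub>R fmean c m u) /\<^sub>R sqrt (real n)"

definition Kcov ::
    "(real ^ 'm \<Rightarrow> real) \<Rightarrow> (real ^ 'm \<Rightarrow> real ^ 'n) \<Rightarrow> (real ^ 'm \<Rightarrow> real ^ 'n ^ 'n) \<Rightarrow>
     real ^ 'm \<Rightarrow> real ^ 'm \<Rightarrow> real ^ 'n ^ 'n" where
  "Kcov c m \<sigma>2 u\<^sub>1 u\<^sub>2 =
     (LINT v:{0..vmin u\<^sub>1 u\<^sub>2}|lborel. c v *\<^sub>R \<sigma>2 v) +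
     (LINT v:{0..vmin u\<^sub>1 u\<^sub>2}|lborel. c v *\<^sub>R outer (m v) (m v)) -
     outer (LINT v:{0..u\<^sub>1}|lborel. c v *\<^sub>R m v) (LINT v:{0..u\<^sub>2}|lborel. c v *\<^sub>R m v)"

text \<open>Degenerate (constant) normal distributions are allowed.\<close>
definition normal_rv :: "'a measure \<Rightarrow> ('a \<Rightarrow> real) \<Rightarrow> bool" where
  "normal_rv N Z \<longleftrightarrow> Z \<in> borel_measurable N \<and>
     ((\<exists>\<mu> \<sigma>. 0 < \<sigma> \<and> distributed N lborel Z (\<lambda>x. ennreal (normal_density \<mu> \<sigma> x))) \<or>
      (\<exists>a. AE \<omega> in N. Z \<omega> = a))"

definition gaussian_field ::
    "'a measure \<Rightarrow> 'i set \<Rightarrow> ('i \<Rightarrow> 'a \<Rightarrow> real ^ 'n) \<Rightarrow> bool" where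
  "gaussian_field N T Q \<longleftrightarrow>
     (\<forall>u \<in> T. Q u \<in> borel_measurable N) \<and>
     (\<forall>F a. finite F \<and> F \<subseteq> T \<longrightarrow> normal_rv N (\<lambda>\<omega>. \<Sum>u\<in>F. a u \<bullet> Q u \<omega>))"

definition centered_gaussian_field ::
    "'a measure \<Rightarrow> 'i set \<Rightarrow> ('i \<Rightarrow> 'a \<Rightarrow> real ^ 'n) \<Rightarrow> bool" where
  "centered_gaussian_field N T Q \<longleftrightarrow>
     gaussian_field N T Q \<and> (\<forall>u \<in> T. (LINT \<omega>|N. Q u \<omega>) = 0)"

text \<open>
  Bounded functions on \<open>T\<close> with the supremum metric; a function on \<open>T\<close> is represented by its
  extension that is \<open>undefined\<close> off \<open>T\<close>.
\<close>
definition bounded_funs :: "'i set \<Rightarrow> ('i \<Rightarrow> 'b :: metric_space) set" where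
  "bounded_funs T = {x \<in> extensional T. bounded (x ` T)}"

text \<open>The value 0 outside \<open>bounded_funs T\<close> is the convention that \<open>Metric_space\<close> needs.\<close>
definition sup_dist :: "'i set \<Rightarrow> ('i \<Rightarrow> 'b :: metric_space) \<Rightarrow> ('i \<Rightarrow> 'b) \<Rightarrow> real" where
  "sup_dist T x y =
     (if x \<in> bounded_funs T \<and> y \<in> bounded_funs T then SUP u\<in>T. dist (x u) (y u) else 0)"

lemma bdd_above_dist_bounded_funs:
  assumes "x \<in> bounded_funs T" "y \<in> bounded_funs T"
  shows "bdd_above ((\<lambda>u. dist (x u) (y u)) ` T)"
proof -
  have "bounded (x ` T \<union> y ` T)"
    using assms by (simp add: bounded_funs_def)
  then obtain B where "\<forall>p \<in> x ` T \<union> y ` T. \<forall>q \<in> x ` T \<union> y ` T. dist p q \<le> B"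
    by (auto simp only: bounded_two_points)
  then show ?thesis
    by (intro bdd_aboveI[of _ B]) auto
qed

lemma Metric_space_bounded_funs:
  assumes "T \<noteq> {}"
  shows "Metric_space (bounded_funs T) (sup_dist T)"
proof
  fix x y :: "'a \<Rightarrow> 'b"
  obtain t where t: "t \<in> T" using assms by blast
  show "sup_dist T x y = sup_dist T y x"
    by (simp add: sup_dist_def dist_commute)
  show "0 \<le> sup_dist T x y"
    by (auto simp: sup_dist_def intro!: cSUP_upper2[OF _ t] bdd_above_dist_bounded_funs)
next
  fix x y :: "'a \<Rightarrow> 'b"
  assume xy: "x \<in> bounded_funs T" "y \<in> bounded_funs T"
  show "sup_dist T x y = 0 \<longleftrightarrow> x = y"
  proof
    assume 0: "sup_dist T x y = 0"
    show "x = y"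
    proof (rule extensionalityI[of _ T])
      fix u assume "u \<in> T"
      then have "dist (x u) (y u) \<le> sup_dist T x y"
        using xy by (auto simp: sup_dist_def intro!: cSUP_upper bdd_above_dist_bounded_funs)
      then show "x u = y u" using 0 by simp
    qed (use xy in \<open>auto simp: bounded_funs_def\<close>)
  qed (use xy assms in \<open>simp add: sup_dist_def\<close>)
next
  fix x y z :: "'a \<Rightarrow> 'b"
  assume xyz: "x \<in> bounded_funs T" "y \<in> bounded_funs T" "z \<in> bounded_funs T"
  have "dist (x u) (z u) \<le> sup_dist T x y + sup_dist T y z" if "u \<in> T" for u
  proof -
    have "dist (x u) (y u) \<le> sup_dist T x y" "dist (y u) (z u) \<le> sup_dist T y z"
      using xyz that by (auto simp: sup_dist_def intro!: cSUP_upper bdd_above_dist_bounded_funs)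
    then show ?thesis using dist_triangle[of "x u" "z u" "y u"] by linarith
  qed
  then have "(SUP u\<in>T. dist (x u) (z u)) \<le> sup_dist T x y + sup_dist T y z"
    using assms by (intro cSUP_least) auto
  then show "sup_dist T x z \<le> sup_dist T x y + sup_dist T y z"
    using xyz by (simp add: sup_dist_def)
qed

abbreviation sup_topology :: "'i set \<Rightarrow> ('i \<Rightarrow> 'b :: metric_space) topology" where
  "sup_topology T \<equiv> Metric_space.mtopology (bounded_funs T) (sup_dist T)"

text \<open>
  Meant for functions \<open>Z\<close> bounded on a probability space, the only ones it is used for. For such
  \<open>Z\<close> it makes no difference that only integrable real-valued majorants \<open>U\<close> are admitted, since
  a measurable majorant can be replaced by its minimum with an upper bound of \<open>Z\<close>.
\<close>
definition outer_expectation :: "'a measure \<Rightarrow> ('a \<Rightarrow> real) \<Rightarrow> real" where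
  "outer_expectation M Z =
     Inf {LINT \<omega>|M. U \<omega> | U. integrable M U \<and> (\<forall>\<omega> \<in> space M. Z \<omega> \<le> U \<omega>)}"

text \<open>
  Weak convergence of the fields \<open>Z n\<close> on \<open>M\<close> to the field \<open>Q\<close> on \<open>N\<close>, for the supremum metric.
  The trajectories of \<open>Q\<close> need to be bounded only almost surely, so \<open>g (Q)\<close> may be arbitrary on a
  null set and its expectation is taken with respect to the completion of \<open>N\<close>. The measurability
  clause says that this expectation is a genuine one and not the default value of the integral.
\<close>
definition weakly_converges_sup ::
    "'i set \<Rightarrow> 'a measure \<Rightarrow> (nat \<Rightarrow> 'i \<Rightarrow> 'a \<Rightarrow> 'b :: metric_space) \<Rightarrow>
     'c measure \<Rightarrow> ('i \<Rightarrow> 'c \<Rightarrow> 'b) \<Rightarrow> bool" where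
  "weakly_converges_sup T M Z N Q \<longleftrightarrow>
     (\<forall>n. \<forall>\<omega> \<in> space M. (\<lambda>u\<in>T. Z n u \<omega>) \<in> bounded_funs T) \<and>
     (AE \<omega> in N. (\<lambda>u\<in>T. Q u \<omega>) \<in> bounded_funs T) \<and>
     (\<forall>g :: ('i \<Rightarrow> 'b) \<Rightarrow> real.
        continuous_map (sup_topology T) euclideanreal g \<and> bounded (g ` bounded_funs T) \<longrightarrow>
        (\<lambda>\<omega>. g (\<lambda>u\<in>T. Q u \<omega>)) \<in> borel_measurable (completion N) \<and>
        (\<lambda>n. outer_expectation M (\<lambda>\<omega>. g (\<lambda>u\<in>T. Z n u \<omega>)))
          \<longlonglongrightarrow> (LINT \<omega>|completion N. g (\<lambda>u\<in>T. Q u \<omega>)))"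

end

theory Submission
  imports Defs
begin

text \<open>
  The field \<open>Qtilde\<close> is the normalized centered sum of the functions \<open>(x, y) \<mapsto> 1(x \<le> u) y\<close>
  at the sample points, so the covariance follows from the defining property of
  conditional expectations, and its finite-dimensional distributions converge by the central limit
  theorem; passing from characteristic functions to continuous functions of several coordinates uses
  the Stone--Weierstrass theorem for trigonometric polynomials.

  The main point is asymptotic equicontinuity when \<open>Y\<close> has only two moments. Symmetrization,
  one observation at a time, replaces the centered sum by a sum with independent random signs
  \<open>\<epsilon> j\<close>. Conditionally on the sample, the weights \<open>(Y j)\<^sup>2\<close> define a dyadic grid
  adapted to the data; a chaining argument over the cells of this grid, using fourth moments of the
  sign sums, bounds the supremum over all boxes by a multiple of
  \<open>\<theta> * sqrt W + sqrt V / \<theta> ^ 3\<close> for every \<open>\<theta> > 0\<close>, where \<open>W\<close> is the total weight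
  and \<open>V\<close> bounds the weight of any one strip of width \<open>1 / r\<close> in a coordinate direction. After
  division by the sample size \<open>n\<close>, \<open>W\<close> is bounded in mean and \<open>V\<close> is small for large \<open>r\<close>,
  because the marginals are uniform and the squares are integrable.

  The Gaussian values at dyadic points come from a Cholesky decomposition of the covariance; they
  inherit the equicontinuity estimate, hence extend to a continuous field. Weak convergence is then
  checked for Lipschitz functionals by discretizing the field on a dyadic grid, and extended to
  bounded continuous ones by Lipschitz approximation from below.
\<close>

subsection \<open>Chaining for sign sums over boxes\<close>

text \<open>With two moments a single observation can carry much of the total weight, so a fixed
  partition of the cube does not control the weight of its cells. Given the sample, the weights are
  plain numbers; measuring each coordinate by accumulated weight makes the chaining constants
  independent of the law of the data. Second moments of sign sums would not suffice: summed over the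
  cells of one level they only return the total weight, without decay. Fourth moments lead to
  squared cell weights, whose sum is at most the total weight times the heaviest cell, and this
  decays geometrically. Chaining then gives \<open>sqrt W * root 8 (V / W)\<close>, a product of
  dependent random quantities; the parameter \<theta> separates them, so that means of
  \<open>W\<close> and \<open>V\<close> suffice. Suprema are taken over countable sets of pairs,
  where measurability is automatic; one-sided continuity of the sample fields recovers the whole
  cube. Continuity of the limit does not come from Gaussian theory: the estimate for the sample
  fields is carried over through finite maxima. Working with characteristic functions admits
  covariances of any rank.\<close>

lemma sum_PiE_insert:
  assumes "a \<notin> A"
  shows "(\<Sum>f\<in>PiE (insert a A) B. g f) = (\<Sum>b\<in>B a. \<Sum>f\<in>PiE A B. g (f(a := b)))"
proof -
  have inj: "inj_on (\<lambda>(b, f). f(a := b)) (B a \<times> PiE A B)"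
    using assms by (auto intro!: inj_onI dest: fun_cong simp: PiE_def extensional_def fun_eq_iff split: if_splits)
      (metis fun_upd_apply)+
  have "(\<Sum>f\<in>PiE (insert a A) B. g f) = (\<Sum>(b, f)\<in>B a \<times> PiE A B. g (f(a := b)))"
    unfolding PiE_insert_eq by (subst sum.reindex[OF inj]) (auto simp: case_prod_unfold)
  then show ?thesis by (simp add: sum.cartesian_product)
qed

text \<open>Distributivity serves twice in the chaining: it splits the indicator of a box into
  indicators of cells, and it turns the sum over all level vectors into a power of one geometric
  sum.\<close>

lemma prod_sum_PiE:
  fixes g :: "'i \<Rightarrow> 'k \<Rightarrow> 'c :: comm_semiring_1"
  assumes "finite A"
  shows "(\<Prod>i\<in>A. \<Sum>k\<in>B i. g i k) = (\<Sum>f\<in>PiE A B. \<Prod>i\<in>A. g i (f i))"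
  using assms
proof (induction A)
  case (insert a A)
  have "(\<Prod>i\<in>A. g i ((f(a := b)) i)) = (\<Prod>i\<in>A. g i (f i))" for f b
    using insert by (intro prod.cong) auto
  then show ?case
    using insert
    by (simp add: sum_PiE_insert sum_distrib_right sum_distrib_left del: fun_upd_apply)
      (simp add: sum_distrib_left[symmetric] sum.swap[of _ "B a"])
qed simp

text \<open>The expectation over random signs is a finite sum over this set divided by its
  cardinality; no further probability space is needed. Extensionality outside \<open>I\<close> keeps
  the set finite.\<close>

definition signs :: "'j set \<Rightarrow> ('j \<Rightarrow> real) set" where
  "signs I = PiE I (\<lambda>_. {-1, 1})"

lemma card_signs: "finite I \<Longrightarrow> card (signs I) = 2 ^ card I"
  by (simp add: signs_def card_PiE numeral_2_eq_2)

lemma sum_signs_insert: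
  "j \<notin> I \<Longrightarrow> (\<Sum>\<epsilon>\<in>signs (insert j I). g \<epsilon>) = (\<Sum>\<epsilon>\<in>signs I. g (\<epsilon>(j := -1)) + g (\<epsilon>(j := 1)))"
  by (simp add: signs_def sum_PiE_insert sum.distrib)

text \<open>Adding an index replaces each sum by the two values with plus and minus the new term,
  and odd powers cancel. The constant 3 reproduces itself: the induction yields
  \<open>3 * s\<^sup>2 + 6 * a\<^sup>2 * s + a ^ 4\<close> per sign pattern, and enlarging the last
  coefficient to 3 completes the square. The middle term needs the exact second moment, hence the
  joint induction.\<close>

lemma sum_signs_moments:
  fixes y :: "'j \<Rightarrow> real"
  assumes "finite I" "A \<subseteq> I"
  shows "(\<Sum>\<epsilon>\<in>signs I. (\<Sum>j\<in>A. \<epsilon> j * y j)\<^sup>2) = 2 ^ card I * (\<Sum>j\<in>A. (y j)\<^sup>2)"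
    and "(\<Sum>\<epsilon>\<in>signs I. (\<Sum>j\<in>A. \<epsilon> j * y j) ^ 4) \<le> 2 ^ card I * (3 * (\<Sum>j\<in>A. (y j)\<^sup>2)\<^sup>2)"
  using assms
proof (induction I arbitrary: A)
  case empty
  { case 1 then show ?case by simp next case 2 then show ?case by simp }
next
  case (insert i I)
  have upd: "(\<Sum>j\<in>A - {i}. (\<epsilon>(i := b)) j * y j) = (\<Sum>j\<in>A - {i}. \<epsilon> j * y j)" for A b and \<epsilon> :: "'j \<Rightarrow> real"
    by (intro sum.cong) auto
  have split: "(\<Sum>j\<in>A. (\<epsilon>(i := b)) j * y j) = (if i \<in> A then b * y i else 0) + (\<Sum>j\<in>A - {i}. \<epsilon> j * y j)"
    if "A \<subseteq> insert i I" for A b and \<epsilon> :: "'j \<Rightarrow> real"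
  proof (cases "i \<in> A")
    case True
    then have "(\<Sum>j\<in>A. (\<epsilon>(i := b)) j * y j) = b * y i + (\<Sum>j\<in>A - {i}. (\<epsilon>(i := b)) j * y j)"
      using that insert(1) finite_subset[of A "insert i I"] by (subst sum.remove[of A i]) auto
    then show ?thesis using True by (simp only: upd if_True)
  next
    case False
    then have "A - {i} = A" by auto
    then show ?thesis using False upd[of \<epsilon> b A] by simp
  qed
  have split2: "(\<Sum>j\<in>A. (y j)\<^sup>2) = (if i \<in> A then (y i)\<^sup>2 else 0) + (\<Sum>j\<in>A - {i}. (y j)\<^sup>2)"
    if "A \<subseteq> insert i I" for A
    using that insert(1) finite_subset[of A "insert i I"]
    by (cases "i \<in> A") (auto simp: sum.remove[of A i] intro!: sum.cong)
  have sq: "(x - a)\<^sup>2 + (a + x)\<^sup>2 = 2 * a\<^sup>2 + 2 * x\<^sup>2" for a x :: real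
    by (simp add: power2_eq_square algebra_simps)
  have fo: "(x - a) ^ 4 + (a + x) ^ 4 = 2 * x ^ 4 + 12 * a\<^sup>2 * x\<^sup>2 + 2 * a ^ 4" for a x :: real
    by (simp add: power2_eq_square power4_eq_xxxx algebra_simps)
  {
    case 1
    then have sub: "A - {i} \<subseteq> I" by auto
    define a where "a = (if i \<in> A then y i else 0)"
    have "(\<Sum>\<epsilon>\<in>signs (insert i I). (\<Sum>j\<in>A. \<epsilon> j * y j)\<^sup>2)
        = (\<Sum>\<epsilon>\<in>signs I. 2 * a\<^sup>2 + 2 * (\<Sum>j\<in>A - {i}. \<epsilon> j * y j)\<^sup>2)"
      using insert(2) unfolding sum_signs_insert[OF insert(2)] split[OF 1]
      by (intro sum.cong refl) (auto simp: a_def sq)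
    also have "\<dots> = 2 ^ card (insert i I) * (\<Sum>j\<in>A. (y j)\<^sup>2)"
      using insert(1,2) unfolding split2[OF 1]
      by (simp add: sum.distrib sum_distrib_left[symmetric] insert.IH(1)[OF sub] card_signs a_def algebra_simps)
    finally show ?case .
  next
    case 2
    then have sub: "A - {i} \<subseteq> I" by auto
    define a where "a = (if i \<in> A then y i else 0)"
    define s where "s = (\<Sum>j\<in>A - {i}. (y j)\<^sup>2)"
    have "(\<Sum>\<epsilon>\<in>signs (insert i I). (\<Sum>j\<in>A. \<epsilon> j * y j) ^ 4)
        = (\<Sum>\<epsilon>\<in>signs I. 2 * (\<Sum>j\<in>A - {i}. \<epsilon> j * y j) ^ 4 + 12 * a\<^sup>2 * (\<Sum>j\<in>A - {i}. \<epsilon> j * y j)\<^sup>2 + 2 * a ^ 4)"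
      using insert(2) unfolding sum_signs_insert[OF insert(2)] split[OF 2]
      by (intro sum.cong refl) (auto simp: a_def fo)
    also have "\<dots> = 2 * (\<Sum>\<epsilon>\<in>signs I. (\<Sum>j\<in>A - {i}. \<epsilon> j * y j) ^ 4) + 12 * a\<^sup>2 * (2 ^ card I * s) + 2 * 2 ^ card I * a ^ 4"
      using insert(1,2)
      by (simp add: sum.distrib sum_distrib_left[symmetric] insert.IH(1)[OF sub] card_signs s_def)
    also have "\<dots> \<le> 2 * (2 ^ card I * (3 * s\<^sup>2)) + 12 * a\<^sup>2 * (2 ^ card I * s) + 2 * 2 ^ card I * a ^ 4"
      using insert.IH(2)[OF sub] by (simp add: s_def)
    also have "\<dots> \<le> 2 * (2 ^ card I * (3 * s\<^sup>2)) + 12 * a\<^sup>2 * (2 ^ card I * s) + 6 * 2 ^ card I * a ^ 4"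
      by simp
    also have "\<dots> = 2 ^ card (insert i I) * (3 * (a\<^sup>2 + s)\<^sup>2)"
      using insert(1,2) by (simp add: power2_eq_square power4_eq_xxxx algebra_simps)
    also have "a\<^sup>2 + s = (\<Sum>j\<in>A. (y j)\<^sup>2)"
      unfolding split2[OF 2] by (simp add: a_def s_def)
    finally show ?case .
  }
qed

section \<open>Dyadic decomposition of boxes and the chaining estimate\<close>

lemma floor_halve: "\<lfloor>x\<rfloor> div 2 = \<lfloor>x / 2 :: real\<rfloor>"
  by (simp add: floor_divide_real_eq_div[of 2 x, symmetric])

text \<open>This is the decomposition of the interval below \<open>t\<close> into dyadic intervals,
  one for each binary digit 1 of \<open>t\<close>. Passing to a finer level changes the comparison
  of the floors only if they agreed before and the new digit is 1 for \<open>t\<close> and 0 for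
  \<open>s\<close>, so the sum telescopes. The assumptions make the comparison false at level
  0.\<close>

lemma dyadic_comparison:
  fixes s t :: real
  assumes "0 \<le> s" "t < 1"
  shows "(\<Sum>k\<in>{1..K}. of_bool (odd \<lfloor>2 ^ k * t\<rfloor> \<and> \<lfloor>2 ^ k * s\<rfloor> = \<lfloor>2 ^ k * t\<rfloor> - 1))
           = (of_bool (\<lfloor>2 ^ K * s\<rfloor> < \<lfloor>2 ^ K * t\<rfloor>) :: real)"
proof (induction K)
  case 0
  have "\<lfloor>t\<rfloor> \<le> 0" "0 \<le> \<lfloor>s\<rfloor>" using assms by linarith+
  then have "\<not> \<lfloor>s\<rfloor> < \<lfloor>t\<rfloor>" by linarith
  then show ?case by simp
next
  case (Suc K)
  define a c where "a = \<lfloor>2 ^ Suc K * s\<rfloor>" "c = \<lfloor>2 ^ Suc K * t\<rfloor>"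
  have "\<lfloor>2 ^ K * s\<rfloor> = a div 2" "\<lfloor>2 ^ K * t\<rfloor> = c div 2"
    by (simp_all add: a_c_def floor_halve)
  then have "(\<Sum>k\<in>{1..Suc K}. of_bool (odd \<lfloor>2 ^ k * t\<rfloor> \<and> \<lfloor>2 ^ k * s\<rfloor> = \<lfloor>2 ^ k * t\<rfloor> - 1))
      = (of_bool (a div 2 < c div 2) + of_bool (odd c \<and> a = c - 1) :: real)"
    using Suc by (simp add: a_c_def)
  also have "\<dots> = of_bool (a < c)"
  proof -
    consider "a div 2 < c div 2" | "a div 2 = c div 2" | "a div 2 > c div 2" by linarith
    then show ?thesis by cases (auto elim!: oddE evenE; presburger)+
  qed
  finally show ?case by (simp add: a_c_def)
qed

lemma of_bool_Ball_prod:
  "finite A \<Longrightarrow> of_bool (\<forall>i\<in>A. P i) = (\<Prod>i\<in>A. of_bool (P i) :: real)"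
proof (induction A rule: finite_induct)
  case (insert x F)
  show ?case
    by (cases "P x") (simp_all add: insert.hyps insert.IH[symmetric])
qed simp

text \<open>Below the threshold \<alpha> the first term suffices; above it
  \<open>\<bar>z\<bar> / \<alpha>\<close> is at least 1 and may be cubed. It turns fourth moments
  into bounds for absolute values, and it later serves as a Young inequality.\<close>

lemma abs_le_add_power4:
  fixes z \<alpha> :: real
  assumes "0 < \<alpha>"
  shows "\<bar>z\<bar> \<le> \<alpha> + z ^ 4 / \<alpha> ^ 3"
proof (cases "\<bar>z\<bar> \<le> \<alpha>")
  case False
  then have "\<alpha> ^ 3 \<le> \<bar>z\<bar> ^ 3" using assms by (intro power_mono) auto
  then have "\<bar>z\<bar> * \<alpha> ^ 3 \<le> \<bar>z\<bar> * \<bar>z\<bar> ^ 3" by (intro mult_left_mono) auto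
  also have "\<dots> = z ^ 4" by (simp add: power4_eq_xxxx power3_eq_cube abs_mult[symmetric])
  finally have "\<bar>z\<bar> \<le> z ^ 4 / \<alpha> ^ 3" using assms by (simp add: field_simps)
  then show ?thesis using assms by linarith
next
  case True
  have "0 \<le> z ^ 4 / \<alpha> ^ 3" using assms by simp
  then show ?thesis using True by linarith
qed

lemma power_eq_half_less_1: "\<rho> ^ k = 1 / 2 \<Longrightarrow> \<rho> < 1" for \<rho> :: real
proof (rule ccontr)
  assume "\<rho> ^ k = 1 / 2" "\<not> \<rho> < 1"
  moreover from this have "1 \<le> \<rho> ^ k" by (intro one_le_power) simp
  ultimately show False by simp
qed

text \<open>
  Each coordinate is rescaled to the fraction of the total weight \<open>\<Sum>j. (y j)\<^sup>2\<close> that lies below it.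
  A box then splits into cells of a fixed finite family, one for each vector \<open>k\<close> of dyadic levels,
  and a cell of level \<open>k\<close> has relative weight at most \<open>2\<close> to the power \<open>- Max k\<close>. Since
  \<open>\<rho> ^ (8 * CARD('d)) = 1 / 2\<close>, this is at most the eighth power of \<open>\<Prod>i. \<rho> ^ k i\<close>, and the sum over
  all \<open>k\<close> becomes a product of geometric series.
\<close>
lemma chaining_bound:
  fixes x :: "'j \<Rightarrow> 'd::finite \<Rightarrow> real" and y :: "'j \<Rightarrow> real" and lab :: "'j \<Rightarrow> 's" and \<rho> p \<beta> :: real
  assumes fin: "finite I" and \<rho>: "0 < \<rho>" "\<rho> ^ (8 * CARD('d)) = 1 / 2" and p: "0 < p" and \<beta>: "0 < \<beta>"
    and W: "(\<Sum>j\<in>I. (y j)\<^sup>2) \<le> p\<^sup>2" and Wl: "\<And>a. (\<Sum>j | j \<in> I \<and> lab j = a. (y j)\<^sup>2) \<le> \<beta> ^ 8 * p\<^sup>2"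
  shows "\<exists>R. (\<forall>\<epsilon> a u. \<bar>\<Sum>j | j \<in> I \<and> lab j = a \<and> (\<forall>i. x j i \<le> u i). \<epsilon> j * y j\<bar> \<le> R \<epsilon>) \<and>
    (\<Sum>\<epsilon>\<in>signs I. R \<epsilon>) \<le> 2 ^ card I * (7 * p * \<beta> * (1 / (1 - \<rho>)) ^ CARD('d))"
proof -
  \<comment> \<open>Points of weight zero contribute nothing; without them the least relative weight
    \<gamma> is positive and a finite depth resolves all points.\<close>
  define J where "J = {j\<in>I. y j \<noteq> 0}"
  define wt where "wt A = (\<Sum>j\<in>A. (y j)\<^sup>2)" for A
  \<comment> \<open>The weight strictly below a point is compared with the weight up to and
    including \<open>v\<close>, so a point of \<open>J\<close> satisfies
    \<open>x j i \<le> v\<close> exactly if \<open>s\<close> is less than \<open>t\<close>, and then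
    the gap contains its own weight. The factor 2 makes \<open>t\<close> strictly less than 1, as
    \<open>dyadic_comparison\<close> requires.\<close>
  define s where "s i j = wt {j'\<in>J. x j' i < x j i} / (2 * p\<^sup>2)" for i j
  define t where "t i v = wt {j'\<in>J. x j' i \<le> v} / (2 * p\<^sup>2)" for i v
  have finJ: "finite J" and JI: "J \<subseteq> I" using fin by (auto simp: J_def)
  have wt_mono: "wt A \<le> wt B" if "A \<subseteq> B" "B \<subseteq> I" for A B
    unfolding wt_def using that fin finite_subset by (intro sum_mono2) auto
  have wt_nonneg: "0 \<le> wt A" for A unfolding wt_def by (intro sum_nonneg) auto
  have wtI: "wt I \<le> p\<^sup>2" using W by (simp add: wt_def)
  have p2: "0 < p\<^sup>2" using p by simp
  have \<rho>1: "\<rho> < 1" by (rule power_eq_half_less_1[OF \<rho>(2)])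
  have s0: "0 \<le> s i j" for i j using wt_nonneg p2 by (simp add: s_def)
  have t1: "t i v < 1" for i v
  proof -
    have "wt {j'\<in>J. x j' i \<le> v} \<le> p\<^sup>2" using wt_mono[of "{j'\<in>J. x j' i \<le> v}" I] JI wtI by fastforce
    then have "wt {j'\<in>J. x j' i \<le> v} < 2 * p\<^sup>2" using p2 by linarith
    then show ?thesis using p2 by (simp add: t_def)
  qed
  have gap: "(y j)\<^sup>2 / (2 * p\<^sup>2) \<le> t i v - s i j" if "j \<in> J" "x j i \<le> v" for i j v
  proof -
    have "wt {j'\<in>J. x j' i < x j i} + (y j)\<^sup>2 = wt (insert j {j'\<in>J. x j' i < x j i})"
      using finJ by (simp add: wt_def)
    also have "\<dots> \<le> wt {j'\<in>J. x j' i \<le> v}" using that JI by (intro wt_mono) auto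
    finally show ?thesis using p2 by (simp add: s_def t_def field_simps)
  qed
  have ngap: "t i v \<le> s i j" if "\<not> x j i \<le> v" for i j v
  proof -
    have "wt {j'\<in>J. x j' i \<le> v} \<le> wt {j'\<in>J. x j' i < x j i}" using that JI by (intro wt_mono) auto
    then show ?thesis using p2 by (simp add: s_def t_def divide_right_mono)
  qed
  define \<gamma> where "\<gamma> = Min (insert 1 ((\<lambda>j. (y j)\<^sup>2 / (2 * p\<^sup>2)) ` J))"
  have \<gamma>: "0 < \<gamma>" "\<And>j. j \<in> J \<Longrightarrow> \<gamma> \<le> (y j)\<^sup>2 / (2 * p\<^sup>2)"
    using finJ p by (auto simp: \<gamma>_def J_def)
  \<comment> \<open>At this depth the own weight of each point spans a whole dyadic interval, so
    comparing integer parts at level \<open>K\<close> decides \<open>x j i \<le> v\<close>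
    exactly.\<close>
  obtain K where K: "1 / \<gamma> < 2 ^ K" using real_arch_pow[of 2 "1 / \<gamma>"] by auto
  have cmp: "\<lfloor>2 ^ K * s i j\<rfloor> < \<lfloor>2 ^ K * t i v\<rfloor> \<longleftrightarrow> x j i \<le> v" if "j \<in> J" for i j v
  proof
    assume *: "x j i \<le> v"
    have "1 \<le> 2 ^ K * \<gamma>" using K \<gamma>(1) by (simp add: field_simps)
    also have "\<dots> \<le> 2 ^ K * (t i v - s i j)" using gap[OF that *] \<gamma>(2)[OF that] by (intro mult_left_mono) auto
    finally show "\<lfloor>2 ^ K * s i j\<rfloor> < \<lfloor>2 ^ K * t i v\<rfloor>" by (simp add: algebra_simps) linarith
  next
    assume *: "\<lfloor>2 ^ K * s i j\<rfloor> < \<lfloor>2 ^ K * t i v\<rfloor>"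
    show "x j i \<le> v"
    proof (rule ccontr)
      assume "\<not> x j i \<le> v"
      then have "2 ^ K * t i v \<le> 2 ^ K * s i j" using ngap by simp
      then have "\<lfloor>2 ^ K * t i v\<rfloor> \<le> \<lfloor>2 ^ K * s i j\<rfloor>" by (rule floor_mono)
      then show False using * by simp
    qed
  qed
  \<comment> \<open>One summand of \<open>dyadic_comparison\<close>: in coordinate \<open>i\<close>
    the point lies in the interval of level \<open>k\<close> that belongs to a digit 1 of
    \<open>t\<close>.\<close>
  define pc where "pc k i v j \<longleftrightarrow> odd \<lfloor>2 ^ k * t i v\<rfloor> \<and> \<lfloor>2 ^ k * s i j\<rfloor> = \<lfloor>2 ^ k * t i v\<rfloor> - 1" for k :: nat and i v j
  define KK where "KK = PiE (UNIV :: 'd set) (\<lambda>_. {1..K})"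
  have finKK: "finite KK" by (simp add: KK_def finite_PiE)
  have ind: "(of_bool (\<forall>i. x j i \<le> u i) :: real) = (\<Sum>k\<in>KK. of_bool (\<forall>i. pc (k i) i (u i) j))" if "j \<in> J" for j u
  proof -
    have "(of_bool (\<forall>i. x j i \<le> u i) :: real) = (\<Prod>i\<in>UNIV. of_bool (x j i \<le> u i))"
      using of_bool_Ball_prod[of UNIV "\<lambda>i. x j i \<le> u i"] by simp
    also have "\<dots> = (\<Prod>i\<in>UNIV. \<Sum>k\<in>{1..K}. of_bool (pc k i (u i) j))"
      unfolding pc_def dyadic_comparison[OF s0 t1] cmp[OF that] ..
    also have "\<dots> = (\<Sum>k\<in>KK. \<Prod>i\<in>UNIV. of_bool (pc (k i) i (u i) j))"
      unfolding KK_def by (rule prod_sum_PiE) simp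
    also have "\<dots> = (\<Sum>k\<in>KK. of_bool (\<forall>i. pc (k i) i (u i) j))"
      using of_bool_Ball_prod[of UNIV "\<lambda>i. pc (k i) i (u i) j" for k] by simp
    finally show ?thesis .
  qed
  \<comment> \<open>These cells are named by sample points and not by \<open>u\<close> or the label,
    so each level has finitely many of them for all boxes at once. This is what allows a supremum
    over \<open>u\<close> to be bounded by a finite sum.\<close>
  define cls where "cls k j0 = {j\<in>J. lab j = lab j0 \<and> (\<forall>i. \<lfloor>2 ^ k i * s i j\<rfloor> = \<lfloor>2 ^ k i * s i j0\<rfloor>)}" for k :: "'d \<Rightarrow> nat" and j0
  define r where "r k = (\<Prod>i\<in>UNIV. \<rho> ^ k i)" for k :: "'d \<Rightarrow> nat"
  have r0: "0 < r k" for k using \<rho>(1) by (simp add: r_def prod_pos)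
  \<comment> \<open>Only light cells are kept; \<open>wt_B\<close> shows that every nonempty piece
    of a box is light, so nothing is lost.\<close>
  define CC where "CC k = {A\<in>cls k ` J. wt A \<le> 2 * \<beta> ^ 4 * p\<^sup>2 * (r k) ^ 4}" for k
  have finCC: "finite (CC k)" for k using finJ by (simp add: CC_def)
  define \<alpha> where "\<alpha> k = p * \<beta> * r k" for k
  have \<alpha>0: "0 < \<alpha> k" for k using p \<beta> r0 by (simp add: \<alpha>_def)
  define R where "R \<epsilon> = (\<Sum>k\<in>KK. \<alpha> k + (\<Sum>A\<in>CC k. (\<Sum>j\<in>A. \<epsilon> j * y j) ^ 4 / \<alpha> k ^ 3))" for \<epsilon>
  have wt_B: "wt B \<le> 2 * \<beta> ^ 4 * p\<^sup>2 * (r k) ^ 4"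
    if B: "B = {j\<in>J. lab j = a \<and> (\<forall>i. pc (k i) i (u i) j)}" and ne: "B \<noteq> {}" for B k a u
  proof -
    have BJ: "B \<subseteq> J" "finite B" using B finJ by auto
    have 1: "wt B \<le> \<beta> ^ 8 * p\<^sup>2"
    proof -
      have "wt B \<le> wt {j. j \<in> I \<and> lab j = a}" using B JI by (intro wt_mono) auto
      then show ?thesis using Wl[of a] by (simp add: wt_def)
    qed
    \<comment> \<open>All weight of the piece lies between its lowest point in direction
      \<open>i\<close> and \<open>u i\<close>, and the corresponding \<open>s\<close> and
      \<open>t\<close> are at most two dyadic steps apart. In particular a heavy point occurs only
      at coarse levels.\<close>
    have 2: "wt B \<le> 4 * p\<^sup>2 / 2 ^ k i" for i
    proof -
      obtain j0 where j0: "j0 \<in> B" "\<And>j. j \<in> B \<Longrightarrow> x j0 i \<le> x j i"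
        using ex_min_if_finite[of "(\<lambda>j. x j i) ` B"] BJ ne by (auto simp: not_less)
      have pc: "\<lfloor>2 ^ k i * s i j\<rfloor> = \<lfloor>2 ^ k i * t i (u i)\<rfloor> - 1" if "j \<in> B" for j
        using that B by (auto simp: pc_def)
      have le: "x j i \<le> u i" if "j \<in> B" for j
      proof (rule ccontr)
        assume "\<not> x j i \<le> u i"
        then have "2 ^ k i * t i (u i) \<le> 2 ^ k i * s i j" using ngap by simp
        then have "\<lfloor>2 ^ k i * t i (u i)\<rfloor> \<le> \<lfloor>2 ^ k i * s i j\<rfloor>" by (rule floor_mono)
        then show False using pc[OF that] by simp
      qed
      have "wt B + wt {j'\<in>J. x j' i < x j0 i} = wt (B \<union> {j'\<in>J. x j' i < x j0 i})"
        unfolding wt_def using BJ finJ j0(2) by (subst sum.union_disjoint) (auto simp: not_less[symmetric])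
      also have "\<dots> \<le> wt {j'\<in>J. x j' i \<le> u i}"
        using BJ JI le[OF j0(1)] le by (intro wt_mono) auto
      finally have "wt B \<le> wt {j'\<in>J. x j' i \<le> u i} - wt {j'\<in>J. x j' i < x j0 i}" by simp
      also have "\<dots> = (t i (u i) - s i j0) * (2 * p\<^sup>2)"
        using p2 by (simp add: s_def t_def diff_divide_distrib[symmetric])
      finally have "wt B \<le> (t i (u i) - s i j0) * (2 * p\<^sup>2)" .
      moreover have "2 ^ k i * t i (u i) - 2 ^ k i * s i j0 \<le> 2" using pc[OF j0(1)] by linarith
      then have "t i (u i) - s i j0 \<le> 2 / 2 ^ k i" by (simp add: field_simps)
      then have "(t i (u i) - s i j0) * (2 * p\<^sup>2) \<le> 2 / 2 ^ k i * (2 * p\<^sup>2)" using p2 by (intro mult_right_mono) auto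
      ultimately show ?thesis by simp
    qed
    have "Max (range k) \<in> range k" by (intro Max_in) auto
    then obtain m where m: "k m = Max (range k)" by (metis imageE)
    have m: "k i \<le> k m" for i unfolding m by (intro Max_ge) auto
    have "(\<Sum>i\<in>UNIV. k i) \<le> CARD('d) * k m" using sum_bounded_above[of UNIV k "k m"] m by simp
    then have "\<rho> ^ (8 * (CARD('d) * k m)) \<le> \<rho> ^ (8 * (\<Sum>i\<in>UNIV. k i))"
      using \<rho>(1) \<rho>1 by (intro power_decreasing) auto
    moreover have "\<rho> ^ (8 * (CARD('d) * k m)) = (\<rho> ^ (8 * CARD('d))) ^ k m"
      by (simp only: mult.assoc[symmetric] power_mult)
    then have "\<rho> ^ (8 * (CARD('d) * k m)) = 1 / 2 ^ k m"
      unfolding \<rho>(2) by (simp add: power_one_over)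
    moreover have "r k = \<rho> ^ (\<Sum>i\<in>UNIV. k i)" by (simp add: r_def power_sum)
    ultimately have rk: "1 / 2 ^ k m \<le> r k ^ 8" by (simp add: power_mult[symmetric] mult.commute)
    \<comment> \<open>Both bounds for the same weight are used, one from the label and one from the
      level of the largest entry of \<open>k\<close>. Their geometric mean keeps decay in
      \<open>k\<close> together with a positive power of \<beta>.\<close>
    have "(wt B)\<^sup>2 \<le> (\<beta> ^ 8 * p\<^sup>2) * (4 * p\<^sup>2 * (1 / 2 ^ k m))"
      unfolding power2_eq_square[of "wt B"] using 1 2[of m] wt_nonneg by (intro mult_mono) auto
    also have "\<dots> \<le> (\<beta> ^ 8 * p\<^sup>2) * (4 * p\<^sup>2 * r k ^ 8)"
      using rk p2 \<beta> by (intro mult_left_mono) auto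
    also have "\<dots> = (2 * \<beta> ^ 4 * p\<^sup>2 * (r k) ^ 4)\<^sup>2"
      by (simp add: power_mult_distrib power_mult[symmetric])
    finally show ?thesis
      by (rule power2_le_imp_le) (use \<beta> p2 r0[of k] in \<open>simp add: less_imp_le\<close>)
  qed
  have bound: "\<bar>\<Sum>j | j \<in> I \<and> lab j = a \<and> (\<forall>i. x j i \<le> u i). \<epsilon> j * y j\<bar> \<le> R \<epsilon>" for \<epsilon> a u
  proof -
    define B where "B k = {j\<in>J. lab j = a \<and> (\<forall>i. pc (k i) i (u i) j)}" for k
    have "(\<Sum>j | j \<in> I \<and> lab j = a \<and> (\<forall>i. x j i \<le> u i). \<epsilon> j * y j)
        = (\<Sum>j\<in>J. of_bool (lab j = a) * (\<epsilon> j * y j) * of_bool (\<forall>i. x j i \<le> u i))"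
      using fin by (intro sum.mono_neutral_cong) (auto simp: J_def)
    also have "\<dots> = (\<Sum>j\<in>J. of_bool (lab j = a) * (\<epsilon> j * y j) * (\<Sum>k\<in>KK. of_bool (\<forall>i. pc (k i) i (u i) j)))"
      using ind by simp
    also have "\<dots> = (\<Sum>k\<in>KK. \<Sum>j\<in>J. of_bool (lab j = a) * (\<epsilon> j * y j) * of_bool (\<forall>i. pc (k i) i (u i) j))"
      by (simp add: sum_distrib_left sum.swap[of _ KK])
    also have "\<dots> = (\<Sum>k\<in>KK. \<Sum>j\<in>B k. \<epsilon> j * y j)"
      using finJ by (intro sum.cong refl sum.mono_neutral_cong_right) (auto simp: B_def)
    finally have "\<bar>\<Sum>j | j \<in> I \<and> lab j = a \<and> (\<forall>i. x j i \<le> u i). \<epsilon> j * y j\<bar> \<le> (\<Sum>k\<in>KK. \<bar>\<Sum>j\<in>B k. \<epsilon> j * y j\<bar>)"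
      by (simp only: sum_abs)
    also have "\<dots> \<le> R \<epsilon>"
      unfolding R_def
    proof (rule sum_mono)
      fix k
      have nn: "0 \<le> (\<Sum>j\<in>A. \<epsilon> j * y j) ^ 4 / \<alpha> k ^ 3" for A using \<alpha>0[of k] by simp
      show "\<bar>\<Sum>j\<in>B k. \<epsilon> j * y j\<bar> \<le> \<alpha> k + (\<Sum>A\<in>CC k. (\<Sum>j\<in>A. \<epsilon> j * y j) ^ 4 / \<alpha> k ^ 3)"
      proof (cases "B k = {}")
        case True
        then show ?thesis using \<alpha>0[of k] nn by (simp add: sum_nonneg add_nonneg_nonneg)
      next
        case False
        then obtain j0 where j0: "j0 \<in> B k" by auto
        \<comment> \<open>Membership fixes the integer part of \<open>s\<close> in every coordinate,
          so a nonempty piece is the full class of any of its members.\<close>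
        have "B k = cls k j0" using j0 by (auto simp: B_def cls_def pc_def)
        then have "B k \<in> CC k" using j0 wt_B[of "B k" a k u] False by (auto simp: CC_def B_def)
        then have "(\<Sum>j\<in>B k. \<epsilon> j * y j) ^ 4 / \<alpha> k ^ 3 \<le> (\<Sum>A\<in>CC k. (\<Sum>j\<in>A. \<epsilon> j * y j) ^ 4 / \<alpha> k ^ 3)"
          using finCC nn by (intro member_le_sum) auto
        then show ?thesis using abs_le_add_power4[OF \<alpha>0[of k], of "\<Sum>j\<in>B k. \<epsilon> j * y j"] by linarith
      qed
    qed
    finally show ?thesis .
  qed
  \<comment> \<open>One factor of each square is bounded by the weight allowed in
    \<open>CC k\<close>; the other factors add up to at most the total weight because classes of one
    level are disjoint.\<close>
  have sumCC: "(\<Sum>A\<in>CC k. (wt A)\<^sup>2) \<le> 2 * \<beta> ^ 4 * p ^ 4 * r k ^ 4" for k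
  proof -
    have "(\<Sum>A\<in>CC k. (wt A)\<^sup>2) \<le> (\<Sum>A\<in>CC k. 2 * \<beta> ^ 4 * p\<^sup>2 * r k ^ 4 * wt A)"
      unfolding power2_eq_square[of "wt _"] using wt_nonneg
      by (intro sum_mono mult_right_mono) (auto simp: CC_def)
    also have "\<dots> = 2 * \<beta> ^ 4 * p\<^sup>2 * r k ^ 4 * (\<Sum>A\<in>CC k. wt A)" by (simp add: sum_distrib_left)
    also have "\<dots> \<le> 2 * \<beta> ^ 4 * p\<^sup>2 * r k ^ 4 * p\<^sup>2"
    proof (rule mult_left_mono)
      have "\<forall>A\<in>CC k. finite A" using finJ by (auto simp: CC_def cls_def)
      moreover have "\<forall>A\<in>CC k. \<forall>B\<in>CC k. A \<noteq> B \<longrightarrow> A \<inter> B = {}" by (auto simp: CC_def cls_def)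
      ultimately have "(\<Sum>A\<in>CC k. wt A) = wt (\<Union> (CC k))" unfolding wt_def by (simp add: sum.Union_disjoint)
      also have "\<dots> \<le> wt I" using JI by (intro wt_mono) (auto simp: CC_def cls_def)
      finally show "(\<Sum>A\<in>CC k. wt A) \<le> p\<^sup>2" using wtI by linarith
    qed (use \<beta> p2 r0[of k] in \<open>simp add: less_imp_le\<close>)
    finally show ?thesis by (simp add: power2_eq_square power4_eq_xxxx algebra_simps)
  qed
  have "(\<Sum>\<epsilon>\<in>signs I. R \<epsilon>) = (\<Sum>k\<in>KK. 2 ^ card I * \<alpha> k + (\<Sum>A\<in>CC k. (\<Sum>\<epsilon>\<in>signs I. (\<Sum>j\<in>A. \<epsilon> j * y j) ^ 4) / \<alpha> k ^ 3))"
    unfolding R_def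
    by (simp add: sum.swap[of _ KK] sum.distrib card_signs[OF fin] sum.swap[of _ "CC _"] sum_divide_distrib)
      (simp add: sum_distrib_left)
  also have "\<dots> \<le> (\<Sum>k\<in>KK. 2 ^ card I * (7 * p * \<beta> * r k))"
  proof (rule sum_mono)
    fix k
    have "(\<Sum>A\<in>CC k. (\<Sum>\<epsilon>\<in>signs I. (\<Sum>j\<in>A. \<epsilon> j * y j) ^ 4) / \<alpha> k ^ 3) \<le> (\<Sum>A\<in>CC k. 2 ^ card I * (3 * (wt A)\<^sup>2) / \<alpha> k ^ 3)"
    proof (intro sum_mono divide_right_mono)
      fix A assume "A \<in> CC k"
      then have "A \<subseteq> I" using JI by (auto simp: CC_def cls_def)
      then show "(\<Sum>\<epsilon>\<in>signs I. (\<Sum>j\<in>A. \<epsilon> j * y j) ^ 4) \<le> 2 ^ card I * (3 * (wt A)\<^sup>2)"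
        unfolding wt_def by (rule sum_signs_moments(2)[OF fin])
    qed (use \<alpha>0[of k] in simp)
    also have "\<dots> = 2 ^ card I * 3 / \<alpha> k ^ 3 * (\<Sum>A\<in>CC k. (wt A)\<^sup>2)"
      by (simp add: sum_distrib_left sum_divide_distrib mult_ac)
    also have "\<dots> \<le> 2 ^ card I * 3 / \<alpha> k ^ 3 * (2 * \<beta> ^ 4 * p ^ 4 * r k ^ 4)"
      using sumCC[of k] \<alpha>0[of k] by (intro mult_left_mono) auto
    \<comment> \<open>The choice of \<alpha> balances its two contributions: the fourth moments give
      3 times 2 copies of \<alpha>, and the threshold itself gives one more, in total 7.\<close>
    also have "\<dots> = 2 ^ card I * (6 * p * \<beta> * r k)"
      using p \<beta> r0[of k] by (simp add: \<alpha>_def field_simps power3_eq_cube power4_eq_xxxx)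
    finally show "2 ^ card I * \<alpha> k + (\<Sum>A\<in>CC k. (\<Sum>\<epsilon>\<in>signs I. (\<Sum>j\<in>A. \<epsilon> j * y j) ^ 4) / \<alpha> k ^ 3) \<le> 2 ^ card I * (7 * p * \<beta> * r k)"
      by (simp add: \<alpha>_def algebra_simps)
  qed
  also have "\<dots> = 2 ^ card I * (7 * p * \<beta> * (\<Sum>k\<in>KK. r k))" by (simp add: sum_distrib_left)
  also have "(\<Sum>k\<in>KK. r k) = (\<Prod>i\<in>(UNIV :: 'd set). \<Sum>k\<in>{1..K}. \<rho> ^ k)"
    unfolding KK_def r_def by (rule prod_sum_PiE[symmetric]) simp
  also have "\<dots> = (\<Sum>k\<in>{1..K}. \<rho> ^ k) ^ CARD('d)" by simp
  also have "2 ^ card I * (7 * p * \<beta> * \<dots>) \<le> 2 ^ card I * (7 * p * \<beta> * (1 / (1 - \<rho>)) ^ CARD('d))"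
  proof -
    have "(\<Sum>k\<in>{1..K}. \<rho> ^ k) \<le> (\<Sum>k<Suc K. \<rho> ^ k)" using \<rho>(1) by (intro sum_mono2) auto
    also have "\<dots> \<le> 1 / (1 - \<rho>)" using \<rho>(1) \<rho>1 by (subst sum_gp_strict) (auto simp: divide_right_mono)
    finally show ?thesis using p \<beta> \<rho>(1) by (intro mult_left_mono power_mono sum_nonneg) auto
  qed
  finally show ?thesis using bound by blast
qed

text \<open>The preceding bound is of the form \<open>sqrt W\<close> times the eighth root of
  \<open>V / W\<close>. Applying \<open>abs_le_add_power4\<close> to that root with threshold
  \<theta> produces one summand in \<open>W\<close> and one in \<open>V\<close>, which can be
  averaged separately. If all weights vanish the quotient is meaningless, but so are the
  sums.\<close>

lemma chaining_bound_young:
  fixes x :: "'j \<Rightarrow> 'd::finite \<Rightarrow> real" and y :: "'j \<Rightarrow> real" and lab :: "'j \<Rightarrow> 's" and \<rho> \<theta> V :: real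
  assumes fin: "finite I" and \<rho>: "0 < \<rho>" "\<rho> ^ (8 * CARD('d)) = 1 / 2" and \<theta>: "0 < \<theta>"
    and V: "\<And>a. (\<Sum>j | j \<in> I \<and> lab j = a. (y j)\<^sup>2) \<le> V"
  shows "\<exists>R. (\<forall>\<epsilon> a u. \<bar>\<Sum>j | j \<in> I \<and> lab j = a \<and> (\<forall>i. x j i \<le> u i). \<epsilon> j * y j\<bar> \<le> R \<epsilon>) \<and>
    (\<Sum>\<epsilon>\<in>signs I. R \<epsilon>) \<le> 2 ^ card I * (7 * (1 / (1 - \<rho>)) ^ CARD('d) * (\<theta> * sqrt (\<Sum>j\<in>I. (y j)\<^sup>2) + sqrt V / \<theta> ^ 3))"
proof -
  define W where "W = (\<Sum>j\<in>I. (y j)\<^sup>2)"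
  define c where "c = 7 * (1 / (1 - \<rho>)) ^ CARD('d)"
  have \<rho>1: "\<rho> < 1" by (rule power_eq_half_less_1[OF \<rho>(2)])
  have c0: "0 \<le> c" using \<rho>1 by (simp add: c_def)
  have V0: "0 \<le> V"
  proof -
    have "0 \<le> (\<Sum>j | j \<in> I \<and> lab j = a. (y j)\<^sup>2)" for a by (intro sum_nonneg) simp
    then show ?thesis using V order_trans by blast
  qed
  show ?thesis
  proof (cases "W = 0")
    case True
    then have "y j = 0" if "j \<in> I" for j using fin that by (auto simp: W_def sum_nonneg_eq_0_iff)
    then have "\<bar>\<Sum>j | j \<in> I \<and> lab j = a \<and> (\<forall>i. x j i \<le> u i). \<epsilon> j * y j\<bar> \<le> 0" for \<epsilon> a u by simp
    moreover have "0 \<le> c * (\<theta> * sqrt W + sqrt V / \<theta> ^ 3)" using True c0 \<theta> V0 by simp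
    ultimately show ?thesis unfolding W_def c_def by (intro exI[of _ "\<lambda>_. 0"]) simp
  next
    case False
    have W0: "0 < W" using False by (simp add: W_def less_le sum_nonneg)
    have "\<exists>j0\<in>I. y j0 \<noteq> 0"
    proof (rule ccontr)
      assume "\<not> ?thesis"
      then have "W = 0" unfolding W_def by (intro sum.neutral) simp
      then show False using False by simp
    qed
    then obtain j0 where j0: "j0 \<in> I" "y j0 \<noteq> 0" by blast
    have "0 < (y j0)\<^sup>2" using j0 by simp
    also have "\<dots> \<le> (\<Sum>j | j \<in> I \<and> lab j = lab j0. (y j)\<^sup>2)"
      using j0 fin by (intro member_le_sum) auto
    also have "\<dots> \<le> V" by (rule V)
    finally have V1: "0 < V" .
    \<comment> \<open>With these values the two weight hypotheses of \<open>chaining_bound\<close>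
      say precisely that the total weight is \<open>W\<close> and each label has weight at most
      \<open>V\<close>.\<close>
    define p \<beta> where "p = sqrt W" and "\<beta> = root 8 (V / W)"
    have p: "0 < p" "p\<^sup>2 = W" using W0 by (auto simp: p_def)
    have \<beta>: "0 < \<beta>" "\<beta> ^ 8 = V / W" using V1 W0 by (auto simp: \<beta>_def)
    have "(\<beta> ^ 4)\<^sup>2 = V / W" using \<beta> by (simp add: power_mult[symmetric])
    then have \<beta>4: "\<beta> ^ 4 = sqrt (V / W)" using \<beta> by (intro real_sqrt_unique[symmetric]) auto
    obtain R where R: "\<And>\<epsilon> a u. \<bar>\<Sum>j | j \<in> I \<and> lab j = a \<and> (\<forall>i. x j i \<le> u i). \<epsilon> j * y j\<bar> \<le> R \<epsilon>"
      "(\<Sum>\<epsilon>\<in>signs I. R \<epsilon>) \<le> 2 ^ card I * (7 * p * \<beta> * (1 / (1 - \<rho>)) ^ CARD('d))"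
    proof -
      have "\<beta> ^ 8 * p\<^sup>2 = V" using W0 unfolding \<beta>(2) p(2) by simp
      then have "\<exists>R. (\<forall>\<epsilon> a u. \<bar>\<Sum>j | j \<in> I \<and> lab j = a \<and> (\<forall>i. x j i \<le> u i). \<epsilon> j * y j\<bar> \<le> R \<epsilon>) \<and>
          (\<Sum>\<epsilon>\<in>signs I. R \<epsilon>) \<le> 2 ^ card I * (7 * p * \<beta> * (1 / (1 - \<rho>)) ^ CARD('d))"
        using V p(2) by (intro chaining_bound[OF fin \<rho> p(1) \<beta>(1)]) (simp_all add: W_def)
      then show ?thesis using that by blast
    qed
    note R(2)
    also have "2 ^ card I * (7 * p * \<beta> * (1 / (1 - \<rho>)) ^ CARD('d)) = 2 ^ card I * (c * (p * \<bar>\<beta>\<bar>))"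
      using \<beta> by (simp add: c_def)
    also have "\<dots> \<le> 2 ^ card I * (c * (p * (\<theta> + \<beta> ^ 4 / \<theta> ^ 3)))"
      using c0 p abs_le_add_power4[OF \<theta>, of \<beta>] by (intro mult_left_mono) auto
    also have "p * (\<theta> + \<beta> ^ 4 / \<theta> ^ 3) = \<theta> * sqrt W + sqrt V / \<theta> ^ 3"
      using W0 unfolding \<beta>4 by (simp add: p_def real_sqrt_divide distrib_left)
    finally have "(\<Sum>\<epsilon>\<in>signs I. R \<epsilon>) \<le> 2 ^ card I * (c * (\<theta> * sqrt W + sqrt V / \<theta> ^ 3))" .
    then show ?thesis unfolding c_def W_def by (intro exI[of _ R] conjI allI R(1))
  qed
qed

subsection \<open>Symmetrization\<close>

text \<open>
  By Jensen's inequality the mean of \<open>h u\<close> may be replaced by \<open>h u z'\<close> for an independent copy \<open>z'\<close>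
  of \<open>z\<close>, and \<open>a u + h u z - h u z'\<close> is the midpoint of \<open>a u + 2 * h u z\<close> and \<open>a u - 2 * h u z'\<close>.
\<close>
lemma symmetrization_step:
  fixes h :: "'u \<Rightarrow> 'z \<Rightarrow> real"
  assumes "prob_space P" and F: "countable F" and h: "\<And>u. u \<in> F \<Longrightarrow> integrable P (h u)"
  shows "2 * (\<integral>\<^sup>+z. (SUP u\<in>F. ennreal \<bar>a u + (h u z - (\<integral>z. h u z \<partial>P))\<bar>) \<partial>P)
    \<le> (\<integral>\<^sup>+z. (SUP u\<in>F. ennreal \<bar>a u - 2 * h u z\<bar>) + (SUP u\<in>F. ennreal \<bar>a u + 2 * h u z\<bar>) \<partial>P)"
proof -
  interpret prob_space P by fact
  have hm[measurable]: "h u \<in> borel_measurable P" if "u \<in> F" for u using h[OF that] by simp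
  have mSUP[measurable]: "(\<lambda>z. SUP u\<in>F. ennreal \<bar>a u - 2 * h u z\<bar>) \<in> borel_measurable P"
    "(\<lambda>z. SUP u\<in>F. ennreal \<bar>a u + 2 * h u z\<bar>) \<in> borel_measurable P"
    "(\<lambda>z. SUP u\<in>F. ennreal \<bar>a u + (h u z - (\<integral>z. h u z \<partial>P))\<bar>) \<in> borel_measurable P"
    using F by (auto intro!: borel_measurable_SUP)
  have "2 * (SUP u\<in>F. ennreal \<bar>a u + (h u z - (\<integral>z. h u z \<partial>P))\<bar>)
      \<le> (SUP u\<in>F. ennreal \<bar>a u + 2 * h u z\<bar>) + (\<integral>\<^sup>+z'. (SUP u\<in>F. ennreal \<bar>a u - 2 * h u z'\<bar>) \<partial>P)" for z
    unfolding SUP_mult_left_ennreal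
  proof (rule SUP_least)
    fix u assume u: "u \<in> F"
    have eq: "a u + (h u z - (\<integral>z. h u z \<partial>P)) = (\<integral>z'. a u + h u z - h u z' \<partial>P)"
      using h[OF u] by (simp add: prob_space)
    have "2 * ennreal \<bar>a u + (h u z - (\<integral>z. h u z \<partial>P))\<bar> \<le> 2 * (\<integral>\<^sup>+z'. ennreal \<bar>a u + h u z - h u z'\<bar> \<partial>P)"
      unfolding eq using integral_norm_bound_ennreal[of P "\<lambda>z'. a u + h u z - h u z'"] h[OF u]
      by (intro mult_left_mono) (simp_all only: real_norm_def Bochner_Integration.integrable_diff integrable_const finite_measure_axioms zero_le)
    also have "\<dots> = (\<integral>\<^sup>+z'. 2 * ennreal \<bar>a u + h u z - h u z'\<bar> \<partial>P)"
      using u by (subst nn_integral_cmult) auto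
    also have "\<dots> \<le> (\<integral>\<^sup>+z'. (SUP u\<in>F. ennreal \<bar>a u + 2 * h u z\<bar>) + (SUP u\<in>F. ennreal \<bar>a u - 2 * h u z'\<bar>) \<partial>P)"
    proof (rule nn_integral_mono)
      fix z'
      have "2 * ennreal \<bar>a u + h u z - h u z'\<bar> = ennreal (2 * \<bar>a u + h u z - h u z'\<bar>)"
        by (simp add: ennreal_mult)
      also have "2 * \<bar>a u + h u z - h u z'\<bar> = \<bar>(a u + 2 * h u z) + (a u - 2 * h u z')\<bar>"
        by (simp add: abs_if)
      also have "ennreal \<dots> \<le> ennreal (\<bar>a u + 2 * h u z\<bar> + \<bar>a u - 2 * h u z'\<bar>)"
        by (intro ennreal_leI abs_triangle_ineq)
      also have "\<dots> = ennreal \<bar>a u + 2 * h u z\<bar> + ennreal \<bar>a u - 2 * h u z'\<bar>" by simp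
      also have "\<dots> \<le> (SUP u\<in>F. ennreal \<bar>a u + 2 * h u z\<bar>) + (SUP u\<in>F. ennreal \<bar>a u - 2 * h u z'\<bar>)"
        using u by (intro add_mono SUP_upper)
      finally show "2 * ennreal \<bar>a u + h u z - h u z'\<bar> \<le> \<dots>" .
    qed
    also have "\<dots> = (SUP u\<in>F. ennreal \<bar>a u + 2 * h u z\<bar>) + (\<integral>\<^sup>+z'. (SUP u\<in>F. ennreal \<bar>a u - 2 * h u z'\<bar>) \<partial>P)"
      by (subst nn_integral_add) (auto simp: emeasure_space_1)
    finally show "2 * ennreal \<bar>a u + (h u z - (\<integral>z. h u z \<partial>P))\<bar> \<le> \<dots>" .
  qed
  then have "(\<integral>\<^sup>+z. 2 * (SUP u\<in>F. ennreal \<bar>a u + (h u z - (\<integral>z. h u z \<partial>P))\<bar>) \<partial>P)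
    \<le> (\<integral>\<^sup>+z. (SUP u\<in>F. ennreal \<bar>a u + 2 * h u z\<bar>) + (\<integral>\<^sup>+z'. (SUP u\<in>F. ennreal \<bar>a u - 2 * h u z'\<bar>) \<partial>P) \<partial>P)"
    by (intro nn_integral_mono)
  then show ?thesis
    by (simp add: nn_integral_cmult nn_integral_add emeasure_space_1 add.commute)
qed

text \<open>Induction on the number of observations. The arbitrary offset \<open>c\<close> makes
  this possible: \<open>symmetrization_step\<close> treats the new observation with the rest of the
  centered sum as its offset, and afterwards the induction hypothesis treats that rest with offset
  \<open>c\<close> shifted by plus or minus twice the new value. The sum over \<open>signs I\<close>
  and the factor \<open>2 ^ card I\<close> together express an average over random signs.\<close>

lemma symmetrization:
  fixes h :: "'u \<Rightarrow> 'z \<Rightarrow> real"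
  assumes P: "prob_space P" and F: "countable F" and h: "\<And>u. u \<in> F \<Longrightarrow> integrable P (h u)" and I: "finite I"
  shows "2 ^ card I * (\<integral>\<^sup>+\<omega>. (SUP u\<in>F. ennreal \<bar>c u + (\<Sum>j\<in>I. h u (\<omega> j) - (\<integral>z. h u z \<partial>P))\<bar>) \<partial>PiM I (\<lambda>_. P))
    \<le> (\<integral>\<^sup>+\<omega>. (\<Sum>\<epsilon>\<in>signs I. SUP u\<in>F. ennreal \<bar>c u + (\<Sum>j\<in>I. 2 * \<epsilon> j * h u (\<omega> j))\<bar>) \<partial>PiM I (\<lambda>_. P))"
  using I
proof (induction I arbitrary: c)
  case empty
  show ?case by (simp add: signs_def)
next
  case (insert i I)
  interpret prob_space P by (rule P)
  interpret product_prob_space "\<lambda>_. P" by standard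
  have hm[measurable]: "h u \<in> borel_measurable P" if "u \<in> F" for u using h[OF that] by simp
  let ?E = "\<lambda>u. \<integral>z. h u z \<partial>P"
  let ?A = "\<lambda>x u. c u + (\<Sum>j\<in>I. h u (x j) - ?E u)"
  let ?f = "\<lambda>\<omega>. (SUP u\<in>F. ennreal \<bar>?A \<omega> u - 2 * h u (\<omega> i)\<bar>) + (SUP u\<in>F. ennreal \<bar>?A \<omega> u + 2 * h u (\<omega> i)\<bar>)"
  let ?g = "\<lambda>\<omega>. (\<Sum>\<epsilon>\<in>signs (insert i I). SUP u\<in>F. ennreal \<bar>c u + (\<Sum>j\<in>insert i I. 2 * \<epsilon> j * h u (\<omega> j))\<bar>)"
  let ?S = "\<lambda>b x. \<Sum>\<epsilon>\<in>signs I. SUP u\<in>F. ennreal \<bar>b u + (\<Sum>j\<in>I. 2 * \<epsilon> j * h u (x j))\<bar>"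
  have upd: "(\<Sum>j\<in>I. k ((x(i := z)) j) j) = (\<Sum>j\<in>I. k (x j) j)" for k :: "'z \<Rightarrow> _ \<Rightarrow> real" and x z
    using insert(2) by (intro sum.cong) auto
  have comp: "(\<lambda>\<omega>. h u (\<omega> j)) \<in> borel_measurable (PiM K (\<lambda>_. P))" if "u \<in> F" "j \<in> K" for u j K
    by (rule measurable_compose[OF measurable_component_singleton[OF that(2)] hm[OF that(1)]])
  have m1: "?f \<in> borel_measurable (PiM (insert i I) (\<lambda>_. P))"
    by (intro borel_measurable_add borel_measurable_SUP F measurable_compose[OF _ measurable_ennreal]
        borel_measurable_abs borel_measurable_diff borel_measurable_sum borel_measurable_times borel_measurable_const comp) auto
  have m2: "?g \<in> borel_measurable (PiM (insert i I) (\<lambda>_. P))"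
    by (intro borel_measurable_add borel_measurable_SUP F measurable_compose[OF _ measurable_ennreal]
        borel_measurable_abs borel_measurable_diff borel_measurable_sum borel_measurable_times borel_measurable_const comp) auto
  have m3: "(\<lambda>\<omega>. SUP u\<in>F. ennreal \<bar>c u + (\<Sum>j\<in>insert i I. h u (\<omega> j) - ?E u)\<bar>) \<in> borel_measurable (PiM (insert i I) (\<lambda>_. P))"
    by (intro borel_measurable_add borel_measurable_SUP F measurable_compose[OF _ measurable_ennreal]
        borel_measurable_abs borel_measurable_diff borel_measurable_sum borel_measurable_times borel_measurable_const comp) auto
  have m4: "(\<lambda>x. SUP u\<in>F. ennreal \<bar>?A x u + b u\<bar>) \<in> borel_measurable (PiM I (\<lambda>_. P))"
    "(\<lambda>x. SUP u\<in>F. ennreal \<bar>?A x u - b u\<bar>) \<in> borel_measurable (PiM I (\<lambda>_. P))" for b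
    by (intro borel_measurable_add borel_measurable_SUP F measurable_compose[OF _ measurable_ennreal]
        borel_measurable_abs borel_measurable_diff borel_measurable_sum borel_measurable_times borel_measurable_const comp; auto)+
  have m5: "?S b \<in> borel_measurable (PiM I (\<lambda>_. P))" for b
    by (intro borel_measurable_add borel_measurable_SUP F measurable_compose[OF _ measurable_ennreal]
        borel_measurable_abs borel_measurable_diff borel_measurable_sum borel_measurable_times borel_measurable_const comp) auto
  have "2 * (\<integral>\<^sup>+\<omega>. (SUP u\<in>F. ennreal \<bar>c u + (\<Sum>j\<in>insert i I. h u (\<omega> j) - ?E u)\<bar>) \<partial>PiM (insert i I) (\<lambda>_. P))
      = 2 * (\<integral>\<^sup>+x. (\<integral>\<^sup>+z. (SUP u\<in>F. ennreal \<bar>?A x u + (h u z - ?E u)\<bar>) \<partial>P) \<partial>PiM I (\<lambda>_. P))"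
    using insert(1,2) upd[of "\<lambda>z j. h u z - ?E u" for u]
    by (subst product_nn_integral_insert[OF insert(1,2) m3]) (simp add: algebra_simps)
  also have "\<dots> = (\<integral>\<^sup>+x. 2 * (\<integral>\<^sup>+z. (SUP u\<in>F. ennreal \<bar>?A x u + (h u z - ?E u)\<bar>) \<partial>P) \<partial>PiM I (\<lambda>_. P))"
  proof (rule nn_integral_cmult[symmetric])
    have "(\<lambda>(x, z). SUP u\<in>F. ennreal \<bar>?A x u + (h u z - ?E u)\<bar>) \<in> borel_measurable (PiM I (\<lambda>_. P) \<Otimes>\<^sub>M P)"
      unfolding case_prod_unfold
      by (intro borel_measurable_add borel_measurable_SUP F measurable_compose[OF _ measurable_ennreal]
        borel_measurable_abs borel_measurable_diff borel_measurable_sum borel_measurable_times borel_measurable_const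
        measurable_compose[OF measurable_fst comp] measurable_compose[OF measurable_snd hm]) auto
    then show "(\<lambda>x. \<integral>\<^sup>+z. (SUP u\<in>F. ennreal \<bar>?A x u + (h u z - ?E u)\<bar>) \<partial>P) \<in> borel_measurable (PiM I (\<lambda>_. P))"
      by (rule sigma_finite_measure.borel_measurable_nn_integral[OF prob_space_imp_sigma_finite[OF \<open>prob_space P\<close>]])
  qed
  also have "\<dots> \<le> (\<integral>\<^sup>+x. (\<integral>\<^sup>+z. ?f (x(i := z)) \<partial>P) \<partial>PiM I (\<lambda>_. P))"
    using upd[of "\<lambda>z j. h u z - ?E u" for u]
    by (intro nn_integral_mono) (simp add: symmetrization_step[OF \<open>prob_space P\<close> F h])
  \<comment> \<open>The new observation is moved to the outer integral; for fixed \<open>z\<close>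
    it becomes a constant shift of the offset.\<close>
  also have "\<dots> = (\<integral>\<^sup>+z. (\<integral>\<^sup>+x. ?f (x(i := z)) \<partial>PiM I (\<lambda>_. P)) \<partial>P)"
    unfolding product_nn_integral_insert[OF insert(1,2) m1, symmetric]
    by (rule product_nn_integral_insert_rev[OF insert(1,2) m1])
  finally have step: "2 * (\<integral>\<^sup>+\<omega>. (SUP u\<in>F. ennreal \<bar>c u + (\<Sum>j\<in>insert i I. h u (\<omega> j) - ?E u)\<bar>) \<partial>PiM (insert i I) (\<lambda>_. P))
      \<le> (\<integral>\<^sup>+z. (\<integral>\<^sup>+x. ?f (x(i := z)) \<partial>PiM I (\<lambda>_. P)) \<partial>P)" .
  have "2 ^ card (insert i I) * (\<integral>\<^sup>+\<omega>. (SUP u\<in>F. ennreal \<bar>c u + (\<Sum>j\<in>insert i I. h u (\<omega> j) - ?E u)\<bar>) \<partial>PiM (insert i I) (\<lambda>_. P))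
      \<le> 2 ^ card I * (\<integral>\<^sup>+z. (\<integral>\<^sup>+x. ?f (x(i := z)) \<partial>PiM I (\<lambda>_. P)) \<partial>P)"
    using mult_left_mono[OF step, of "2 ^ card I"] insert(1,2) by (simp add: mult_ac)
  also have "\<dots> \<le> (\<integral>\<^sup>+z. 2 ^ card I * (\<integral>\<^sup>+x. ?f (x(i := z)) \<partial>PiM I (\<lambda>_. P)) \<partial>P)"
  proof -
    have "(\<lambda>(z, x). ?f (x(i := z))) \<in> borel_measurable (P \<Otimes>\<^sub>M PiM I (\<lambda>_. P))"
      using measurable_compose[OF measurable_compose[OF measurable_pair_swap' measurable_add_dim] m1]
      by (simp only: case_prod_unfold fst_conv snd_conv)
    then have "(\<lambda>z. \<integral>\<^sup>+x. ?f (x(i := z)) \<partial>PiM I (\<lambda>_. P)) \<in> borel_measurable P"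
      by (rule sigma_finite_measure.borel_measurable_nn_integral[rotated])
        (intro prob_space_imp_sigma_finite prob_space_PiM \<open>prob_space P\<close>)
    then show ?thesis by (simp add: nn_integral_cmult)
  qed
  also have "\<dots> \<le> (\<integral>\<^sup>+z. (\<integral>\<^sup>+x. ?g (x(i := z)) \<partial>PiM I (\<lambda>_. P)) \<partial>P)"
  proof (rule nn_integral_mono)
    fix z
    have "2 ^ card I * (\<integral>\<^sup>+x. ?f (x(i := z)) \<partial>PiM I (\<lambda>_. P))
       = 2 ^ card I * (\<integral>\<^sup>+x. (SUP u\<in>F. ennreal \<bar>(c u - 2 * h u z) + (\<Sum>j\<in>I. h u (x j) - ?E u)\<bar>) \<partial>PiM I (\<lambda>_. P))
       + 2 ^ card I * (\<integral>\<^sup>+x. (SUP u\<in>F. ennreal \<bar>(c u + 2 * h u z) + (\<Sum>j\<in>I. h u (x j) - ?E u)\<bar>) \<partial>PiM I (\<lambda>_. P))"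
    proof -
      have "(\<integral>\<^sup>+x. ?f (x(i := z)) \<partial>PiM I (\<lambda>_. P))
          = (\<integral>\<^sup>+x. (SUP u\<in>F. ennreal \<bar>?A x u - 2 * h u z\<bar>) + (SUP u\<in>F. ennreal \<bar>?A x u + 2 * h u z\<bar>) \<partial>PiM I (\<lambda>_. P))"
        by (simp only: fun_upd_same upd[of "\<lambda>z j. h u z - ?E u" for u])
      also have "\<dots> = (\<integral>\<^sup>+x. (SUP u\<in>F. ennreal \<bar>?A x u - 2 * h u z\<bar>) \<partial>PiM I (\<lambda>_. P))
          + (\<integral>\<^sup>+x. (SUP u\<in>F. ennreal \<bar>?A x u + 2 * h u z\<bar>) \<partial>PiM I (\<lambda>_. P))"
        by (rule nn_integral_add[OF m4(2) m4(1)])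
      moreover have "c u + s - b = c u - b + s" "c u + s + b = c u + b + s" for u and s b :: real
        by simp_all
      ultimately show ?thesis by (simp only: distrib_left)
    qed
    also have "\<dots> \<le> (\<integral>\<^sup>+x. ?S (\<lambda>u. c u - 2 * h u z) x \<partial>PiM I (\<lambda>_. P)) + (\<integral>\<^sup>+x. ?S (\<lambda>u. c u + 2 * h u z) x \<partial>PiM I (\<lambda>_. P))"
      by (intro add_mono insert.IH)
    also have "\<dots> = (\<integral>\<^sup>+x. ?S (\<lambda>u. c u - 2 * h u z) x + ?S (\<lambda>u. c u + 2 * h u z) x \<partial>PiM I (\<lambda>_. P))"
      by (rule nn_integral_add[symmetric, OF m5 m5])
    also have "\<dots> = (\<integral>\<^sup>+x. ?g (x(i := z)) \<partial>PiM I (\<lambda>_. P))"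
    proof (rule nn_integral_cong)
      fix x
      have "(\<Sum>j\<in>insert i I. 2 * (\<epsilon>(i := b)) j * h u ((x(i := z)) j)) = 2 * b * h u z + (\<Sum>j\<in>I. 2 * \<epsilon> j * h u (x j))"
        for b u \<epsilon>
      proof -
        have "(\<Sum>j\<in>I. 2 * (\<epsilon>(i := b)) j * h u ((x(i := z)) j)) = (\<Sum>j\<in>I. 2 * \<epsilon> j * h u (x j))"
          using insert(2) by (intro sum.cong) auto
        then show ?thesis using insert(1,2) by (simp del: fun_upd_apply) simp
      qed
      then show "?S (\<lambda>u. c u - 2 * h u z) x + ?S (\<lambda>u. c u + 2 * h u z) x = ?g (x(i := z))"
        unfolding sum_signs_insert[OF insert(2)] by (simp add: sum.distrib algebra_simps del: fun_upd_apply)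
    qed
    finally show "2 ^ card I * (\<integral>\<^sup>+x. ?f (x(i := z)) \<partial>PiM I (\<lambda>_. P)) \<le> \<dots>" .
  qed
  also have "\<dots> = (\<integral>\<^sup>+\<omega>. ?g \<omega> \<partial>PiM (insert i I) (\<lambda>_. P))"
    by (rule product_nn_integral_insert_rev[symmetric, OF insert(1,2) m2])
  finally show ?case .
qed

subsection \<open>Characteristic functions and weak convergence\<close>

text \<open>Real trigonometric polynomials in the first \<open>m\<close> coordinates. A list of
  coefficients and frequencies may contain repetitions, so sums become concatenation and products
  need no collection of terms.\<close>

definition trig_fun :: "nat \<Rightarrow> ((nat \<Rightarrow> real) \<Rightarrow> real) \<Rightarrow> bool" where
  "trig_fun m f \<longleftrightarrow> (\<exists>cs :: (complex \<times> (nat \<Rightarrow> real)) list.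
     \<forall>x. complex_of_real (f x) = (\<Sum>(c, t)\<leftarrow>cs. c * cis (\<Sum>i<m. t i * x i)))"

lemma trig_fun_const: "trig_fun m (\<lambda>_. a)"
  unfolding trig_fun_def by (rule exI[of _ "[(of_real a, \<lambda>_. 0)]"]) simp

lemma trig_fun_add: "trig_fun m f \<Longrightarrow> trig_fun m g \<Longrightarrow> trig_fun m (\<lambda>x. f x + g x)"
  unfolding trig_fun_def
proof (elim exE)
  fix cs ds :: "(complex \<times> (nat \<Rightarrow> real)) list"
  assume "\<forall>x. complex_of_real (f x) = (\<Sum>(c, t)\<leftarrow>cs. c * cis (\<Sum>i<m. t i * x i))"
    "\<forall>x. complex_of_real (g x) = (\<Sum>(c, t)\<leftarrow>ds. c * cis (\<Sum>i<m. t i * x i))"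
  then show "\<exists>cs. \<forall>x. complex_of_real (f x + g x) = (\<Sum>(c, t)\<leftarrow>cs. c * cis (\<Sum>i<m. t i * x i))"
    by (intro exI[of _ "cs @ ds"]) simp
qed

lemma trig_fun_mult: "trig_fun m f \<Longrightarrow> trig_fun m g \<Longrightarrow> trig_fun m (\<lambda>x. f x * g x)"
  unfolding trig_fun_def
proof (elim exE)
  fix cs ds :: "(complex \<times> (nat \<Rightarrow> real)) list"
  assume *: "\<forall>x. complex_of_real (f x) = (\<Sum>(c, t)\<leftarrow>cs. c * cis (\<Sum>i<m. t i * x i))"
    "\<forall>x. complex_of_real (g x) = (\<Sum>(c, t)\<leftarrow>ds. c * cis (\<Sum>i<m. t i * x i))"
  define es where "es = concat (map (\<lambda>(c, t). map (\<lambda>(d, s). (c * d, \<lambda>i. t i + s i)) ds) cs)"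
  have "complex_of_real (f x * g x) = (\<Sum>(c, t)\<leftarrow>es. c * cis (\<Sum>i<m. t i * x i))" for x
  proof -
    have 1: "(\<Sum>(c, t)\<leftarrow>map (\<lambda>(d, s). (c * d, \<lambda>i. t i + s i)) ds. c * cis (\<Sum>i<m. t i * x i))
        = c * cis (\<Sum>i<m. t i * x i) * (\<Sum>(c, t)\<leftarrow>ds. c * cis (\<Sum>i<m. t i * x i))" for c t
      by (induction ds) (auto simp: cis_mult[symmetric] sum.distrib algebra_simps)
    have "(\<Sum>(c, t)\<leftarrow>es. c * cis (\<Sum>i<m. t i * x i))
        = (\<Sum>(c, t)\<leftarrow>cs. c * cis (\<Sum>i<m. t i * x i)) * (\<Sum>(c, t)\<leftarrow>ds. c * cis (\<Sum>i<m. t i * x i))"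
      unfolding es_def by (induction cs) (auto simp: 1 algebra_simps simp del: map_map)
    then show ?thesis using * by simp
  qed
  then show "\<exists>cs. \<forall>x. complex_of_real (f x * g x) = (\<Sum>(c, t)\<leftarrow>cs. c * cis (\<Sum>i<m. t i * x i))" by blast
qed

lemma trig_fun_sin: "i < m \<Longrightarrow> trig_fun m (\<lambda>x. sin (x i / R))"
  unfolding trig_fun_def
proof (intro exI[of _ "[(-\<i> / 2, \<lambda>j. if j = i then 1 / R else 0), (\<i> / 2, \<lambda>j. if j = i then - 1 / R else 0)]"] allI)
  fix x :: "nat \<Rightarrow> real"
  assume i: "i < m"
  have *: "(\<Sum>j<m. (if j = i then a else 0) * x j) = a * x i" for a
    using i sum.delta[of "{..<m}" i "\<lambda>j. a * x j"] by (simp add: if_distrib[of "\<lambda>a. a * _"] cong: if_cong)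
  show "complex_of_real (sin (x i / R)) = (\<Sum>(c, t)\<leftarrow>[(-\<i> / 2, \<lambda>j. if j = i then 1 / R else 0), (\<i> / 2, \<lambda>j. if j = i then - 1 / R else 0)]. c * cis (\<Sum>i<m. t i * x i))"
    by (simp add: *) (simp add: complex_eq_iff)
qed

lemma trig_fun_continuous: 
  assumes "trig_fun m f" shows "continuous_on UNIV f"
proof -
  obtain cs where "\<forall>x. complex_of_real (f x) = (\<Sum>(c, t)\<leftarrow>cs. c * cis (\<Sum>i<m. t i * x i))"
    using assms by (auto simp: trig_fun_def)
  then have "f x = Re (\<Sum>(c, t)\<leftarrow>cs. c * cis (\<Sum>i<m. t i * x i))" for x
    by (metis Re_complex_of_real)
  then have f: "f = (\<lambda>x. Re (\<Sum>(c, t)\<leftarrow>cs. c * cis (\<Sum>i<m. t i * x i)))" by auto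
  have "continuous_on UNIV (\<lambda>x :: nat \<Rightarrow> real. (\<Sum>(c, t)\<leftarrow>cs. c * cis (\<Sum>i<m. t i * x i)))"
  proof (induction cs)
    case (Cons a cs)
    have "continuous_on UNIV (\<lambda>x :: nat \<Rightarrow> real. fst a * cis (\<Sum>i<m. snd a i * x i))"
      unfolding cis_conv_exp by (intro continuous_intros continuous_on_product_coordinates)
    then show ?case using Cons by (auto simp: case_prod_unfold intro: continuous_on_add)
  qed simp
  then show ?thesis unfolding f by (intro continuous_on_Re)
qed

text \<open>Tychonoff, restated for the topology on function types; it supplies the compact set for
  the Stone--Weierstrass argument.\<close>

lemma compact_PiE_UNIV:
  assumes "\<And>i. compact (S i :: 'b::topological_space set)"
  shows "compact (PiE UNIV S)"
proof -
  have "compactin (product_topology (\<lambda>i. euclidean) UNIV) (PiE UNIV S)"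
    using assms by (simp add: compactin_PiE)
  then show ?thesis by (simp add: euclidean_product_topology compactin_euclidean_iff)
qed

lemma trig_fun_integral_tendsto:
  assumes M: "prob_space M" and N: "prob_space N"
    and Z: "\<And>n i. Z n i \<in> borel_measurable M" and V: "\<And>i. V i \<in> borel_measurable N"
    and char: "\<And>t. (\<lambda>n. \<integral>\<omega>. cis (\<Sum>i<m. t i * Z n i \<omega>) \<partial>M) \<longlonglongrightarrow> (\<integral>\<omega>. cis (\<Sum>i<m. t i * V i \<omega>) \<partial>N)"
    and f: "trig_fun m f"
  shows "(\<lambda>n. \<integral>\<omega>. f (\<lambda>i. Z n i \<omega>) \<partial>M) \<longlonglongrightarrow> (\<integral>\<omega>. f (\<lambda>i. V i \<omega>) \<partial>N)"
proof -
  interpret M: prob_space M by fact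
  interpret N: prob_space N by fact
  note [measurable] = Z V
  obtain cs where cs: "\<And>x. complex_of_real (f x) = (\<Sum>(c, t)\<leftarrow>cs. c * cis (\<Sum>i<m. t i * x i))"
    using f by (auto simp: trig_fun_def)
  have cis_meas[measurable]: "cis \<in> borel_measurable borel"
    by (intro borel_measurable_continuous_onI continuous_on_cis continuous_on_id)
  have int: "integrable M (\<lambda>\<omega>. cis (\<Sum>i<m. t i * Z n i \<omega>))" "integrable N (\<lambda>\<omega>. cis (\<Sum>i<m. t i * V i \<omega>))" for t n
    by (intro M.integrable_const_bound[of _ 1] N.integrable_const_bound[of _ 1]; simp)+
  have "(\<forall>n. integrable M (\<lambda>\<omega>. \<Sum>(c, t)\<leftarrow>ds. c * cis (\<Sum>i<m. t i * Z n i \<omega>))) \<and>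
    integrable N (\<lambda>\<omega>. \<Sum>(c, t)\<leftarrow>ds. c * cis (\<Sum>i<m. t i * V i \<omega>)) \<and>
    (\<lambda>n. \<integral>\<omega>. (\<Sum>(c, t)\<leftarrow>ds. c * cis (\<Sum>i<m. t i * Z n i \<omega>)) \<partial>M) \<longlonglongrightarrow> (\<integral>\<omega>. (\<Sum>(c, t)\<leftarrow>ds. c * cis (\<Sum>i<m. t i * V i \<omega>)) \<partial>N)" for ds
  proof (induction ds)
    case (Cons a ds)
    then show ?case using int char[of "snd a"]
      by (auto simp: case_prod_unfold intro!: tendsto_add tendsto_mult)
  qed simp
  from this[of cs] have "(\<lambda>n. \<integral>\<omega>. complex_of_real (f (\<lambda>i. Z n i \<omega>)) \<partial>M) \<longlonglongrightarrow> (\<integral>\<omega>. complex_of_real (f (\<lambda>i. V i \<omega>)) \<partial>N)"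
    unfolding cs by simp
  then show ?thesis by (simp add: tendsto_of_real_iff)
qed

lemma prob_abs_gt_small:
  assumes "prob_space N" "V \<in> borel_measurable N" "0 < e"
  shows "\<exists>R. measure N {\<omega>\<in>space N. R < \<bar>V \<omega> :: real\<bar>} \<le> e"
proof -
  interpret prob_space N by fact
  note [measurable] = assms(2)
  have "(\<lambda>k. prob {\<omega>\<in>space N. real k < \<bar>V \<omega>\<bar>}) \<longlonglongrightarrow> prob (\<Inter>k. {\<omega>\<in>space N. real k < \<bar>V \<omega>\<bar>})"
    by (rule finite_Lim_measure_decseq) (auto simp: decseq_def)
  moreover have "(\<Inter>k. {\<omega>\<in>space N. real k < \<bar>V \<omega>\<bar>}) = {}"
    by auto (metis less_asym reals_Archimedean2)
  ultimately have "(\<lambda>k. prob {\<omega>\<in>space N. real k < \<bar>V \<omega>\<bar>}) \<longlonglongrightarrow> 0" by simp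
  then have "eventually (\<lambda>k. prob {\<omega>\<in>space N. real k < \<bar>V \<omega>\<bar>} < e) sequentially"
    by (rule order_tendstoD) fact
  then show ?thesis unfolding eventually_sequentially by (meson order_refl less_imp_le)
qed

text \<open>On the exceptional set the two functions differ by at most \<open>2 * B + e\<close>. The
  bounds are asymmetric because the second function is a uniform approximation that may overshoot by
  \<open>e\<close>.\<close>

lemma integral_close:
  fixes f g :: "'a \<Rightarrow> real"
  assumes M: "prob_space M" and "f \<in> borel_measurable M" "g \<in> borel_measurable M" "A \<in> sets M"
    and "\<And>\<omega>. \<bar>f \<omega>\<bar> \<le> B" "\<And>\<omega>. \<bar>g \<omega>\<bar> \<le> B + e" "\<And>\<omega>. \<omega> \<in> space M - A \<Longrightarrow> \<bar>f \<omega> - g \<omega>\<bar> \<le> e"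
    and "measure M A \<le> d" "0 \<le> e"
  shows "\<bar>(\<integral>\<omega>. f \<omega> \<partial>M) - (\<integral>\<omega>. g \<omega> \<partial>M)\<bar> \<le> e + 2 * B * d"
proof -
  interpret prob_space M by fact
  note [measurable] = assms(2-4)
  have B: "0 \<le> B" using assms(5)[of undefined] by linarith
  have int: "integrable M f" "integrable M g"
    by (rule integrable_const_bound[of _ B], use assms in simp_all)
      (rule integrable_const_bound[of _ "B + e"], use assms in simp_all)
  then have "\<bar>(\<integral>\<omega>. f \<omega> \<partial>M) - (\<integral>\<omega>. g \<omega> \<partial>M)\<bar> = \<bar>\<integral>\<omega>. f \<omega> - g \<omega> \<partial>M\<bar>" by simp
  also have "\<dots> \<le> (\<integral>\<omega>. \<bar>f \<omega> - g \<omega>\<bar> \<partial>M)" by (rule integral_abs_bound)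
  also have "\<dots> \<le> (\<integral>\<omega>. e + 2 * B * indicator A \<omega> \<partial>M)"
  proof (rule integral_mono)
    fix \<omega> assume "\<omega> \<in> space M"
    then show "\<bar>f \<omega> - g \<omega>\<bar> \<le> e + 2 * B * indicator A \<omega>"
      using assms(5,6)[of \<omega>] assms(7)[of \<omega>] B by (cases "\<omega> \<in> A") auto
  qed (use int in \<open>auto simp: emeasure_eq_measure\<close>)
  also have "\<dots> = e + 2 * B * measure M A" by (simp add: prob_space emeasure_eq_measure)
  also have "\<dots> \<le> e + 2 * B * d" using assms B by (intro add_left_mono mult_left_mono) auto
  finally show ?thesis .
qed

text \<open>Trigonometric polynomials approximate \<phi> only on bounded sets, and tightness
  controls the rest. Their global bound must not depend on the radius, which rules out a direct
  approximation on a box; substituting \<open>sin (x i / R)\<close> compactifies all of space at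
  once. Sequences whose first \<open>m\<close> entries matter stand for vectors, since
  \<open>m\<close> varies.\<close>

lemma weak_convergence_of_char:
  fixes \<phi> :: "(nat \<Rightarrow> real) \<Rightarrow> real"
  assumes M: "prob_space M" and N: "prob_space N"
    and Z: "\<And>n i. Z n i \<in> borel_measurable M" and V: "\<And>i. V i \<in> borel_measurable N"
    and char: "\<And>t. (\<lambda>n. \<integral>\<omega>. cis (\<Sum>i<m. t i * Z n i \<omega>) \<partial>M) \<longlonglongrightarrow> (\<integral>\<omega>. cis (\<Sum>i<m. t i * V i \<omega>) \<partial>N)"
    and tight: "\<And>i e. 0 < e \<Longrightarrow> \<exists>R. \<forall>n. measure M {\<omega>\<in>space M. R < \<bar>Z n i \<omega>\<bar>} \<le> e"
    and cont: "continuous_on UNIV \<phi>" and bdd: "\<And>x. \<bar>\<phi> x\<bar> \<le> B"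
    and dep: "\<And>x. \<phi> x = \<phi> (\<lambda>i. if i < m then x i else 0)"
  shows "(\<lambda>n. \<integral>\<omega>. \<phi> (\<lambda>i. Z n i \<omega>) \<partial>M) \<longlonglongrightarrow> (\<integral>\<omega>. \<phi> (\<lambda>i. V i \<omega>) \<partial>N)"
proof (rule LIMSEQ_I)
  fix \<epsilon> :: real assume \<epsilon>: "0 < \<epsilon>"
  interpret M: prob_space M by fact
  interpret N: prob_space N by fact
  note [measurable] = Z V
  have B: "0 \<le> B" using bdd[of undefined] by linarith
  \<comment> \<open>Two replacement errors of \<epsilon>/4 each leave \<epsilon>/2 for the
    convergence of the trigonometric part.\<close>
  define e where "e = \<epsilon> / (4 * (1 + 2 * B * real m))"
  have e: "0 < e" "4 * (e + 2 * B * (real m * e)) = \<epsilon>"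
  proof -
    define q where "q = 1 + 2 * B * real m"
    have q: "0 < q" using B by (simp add: q_def add_pos_nonneg)
    then show "0 < e" using \<epsilon> by (simp add: e_def q_def)
    have "4 * (e + 2 * B * (real m * e)) = 4 * e * q" by (simp add: q_def algebra_simps)
    also have "\<dots> = \<epsilon>" using q unfolding e_def q_def[symmetric] by simp
    finally show "4 * (e + 2 * B * (real m * e)) = \<epsilon>" .
  qed
  have "\<exists>R. \<forall>n. measure M {\<omega>\<in>space M. R < \<bar>Z n i \<omega>\<bar>} \<le> e" "\<exists>R. measure N {\<omega>\<in>space N. R < \<bar>V i \<omega>\<bar>} \<le> e" for i
    using tight[OF e(1)] prob_abs_gt_small[OF N V e(1)] by blast+
  then obtain R1 R2 where R12: "\<And>i n. measure M {\<omega>\<in>space M. R1 i < \<bar>Z n i \<omega>\<bar>} \<le> e" "\<And>i. measure N {\<omega>\<in>space N. R2 i < \<bar>V i \<omega>\<bar>} \<le> e"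
    by metis
  define R where "R = Max (insert 1 (R1 ` {..<m} \<union> R2 ` {..<m}))"
  have R: "0 < R" "\<And>i. i < m \<Longrightarrow> R1 i \<le> R" "\<And>i. i < m \<Longrightarrow> R2 i \<le> R"
    by (auto simp: R_def Max_gr_iff)
  define A1 where "A1 n = (\<Union>i<m. {\<omega>\<in>space M. R < \<bar>Z n i \<omega>\<bar>})" for n
  define A2 where "A2 = (\<Union>i<m. {\<omega>\<in>space N. R < \<bar>V i \<omega>\<bar>})"
  have A_sets: "A1 n \<in> sets M" "A2 \<in> sets N" for n by (auto simp: A1_def A2_def)
  have A1: "measure M (A1 n) \<le> real m * e" for n
  proof -
    have "measure M (A1 n) \<le> (\<Sum>i<m. measure M {\<omega>\<in>space M. R < \<bar>Z n i \<omega>\<bar>})"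
      unfolding A1_def by (intro M.finite_measure_subadditive_finite) auto
    also have "\<dots> \<le> (\<Sum>i<m. e)"
    proof (rule sum_mono)
      fix i assume "i \<in> {..<m}"
      then have "measure M {\<omega>\<in>space M. R < \<bar>Z n i \<omega>\<bar>} \<le> measure M {\<omega>\<in>space M. R1 i < \<bar>Z n i \<omega>\<bar>}"
        using R(2)[of i] by (intro M.finite_measure_mono) auto
      then show "measure M {\<omega>\<in>space M. R < \<bar>Z n i \<omega>\<bar>} \<le> e" using R12(1)[of i n] by linarith
    qed
    finally show ?thesis by simp
  qed
  have A2: "measure N A2 \<le> real m * e"
  proof -
    have "measure N A2 \<le> (\<Sum>i<m. measure N {\<omega>\<in>space N. R < \<bar>V i \<omega>\<bar>})"
      unfolding A2_def by (intro N.finite_measure_subadditive_finite) auto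
    also have "\<dots> \<le> (\<Sum>i<m. e)"
    proof (rule sum_mono)
      fix i assume "i \<in> {..<m}"
      then have "measure N {\<omega>\<in>space N. R < \<bar>V i \<omega>\<bar>} \<le> measure N {\<omega>\<in>space N. R2 i < \<bar>V i \<omega>\<bar>}"
        using R(3)[of i] by (intro N.finite_measure_mono) auto
      then show "measure N {\<omega>\<in>space N. R < \<bar>V i \<omega>\<bar>} \<le> e" using R12(2)[of i] by linarith
    qed
    finally show ?thesis by simp
  qed
  define S where "S = PiE (UNIV :: nat set) (\<lambda>i. if i < m then {-1..1::real} else {0})"
  \<comment> \<open>The sine maps the line into a compact interval and is a trigonometric
    polynomial; \<psi> is \<phi> read through the inverse sine. The remaining coordinates are frozen
    at 0, so the first \<open>m\<close> coordinates separate the points of \<open>S\<close>.\<close>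
  define sn where "sn x = (\<lambda>i. if i < m then sin (x i / R) else 0)" for x :: "nat \<Rightarrow> real"
  define \<psi> where "\<psi> s = \<phi> (\<lambda>i. if i < m then R * arcsin (s i) else 0)" for s :: "nat \<Rightarrow> real"
  have snS: "sn x \<in> S" for x by (auto simp: sn_def S_def)
  have S_iff: "s \<in> S \<longleftrightarrow> (\<forall>i. (i < m \<longrightarrow> -1 \<le> s i \<and> s i \<le> 1) \<and> (m \<le> i \<longrightarrow> s i = 0))" for s
    by (auto simp: S_def PiE_iff not_less[symmetric])
  have coord: "continuous_on X (\<lambda>s :: nat \<Rightarrow> real. s i)" for i X
    by (rule continuous_on_subset[OF continuous_on_product_coordinates]) simp
  have contpsi: "continuous_on S \<psi>"
  proof -
    have "continuous_on S (\<lambda>s :: nat \<Rightarrow> real. (\<lambda>i. if i < m then R * arcsin (s i) else 0))"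
    proof (rule continuous_on_coordinatewise_then_product)
      fix i
      show "continuous_on S (\<lambda>s :: nat \<Rightarrow> real. if i < m then R * arcsin (s i) else 0)"
        by (cases "i < m") (auto simp: S_iff intro!: continuous_intros continuous_on_arcsin coord)
    qed
    then show ?thesis unfolding \<psi>_def
      by (intro continuous_on_compose2[OF cont]) auto
  qed
  \<comment> \<open>The algebra consists of the continuous functions on \<open>S\<close> whose
    composition with the sines is a trigonometric polynomial.\<close>
  have "\<exists>p. (continuous_on S p \<and> trig_fun m (\<lambda>x. p (sn x))) \<and> (\<forall>s\<in>S. \<bar>\<psi> s - p s\<bar> < e)"
  proof (rule Stone_Weierstrass_HOL)
    show "compact S" unfolding S_def by (intro compact_PiE_UNIV) auto
    show "\<exists>f. (continuous_on S f \<and> trig_fun m (\<lambda>x. f (sn x))) \<and> f s \<noteq> f s'" if "s \<in> S \<and> s' \<in> S \<and> s \<noteq> s'" for s s'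
    proof -
      have "\<exists>i. s i \<noteq> s' i" using that by (auto simp: fun_eq_iff)
      then obtain i where i: "s i \<noteq> s' i" by blast
      moreover have "s i = s' i" if "m \<le> i" using that \<open>s \<in> S \<and> s' \<in> S \<and> s \<noteq> s'\<close> by (simp add: S_iff)
      ultimately have "i < m" by (meson not_less)
      with i show ?thesis
        by (intro exI[of _ "\<lambda>s. s i"]) (auto simp: sn_def coord trig_fun_sin)
    qed
  qed (auto intro: trig_fun_const trig_fun_add trig_fun_mult continuous_on_add continuous_on_mult contpsi e(1))
  then obtain p where p: "continuous_on S p" "trig_fun m (\<lambda>x. p (sn x))" "\<And>s. s \<in> S \<Longrightarrow> \<bar>\<psi> s - p s\<bar> < e" by blast
  define T where "T x = p (sn x)" for x
  have T_bdd: "\<bar>T x\<bar> \<le> B + e" for x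
    using p(3)[OF snS[of x]] bdd[of "\<lambda>i. if i < m then R * arcsin (sn x i) else 0"] unfolding T_def \<psi>_def by linarith
  have T_close: "\<bar>\<phi> x - T x\<bar> \<le> e" if "\<And>i. i < m \<Longrightarrow> \<bar>x i\<bar> \<le> R" for x
  proof -
    have "(if i < m then R * arcsin (sn x i) else 0) = (if i < m then x i else 0)" for i
    proof (cases "i < m")
      case True
      then have "x i / R \<le> 1" "-1 \<le> x i / R" using that[OF True] R(1) by (auto simp: field_simps)
      \<comment> \<open>Inside the box the argument of the sine is at most 1 in absolute value,
        hence within the range where the inverse sine undoes it.\<close>
      then have "- (pi / 2) \<le> x i / R" "x i / R \<le> pi / 2" using pi_ge_two by linarith+
      then have "arcsin (sin (x i / R)) = x i / R" by (intro arcsin_sin) auto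
      then show ?thesis using True R(1) by (simp add: sn_def)
    qed simp
    then have "\<psi> (sn x) = \<phi> x" unfolding \<psi>_def using dep[of x] by simp
    then show ?thesis using p(3)[OF snS[of x]] unfolding T_def by linarith
  qed
  have contT: "continuous_on UNIV T" unfolding T_def by (rule trig_fun_continuous[OF p(2)])
  have Zm: "(\<lambda>\<omega> i. Z n i \<omega>) \<in> borel_measurable M" "(\<lambda>\<omega> i. V i \<omega>) \<in> borel_measurable N" for n
    by (auto intro: measurable_coordinatewise_then_product)
  have meas: "(\<lambda>\<omega>. \<phi> (\<lambda>i. Z n i \<omega>)) \<in> borel_measurable M" "(\<lambda>\<omega>. T (\<lambda>i. Z n i \<omega>)) \<in> borel_measurable M"
    "(\<lambda>\<omega>. \<phi> (\<lambda>i. V i \<omega>)) \<in> borel_measurable N" "(\<lambda>\<omega>. T (\<lambda>i. V i \<omega>)) \<in> borel_measurable N" for n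
    by (rule measurable_compose[OF Zm(1) borel_measurable_continuous_onI[OF cont]]
        measurable_compose[OF Zm(1) borel_measurable_continuous_onI[OF contT]]
        measurable_compose[OF Zm(2) borel_measurable_continuous_onI[OF cont]]
        measurable_compose[OF Zm(2) borel_measurable_continuous_onI[OF contT]])+
  have c1: "\<bar>(\<integral>\<omega>. \<phi> (\<lambda>i. Z n i \<omega>) \<partial>M) - (\<integral>\<omega>. T (\<lambda>i. Z n i \<omega>) \<partial>M)\<bar> \<le> e + 2 * B * (real m * e)" for n
    using M meas(1,2) A_sets(1) bdd T_bdd _ A1
    by (rule integral_close) (use e in \<open>auto simp: A1_def not_less intro!: T_close\<close>)
  have c2: "\<bar>(\<integral>\<omega>. \<phi> (\<lambda>i. V i \<omega>) \<partial>N) - (\<integral>\<omega>. T (\<lambda>i. V i \<omega>) \<partial>N)\<bar> \<le> e + 2 * B * (real m * e)"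
    using N meas(3,4) A_sets(2) bdd T_bdd _ A2
    by (rule integral_close) (use e in \<open>auto simp: A2_def not_less intro!: T_close\<close>)
  have "(\<lambda>n. \<integral>\<omega>. T (\<lambda>i. Z n i \<omega>) \<partial>M) \<longlonglongrightarrow> (\<integral>\<omega>. T (\<lambda>i. V i \<omega>) \<partial>N)"
    by (rule trig_fun_integral_tendsto[OF M N Z V char p(2)[folded T_def]])
  then have "\<exists>n0. \<forall>n\<ge>n0. norm ((\<integral>\<omega>. T (\<lambda>i. Z n i \<omega>) \<partial>M) - (\<integral>\<omega>. T (\<lambda>i. V i \<omega>) \<partial>N)) < \<epsilon> / 2"
    using \<epsilon> by (intro LIMSEQ_D) auto
  then obtain n0 where n0: "\<And>n. n \<ge> n0 \<Longrightarrow> \<bar>(\<integral>\<omega>. T (\<lambda>i. Z n i \<omega>) \<partial>M) - (\<integral>\<omega>. T (\<lambda>i. V i \<omega>) \<partial>N)\<bar> < \<epsilon> / 2"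
    by auto
  have "norm ((\<integral>\<omega>. \<phi> (\<lambda>i. Z n i \<omega>) \<partial>M) - (\<integral>\<omega>. \<phi> (\<lambda>i. V i \<omega>) \<partial>N)) < \<epsilon>" if "n \<ge> n0" for n
  proof -
    have q: "e + 2 * B * (real m * e) = \<epsilon> / 4" using e(2) by simp
    show ?thesis using c1[of n] c2 n0[OF that] unfolding q real_norm_def by linarith
  qed
  then show "\<exists>n0. \<forall>n\<ge>n0. norm ((\<integral>\<omega>. \<phi> (\<lambda>i. Z n i \<omega>) \<partial>M) - (\<integral>\<omega>. \<phi> (\<lambda>i. V i \<omega>) \<partial>N)) < \<epsilon>" by blast
qed

subsection \<open>Gaussian sequences\<close>

definition psd_kernel :: "(nat \<Rightarrow> nat \<Rightarrow> real) \<Rightarrow> bool" where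
  "psd_kernel \<kappa> \<longleftrightarrow> (\<forall>k l. \<kappa> k l = \<kappa> l k) \<and>
     (\<forall>F c. finite F \<longrightarrow> 0 \<le> (\<Sum>k\<in>F. \<Sum>l\<in>F. c k * c l * \<kappa> k l))"

lemma psd_kernelD:
  "psd_kernel \<kappa> \<Longrightarrow> finite F \<Longrightarrow> 0 \<le> (\<Sum>k\<in>F. \<Sum>l\<in>F. c k * c l * \<kappa> k l)"
  unfolding psd_kernel_def by blast

lemma psd_kernel_diag: "psd_kernel \<kappa> \<Longrightarrow> 0 \<le> \<kappa> j j"
proof -
  assume "psd_kernel \<kappa>"
  then have "0 \<le> (\<Sum>k\<in>{j}. \<Sum>l\<in>{j}. 1 * 1 * \<kappa> k l)" by (rule psd_kernelD) simp
  then show ?thesis by simp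
qed

text \<open>With a vanishing diagonal entry the quadratic form on two indices is affine in the
  coefficient of \<open>j\<close>, so it stays nonnegative only if its slope vanishes.\<close>

lemma psd_kernel_diag_zero:
  assumes "psd_kernel \<kappa>" "\<kappa> j j = 0"
  shows "\<kappa> k j = 0"
proof (cases "k = j")
  case False
  have sym: "\<kappa> j k = \<kappa> k j" using assms(1) by (simp add: psd_kernel_def)
  \<comment> \<open>For a nonzero slope this coefficient would make the form equal to -1.\<close>
  define s where "s = - (\<kappa> k k + 1) / (2 * \<kappa> k j)"
  define c where "c = (\<lambda>i. if i = j then s else 1)"
  have "0 \<le> (\<Sum>i\<in>{k, j}. \<Sum>l\<in>{k, j}. c i * c l * \<kappa> i l)"
    by (rule psd_kernelD[OF assms(1)]) simp
  then have "0 \<le> \<kappa> k k + 2 * s * \<kappa> k j"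
    using False assms(2) by (simp add: c_def sym)
  moreover have "2 * s * \<kappa> k j = - (\<kappa> k k + 1)" if "\<kappa> k j \<noteq> 0" using that by (simp add: s_def)
  ultimately show ?thesis by fastforce
qed (use assms in simp)

text \<open>Completing the square: the new form at \<open>c\<close> is the old form at
  \<open>c\<close> minus a multiple of the unit vector of \<open>j\<close>. If the pivot is zero,
  division by zero yields 0 and the kernel is unchanged.\<close>

lemma psd_kernel_schur:
  assumes "psd_kernel \<kappa>"
  shows "psd_kernel (\<lambda>k l. \<kappa> k l - \<kappa> k j * \<kappa> j l / \<kappa> j j)"
proof (cases "\<kappa> j j = 0")
  case True
  then show ?thesis using assms by simp
next
  case False
  have sym: "\<kappa> k l = \<kappa> l k" for k l using assms by (simp add: psd_kernel_def)
  have "0 \<le> (\<Sum>k\<in>F. \<Sum>l\<in>F. c k * c l * (\<kappa> k l - \<kappa> k j * \<kappa> j l / \<kappa> j j))" if F: "finite F" for F c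
  proof -
    define c0 where "c0 = (\<lambda>k. if k \<in> F then c k else 0)"
    define F' where "F' = insert j F"
    have F': "finite F'" "j \<in> F'" using F by (auto simp: F'_def)
    have ext1: "(\<Sum>k\<in>F. c k * f k) = (\<Sum>k\<in>F'. c0 k * f k)" for f
      using F' by (intro sum.mono_neutral_cong_left) (auto simp: F'_def c0_def)
    \<comment> \<open>The quotient of \<open>r\<close> by the pivot is the multiple that minimizes
      the old form along direction \<open>j\<close>.\<close>
    define r where "r = (\<Sum>k\<in>F'. c0 k * \<kappa> k j)"
    define s where "s = r / \<kappa> j j"
    define q where "q = (\<Sum>k\<in>F'. \<Sum>l\<in>F'. c0 k * c0 l * \<kappa> k l)"
    define \<delta> where "\<delta> = (\<lambda>k. if k = j then s else 0)"
    have dl: "(\<Sum>l\<in>F'. \<delta> l * f l) = s * f j" for f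
      using F' sum.delta[of F' j "\<lambda>l. s * f l"] by (simp add: \<delta>_def if_distrib[of "\<lambda>a. a * _"] cong: if_cong)
    have in1: "(\<Sum>l\<in>F'. (c0 l - \<delta> l) * \<kappa> k l) = (\<Sum>l\<in>F'. c0 l * \<kappa> k l) - s * \<kappa> k j" for k
      by (simp add: left_diff_distrib sum_subtractf dl)
    have "(\<Sum>k\<in>F'. \<Sum>l\<in>F'. (c0 k - \<delta> k) * (c0 l - \<delta> l) * \<kappa> k l)
        = (\<Sum>k\<in>F'. (c0 k - \<delta> k) * (\<Sum>l\<in>F'. (c0 l - \<delta> l) * \<kappa> k l))"
      by (simp add: sum_distrib_left mult.assoc)
    also have "\<dots> = (\<Sum>k\<in>F'. c0 k * ((\<Sum>l\<in>F'. c0 l * \<kappa> k l) - s * \<kappa> k j)) - s * ((\<Sum>l\<in>F'. c0 l * \<kappa> j l) - s * \<kappa> j j)"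
      unfolding in1 by (simp add: left_diff_distrib sum_subtractf dl)
    also have "(\<Sum>l\<in>F'. c0 l * \<kappa> j l) = r" unfolding r_def by (intro sum.cong refl) (metis sym)
    also have "(\<Sum>k\<in>F'. c0 k * ((\<Sum>l\<in>F'. c0 l * \<kappa> k l) - s * \<kappa> k j)) = q - s * r"
      by (simp add: right_diff_distrib sum_subtractf q_def r_def sum_distrib_left mult_ac)
    also have "q - s * r - s * (r - s * \<kappa> j j) = q - r * r / \<kappa> j j"
      using False by (simp add: s_def field_simps)
    finally have form: "(\<Sum>k\<in>F'. \<Sum>l\<in>F'. (c0 k - \<delta> k) * (c0 l - \<delta> l) * \<kappa> k l) = q - r * r / \<kappa> j j" .
    have "r * r / \<kappa> j j = (\<Sum>k\<in>F'. \<Sum>l\<in>F'. c0 k * \<kappa> k j * (c0 l * \<kappa> l j) / \<kappa> j j)"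
      by (simp add: r_def sum_product sum_divide_distrib)
    also have "\<dots> = (\<Sum>k\<in>F'. \<Sum>l\<in>F'. c0 k * c0 l * (\<kappa> k j * \<kappa> j l / \<kappa> j j))"
    proof (intro sum.cong refl)
      fix k l
      have "\<kappa> l j = \<kappa> j l" by (rule sym)
      then show "c0 k * \<kappa> k j * (c0 l * \<kappa> l j) / \<kappa> j j = c0 k * c0 l * (\<kappa> k j * \<kappa> j l / \<kappa> j j)"
        by simp
    qed
    finally have rr: "r * r / \<kappa> j j = (\<Sum>k\<in>F'. \<Sum>l\<in>F'. c0 k * c0 l * (\<kappa> k j * \<kappa> j l / \<kappa> j j))" .
    have "q - r * r / \<kappa> j j = (\<Sum>k\<in>F'. \<Sum>l\<in>F'. c0 k * c0 l * (\<kappa> k l - \<kappa> k j * \<kappa> j l / \<kappa> j j))"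
      unfolding rr q_def by (simp only: right_diff_distrib sum_subtractf)
    also have "\<dots> = (\<Sum>k\<in>F'. c0 k * (\<Sum>l\<in>F'. c0 l * (\<kappa> k l - \<kappa> k j * \<kappa> j l / \<kappa> j j)))"
      by (simp only: sum_distrib_left mult.assoc)
    also have "\<dots> = (\<Sum>k\<in>F. \<Sum>l\<in>F. c k * c l * (\<kappa> k l - \<kappa> k j * \<kappa> j l / \<kappa> j j))"
      unfolding ext1[symmetric] by (simp only: sum_distrib_left mult.assoc)
    finally have X: "q - r * r / \<kappa> j j = (\<Sum>k\<in>F. \<Sum>l\<in>F. c k * c l * (\<kappa> k l - \<kappa> k j * \<kappa> j l / \<kappa> j j))" .
    have "(\<Sum>k\<in>F. \<Sum>l\<in>F. c k * c l * (\<kappa> k l - \<kappa> k j * \<kappa> j l / \<kappa> j j))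
        = (\<Sum>k\<in>F'. \<Sum>l\<in>F'. (c0 k - \<delta> k) * (c0 l - \<delta> l) * \<kappa> k l)"
      by (rule trans[OF X[symmetric] form[symmetric]])
    moreover have "0 \<le> (\<Sum>k\<in>F'. \<Sum>l\<in>F'. (c0 k - \<delta> k) * (c0 l - \<delta> l) * \<kappa> k l)"
      by (rule psd_kernelD[OF assms F'(1), of "\<lambda>k. c0 k - \<delta> k"])
    ultimately show ?thesis by (simp only:)
  qed
  moreover have "\<kappa> k l - \<kappa> k j * \<kappa> j l / \<kappa> j j = \<kappa> l k - \<kappa> l j * \<kappa> j k / \<kappa> j j" for k l
    using sym[of k l] sym[of k j] sym[of l j] by simp
  ultimately show ?thesis unfolding psd_kernel_def by (intro conjI allI impI)
qed

text \<open>Gaussian elimination of the indices below the first argument, in their natural order, on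
  an infinite matrix. A zero pivot causes no change because of the convention for division by
  zero.\<close>

fun schur :: "(nat \<Rightarrow> nat \<Rightarrow> real) \<Rightarrow> nat \<Rightarrow> nat \<Rightarrow> nat \<Rightarrow> real" where
  "schur \<kappa> 0 k l = \<kappa> k l"
| "schur \<kappa> (Suc j) k l = schur \<kappa> j k l - schur \<kappa> j k j * schur \<kappa> j j l / schur \<kappa> j j j"

lemma psd_kernel_schur_iter:
  assumes "psd_kernel \<kappa>"
  shows "psd_kernel (schur \<kappa> n)"
proof (induction n)
  case 0
  have "schur \<kappa> 0 = \<kappa>" by (intro ext) simp
  then show ?case using assms by simp
next
  case (Suc n)
  have "schur \<kappa> (Suc n) = (\<lambda>k l. schur \<kappa> n k l - schur \<kappa> n k n * schur \<kappa> n n l / schur \<kappa> n n n)"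
    by (intro ext) simp
  then show ?case using psd_kernel_schur[OF Suc, of n] by (simp only:)
qed

text \<open>A nonzero pivot clears its own row; a zero pivot in a positive semidefinite kernel has a
  zero row already. Later eliminations preserve zero rows.\<close>

lemma schur_eq_0:
  assumes "psd_kernel \<kappa>" "k < n"
  shows "schur \<kappa> n k l = 0"
  using assms(2)
proof (induction n arbitrary: l)
  case (Suc n)
  show ?case
  proof (cases "k = n")
    case True
    have p: "psd_kernel (schur \<kappa> n)" using assms(1) by (rule psd_kernel_schur_iter)
    then have "schur \<kappa> n n l = schur \<kappa> n l n" by (simp add: psd_kernel_def)
    then show ?thesis using psd_kernel_diag_zero[OF p, of n l] True by simp
  qed (use Suc in simp)
qed simp

text \<open>The columns are the pivot columns of the elimination divided by the root of the pivot,
  and each elimination step subtracts one product of columns. After more than \<open>k\<close> steps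
  nothing remains in row \<open>k\<close>, so the sum is exact and finite even though the kernel is
  infinite.\<close>

lemma cholesky_decomposition:
  assumes "psd_kernel \<kappa>"
  obtains a where "\<And>k j. k < j \<Longrightarrow> a k j = 0" "\<And>k l n. k < n \<Longrightarrow> \<kappa> k l = (\<Sum>j<n. a k j * a l j)"
proof
  define a where "a k j = schur \<kappa> j k j / sqrt (schur \<kappa> j j j)" for k j
  have psd: "psd_kernel (schur \<kappa> j)" for j using assms by (rule psd_kernel_schur_iter)
  show "a k j = 0" if "k < j" for k j using schur_eq_0[OF assms that] by (simp add: a_def)
  have "\<kappa> k l - schur \<kappa> n k l = (\<Sum>j<n. a k j * a l j)" for k l n
  proof (induction n)
    case (Suc n)
    have "a k n * a l n = schur \<kappa> n k n * schur \<kappa> n n l / schur \<kappa> n n n"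
      using psd_kernel_diag[OF psd[of n], of n] psd[of n] by (simp add: a_def psd_kernel_def)
    then show ?case using Suc by simp
  qed simp
  from this[of _ _ n for n] show "\<kappa> k l = (\<Sum>j<n. a k j * a l j)" if "k < n" for k l n
    using schur_eq_0[OF assms that, of l] by (metis diff_zero)
qed

text \<open>
  The sample space \<open>real ^ 'm \<Rightarrow> real ^ 'n\<close> only serves to carry a sequence of independent standard
  normal variables, each stored as a constant vector at one point of an infinite set.
\<close>
lemma gaussian_sequence_exists:
  assumes \<kappa>: "psd_kernel \<kappa>"
  shows "\<exists>(N :: (real ^ 'm \<Rightarrow> real ^ 'n) measure) V. prob_space N \<and> (\<forall>k. V k \<in> borel_measurable N) \<and>
    (\<forall>m t. (\<integral>\<omega>. cis (\<Sum>k<m. t k * V k \<omega>) \<partial>N) = of_real (exp (- (\<Sum>k<m. \<Sum>l<m. t k * t l * \<kappa> k l) / 2)))"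
proof -
  obtain a where a: "\<And>k j. k < j \<Longrightarrow> a k j = 0" "\<And>k l n. k < n \<Longrightarrow> \<kappa> k l = (\<Sum>j<n. a k j * a l j)"
    using cholesky_decomposition[OF \<kappa>] by blast
  define G where "G = distr std_normal_distribution borel (\<lambda>x. vec x :: real ^ 'n)"
  define N where "N = PiM (UNIV :: (real ^ 'm) set) (\<lambda>_. G)"
  have vec_meas: "(\<lambda>x. vec x :: real ^ 'n) \<in> borel_measurable borel"
    unfolding vec_def by (intro borel_measurable_continuous_onI continuous_intros)
  interpret S: real_distribution std_normal_distribution by (rule real_dist_normal_dist)
  have "prob_space G" unfolding G_def using vec_meas by (intro S.prob_space_distr) simp
  then interpret product_prob_space "\<lambda>_. G" "UNIV :: (real ^ 'm) set" by (intro product_prob_spaceI)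
  interpret N: prob_space N unfolding N_def by (rule P.prob_space_axioms)
  have setsG: "sets G = sets borel" by (simp add: G_def)
  define f where "f = (\<lambda>k :: nat. vec (real k) :: real ^ 'm)"
  have f: "inj f" by (auto simp: f_def inj_on_def vec_eq_iff)
  define i0 :: 'n where "i0 = undefined"
  have nth: "(\<lambda>v :: real ^ 'n. v $ i0) \<in> borel_measurable borel"
    by (intro borel_measurable_continuous_onI continuous_intros)
  define g where "g = (\<lambda>k \<omega> :: real ^ 'm \<Rightarrow> real ^ 'n. \<omega> (f k) $ i0)"
  have comp: "(\<lambda>\<omega>. \<omega> (f k)) \<in> borel_measurable N" for k
    unfolding N_def measurable_cong_sets[OF refl setsG[symmetric]] by (rule measurable_component_singleton) simp
  have dcomp: "distr N borel (\<lambda>\<omega>. \<omega> (f k)) = G" for k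
    using distr_PiM_component[of UNIV "\<lambda>_. G" "f k"] \<open>prob_space G\<close>
    by (simp add: N_def distr_cong[OF refl setsG[symmetric] refl])
  \<comment> \<open>Restricting the product measure to the injectively chosen points is again a
    product, which is the independence of the sampled vectors.\<close>
  have "distr N (PiM UNIV (\<lambda>_. borel)) (\<lambda>x. \<lambda>k\<in>UNIV. x (f k)) = PiM UNIV (\<lambda>k. distr N borel (\<lambda>x. x (f k)))"
  proof -
    have "distr N (PiM UNIV (\<lambda>_. borel)) (\<lambda>x. \<lambda>k\<in>UNIV. x (f k)) = distr N (PiM UNIV (\<lambda>_. G)) (\<lambda>x. \<lambda>k\<in>UNIV. x (f k))"
      by (intro distr_cong sets_PiM_cong refl) (simp add: setsG)
    also have "\<dots> = PiM UNIV (\<lambda>_. G)"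
      unfolding N_def by (rule distr_PiM_reindex) (use f \<open>prob_space G\<close> in auto)
    finally show ?thesis by (simp add: dcomp)
  qed
  then have "N.indep_vars (\<lambda>_. borel) (\<lambda>k \<omega>. \<omega> (f k)) UNIV"
    using comp by (subst N.indep_vars_iff_distr_eq_PiM') auto
  then have indep: "N.indep_vars (\<lambda>_. borel) g UNIV"
    unfolding g_def by (rule N.indep_vars_compose2) simp
  have g_meas[measurable]: "g k \<in> borel_measurable N" for k
    unfolding g_def by (rule measurable_compose[OF comp nth])
  have dg: "distr N borel (g k) = std_normal_distribution" for k
  proof -
    have "distr N borel (g k) = distr (distr N borel (\<lambda>\<omega>. \<omega> (f k))) borel (\<lambda>v. v $ i0)"
      using comp by (subst distr_distr) (auto simp: g_def comp_def)
    also have "\<dots> = distr std_normal_distribution borel (\<lambda>x. x)"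
      unfolding dcomp G_def using vec_meas by (subst distr_distr) (auto simp: comp_def)
    also have "\<dots> = std_normal_distribution" by (rule distr_id2) simp
    finally show ?thesis .
  qed
  \<comment> \<open>The factor is lower triangular, so each variable is a finite combination and no
    series has to converge.\<close>
  define V where "V = (\<lambda>k \<omega>. \<Sum>j\<le>k. a k j * g j \<omega>)"
  have V_meas: "V k \<in> borel_measurable N" for k unfolding V_def by measurable
  have "(\<integral>\<omega>. cis (\<Sum>k<m. t k * V k \<omega>) \<partial>N) = of_real (exp (- (\<Sum>k<m. \<Sum>l<m. t k * t l * \<kappa> k l) / 2))" for m t
  proof -
    define c where "c j = (\<Sum>k<m. t k * a k j)" for j
    have "(\<Sum>k<m. t k * V k \<omega>) = (\<Sum>j<m. c j * g j \<omega>)" for \<omega>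
    proof -
      have "V k \<omega> = (\<Sum>j<m. a k j * g j \<omega>)" if "k < m" for k
        unfolding V_def using that a(1) by (intro sum.mono_neutral_left) auto
      then have "(\<Sum>k<m. t k * V k \<omega>) = (\<Sum>k<m. \<Sum>j<m. t k * a k j * g j \<omega>)"
        by (simp add: sum_distrib_left mult.assoc)
      then show ?thesis by (subst (asm) sum.swap) (simp add: c_def sum_distrib_right)
    qed
    then have "(\<integral>\<omega>. cis (\<Sum>k<m. t k * V k \<omega>) \<partial>N) = char (distr N borel (\<lambda>\<omega>. \<Sum>j\<in>{..<m}. c j * g j \<omega>)) 1"
      unfolding char_def by (subst integral_distr) (auto simp: cis_conv_exp mult.commute)
    also have "\<dots> = (\<Prod>j<m. char (distr N borel (\<lambda>\<omega>. c j * g j \<omega>)) 1)"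
    proof (rule N.char_distr_sum)
      have "N.indep_vars (\<lambda>_. borel) g {..<m}" using indep by (rule N.indep_vars_subset) simp
      then show "N.indep_vars (\<lambda>_. borel) (\<lambda>j \<omega>. c j * g j \<omega>) {..<m}"
        by (rule N.indep_vars_compose2) simp
    qed
    also have "\<dots> = (\<Prod>j<m. of_real (exp (- (c j)\<^sup>2 / 2)))"
    proof (rule prod.cong[OF refl])
      fix j
      have "char (distr N borel (\<lambda>\<omega>. c j * g j \<omega>)) 1 = char (distr N borel (g j)) (c j)"
        unfolding char_def by (simp add: integral_distr)
      then show "char (distr N borel (\<lambda>\<omega>. c j * g j \<omega>)) 1 = of_real (exp (- (c j)\<^sup>2 / 2))"
        by (simp add: dg char_std_normal_distribution)
    qed
    also have "\<dots> = of_real (exp (\<Sum>j<m. - (c j)\<^sup>2 / 2))"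
      by (simp add: exp_sum del: of_real_exp)
    also have "(\<Sum>j<m. - (c j)\<^sup>2 / 2) = - (\<Sum>j<m. (c j)\<^sup>2) / 2"
      by (simp add: sum_negf sum_divide_distrib)
    also have "(\<Sum>j<m. (c j)\<^sup>2) = (\<Sum>k<m. \<Sum>l<m. t k * t l * \<kappa> k l)"
    proof -
      have "(\<Sum>j<m. (c j)\<^sup>2) = (\<Sum>j<m. \<Sum>k<m. \<Sum>l<m. t k * t l * (a k j * a l j))"
        unfolding c_def power2_eq_square sum_product by (simp add: mult_ac)
      also have "\<dots> = (\<Sum>k<m. \<Sum>l<m. \<Sum>j<m. t k * t l * (a k j * a l j))"
        by (subst sum.swap) (subst (2) sum.swap, simp)
      also have "\<dots> = (\<Sum>k<m. \<Sum>l<m. t k * t l * \<kappa> k l)"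
        using a(2)[of _ m] by (simp add: sum_distrib_left[symmetric])
      finally show ?thesis .
    qed
    finally show ?thesis .
  qed
  then show ?thesis using N.prob_space_axioms V_meas by blast
qed

subsection \<open>Asymptotic equicontinuity\<close>

text \<open>Only points with \<open>i\<close>-th coordinate between \<open>p i\<close> and
  \<open>q i\<close> contribute to the increment. As \<open>q i - p i\<close> is at most
  \<open>1 / r\<close>, they lie in at most two strips, those of the endpoints. Two strips and two
  box sums in each account for the factor 4.\<close>

lemma abs_increment_le_one_coordinate:
  fixes x :: "'j \<Rightarrow> 'd \<Rightarrow> real" and e :: "'j \<Rightarrow> real" and r :: nat and I :: "'j set"
  defines "S \<equiv> \<lambda>w. \<Sum>j | j \<in> I \<and> (\<forall>i. x j i \<le> w i). e j"
  assumes fin: "finite I" and r: "0 < r"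
    and R: "\<And>a w. \<bar>\<Sum>j | j \<in> I \<and> min (int r) (max 0 \<lfloor>real r * x j i\<rfloor>) = a \<and> (\<forall>i. x j i \<le> w i). e j\<bar> \<le> R"
    and pq: "\<And>k. k \<noteq> i \<Longrightarrow> p k = q k" "0 \<le> p i" "p i \<le> q i" "q i \<le> 1" "q i - p i \<le> 1 / real r"
  shows "\<bar>S q - S p\<bar> \<le> 4 * R"
proof -
  define lab where "lab j = min (int r) (max 0 \<lfloor>real r * x j i\<rfloor>)" for j
  define Sa where "Sa a w = (\<Sum>j | j \<in> I \<and> lab j = a \<and> (\<forall>i. x j i \<le> w i). e j)" for a w
  \<comment> \<open>A set rather than a pair of labels, so that a strip containing both endpoints is
    counted once.\<close>
  define A where "A = {\<lfloor>real r * p i\<rfloor>, \<lfloor>real r * q i\<rfloor>}"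
  have R': "\<bar>Sa a w\<bar> \<le> R" for a w using R unfolding Sa_def lab_def .
  then have R0: "0 \<le> R" using abs_ge_zero order_trans by blast
  have Sum: "S w = (\<Sum>j\<in>I. e j * of_bool (\<forall>i. x j i \<le> w i))" for w
    unfolding S_def using fin by (intro sum.mono_neutral_cong_left) auto
  have SumA: "(\<Sum>a\<in>A. Sa a w) = (\<Sum>j\<in>I. e j * of_bool (\<forall>i. x j i \<le> w i) * of_bool (lab j \<in> A))" for w
  proof -
    have "(\<Sum>a\<in>A. Sa a w) = (\<Sum>a\<in>A. \<Sum>j\<in>I. e j * of_bool (\<forall>i. x j i \<le> w i) * of_bool (lab j = a))"
      unfolding Sa_def using fin by (intro sum.cong sum.mono_neutral_cong_left) auto
    also have "\<dots> = (\<Sum>j\<in>I. e j * of_bool (\<forall>i. x j i \<le> w i) * (\<Sum>a\<in>A. of_bool (lab j = a)))"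
      by (subst sum.swap) (simp add: sum_distrib_left)
    also have "(\<lambda>j. \<Sum>a\<in>A. of_bool (lab j = a)) = (\<lambda>j. of_bool (lab j \<in> A) :: real)"
      by (intro ext) (simp add: A_def of_bool_def)
    finally show ?thesis .
  qed
  have "S q - S p = (\<Sum>j\<in>I. e j * (of_bool (\<forall>i. x j i \<le> q i) - of_bool (\<forall>i. x j i \<le> p i)))"
    unfolding Sum by (simp add: sum_subtractf right_diff_distrib)
  also have "\<dots> = (\<Sum>j\<in>I. e j * (of_bool (\<forall>i. x j i \<le> q i) - of_bool (\<forall>i. x j i \<le> p i)) * of_bool (lab j \<in> A))"
  proof (intro sum.cong refl)
    fix j
    show "e j * (of_bool (\<forall>i. x j i \<le> q i) - of_bool (\<forall>i. x j i \<le> p i))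
        = e j * (of_bool (\<forall>i. x j i \<le> q i) - of_bool (\<forall>i. x j i \<le> p i)) * of_bool (lab j \<in> A)"
    proof (cases "(\<forall>i. x j i \<le> q i) \<longleftrightarrow> (\<forall>i. x j i \<le> p i)")
      case False
      have "x j k \<le> q k" if "x j k \<le> p k" for k using that pq(1)[of k] pq(3) by (cases "k = i") auto
      then have "\<forall>i. x j i \<le> q i" "\<not> (\<forall>i. x j i \<le> p i)" using False by blast+
      then have "p i < x j i" "x j i \<le> q i" using pq(1) by (metis not_less)+
      then have *: "real r * p i \<le> real r * x j i" "real r * x j i \<le> real r * q i" using r by auto
      have "real r * q i \<le> real r * p i + 1" using pq(5) r by (simp add: field_simps)
      then have "\<lfloor>real r * q i\<rfloor> \<le> \<lfloor>real r * p i\<rfloor> + 1" by linarith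
      moreover have "\<lfloor>real r * p i\<rfloor> \<le> \<lfloor>real r * x j i\<rfloor>" "\<lfloor>real r * x j i\<rfloor> \<le> \<lfloor>real r * q i\<rfloor>"
        using * by (auto intro: floor_mono)
      moreover have "0 \<le> \<lfloor>real r * p i\<rfloor>" using pq(2) by simp
      moreover have "real r * q i \<le> real r" using pq(4) by (simp add: mult_left_le)
      then have "\<lfloor>real r * q i\<rfloor> \<le> int r" by linarith
      ultimately have "lab j = \<lfloor>real r * x j i\<rfloor>"
        "\<lfloor>real r * x j i\<rfloor> = \<lfloor>real r * p i\<rfloor> \<or> \<lfloor>real r * x j i\<rfloor> = \<lfloor>real r * q i\<rfloor>"
        unfolding lab_def by linarith+
      then have "lab j \<in> A" by (auto simp: A_def)
      then show ?thesis by simp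
    qed simp
  qed
  also have "\<dots> = (\<Sum>a\<in>A. Sa a q - Sa a p)"
    unfolding sum_subtractf SumA by (simp add: sum_subtractf[symmetric] left_diff_distrib right_diff_distrib mult_ac)
  finally have "\<bar>S q - S p\<bar> \<le> (\<Sum>a\<in>A. \<bar>Sa a q - Sa a p\<bar>)" by (simp only: sum_abs)
  also have "\<dots> \<le> (\<Sum>a\<in>A. 2 * R)"
  proof (rule sum_mono)
    fix a
    show "\<bar>Sa a q - Sa a p\<bar> \<le> 2 * R" using R'[of a q] R'[of a p] by linarith
  qed
  also have "\<dots> = real (card A) * (2 * R)" by simp
  also have "\<dots> \<le> 2 * (2 * R)"
    using R0 card_insert_le_m1[of 2 "{\<lfloor>real r * q i\<rfloor>}" "\<lfloor>real r * p i\<rfloor>"] by (intro mult_right_mono) (auto simp: A_def card_insert_if)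
  finally show ?thesis by simp
qed

text \<open>The corner is moved from \<open>v\<close> to \<open>u\<close> one coordinate at a time
  through mixed vectors; each move is an increment in a single direction, taken in whichever order
  makes it increasing.\<close>

lemma abs_increment_le:
  fixes x :: "'j \<Rightarrow> 'd::finite \<Rightarrow> real" and e :: "'j \<Rightarrow> real" and r :: nat and I :: "'j set"
  defines "S \<equiv> \<lambda>w. \<Sum>j | j \<in> I \<and> (\<forall>i. x j i \<le> w i). e j"
  assumes fin: "finite I" and r: "0 < r"
    and R: "\<And>i a w. \<bar>\<Sum>j | j \<in> I \<and> min (int r) (max 0 \<lfloor>real r * x j i\<rfloor>) = a \<and> (\<forall>i. x j i \<le> w i). e j\<bar> \<le> R i"
    and u: "\<And>i. 0 \<le> u i \<and> u i \<le> 1" and v: "\<And>i. 0 \<le> v i \<and> v i \<le> 1" and uv: "\<And>i. \<bar>u i - v i\<bar> \<le> 1 / real r"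
  shows "\<bar>S u - S v\<bar> \<le> 4 * (\<Sum>i\<in>UNIV. R i)"
proof -
  define mix where "mix A = (\<lambda>i. if i \<in> A then u i else v i)" for A
  have "\<bar>S (mix A) - S v\<bar> \<le> 4 * (\<Sum>i\<in>A. R i)" if "finite A" for A
    using that
  proof induction
    case empty
    then show ?case by (simp add: mix_def)
  next
    case (insert i A)
    have "\<bar>S (mix (insert i A)) - S (mix A)\<bar> \<le> 4 * R i"
    proof (cases "u i \<le> v i")
      case True
      have "\<bar>S (mix A) - S (mix (insert i A))\<bar> \<le> 4 * R i"
        unfolding S_def using True insert(2) u v uv[of i]
        by (intro abs_increment_le_one_coordinate[OF fin r R]) (auto simp: mix_def)
      then show ?thesis by (simp add: abs_minus_commute)
    next
      case False
      then show ?thesis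
        unfolding S_def using insert(2) u v uv[of i]
        by (intro abs_increment_le_one_coordinate[OF fin r R]) (auto simp: mix_def)
    qed
    then show ?case using insert by simp
  qed
  from this[of UNIV] show ?thesis by (simp add: mix_def)
qed

text \<open>Independent summands contribute the square of the total mean plus their second moments.
  Integrating one observation at a time with a nonnegative offset needs only upper bounds for the
  mean and the second moment: the cross term is monotone in the mean because all sums are
  nonnegative.\<close>

lemma nn_integral_PiM_sum_square:
  fixes g :: "'z \<Rightarrow> real" and c e v L :: real and I :: "'i set"
  assumes P: "prob_space P" and I: "finite I" and g[measurable]: "g \<in> borel_measurable P"
    and bd: "\<And>z. 0 \<le> g z" "\<And>z. g z \<le> L" and e: "(\<integral>z. g z \<partial>P) \<le> e" and v: "(\<integral>z. (g z)\<^sup>2 \<partial>P) \<le> v" and c: "0 \<le> c"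
  shows "(\<integral>\<^sup>+\<omega>. ennreal ((c + (\<Sum>j\<in>I. g (\<omega> j)))\<^sup>2) \<partial>PiM I (\<lambda>_. P)) \<le> ennreal ((c + card I * e)\<^sup>2 + card I * v)"
  using I c
proof (induction I arbitrary: c)
  case empty
  interpret prob_space "PiM ({} :: 'i set) (\<lambda>_. P)" by (intro prob_space_PiM P)
  show ?case using emeasure_space_1 by simp
next
  case (insert i I)
  interpret pr: prob_space P by (rule P)
  interpret product_prob_space "\<lambda>_. P" by standard
  interpret PI: prob_space "PiM I (\<lambda>_. P)" by (intro prob_space_PiM \<open>prob_space P\<close>)
  have L: "0 \<le> L" using bd order_trans by blast
  have int: "integrable P g" "integrable P (\<lambda>z. (g z)\<^sup>2)"
    by (rule pr.integrable_const_bound[of _ L], use bd in simp_all)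
      (rule pr.integrable_const_bound[of _ "L\<^sup>2"], use bd in \<open>auto intro!: power_mono\<close>)
  have "0 \<le> (\<integral>z. g z \<partial>P)" using bd(1) by (intro Bochner_Integration.integral_nonneg)
  then have e0: "0 \<le> e" using e by linarith
  have "0 \<le> (\<integral>z. (g z)\<^sup>2 \<partial>P)" by (intro Bochner_Integration.integral_nonneg) simp
  then have v0: "0 \<le> v" using v by linarith
  have "(\<integral>\<^sup>+\<omega>. ennreal ((c + (\<Sum>j\<in>insert i I. g (\<omega> j)))\<^sup>2) \<partial>PiM (insert i I) (\<lambda>_. P))
      = (\<integral>\<^sup>+x. (\<integral>\<^sup>+z. ennreal ((c + (\<Sum>j\<in>I. g (x j)) + g z)\<^sup>2) \<partial>P) \<partial>PiM I (\<lambda>_. P))"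
  proof (subst product_nn_integral_insert[OF insert(1,2)])
    have "(\<Sum>j\<in>insert i I. g ((x(i := z)) j)) = g z + (\<Sum>j\<in>I. g (x j))" for x z
    proof -
      have "(\<Sum>j\<in>I. g ((x(i := z)) j)) = (\<Sum>j\<in>I. g (x j))" using insert(2) by (intro sum.cong) auto
      then show ?thesis using insert(1,2) by (simp del: fun_upd_apply) simp
    qed
    then show "(\<integral>\<^sup>+x. \<integral>\<^sup>+z. ennreal ((c + (\<Sum>j\<in>insert i I. g ((x(i := z)) j)))\<^sup>2) \<partial>P \<partial>PiM I (\<lambda>_. P))
      = (\<integral>\<^sup>+x. (\<integral>\<^sup>+z. ennreal ((c + (\<Sum>j\<in>I. g (x j)) + g z)\<^sup>2) \<partial>P) \<partial>PiM I (\<lambda>_. P))"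
      by (simp add: add_ac del: fun_upd_apply)
  qed measurable
  also have "\<dots> \<le> (\<integral>\<^sup>+x. ennreal ((c + e + (\<Sum>j\<in>I. g (x j)))\<^sup>2) + ennreal v \<partial>PiM I (\<lambda>_. P))"
  proof (rule nn_integral_mono)
    fix x
    define s where "s = c + (\<Sum>j\<in>I. g (x j))"
    have s: "0 \<le> s" using insert.prems bd(1) by (simp add: s_def sum_nonneg)
    have sq: "(s + g z)\<^sup>2 = s\<^sup>2 + 2 * s * g z + (g z)\<^sup>2" for z by (simp add: power2_sum)
    have "integrable P (\<lambda>z. (s + g z)\<^sup>2)" unfolding sq using int by simp
    then have "(\<integral>\<^sup>+z. ennreal ((s + g z)\<^sup>2) \<partial>P) = ennreal (\<integral>z. (s + g z)\<^sup>2 \<partial>P)"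
      by (intro nn_integral_eq_integral) auto
    also have "(\<integral>z. (s + g z)\<^sup>2 \<partial>P) = (\<integral>z. s\<^sup>2 + 2 * s * g z + (g z)\<^sup>2 \<partial>P)" by (simp only: sq)
    also have "(\<integral>z. s\<^sup>2 + 2 * s * g z + (g z)\<^sup>2 \<partial>P) = s\<^sup>2 + 2 * s * (\<integral>z. g z \<partial>P) + (\<integral>z. (g z)\<^sup>2 \<partial>P)"
      using int by (simp add: pr.prob_space)
    also have "ennreal \<dots> \<le> ennreal ((s + e)\<^sup>2 + v)"
    proof (rule ennreal_leI)
      have "s\<^sup>2 + 2 * s * (\<integral>z. g z \<partial>P) + (\<integral>z. (g z)\<^sup>2 \<partial>P) \<le> s\<^sup>2 + 2 * s * e + v"
        using e v s by (intro add_mono mult_left_mono) auto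
      also have "\<dots> \<le> (s + e)\<^sup>2 + v" by (simp add: power2_sum)
      finally show "s\<^sup>2 + 2 * s * (\<integral>z. g z \<partial>P) + (\<integral>z. (g z)\<^sup>2 \<partial>P) \<le> (s + e)\<^sup>2 + v" .
    qed
    finally show "(\<integral>\<^sup>+z. ennreal ((c + (\<Sum>j\<in>I. g (x j)) + g z)\<^sup>2) \<partial>P) \<le> ennreal ((c + e + (\<Sum>j\<in>I. g (x j)))\<^sup>2) + ennreal v"
      using v0 by (simp add: s_def ennreal_plus[symmetric] add_ac del: ennreal_plus)
  qed
  also have "\<dots> = (\<integral>\<^sup>+x. ennreal ((c + e + (\<Sum>j\<in>I. g (x j)))\<^sup>2) \<partial>PiM I (\<lambda>_. P)) + ennreal v"
    by (subst nn_integral_add) (auto simp: PI.emeasure_space_1)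
  also have "\<dots> \<le> ennreal ((c + e + card I * e)\<^sup>2 + card I * v) + ennreal v"
    using insert.prems e0 by (intro add_right_mono insert.IH) auto
  also have "\<dots> = ennreal ((c + card (insert i I) * e)\<^sup>2 + card (insert i I) * v)"
    using insert(1,2) v0 by (simp add: ennreal_plus[symmetric] algebra_simps del: ennreal_plus)
  finally show ?case .
qed

text \<open>On the unit interval the clamping is inactive and the label is an integer part, so a
  strip lies in an interval of length \<open>1 / r\<close>.\<close>

lemma strip_prob:
  fixes P :: "((real ^ 'm) \<times> (real ^ 'n)) measure"
  assumes sets: "sets P = sets borel"
    and unif: "distr P borel (\<lambda>z. fst z $ i) = uniform_measure lborel {0..1}" and r: "0 < (r :: nat)"
  shows "measure P {z \<in> space P. min (int r) (max 0 \<lfloor>real r * (fst z $ i)\<rfloor>) = s} \<le> 1 / real r"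
proof -
  have [measurable]: "(\<lambda>z. fst z $ i) \<in> borel_measurable P"
    unfolding measurable_cong_sets[OF sets refl] by (intro borel_measurable_continuous_onI continuous_intros)
  define A where "A = {x :: real. min (int r) (max 0 \<lfloor>real r * x\<rfloor>) = s}"
  have A[measurable]: "A \<in> sets borel" unfolding A_def by measurable
  have "{z \<in> space P. min (int r) (max 0 \<lfloor>real r * (fst z $ i)\<rfloor>) = s} = (\<lambda>z. fst z $ i) -` A \<inter> space P"
    by (auto simp: A_def)
  then have "measure P {z \<in> space P. min (int r) (max 0 \<lfloor>real r * (fst z $ i)\<rfloor>) = s} = measure (uniform_measure lborel {0..1}) A"
    unfolding unif[symmetric] by (simp add: measure_distr)
  also have "\<dots> = measure lborel ({0..1} \<inter> A)" by (subst measure_uniform_measure) auto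
  also have "\<dots> \<le> measure lborel {of_int s / real r .. (of_int s + 1) / real r}"
  proof (rule measure_mono_fmeasurable)
    show "{0..1} \<inter> A \<subseteq> {of_int s / real r .. (of_int s + 1) / real r}"
    proof
      fix x assume x: "x \<in> {0..1} \<inter> A"
      then have "real r * x \<le> real r" "0 \<le> real r * x" using r by (auto simp: mult_left_le)
      then have "\<lfloor>real r * x\<rfloor> = s" using x by (auto simp: A_def) linarith+
      then have "of_int s \<le> real r * x" "real r * x \<le> of_int s + 1" by linarith+
      then show "x \<in> {of_int s / real r .. (of_int s + 1) / real r}" using r by (simp add: field_simps)
    qed
  qed (use emeasure_lborel_cbox_finite[of "of_int s / real r" "(of_int s + 1) / real r"] in \<open>auto simp: fmeasurable_def\<close>)
  also have "\<dots> = 1 / real r" using r by (simp add: field_simps)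
  finally show ?thesis .
qed

section \<open>Averages over the sample, truncation and the equicontinuity estimate\<close>

lemma integrable_of_nn_integral_le:
  fixes f :: "'a \<Rightarrow> real"
  assumes "f \<in> borel_measurable M" "\<And>x. 0 \<le> f x" "(\<integral>\<^sup>+x. ennreal (f x) \<partial>M) \<le> ennreal A" "0 \<le> A"
  shows "integrable M f" "(\<integral>x. f x \<partial>M) \<le> A"
proof -
  show int: "integrable M f"
    using assms by (intro integrableI_nonneg) (auto simp: le_less_trans[OF assms(3)])
  have "ennreal (\<integral>x. f x \<partial>M) \<le> ennreal A" using assms int by (subst nn_integral_eq_integral[symmetric]) auto
  then show "(\<integral>x. f x \<partial>M) \<le> A" using assms(4) by (simp add: ennreal_le_iff)
qed

lemma integral_PiM_average:
  fixes f :: "'z \<Rightarrow> real"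
  assumes P: "prob_space P" and f: "integrable P f" and n: "0 < n"
  shows "integrable (PiM {1..n} (\<lambda>_. P)) (\<lambda>\<omega>. (1 / real n) * (\<Sum>j\<in>{1..n}. f (\<omega> j)))"
    and "(\<integral>\<omega>. (1 / real n) * (\<Sum>j\<in>{1..n}. f (\<omega> j)) \<partial>PiM {1..n} (\<lambda>_. P)) = (\<integral>z. f z \<partial>P)"
proof -
  have 1: "integrable (PiM {1..n} (\<lambda>_. P)) (\<lambda>\<omega>. f (\<omega> j))" "(\<integral>\<omega>. f (\<omega> j) \<partial>PiM {1..n} (\<lambda>_. P)) = (\<integral>z. f z \<partial>P)"
    if j: "j \<in> {1..n}" for j
  proof -
    have d: "distr (PiM {1..n} (\<lambda>_. P)) P (\<lambda>\<omega>. \<omega> j) = P" using P j by (intro distr_PiM_component)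
    show "integrable (PiM {1..n} (\<lambda>_. P)) (\<lambda>\<omega>. f (\<omega> j))"
      using integrable_distr[OF measurable_component_singleton[OF j, of "\<lambda>_. P"], of f] f unfolding d by simp
    show "(\<integral>\<omega>. f (\<omega> j) \<partial>PiM {1..n} (\<lambda>_. P)) = (\<integral>z. f z \<partial>P)"
      using f j by (subst d[symmetric], subst integral_distr) auto
  qed
  then show "integrable (PiM {1..n} (\<lambda>_. P)) (\<lambda>\<omega>. (1 / real n) * (\<Sum>j\<in>{1..n}. f (\<omega> j)))"
    by (intro integrable_mult_right Bochner_Integration.integrable_sum) blast
  have "(\<integral>\<omega>. (1 / real n) * (\<Sum>j\<in>{1..n}. f (\<omega> j)) \<partial>PiM {1..n} (\<lambda>_. P)) = (1 / real n) * (\<Sum>j\<in>{1..n}. \<integral>z. f z \<partial>P)"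
    using 1 by (simp add: Bochner_Integration.integral_sum)
  also have "\<dots> = (\<integral>z. f z \<partial>P)" using n by simp
  finally show "(\<integral>\<omega>. (1 / real n) * (\<Sum>j\<in>{1..n}. f (\<omega> j)) \<partial>PiM {1..n} (\<lambda>_. P)) = (\<integral>z. f z \<partial>P)" .
qed

text \<open>The square of \<open>Y\<close> is only integrable, whereas averages over strips need a
  second moment; the squares are therefore cut at \<open>L\<close> and the excess is kept small in
  mean.\<close>

lemma truncation_error_small:
  fixes f :: "'z \<Rightarrow> real"
  assumes f: "integrable P f" "\<And>z. 0 \<le> f z" and \<delta>: "0 < \<delta>"
  shows "\<exists>L>0. (\<integral>z. f z - min (f z) L \<partial>P) \<le> \<delta>"
proof -
  have "(\<lambda>k. \<integral>z. f z - min (f z) (real k) \<partial>P) \<longlonglongrightarrow> (\<integral>z. 0 \<partial>P)"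
  proof (rule integral_dominated_convergence[where w = f])
    show "AE z in P. (\<lambda>k. f z - min (f z) (real k)) \<longlonglongrightarrow> 0"
    proof (rule AE_I2, rule tendsto_eventually)
      fix z
      obtain N where "f z \<le> real N" using real_arch_simple by blast
      then show "\<forall>\<^sub>F k in sequentially. f z - min (f z) (real k) = 0"
        by (intro eventually_sequentiallyI[of N]) auto
    qed
  qed (use f in \<open>auto simp: min_def\<close>)
  then have "eventually (\<lambda>k. (\<integral>z. f z - min (f z) (real k) \<partial>P) < \<delta>) sequentially"
    using \<delta> by (intro order_tendstoD) auto
  then obtain N where "\<And>k. k \<ge> N \<Longrightarrow> (\<integral>z. f z - min (f z) (real k) \<partial>P) < \<delta>"
    unfolding eventually_sequentially by blast
  from this[of "Suc N"] show ?thesis by (intro exI[of _ "real (Suc N)"]) (simp del: of_nat_Suc)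
qed

text \<open>Linearizes a square root at scale \<open>a\<close>, so that its mean is controlled by
  the mean of \<open>z\<close>.\<close>

lemma sqrt_le_add_div:
  assumes "0 < a" "0 \<le> z"
  shows "sqrt z \<le> a + z / a"
proof (cases "sqrt z \<le> a")
  case False
  then have "a * sqrt z \<le> sqrt z * sqrt z" using assms by (intro mult_right_mono) auto
  then have "sqrt z \<le> z / a" using assms by (simp add: field_simps)
  then show ?thesis using assms by linarith
next
  case True
  have "0 \<le> z / a" using assms by simp
  then show ?thesis using True by linarith
qed

lemma exists_chaining_ratio: "\<exists>\<rho>::real. 0 < \<rho> \<and> \<rho> ^ (8 * CARD('d::finite)) = 1 / 2"
  by (intro exI[of _ "root (8 * CARD('d)) (1 / 2)"]) (simp add: real_root_pow_pos)

text \<open>After symmetrization the sample is fixed and the chaining bound is applied once for each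
  coordinate direction, with strips as labels. What remains random is the total weight, whose mean
  is the second moment, and the heaviest strip. A maximum over strips has no convenient mean, so it
  is dominated by the truncation excess plus a sum of squared strip averages; with
  \<open>r + 1\<close> strips and mean squares of order \<open>1 / r ^ 2\<close> this sum is
  small.\<close>

lemma equicontinuity_product:
  fixes P :: "((real ^ 'm) \<times> (real ^ 'n)) measure" and l :: 'n
  defines "h \<equiv> \<lambda>(u, v) z. (indicat_real {x. x \<le> u} (fst z) - indicat_real {x. x \<le> v} (fst z)) * snd z $ l"
  assumes P: "prob_space P" and sets: "sets P = sets borel" and sq: "integrable P (\<lambda>z. (snd z $ l)\<^sup>2)"
    and unif: "\<And>i. distr P borel (\<lambda>z. fst z $ i) = uniform_measure lborel {0..1}" and \<epsilon>: "0 < \<epsilon>"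
  shows "\<exists>r n0. 0 < r \<and> (\<forall>n\<ge>n0. \<forall>F. countable F \<longrightarrow>
    F \<subseteq> {(u, v). u \<in> {0..1} \<and> v \<in> {0..1} \<and> (\<forall>i. \<bar>u $ i - v $ i\<bar> \<le> 1 / real r)} \<longrightarrow>
    (\<integral>\<^sup>+\<omega>. (SUP p\<in>F. ennreal \<bar>(\<Sum>j\<in>{1..n}. h p (\<omega> j) - (\<integral>z. h p z \<partial>P)) / sqrt (real n)\<bar>) \<partial>PiM {1..n} (\<lambda>_. P)) \<le> ennreal \<epsilon>)"
proof -
  interpret P: prob_space P by fact
  note [simp del] = One_nat_def
  obtain \<rho> :: real where \<rho>: "0 < \<rho>" "\<rho> ^ (8 * CARD('m)) = 1 / 2" using exists_chaining_ratio by blast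
  have \<rho>1: "\<rho> < 1" by (rule power_eq_half_less_1[OF \<rho>(2)])
  define C where "C = 7 * (1 / (1 - \<rho>)) ^ CARD('m)"
  have C: "0 < C" using \<rho>1 by (simp add: C_def)
  \<comment> \<open>The 8 is the 2 in front of the signs after symmetrization times the 4 from
    \<open>abs_increment_le\<close>; the sum over coordinate directions gives the
    cardinality.\<close>
  define K where "K = 8 * C * real CARD('m)"
  have K: "0 < K" using C by (simp add: K_def)
  define m2 where "m2 = (\<integral>z. (snd z $ l)\<^sup>2 \<partial>P)"
  have m2: "0 \<le> m2" unfolding m2_def by (intro Bochner_Integration.integral_nonneg) simp
  \<comment> \<open>First \<theta> makes the contribution of the total weight equal to \<epsilon>/2,
    then \<open>a\<close> is chosen relative to \<theta> so that the heaviest strip contributes the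
    other half. Adding 1 to \<open>m2\<close> keeps the quotient defined when \<open>Y\<close>
    vanishes.\<close>
  define \<theta> where "\<theta> = \<epsilon> / (2 * K * (1 + m2))"
  have \<theta>: "0 < \<theta>" "K * (\<theta> * (1 + m2)) = \<epsilon> / 2" using \<epsilon> K m2 by (auto simp: \<theta>_def)
  define a where "a = \<epsilon> * \<theta> ^ 3 / (4 * K)"
  have a: "0 < a" "K * (2 * a) / \<theta> ^ 3 = \<epsilon> / 2" using \<epsilon> K \<theta> by (auto simp: a_def)
  \<comment> \<open>The mean of the strip bound \<open>V\<close> is to be at most the square of
    \<open>a\<close>: a third each for the truncation excess, for \<open>b\<close>, and for the
    squared averages divided by \<open>b\<close>.\<close>
  define b where "b = a\<^sup>2 / 3"
  have b: "0 < b" using a by (simp add: b_def)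
  have "\<exists>L>0. (\<integral>z. (snd z $ l)\<^sup>2 - min ((snd z $ l)\<^sup>2) L \<partial>P) \<le> a\<^sup>2 / 3"
    by (rule truncation_error_small[OF sq]) (use a in auto)
  then obtain L where L: "0 < L" "(\<integral>z. (snd z $ l)\<^sup>2 - min ((snd z $ l)\<^sup>2) L \<partial>P) \<le> a\<^sup>2 / 3" by blast
  obtain r0 where r0: "4 * L\<^sup>2 / (a\<^sup>2 * b / 3) \<le> real r0" using real_arch_simple by blast
  define r where "r = Suc r0"
  have r: "0 < r" "4 * L\<^sup>2 / (a\<^sup>2 * b / 3) \<le> real r" using r0 by (auto simp: r_def)
  show ?thesis
  \<comment> \<open>The same number serves as strip count and as threshold for the sample size: from
    \<open>r \<le> n\<close> on, the fluctuation term \<open>1 / n\<close> is no larger than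
    \<open>1 / r\<close>.\<close>
  proof (rule exI[of _ r], rule exI[of _ r], intro conjI allI impI)
    fix n and F :: "((real ^ 'm) \<times> (real ^ 'm)) set"
    assume n: "r \<le> n" and F: "countable F"
      "F \<subseteq> {(u, v). u \<in> {0..1} \<and> v \<in> {0..1} \<and> (\<forall>i. \<bar>u $ i - v $ i\<bar> \<le> 1 / real r)}"
    have n0: "0 < n" using n r by linarith
    \<comment> \<open>The bound for the mean square of the average over one strip: squared mean plus
      second moment divided by the sample size.\<close>
    define q where "q = L\<^sup>2 / (real r)\<^sup>2 + L\<^sup>2 / (real n * real r)"
    have q0: "0 \<le> q" by (simp add: q_def)
    have q: "(real r + 1) * q \<le> a\<^sup>2 * b / 3"
    proof -
      have "(real r + 1) * q \<le> (2 * real r) * q" using q0 r by (intro mult_right_mono) auto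
      also have "\<dots> = 2 * L\<^sup>2 / real r + 2 * L\<^sup>2 / real n"
        using r n0 by (simp add: q_def distrib_left power2_eq_square)
      also have "\<dots> \<le> 2 * L\<^sup>2 / real r + 2 * L\<^sup>2 / real r"
        using n r by (intro add_left_mono divide_left_mono mult_pos_pos) auto
      also have "\<dots> = 4 * L\<^sup>2 / real r" by simp
      also have "\<dots> \<le> a\<^sup>2 * b / 3" using r a b by (simp add: field_simps)
      finally show ?thesis .
    qed
    let ?PP = "PiM {1..n} (\<lambda>_. P)"
    interpret PP: prob_space ?PP by (intro prob_space_PiM P)
    define lab where "lab i z = min (int r) (max 0 \<lfloor>real r * (fst z $ i)\<rfloor>)" for i and z :: "(real ^ 'm) \<times> (real ^ 'n)"
    have m_fst[measurable]: "(\<lambda>z. fst z $ i) \<in> borel_measurable P" for i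
      unfolding measurable_cong_sets[OF sets refl] by (intro borel_measurable_continuous_onI continuous_intros)
    have m_snd[measurable]: "(\<lambda>z. snd z $ l) \<in> borel_measurable P"
      unfolding measurable_cong_sets[OF sets refl] by (intro borel_measurable_continuous_onI continuous_intros)
    define g where "g i s z = min ((snd z $ l)\<^sup>2) L * of_bool (lab i z = s)" for i s and z :: "(real ^ 'm) \<times> (real ^ 'n)"
    have g_meas[measurable]: "g i s \<in> borel_measurable P" for i s unfolding g_def lab_def by measurable
    define \<tau> where "\<tau> z = (snd z $ l)\<^sup>2 - min ((snd z $ l)\<^sup>2) L" for z :: "(real ^ 'm) \<times> (real ^ 'n)"
    define avg where "avg f \<omega> = (1 / real n) * (\<Sum>j\<in>{1..n}. f (\<omega> j))" for f :: "_ \<Rightarrow> real" and \<omega> :: "nat \<Rightarrow> (real ^ 'm) \<times> (real ^ 'n)"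
    have g_bd: "0 \<le> g i s z" "g i s z \<le> L" for i s z using L by (auto simp: g_def)
    have g_int: "integrable P (g i s)" for i s
      by (rule P.integrable_const_bound[of _ L]) (use g_bd in auto)
    have strip: "measure P {z \<in> space P. lab i z = s} \<le> 1 / real r" for i s
      unfolding lab_def by (rule strip_prob[OF sets unif r(1)])
    have strip_sets[measurable]: "{z \<in> space P. lab i z = s} \<in> sets P" for i s unfolding lab_def by measurable
    have ind_int: "(\<integral>z. D * of_bool (lab i z = s) \<partial>P) = D * measure P {z \<in> space P. lab i z = s}"
      "integrable P (\<lambda>z. D * of_bool (lab i z = s))" for D i s
    proof -
      have *: "of_bool (lab i z = s) = indicat_real {z \<in> space P. lab i z = s} z" if "z \<in> space P" for z
        using that by (simp add: indicator_def)
      have "(\<integral>z. D * of_bool (lab i z = s) \<partial>P) = (\<integral>z. D * indicat_real {z \<in> space P. lab i z = s} z \<partial>P)"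
        by (intro Bochner_Integration.integral_cong refl) (simp only: *)
      then show "(\<integral>z. D * of_bool (lab i z = s) \<partial>P) = D * measure P {z \<in> space P. lab i z = s}" by simp
      have "integrable P (\<lambda>z. D * indicat_real {z \<in> space P. lab i z = s} z)"
        by (intro integrable_mult_right integrable_real_indicator) (auto simp: P.emeasure_eq_measure)
      then show "integrable P (\<lambda>z. D * of_bool (lab i z = s))"
        by (subst Bochner_Integration.integrable_cong[OF refl, of P _ "\<lambda>z. D * indicat_real {z \<in> space P. lab i z = s} z"]) (simp_all only: *)
    qed
    have g_e: "(\<integral>z. g i s z \<partial>P) \<le> L / real r" for i s
    proof -
      have "(\<integral>z. g i s z \<partial>P) \<le> (\<integral>z. L * of_bool (lab i z = s) \<partial>P)"
        by (intro integral_mono g_int ind_int) (auto simp: g_def)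
      also have "\<dots> \<le> L * (1 / real r)" unfolding ind_int using L strip by (intro mult_left_mono) auto
      finally show ?thesis by simp
    qed
    have g_v: "(\<integral>z. (g i s z)\<^sup>2 \<partial>P) \<le> L\<^sup>2 / real r" for i s
    proof -
      have "(\<integral>z. (g i s z)\<^sup>2 \<partial>P) \<le> (\<integral>z. L\<^sup>2 * of_bool (lab i z = s) \<partial>P)"
      proof (intro integral_mono ind_int)
        show "integrable P (\<lambda>z. (g i s z)\<^sup>2)"
          by (rule P.integrable_const_bound[of _ "L\<^sup>2"]) (use g_bd in \<open>auto intro!: power_mono\<close>)
        show "(g i s z)\<^sup>2 \<le> L\<^sup>2 * of_bool (lab i z = s)" for z
          using g_bd[of i s z] by (cases "lab i z = s") (auto intro!: power_mono simp: g_def)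
      qed
      also have "\<dots> \<le> L\<^sup>2 * (1 / real r)" unfolding ind_int using L strip by (intro mult_left_mono) auto
      finally show ?thesis by simp
    qed
    have T_int: "integrable ?PP (\<lambda>\<omega>. (avg (g i s) \<omega>)\<^sup>2)" "(\<integral>\<omega>. (avg (g i s) \<omega>)\<^sup>2 \<partial>?PP) \<le> q" for i s
    proof -
      have meas: "(\<lambda>\<omega>. avg (g i s) \<omega>) \<in> borel_measurable ?PP" unfolding avg_def by measurable
      have "(\<integral>\<^sup>+\<omega>. ennreal ((avg (g i s) \<omega>)\<^sup>2) \<partial>?PP)
          = (\<integral>\<^sup>+\<omega>. ennreal (1 / (real n)\<^sup>2) * ennreal ((0 + (\<Sum>j\<in>{1..n}. g i s (\<omega> j)))\<^sup>2) \<partial>?PP)"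
        by (simp add: avg_def power_divide ennreal_mult[symmetric])
      also have "\<dots> = ennreal (1 / (real n)\<^sup>2) * (\<integral>\<^sup>+\<omega>. ennreal ((0 + (\<Sum>j\<in>{1..n}. g i s (\<omega> j)))\<^sup>2) \<partial>?PP)"
        by (rule nn_integral_cmult) measurable
      also have "\<dots> \<le> ennreal (1 / (real n)\<^sup>2) * ennreal ((0 + card {1..n} * (L / real r))\<^sup>2 + card {1..n} * (L\<^sup>2 / real r))"
        by (intro mult_left_mono nn_integral_PiM_sum_square[where L = L] P g_bd g_e g_v g_meas) auto
      also have "\<dots> = ennreal q"
      proof -
        have "1 / (real n)\<^sup>2 * ((0 + card {1..n} * (L / real r))\<^sup>2 + card {1..n} * (L\<^sup>2 / real r)) = q"
          using n0 r(1) by (simp add: q_def power2_eq_square field_simps)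
        then show ?thesis
          by (subst ennreal_mult[symmetric]) auto
      qed
      finally have le: "(\<integral>\<^sup>+\<omega>. ennreal ((avg (g i s) \<omega>)\<^sup>2) \<partial>?PP) \<le> ennreal q" .
      show "integrable ?PP (\<lambda>\<omega>. (avg (g i s) \<omega>)\<^sup>2)" "(\<integral>\<omega>. (avg (g i s) \<omega>)\<^sup>2 \<partial>?PP) \<le> q"
        by (rule integrable_of_nn_integral_le[OF _ _ le q0]; use meas in simp)+
    qed
    have \<tau>_int: "integrable P \<tau>" unfolding \<tau>_def
      using sq L by (intro Bochner_Integration.integrable_diff Bochner_Integration.integrable_bound[OF sq]) auto
    have avg_int: "integrable ?PP (avg f)" "(\<integral>\<omega>. avg f \<omega> \<partial>?PP) = (\<integral>z. f z \<partial>P)" if "integrable P f" for f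
      unfolding avg_def using integral_PiM_average[OF P that n0] by auto
    define sqY where "sqY z = (snd z $ l)\<^sup>2" for z :: "(real ^ 'm) \<times> (real ^ 'n)"
    have sqY: "integrable P sqY" "(\<integral>z. sqY z \<partial>P) = m2" using sq by (auto simp: sqY_def[abs_def] m2_def)
    \<comment> \<open>This bounds the weight of every strip in direction \<open>i\<close>
      simultaneously, since a strip average is at most \<open>b\<close> plus its square over
      \<open>b\<close>, and that square is one term of the sum.\<close>
    define V where "V i \<omega> = avg \<tau> \<omega> + b + (1 / b) * (\<Sum>s\<in>{0..int r}. (avg (g i s) \<omega>)\<^sup>2)" for i \<omega>
    \<comment> \<open>Dominates the chaining bound with both square roots linearized, at scale 1 for
      the total weight and at scale \<open>a\<close> for the strips.\<close>
    define B where "B i \<omega> = \<theta> * (1 + avg sqY \<omega>) + (a + V i \<omega> / a) / \<theta> ^ 3" for i \<omega>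
    have V_int: "integrable ?PP (V i)" for i unfolding V_def
      using \<tau>_int T_int by (intro Bochner_Integration.integrable_add PP.integrable_const avg_int integrable_mult_right Bochner_Integration.integrable_sum) auto
    have V_E: "(\<integral>\<omega>. V i \<omega> \<partial>?PP) \<le> a\<^sup>2" for i
    proof -
      have "(\<integral>\<omega>. V i \<omega> \<partial>?PP) = (\<integral>z. \<tau> z \<partial>P) + b + (1 / b) * (\<Sum>s\<in>{0..int r}. \<integral>\<omega>. (avg (g i s) \<omega>)\<^sup>2 \<partial>?PP)"
        unfolding V_def using \<tau>_int T_int
        by (simp add: avg_int PP.prob_space)
      also have "\<dots> \<le> a\<^sup>2 / 3 + b + (1 / b) * (\<Sum>s\<in>{0..int r}. q)"
        using L(2) b T_int(2) unfolding \<tau>_def by (intro add_mono mult_left_mono sum_mono) auto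
      also have "(\<Sum>s\<in>{0..int r}. q) = (real r + 1) * q" by simp
      also have "a\<^sup>2 / 3 + b + (1 / b) * ((real r + 1) * q) \<le> a\<^sup>2 / 3 + a\<^sup>2 / 3 + (1 / b) * (a\<^sup>2 * b / 3)"
        using q b by (intro add_mono mult_left_mono) (auto simp: b_def)
      also have "\<dots> = a\<^sup>2" using b by simp
      finally show ?thesis .
    qed
    have B_int: "integrable ?PP (B i)" for i unfolding B_def
      using V_int avg_int(1)[OF sqY(1)]
      by (intro Bochner_Integration.integrable_add PP.integrable_const integrable_mult_right integrable_divide) auto
    have B_E: "(\<integral>\<omega>. B i \<omega> \<partial>?PP) \<le> \<theta> * (1 + m2) + 2 * a / \<theta> ^ 3" for i
    proof -
      have "(\<integral>\<omega>. B i \<omega> \<partial>?PP) = \<theta> * (1 + m2) + (a + (\<integral>\<omega>. V i \<omega> \<partial>?PP) / a) / \<theta> ^ 3"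
        unfolding B_def using V_int avg_int[OF sqY(1)] sqY(2) by (simp add: PP.prob_space)
      also have "\<dots> \<le> \<theta> * (1 + m2) + (a + a\<^sup>2 / a) / \<theta> ^ 3"
        using V_E \<theta> a by (intro add_left_mono divide_right_mono) auto
      also have "\<dots> = \<theta> * (1 + m2) + 2 * a / \<theta> ^ 3" using a by (simp add: power2_eq_square)
      finally show ?thesis .
    qed
    have avg_nonneg: "0 \<le> avg f \<omega>" if "\<And>z. 0 \<le> f z" for f \<omega>
      unfolding avg_def using that by (simp add: sum_nonneg)
    have \<tau>_nonneg: "0 \<le> \<tau> z" for z by (simp add: \<tau>_def)
    have V_nonneg: "0 \<le> V i \<omega>" for i \<omega>
      unfolding V_def using b by (intro add_nonneg_nonneg avg_nonneg \<tau>_nonneg mult_nonneg_nonneg sum_nonneg) auto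
    have B_nonneg: "0 \<le> B i \<omega>" for i \<omega>
      unfolding B_def using \<theta> a V_nonneg avg_nonneg[of sqY \<omega>]
      by (intro add_nonneg_nonneg mult_nonneg_nonneg divide_nonneg_nonneg) (auto simp: sqY_def)
    define h' where "h' p z = h p z / sqrt (real n)" for p z
    \<comment> \<open>A deterministic inequality for each fixed sample; the normalization is
      absorbed into \<open>h'\<close> so that the weights are already divided by the sample
      size.\<close>
    have pointwise: "(\<Sum>\<epsilon>\<in>signs {1..n}. SUP p\<in>F. ennreal \<bar>0 + (\<Sum>j\<in>{1..n}. 2 * \<epsilon> j * h' p (\<omega> j))\<bar>)
        \<le> ennreal (2 ^ n * (8 * C * (\<Sum>i\<in>UNIV. B i \<omega>)))" for \<omega>
    proof -
      define x where "x j i = fst (\<omega> j) $ i" for j i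
      define y where "y j = snd (\<omega> j) $ l / sqrt (real n)" for j
      have y2: "(\<Sum>j\<in>{1..n}. (y j)\<^sup>2) = avg sqY \<omega>"
        by (simp add: y_def power_divide avg_def sqY_def sum_divide_distrib)
      have Vb: "(\<Sum>j | j \<in> {1..n} \<and> lab i (\<omega> j) = s. (y j)\<^sup>2) \<le> V i \<omega>" for i s
      proof -
        define T where "T = avg (g i s) \<omega>"
        have "(\<Sum>j | j \<in> {1..n} \<and> lab i (\<omega> j) = s. (y j)\<^sup>2) = (\<Sum>j\<in>{1..n}. sqY (\<omega> j) / real n * of_bool (lab i (\<omega> j) = s))"
          by (intro sum.mono_neutral_cong_left) (auto simp: y_def sqY_def power_divide)
        also have "\<dots> \<le> (\<Sum>j\<in>{1..n}. (\<tau> (\<omega> j) + g i s (\<omega> j)) / real n)"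
          by (intro sum_mono) (auto simp: \<tau>_def g_def sqY_def divide_right_mono)
        also have "\<dots> = avg \<tau> \<omega> + T"
          by (simp add: avg_def T_def sum.distrib add_divide_distrib sum_divide_distrib)
        also have "T \<le> b + (1 / b) * (\<Sum>s\<in>{0..int r}. (avg (g i s) \<omega>)\<^sup>2)"
        proof (cases "s \<in> {0..int r}")
          case True
          have T0: "0 \<le> T" unfolding T_def by (intro avg_nonneg g_bd)
          have "T = sqrt (T\<^sup>2)" using T0 by simp
          also have "\<dots> \<le> b + T\<^sup>2 / b" by (intro sqrt_le_add_div b) simp
          also have "\<dots> \<le> b + (1 / b) * (\<Sum>s\<in>{0..int r}. (avg (g i s) \<omega>)\<^sup>2)"
          proof -
            have "T\<^sup>2 \<le> (\<Sum>s\<in>{0..int r}. (avg (g i s) \<omega>)\<^sup>2)"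
              unfolding T_def using True by (intro member_le_sum) auto
            then show ?thesis using b by (simp add: divide_right_mono)
          qed
          finally show ?thesis .
        next
          case False
          \<comment> \<open>Clamping produces no labels outside this range, so the corresponding
            strips are empty.\<close>
          then have "g i s z = 0" for z using r by (auto simp: g_def lab_def)
          then have "T = 0" by (simp add: T_def avg_def)
          then show ?thesis using b by (simp add: sum_nonneg)
        qed
        finally show ?thesis by (simp add: V_def)
      qed
      \<comment> \<open>The boxes inside a strip still involve all coordinates; the direction
        \<open>i\<close> enters only through the labels.\<close>
      have "\<forall>i. \<exists>R. (\<forall>\<epsilon> s w. \<bar>\<Sum>j | j \<in> {1..n} \<and> lab i (\<omega> j) = s \<and> (\<forall>i. x j i \<le> w i). \<epsilon> j * y j\<bar> \<le> R \<epsilon>) \<and>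
          (\<Sum>\<epsilon>\<in>signs {1..n}. R \<epsilon>) \<le> 2 ^ card {1..n} * (7 * (1 / (1 - \<rho>)) ^ CARD('m) * (\<theta> * sqrt (\<Sum>j\<in>{1..n}. (y j)\<^sup>2) + sqrt (V i \<omega>) / \<theta> ^ 3))"
        by (intro allI chaining_bound_young \<rho> \<theta> Vb) simp
      from choice[OF this] obtain R where R': "\<forall>i. (\<forall>\<epsilon> s w. \<bar>\<Sum>j | j \<in> {1..n} \<and> lab i (\<omega> j) = s \<and> (\<forall>i. x j i \<le> w i). \<epsilon> j * y j\<bar> \<le> R i \<epsilon>) \<and>
          (\<Sum>\<epsilon>\<in>signs {1..n}. R i \<epsilon>) \<le> 2 ^ card {1..n} * (7 * (1 / (1 - \<rho>)) ^ CARD('m) * (\<theta> * sqrt (\<Sum>j\<in>{1..n}. (y j)\<^sup>2) + sqrt (V i \<omega>) / \<theta> ^ 3))" ..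
      have R: "\<bar>\<Sum>j | j \<in> {1..n} \<and> lab i (\<omega> j) = s \<and> (\<forall>i. x j i \<le> w i). \<epsilon> j * y j\<bar> \<le> R i \<epsilon>" for i \<epsilon> s w
        using R'[rule_format, of i] by blast
      have R2: "(\<Sum>\<epsilon>\<in>signs {1..n}. R i \<epsilon>) \<le> 2 ^ card {1..n} * (7 * (1 / (1 - \<rho>)) ^ CARD('m) * (\<theta> * sqrt (\<Sum>j\<in>{1..n}. (y j)\<^sup>2) + sqrt (V i \<omega>) / \<theta> ^ 3))" for i
        using R'[rule_format, of i] by (elim conjE)
      have RB: "(\<Sum>\<epsilon>\<in>signs {1..n}. R i \<epsilon>) \<le> 2 ^ n * (C * B i \<omega>)" for i
      proof -
        have "sqrt (avg sqY \<omega>) \<le> 1 + avg sqY \<omega>"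
          using sqrt_le_add_div[of 1 "avg sqY \<omega>"] avg_nonneg[of sqY \<omega>] by (simp add: sqY_def)
        moreover have "sqrt (V i \<omega>) \<le> a + V i \<omega> / a" using sqrt_le_add_div[OF a(1) V_nonneg] .
        ultimately have "\<theta> * sqrt (avg sqY \<omega>) + sqrt (V i \<omega>) / \<theta> ^ 3 \<le> B i \<omega>"
          unfolding B_def using \<theta> by (intro add_mono mult_left_mono divide_right_mono) auto
        then have "2 ^ n * (C * (\<theta> * sqrt (avg sqY \<omega>) + sqrt (V i \<omega>) / \<theta> ^ 3)) \<le> 2 ^ n * (C * B i \<omega>)"
          using C by (intro mult_left_mono) auto
        moreover have "(\<Sum>\<epsilon>\<in>signs {1..n}. R i \<epsilon>) \<le> 2 ^ n * (C * (\<theta> * sqrt (avg sqY \<omega>) + sqrt (V i \<omega>) / \<theta> ^ 3))"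
          using R2[of i] by (simp add: y2 C_def)
        ultimately show ?thesis by (rule order_trans[rotated])
      qed
      have "(SUP p\<in>F. ennreal \<bar>0 + (\<Sum>j\<in>{1..n}. 2 * \<epsilon> j * h' p (\<omega> j))\<bar>) \<le> ennreal (8 * (\<Sum>i\<in>UNIV. R i \<epsilon>))" for \<epsilon>
      proof (rule SUP_least)
        fix p assume "p \<in> F"
        then obtain u v where p: "p = (u, v)" "u \<in> {0..1}" "v \<in> {0..1}" "\<And>i. \<bar>u $ i - v $ i\<bar> \<le> 1 / real r"
          using F(2) by auto
        define S where "S w = (\<Sum>j | j \<in> {1..n} \<and> (\<forall>i. x j i \<le> w i). \<epsilon> j * y j)" for w
        have ind: "(\<Sum>j\<in>{1..n}. \<epsilon> j * y j * indicat_real {x. x \<le> u} (fst (\<omega> j))) = S (($) u)" for u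
          unfolding S_def by (intro sum.mono_neutral_cong_right) (auto simp: indicator_def less_eq_vec_def x_def)
        have "(\<Sum>j\<in>{1..n}. 2 * \<epsilon> j * h' p (\<omega> j)) = 2 * (S (($) u) - S (($) v))"
          unfolding ind[symmetric] sum_subtractf[symmetric] sum_distrib_left
          by (intro sum.cong refl) (simp add: h'_def h_def p y_def algebra_simps diff_divide_distrib)
        moreover have "\<bar>S (($) u) - S (($) v)\<bar> \<le> 4 * (\<Sum>i\<in>UNIV. R i \<epsilon>)"
          unfolding S_def
        proof (rule abs_increment_le[OF _ r(1)])
          show "\<bar>\<Sum>j | j \<in> {1..n} \<and> min (int r) (max 0 \<lfloor>real r * x j i\<rfloor>) = a \<and> (\<forall>i. x j i \<le> w i). \<epsilon> j * y j\<bar> \<le> R i \<epsilon>" for i a w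
            using R unfolding lab_def x_def by blast
        qed (use p(2-4) in \<open>auto simp: less_eq_vec_def\<close>)
        ultimately show "ennreal \<bar>0 + (\<Sum>j\<in>{1..n}. 2 * \<epsilon> j * h' p (\<omega> j))\<bar> \<le> ennreal (8 * (\<Sum>i\<in>UNIV. R i \<epsilon>))"
          by (intro ennreal_leI) (simp add: abs_mult)
      qed
      then have "(\<Sum>\<epsilon>\<in>signs {1..n}. SUP p\<in>F. ennreal \<bar>0 + (\<Sum>j\<in>{1..n}. 2 * \<epsilon> j * h' p (\<omega> j))\<bar>)
          \<le> (\<Sum>\<epsilon>\<in>signs {1..n}. ennreal (8 * (\<Sum>i\<in>UNIV. R i \<epsilon>)))"
        by (intro sum_mono)
      also have "\<dots> = ennreal (\<Sum>\<epsilon>\<in>signs {1..n}. 8 * (\<Sum>i\<in>UNIV. R i \<epsilon>))"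
      proof (rule sum_ennreal)
        have "0 \<le> R i \<epsilon>" for i \<epsilon> by (rule order_trans[OF abs_ge_zero R])
        then show "0 \<le> 8 * (\<Sum>i\<in>UNIV. R i \<epsilon>)" for \<epsilon> by (simp add: sum_nonneg)
      qed
      also have "\<dots> \<le> ennreal (2 ^ n * (8 * C * (\<Sum>i\<in>UNIV. B i \<omega>)))"
      proof (rule ennreal_leI)
        have "(\<Sum>\<epsilon>\<in>signs {1..n}. 8 * (\<Sum>i\<in>UNIV. R i \<epsilon>)) = 8 * (\<Sum>i\<in>UNIV. \<Sum>\<epsilon>\<in>signs {1..n}. R i \<epsilon>)"
          by (subst sum.swap) (simp add: sum_distrib_left)
        also have "\<dots> \<le> 8 * (\<Sum>i\<in>UNIV. 2 ^ n * (C * B i \<omega>))"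
          by (intro mult_left_mono sum_mono RB) simp
        also have "\<dots> = 2 ^ n * (8 * C * (\<Sum>i\<in>UNIV. B i \<omega>))" by (simp add: sum_distrib_left mult_ac)
        finally show "(\<Sum>\<epsilon>\<in>signs {1..n}. 8 * (\<Sum>i\<in>UNIV. R i \<epsilon>)) \<le> 2 ^ n * (8 * C * (\<Sum>i\<in>UNIV. B i \<omega>))" .
      qed
      finally show ?thesis .
    qed
    have Y_int: "integrable P (\<lambda>z. snd z $ l)"
      by (rule P.square_integrable_imp_integrable[OF m_snd sq])
    have h_int: "integrable P (h' p)" for p
    proof -
      obtain u v where p: "p = (u, v)" by (cases p)
      have m: "(\<lambda>z. indicat_real {x. x \<le> w} (fst z)) \<in> borel_measurable P" for w
      proof -
        have *: "(\<lambda>z :: (real ^ 'm) \<times> (real ^ 'n). indicat_real {x. x \<le> w} (fst z)) = (\<lambda>z. of_bool (\<forall>i. fst z $ i \<le> w $ i))"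
          by (auto simp: indicator_def less_eq_vec_def)
        show ?thesis unfolding * by measurable
      qed
      have "integrable P (\<lambda>z. indicat_real {x. x \<le> w} (fst z) * snd z $ l)" for w
        using m by (intro Bochner_Integration.integrable_bound[OF Y_int]) (auto simp: indicator_def)
      then show ?thesis unfolding h'_def[abs_def] h_def p by (simp add: left_diff_distrib)
    qed
    have "2 ^ n * (\<integral>\<^sup>+\<omega>. (SUP p\<in>F. ennreal \<bar>0 + (\<Sum>j\<in>{1..n}. h' p (\<omega> j) - (\<integral>z. h' p z \<partial>P))\<bar>) \<partial>?PP)
        \<le> (\<integral>\<^sup>+\<omega>. (\<Sum>\<epsilon>\<in>signs {1..n}. SUP p\<in>F. ennreal \<bar>0 + (\<Sum>j\<in>{1..n}. 2 * \<epsilon> j * h' p (\<omega> j))\<bar>) \<partial>?PP)"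
      using symmetrization[OF P F(1) h_int, where I = "{1..n}" and c = "\<lambda>_. 0"] by simp
    also have "\<dots> \<le> (\<integral>\<^sup>+\<omega>. ennreal (2 ^ n * (8 * C * (\<Sum>i\<in>UNIV. B i \<omega>))) \<partial>?PP)"
      by (intro nn_integral_mono pointwise)
    also have "\<dots> = ennreal (\<integral>\<omega>. 2 ^ n * (8 * C * (\<Sum>i\<in>UNIV. B i \<omega>)) \<partial>?PP)"
      using B_int C B_nonneg
      by (intro nn_integral_eq_integral integrable_mult_right Bochner_Integration.integrable_sum AE_I2 mult_nonneg_nonneg sum_nonneg) auto
    also have "\<dots> \<le> ennreal (2 ^ n * \<epsilon>)"
    proof (rule ennreal_leI)
      have "(\<integral>\<omega>. 2 ^ n * (8 * C * (\<Sum>i\<in>UNIV. B i \<omega>)) \<partial>?PP) = 2 ^ n * (8 * C * (\<Sum>i\<in>UNIV. \<integral>\<omega>. B i \<omega> \<partial>?PP))"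
        using B_int by simp
      also have "\<dots> \<le> 2 ^ n * (8 * C * (\<Sum>i\<in>(UNIV :: 'm set). \<theta> * (1 + m2) + 2 * a / \<theta> ^ 3))"
        using C by (intro mult_left_mono sum_mono B_E) auto
      also have "\<dots> = 2 ^ n * (K * (\<theta> * (1 + m2)) + K * (2 * a) / \<theta> ^ 3)"
        by (simp add: K_def algebra_simps)
      also have "\<dots> = 2 ^ n * \<epsilon>" unfolding \<theta>(2) a(2) by simp
      finally show "(\<integral>\<omega>. 2 ^ n * (8 * C * (\<Sum>i\<in>UNIV. B i \<omega>)) \<partial>?PP) \<le> 2 ^ n * \<epsilon>" .
    qed
    also have "\<dots> = 2 ^ n * ennreal \<epsilon>" using \<epsilon> by (simp add: ennreal_mult ennreal_power[symmetric])
    finally have fin: "2 ^ n * (\<integral>\<^sup>+\<omega>. (SUP p\<in>F. ennreal \<bar>0 + (\<Sum>j\<in>{1..n}. h' p (\<omega> j) - (\<integral>z. h' p z \<partial>P))\<bar>) \<partial>?PP) \<le> 2 ^ n * ennreal \<epsilon>" .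
    have "(\<Sum>j\<in>{1..n}. h p (\<omega> j) - (\<integral>z. h p z \<partial>P)) / sqrt (real n) = 0 + (\<Sum>j\<in>{1..n}. h' p (\<omega> j) - (\<integral>z. h' p z \<partial>P))" for p \<omega>
      by (simp add: h'_def[abs_def] sum_divide_distrib diff_divide_distrib)
    with fin show "(\<integral>\<^sup>+\<omega>. (SUP p\<in>F. ennreal \<bar>(\<Sum>j\<in>{1..n}. h p (\<omega> j) - (\<integral>z. h p z \<partial>P)) / sqrt (real n)\<bar>) \<partial>?PP) \<le> ennreal \<epsilon>"
    proof -
      have pow: "(2 :: ennreal) ^ n = ennreal (2 ^ n)" using ennreal_power[of 2 n] by simp
      assume eq: "\<And>p \<omega>. (\<Sum>j\<in>{1..n}. h p (\<omega> j) - (\<integral>z. h p z \<partial>P)) / sqrt (real n) = 0 + (\<Sum>j\<in>{1..n}. h' p (\<omega> j) - (\<integral>z. h' p z \<partial>P))"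
      from fin show ?thesis unfolding eq pow
        by (subst (asm) ennreal_mult_le_mult_iff) auto
    qed
  qed (use r in simp)
qed

lemma (in prob_space) second_moment_indep_sum:
  fixes X :: "'i \<Rightarrow> 'a \<Rightarrow> real"
  assumes indep: "indep_vars (\<lambda>_. borel) X I" and I: "finite I"
    and sq: "\<And>i. i \<in> I \<Longrightarrow> integrable M (\<lambda>\<omega>. (X i \<omega>)\<^sup>2)" and mean: "\<And>i. i \<in> I \<Longrightarrow> expectation (X i) = 0"
  shows "integrable M (\<lambda>\<omega>. (\<Sum>i\<in>I. X i \<omega>)\<^sup>2)"
    and "expectation (\<lambda>\<omega>. (\<Sum>i\<in>I. X i \<omega>)\<^sup>2) = (\<Sum>i\<in>I. expectation (\<lambda>\<omega>. (X i \<omega>)\<^sup>2))"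
proof -
  have meas[measurable]: "X i \<in> borel_measurable M" if "i \<in> I" for i
    using indep that by (auto simp: indep_vars_def)
  have int: "integrable M (X i)" if "i \<in> I" for i
    by (rule square_integrable_imp_integrable[OF meas[OF that] sq[OF that]])
  have prod: "integrable M (\<lambda>\<omega>. X i \<omega> * X j \<omega>)"
    "expectation (\<lambda>\<omega>. X i \<omega> * X j \<omega>) = (if i = j then expectation (\<lambda>\<omega>. (X i \<omega>)\<^sup>2) else 0)"
    if ij: "i \<in> I" "j \<in> I" for i j
  proof -
    consider "i = j" | "i \<noteq> j" by blast
    then have "integrable M (\<lambda>\<omega>. X i \<omega> * X j \<omega>) \<and>
      expectation (\<lambda>\<omega>. X i \<omega> * X j \<omega>) = (if i = j then expectation (\<lambda>\<omega>. (X i \<omega>)\<^sup>2) else 0)"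
    proof cases
      case 1
      then show ?thesis using sq[OF ij(1)] by (simp add: power2_eq_square)
    next
      case 2
      have ind: "indep_vars (\<lambda>_. borel) X {i, j}" using indep by (rule indep_vars_subset) (use ij in auto)
      have "integrable M (\<lambda>\<omega>. \<Prod>k\<in>{i, j}. X k \<omega>)"
        by (rule indep_vars_integrable[OF _ ind]) (use ij int in auto)
      moreover have "expectation (\<lambda>\<omega>. \<Prod>k\<in>{i, j}. X k \<omega>) = (\<Prod>k\<in>{i, j}. expectation (X k))"
        by (rule indep_vars_lebesgue_integral[OF _ ind]) (use ij int in auto)
      ultimately show ?thesis using 2 mean[OF ij(1)] by simp
    qed
    then show "integrable M (\<lambda>\<omega>. X i \<omega> * X j \<omega>)"
      "expectation (\<lambda>\<omega>. X i \<omega> * X j \<omega>) = (if i = j then expectation (\<lambda>\<omega>. (X i \<omega>)\<^sup>2) else 0)"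
      by auto
  qed
  show "integrable M (\<lambda>\<omega>. (\<Sum>i\<in>I. X i \<omega>)\<^sup>2)"
    unfolding power2_eq_square sum_product by (intro Bochner_Integration.integrable_sum prod(1))
  have "expectation (\<lambda>\<omega>. (\<Sum>i\<in>I. X i \<omega>)\<^sup>2) = (\<Sum>i\<in>I. \<Sum>j\<in>I. expectation (\<lambda>\<omega>. X i \<omega> * X j \<omega>))"
    unfolding power2_eq_square sum_product
    by (simp add: Bochner_Integration.integral_sum prod(1))
  also have "\<dots> = (\<Sum>i\<in>I. \<Sum>j\<in>I. if i = j then expectation (\<lambda>\<omega>. (X i \<omega>)\<^sup>2) else 0)"
    by (intro sum.cong refl prod(2))
  also have "\<dots> = (\<Sum>i\<in>I. expectation (\<lambda>\<omega>. (X i \<omega>)\<^sup>2))"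
    using I by (intro sum.cong refl) simp
  finally show "expectation (\<lambda>\<omega>. (\<Sum>i\<in>I. X i \<omega>)\<^sup>2) = (\<Sum>i\<in>I. expectation (\<lambda>\<omega>. (X i \<omega>)\<^sup>2))" .
qed

lemma borel_measurable_vec_lambda:
  fixes f :: "'n::finite \<Rightarrow> 'a \<Rightarrow> real"
  assumes "\<And>l. f l \<in> borel_measurable M"
  shows "(\<lambda>\<omega>. \<chi> l. f l \<omega>) \<in> borel_measurable M"
  using assms by (subst borel_measurable_euclidean_space) (auto simp: Basis_vec_def inner_axis)

definition close_pairs :: "nat \<Rightarrow> ((real ^ 'm) \<times> (real ^ 'm)) set" where
  "close_pairs r = {(u, v). u \<in> {0..1} \<and> v \<in> {0..1} \<and> (\<forall>i. \<bar>u $ i - v $ i\<bar> \<le> 1 / real r)}"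

lemma close_pairs_antimono:
  assumes "0 < r" "r \<le> R"
  shows "close_pairs R \<subseteq> close_pairs r"
proof -
  have "1 / real R \<le> 1 / real r" using assms by (intro divide_left_mono) auto
  then have "\<bar>u $ i - v $ i\<bar> \<le> 1 / real r" if "\<forall>i. \<bar>u $ i - v $ i\<bar> \<le> 1 / real R" for u v :: "real ^ 'm" and i
    using that order_trans by blast
  then show ?thesis unfolding close_pairs_def by auto
qed

lemma integrable_mult_of_sq:
  fixes f g :: "'z \<Rightarrow> real"
  assumes "f \<in> borel_measurable N" "g \<in> borel_measurable N" "integrable N (\<lambda>z. (f z)\<^sup>2)" "integrable N (\<lambda>z. (g z)\<^sup>2)"
  shows "integrable N (\<lambda>z. f z * g z)"
proof (rule Bochner_Integration.integrable_bound)
  show "integrable N (\<lambda>z. (f z)\<^sup>2 + (g z)\<^sup>2)" using assms by simp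
  have "\<bar>f z * g z\<bar> \<le> (f z)\<^sup>2 + (g z)\<^sup>2" for z
  proof -
    have "2 * \<bar>f z * g z\<bar> \<le> (f z)\<^sup>2 + (g z)\<^sup>2"
      using sum_squares_bound[of "\<bar>f z\<bar>" "\<bar>g z\<bar>"] by (simp add: abs_mult)
    then show ?thesis using abs_ge_zero[of "f z * g z"] by linarith
  qed
  then show "AE z in N. norm (f z * g z) \<le> norm ((f z)\<^sup>2 + (g z)\<^sup>2)" by simp
qed (use assms in simp)

text \<open>Here \<open>P\<close> is the law of \<open>(X, Y)\<close> and \<open>Z i\<close> stands for \<open>(Xs i, Ys i)\<close>.\<close>
locale box_sums = M: prob_space M + P: prob_space P
  for M :: "'a measure" and P :: "((real ^ 'm) \<times> (real ^ 'n)) measure" +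
  fixes Z :: "nat \<Rightarrow> 'a \<Rightarrow> (real ^ 'm) \<times> (real ^ 'n)"
  assumes sets_P: "sets P = sets borel"
    and indep: "M.indep_vars (\<lambda>_. borel) Z {1..}"
    and law: "\<And>i. 1 \<le> i \<Longrightarrow> distr M borel (Z i) = P"
    and sq_norm: "integrable P (\<lambda>z. (norm (snd z))\<^sup>2)"
    and unif: "\<And>i. distr P borel (\<lambda>z. fst z $ i) = uniform_measure lborel {0..1}"
begin

definition h :: "real ^ 'm \<Rightarrow> 'n \<Rightarrow> (real ^ 'm) \<times> (real ^ 'n) \<Rightarrow> real" where
  "h u l z = indicat_real {x. x \<le> u} (fst z) * snd z $ l"

text \<open>Centered by integrals under \<open>P\<close> and not by \<open>fmean\<close>, so that
  the probabilistic part stays independent of densities and conditional expectations.\<close>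

definition S :: "nat \<Rightarrow> real ^ 'm \<Rightarrow> 'n \<Rightarrow> 'a \<Rightarrow> real" where
  "S n u l \<omega> = (\<Sum>j\<in>{1..n}. h u l (Z j \<omega>) - (\<integral>z. h u l z \<partial>P)) / sqrt (real n)"

definition SV :: "nat \<Rightarrow> real ^ 'm \<Rightarrow> 'a \<Rightarrow> real ^ 'n" where
  "SV n u \<omega> = (\<chi> l. S n u l \<omega>)"

definition covK :: "real ^ 'm \<Rightarrow> 'n \<Rightarrow> real ^ 'm \<Rightarrow> 'n \<Rightarrow> real" where
  "covK u k v l = (\<integral>z. h u k z * h v l z \<partial>P) - (\<integral>z. h u k z \<partial>P) * (\<integral>z. h v l z \<partial>P)"

lemma snd_meas: "(\<lambda>z. snd z $ l) \<in> borel_measurable P"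
  unfolding measurable_cong_sets[OF sets_P refl] by (intro borel_measurable_continuous_onI continuous_intros)

lemma fst_meas: "(\<lambda>z. fst z $ i) \<in> borel_measurable P"
  unfolding measurable_cong_sets[OF sets_P refl] by (intro borel_measurable_continuous_onI continuous_intros)

lemma snd_vec_meas: "snd \<in> borel_measurable P"
  unfolding measurable_cong_sets[OF sets_P refl] by (intro borel_measurable_continuous_onI continuous_intros)

lemma ind_meas: "(\<lambda>z. indicat_real {x. x \<le> u} (fst z)) \<in> borel_measurable P"
proof -
  note [measurable] = fst_meas
  have *: "(\<lambda>z :: (real ^ 'm) \<times> (real ^ 'n). indicat_real {x. x \<le> u} (fst z)) = (\<lambda>z. of_bool (\<forall>i. fst z $ i \<le> u $ i))"
    by (auto simp: indicator_def less_eq_vec_def)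
  show ?thesis unfolding * by measurable
qed

lemma h_meas[measurable]: "h u l \<in> borel_measurable P"
  unfolding h_def using ind_meas snd_meas by (rule borel_measurable_times)

lemma sq_comp: "integrable P (\<lambda>z. (snd z $ l)\<^sup>2)"
proof (rule Bochner_Integration.integrable_bound[OF sq_norm])
  have "\<bar>snd z $ l\<bar>\<^sup>2 \<le> (norm (snd z))\<^sup>2" for z :: "(real ^ 'm) \<times> (real ^ 'n)"
    by (intro power_mono component_le_norm_cart) simp
  then show "AE z in P. norm ((snd z $ l)\<^sup>2) \<le> norm ((norm (snd z))\<^sup>2)" by simp
qed (use snd_meas in simp)

lemma h_sq: "integrable P (\<lambda>z. (h u l z)\<^sup>2)"
proof (rule Bochner_Integration.integrable_bound[OF sq_comp[of l]])
  show "(\<lambda>z. (h u l z)\<^sup>2) \<in> borel_measurable P" by measurable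
qed (auto simp: h_def indicator_def)

lemma h_int: "integrable P (h u l)"
  by (rule P.square_integrable_imp_integrable[OF h_meas h_sq])

lemma hh_int: "integrable P (\<lambda>z. h u k z * h v l z)"
  by (intro integrable_mult_of_sq h_meas h_sq)

lemma Z_meas: "1 \<le> i \<Longrightarrow> Z i \<in> borel_measurable M"
  using indep by (auto simp: M.indep_vars_def)

lemma Z_meas_P: "1 \<le> i \<Longrightarrow> Z i \<in> measurable M P"
  using Z_meas measurable_cong_sets[OF refl sets_P] by blast

lemma distr_Z: "1 \<le> i \<Longrightarrow> distr M P (Z i) = P"
  using law distr_cong[OF refl sets_P refl] by metis

lemma S_meas[measurable]: "S n u l \<in> borel_measurable M"
  unfolding S_def
  by (intro borel_measurable_divide borel_measurable_sum borel_measurable_diff borel_measurable_const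
      measurable_compose[OF Z_meas_P h_meas]) auto

lemma SV_meas[measurable]: "SV n u \<in> borel_measurable M"
  unfolding SV_def by (intro borel_measurable_vec_lambda S_meas)

text \<open>Symmetrization integrates the observations one at a time on a product space;
  independence and the common law identify that space with the distribution of the sample.\<close>

lemma nn_integral_sample:
  assumes "0 < n" "f \<in> borel_measurable (PiM {1..n} (\<lambda>_. P))"
  shows "(\<integral>\<^sup>+\<omega>. f (\<lambda>j\<in>{1..n}. Z j \<omega>) \<partial>M) = (\<integral>\<^sup>+x. f x \<partial>PiM {1..n} (\<lambda>_. P))"
proof -
  note [simp del] = One_nat_def
  have ind: "M.indep_vars (\<lambda>_. borel) Z {1..n}" using indep by (rule M.indep_vars_subset) auto
  have "distr M (PiM {1..n} (\<lambda>_. P)) (\<lambda>x. \<lambda>i\<in>{1..n}. Z i x) = distr M (PiM {1..n} (\<lambda>_. borel)) (\<lambda>x. \<lambda>i\<in>{1..n}. Z i x)"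
    by (intro distr_cong sets_PiM_cong refl) (simp add: sets_P)
  also have "\<dots> = PiM {1..n} (\<lambda>i. distr M borel (Z i))"
    using ind assms(1) Z_meas by (subst (asm) M.indep_vars_iff_distr_eq_PiM') auto
  also have "\<dots> = PiM {1..n} (\<lambda>_. P)" by (intro PiM_cong refl law) auto
  finally have d: "distr M (PiM {1..n} (\<lambda>_. P)) (\<lambda>x. \<lambda>i\<in>{1..n}. Z i x) = PiM {1..n} (\<lambda>_. P)" .
  have m: "(\<lambda>x. \<lambda>i\<in>{1..n}. Z i x) \<in> measurable M (PiM {1..n} (\<lambda>_. P))"
    by (intro measurable_restrict Z_meas_P) auto
  show ?thesis using nn_integral_distr[OF m, of f] assms(2) by (simp add: d)
qed

lemma equicontinuity_component:
  assumes "0 < \<epsilon>"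
  shows "\<exists>r n0. 0 < r \<and> (\<forall>n\<ge>n0. \<forall>F. countable F \<longrightarrow>
    F \<subseteq> close_pairs r \<longrightarrow>
    (\<integral>\<^sup>+\<omega>. (SUP (u, v)\<in>F. ennreal \<bar>S n u l \<omega> - S n v l \<omega>\<bar>) \<partial>M) \<le> ennreal \<epsilon>)"
proof -
  note [simp del] = One_nat_def
  define g where "g = (\<lambda>(u :: real ^ 'm, v) (z :: (real ^ 'm) \<times> (real ^ 'n)). (indicat_real {x. x \<le> u} (fst z) - indicat_real {x. x \<le> v} (fst z)) * snd z $ l)"
  obtain r n0 where rn: "0 < r \<and> (\<forall>n\<ge>n0. \<forall>F. countable F \<longrightarrow>
    F \<subseteq> close_pairs r \<longrightarrow>
    (\<integral>\<^sup>+\<omega>. (SUP p\<in>F. ennreal \<bar>(\<Sum>j\<in>{1..n}. g p (\<omega> j) - (\<integral>z. g p z \<partial>P)) / sqrt (real n)\<bar>) \<partial>PiM {1..n} (\<lambda>_. P)) \<le> ennreal \<epsilon>)"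
    using equicontinuity_product[OF P.prob_space_axioms sets_P sq_comp[of l] unif assms] unfolding g_def close_pairs_def by (elim exE)
  note r = conjunct1[OF rn] and n0 = conjunct2[OF rn, rule_format]
  have g: "g (u, v) z = h u l z - h v l z" for u v z by (simp add: g_def h_def left_diff_distrib)
  have g_int: "integrable P (g p)" for p by (cases p) (simp add: g[abs_def] h_int)
  show ?thesis
  proof (rule exI[of _ r], rule exI[of _ "max 1 n0"], intro conjI allI impI r)
    fix n and F :: "((real ^ 'm) \<times> (real ^ 'm)) set"
    assume n: "max 1 n0 \<le> n" and F: "countable F"
      "F \<subseteq> close_pairs r"
    define f where "f x = (SUP p\<in>F. ennreal \<bar>(\<Sum>j\<in>{1..n}. g p (x j) - (\<integral>z. g p z \<partial>P)) / sqrt (real n)\<bar>)" for x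
    have f_meas: "f \<in> borel_measurable (PiM {1..n} (\<lambda>_. P))"
      unfolding f_def using g_int
      by (intro borel_measurable_SUP F measurable_compose[OF _ measurable_ennreal] borel_measurable_abs
          borel_measurable_divide borel_measurable_sum borel_measurable_diff borel_measurable_const
          measurable_compose[OF measurable_component_singleton borel_measurable_integrable]) auto
    have "(\<integral>\<^sup>+\<omega>. (SUP (u, v)\<in>F. ennreal \<bar>S n u l \<omega> - S n v l \<omega>\<bar>) \<partial>M) = (\<integral>\<^sup>+\<omega>. f (\<lambda>j\<in>{1..n}. Z j \<omega>) \<partial>M)"
    proof (rule nn_integral_cong)
      fix \<omega>
      have "S n u l \<omega> - S n v l \<omega> = (\<Sum>j\<in>{1..n}. g (u, v) ((\<lambda>j\<in>{1..n}. Z j \<omega>) j) - (\<integral>z. g (u, v) z \<partial>P)) / sqrt (real n)" for u v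
        unfolding S_def diff_divide_distrib[symmetric] sum_subtractf[symmetric]
        by (intro arg_cong2[where f = "(/)"] sum.cong refl) (simp add: g[abs_def] h_int)
      then show "(SUP (u, v)\<in>F. ennreal \<bar>S n u l \<omega> - S n v l \<omega>\<bar>) = f (\<lambda>j\<in>{1..n}. Z j \<omega>)"
        unfolding f_def by (simp add: case_prod_unfold)
    qed
    also have "\<dots> = (\<integral>\<^sup>+x. f x \<partial>PiM {1..n} (\<lambda>_. P))" using n by (intro nn_integral_sample f_meas) simp
    also have "\<dots> \<le> ennreal \<epsilon>" unfolding f_def using n by (intro n0 F) simp
    finally show "(\<integral>\<^sup>+\<omega>. (SUP (u, v)\<in>F. ennreal \<bar>S n u l \<omega> - S n v l \<omega>\<bar>) \<partial>M) \<le> ennreal \<epsilon>" .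
  qed
qed

text \<open>The Euclidean norm is at most the sum of the absolute components. The finest of the
  component scales works for all of them because \<open>close_pairs\<close> shrinks as the scale
  becomes finer.\<close>

lemma equicontinuity:
  assumes "0 < \<epsilon>"
  shows "\<exists>r n0. 0 < r \<and> (\<forall>n\<ge>n0. \<forall>F. countable F \<longrightarrow>
    F \<subseteq> close_pairs r \<longrightarrow>
    (\<integral>\<^sup>+\<omega>. (SUP (u, v)\<in>F. ennreal (norm (SV n u \<omega> - SV n v \<omega>))) \<partial>M) \<le> ennreal \<epsilon>)"
proof -
  define e where "e = \<epsilon> / real CARD('n)"
  have e: "0 < e" using assms by (simp add: e_def)
  have "\<forall>l. \<exists>r n0. 0 < r \<and> (\<forall>n\<ge>n0. \<forall>F. countable F \<longrightarrow>
    F \<subseteq> close_pairs r \<longrightarrow>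
    (\<integral>\<^sup>+\<omega>. (SUP (u, v)\<in>F. ennreal \<bar>S n u l \<omega> - S n v l \<omega>\<bar>) \<partial>M) \<le> ennreal e)"
    by (intro allI equicontinuity_component e)
  from choice[OF this] obtain r where "\<forall>l. \<exists>n0. 0 < r l \<and> (\<forall>n\<ge>n0. \<forall>F. countable F \<longrightarrow>
    F \<subseteq> close_pairs (r l) \<longrightarrow>
    (\<integral>\<^sup>+\<omega>. (SUP (u, v)\<in>F. ennreal \<bar>S n u l \<omega> - S n v l \<omega>\<bar>) \<partial>M) \<le> ennreal e)" ..
  from choice[OF this] obtain n0 where rn: "\<forall>l. 0 < r l \<and> (\<forall>n\<ge>n0 l. \<forall>F. countable F \<longrightarrow>
    F \<subseteq> close_pairs (r l) \<longrightarrow>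
    (\<integral>\<^sup>+\<omega>. (SUP (u, v)\<in>F. ennreal \<bar>S n u l \<omega> - S n v l \<omega>\<bar>) \<partial>M) \<le> ennreal e)" ..
  have r: "0 < r l" for l using rn by simp
  note n0 = conjunct2[OF rn[THEN spec], rule_format]
  define R where "R = Max (range r)"
  have R: "r l \<le> R" for l unfolding R_def by (intro Max_ge) auto
  show ?thesis
  proof (rule exI[of _ R], rule exI[of _ "Max (range n0)"], intro conjI allI impI)
    show "0 < R" using R[of undefined] r[of undefined] by linarith
    fix n and F :: "((real ^ 'm) \<times> (real ^ 'm)) set"
    assume n: "Max (range n0) \<le> n" and F: "countable F"
      "F \<subseteq> close_pairs R"
    have n': "n0 l \<le> n" for l using n by (meson Max_ge finite finite_imageI order_trans rangeI)
    have F': "F \<subseteq> close_pairs (r l)" for l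
      using F(2) close_pairs_antimono[OF r R] by (rule subset_trans)
    have "(\<integral>\<^sup>+\<omega>. (SUP (u, v)\<in>F. ennreal (norm (SV n u \<omega> - SV n v \<omega>))) \<partial>M)
        \<le> (\<integral>\<^sup>+\<omega>. (\<Sum>l\<in>UNIV. SUP (u, v)\<in>F. ennreal \<bar>S n u l \<omega> - S n v l \<omega>\<bar>) \<partial>M)"
    proof (intro nn_integral_mono SUP_least)
      fix \<omega> p assume p: "p \<in> F"
      obtain u v where uv: "p = (u, v)" by (cases p)
      have "norm (SV n u \<omega> - SV n v \<omega>) \<le> (\<Sum>l\<in>UNIV. \<bar>S n u l \<omega> - S n v l \<omega>\<bar>)"
        using norm_le_l1_cart[of "SV n u \<omega> - SV n v \<omega>"] by (simp add: SV_def)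
      then have "ennreal (norm (SV n u \<omega> - SV n v \<omega>)) \<le> (\<Sum>l\<in>UNIV. ennreal \<bar>S n u l \<omega> - S n v l \<omega>\<bar>)"
        by (subst sum_ennreal) (auto intro: ennreal_leI)
      also have "\<dots> \<le> (\<Sum>l\<in>UNIV. SUP (u, v)\<in>F. ennreal \<bar>S n u l \<omega> - S n v l \<omega>\<bar>)"
        using p uv by (intro sum_mono SUP_upper2[of p]) auto
      finally show "(case p of (u, v) \<Rightarrow> ennreal (norm (SV n u \<omega> - SV n v \<omega>))) \<le> (\<Sum>l\<in>UNIV. SUP (u, v)\<in>F. ennreal \<bar>S n u l \<omega> - S n v l \<omega>\<bar>)"
        by (simp add: uv)
    qed
    also have "\<dots> = (\<Sum>l\<in>UNIV. \<integral>\<^sup>+\<omega>. (SUP (u, v)\<in>F. ennreal \<bar>S n u l \<omega> - S n v l \<omega>\<bar>) \<partial>M)"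
      using F(1) by (intro nn_integral_sum borel_measurable_SUP) (auto simp: case_prod_unfold)
    also have "\<dots> \<le> (\<Sum>l\<in>(UNIV :: 'n set). ennreal e)"
      by (intro sum_mono n0 n' F(1) F')
    also have "\<dots> = ennreal \<epsilon>"
      by (subst sum_ennreal) (use e in \<open>auto simp: e_def\<close>)
    finally show "(\<integral>\<^sup>+\<omega>. (SUP (u, v)\<in>F. ennreal (norm (SV n u \<omega> - SV n v \<omega>))) \<partial>M) \<le> ennreal \<epsilon>" .
  qed
qed

end

subsection \<open>Convergence of the finite-dimensional distributions\<close>

text \<open>Observations are numbered from 1, the central limit theorem numbers them from 0.\<close>

lemma (in prob_space) indep_vars_Suc:
  assumes "indep_vars M' X {1..}"
  shows "indep_vars (\<lambda>i. M' (Suc i)) (\<lambda>i. X (Suc i)) UNIV"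
  unfolding indep_vars_def2
proof (intro conjI ballI)
  show "random_variable (M' (Suc i)) (X (Suc i))" for i using assms by (simp add: indep_vars_def2)
  have ind: "indep_sets (\<lambda>i. {X i -` A \<inter> space M |A. A \<in> sets (M' i)}) {1..}"
    using assms by (simp add: indep_vars_def2)
  show "indep_sets (\<lambda>i. {X (Suc i) -` A \<inter> space M |A. A \<in> sets (M' (Suc i))}) UNIV"
  proof (rule indep_setsI)
    show "{X (Suc i) -` A \<inter> space M |A. A \<in> sets (M' (Suc i))} \<subseteq> events" for i
      using ind by (auto simp: indep_sets_def)
    fix A and J :: "nat set"
    assume J: "J \<noteq> {}" "J \<subseteq> UNIV" "finite J" and A: "\<forall>j\<in>J. A j \<in> {X (Suc j) -` A \<inter> space M |A. A \<in> sets (M' (Suc j))}"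
    have "prob (\<Inter>j\<in>Suc ` J. A (j - 1)) = (\<Prod>j\<in>Suc ` J. prob (A (j - 1)))"
      by (rule indep_setsD[OF ind]) (use J A in auto)
    then show "prob (\<Inter> (A ` J)) = (\<Prod>j\<in>J. prob (A j))"
      by (simp add: prod.reindex)
  qed
qed

lemma char_eq_integral_cis: "char N t = (\<integral>x. cis (t * x) \<partial>N)"
  unfolding char_def by (simp add: cis_conv_exp)

lemma cis_meas[measurable]: "cis \<in> borel_measurable borel"
  by (intro borel_measurable_continuous_onI continuous_on_cis continuous_on_id)

context box_sums begin

lemma Z_integral:
  fixes f :: "(real ^ 'm) \<times> (real ^ 'n) \<Rightarrow> real"
  assumes "1 \<le> i" "f \<in> borel_measurable P"
  shows "(\<integral>\<omega>. f (Z i \<omega>) \<partial>M) = (\<integral>z. f z \<partial>P)" "integrable M (\<lambda>\<omega>. f (Z i \<omega>)) \<longleftrightarrow> integrable P f"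
  using integral_distr[OF Z_meas_P[OF assms(1)], of f] integrable_distr_eq[OF Z_meas_P[OF assms(1)], of f] assms
  by (simp_all add: distr_Z)

lemma centered_second_moment:
  fixes f :: "(real ^ 'm) \<times> (real ^ 'n) \<Rightarrow> real"
  assumes "f \<in> borel_measurable P" and sq: "integrable P (\<lambda>z. (f z)\<^sup>2)"
  shows "integrable P (\<lambda>z. (f z - (\<integral>z. f z \<partial>P))\<^sup>2)"
    "(\<integral>z. (f z - (\<integral>z. f z \<partial>P))\<^sup>2 \<partial>P) = (\<integral>z. (f z)\<^sup>2 \<partial>P) - (\<integral>z. f z \<partial>P)\<^sup>2"
proof -
  define \<mu> where "\<mu> = (\<integral>z. f z \<partial>P)"
  have int: "integrable P f" by (rule P.square_integrable_imp_integrable[OF assms])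
  have *: "(f z - \<mu>)\<^sup>2 = (f z)\<^sup>2 - 2 * \<mu> * f z + \<mu>\<^sup>2" for z by (simp add: power2_diff)
  have "integrable P (\<lambda>z. (f z - \<mu>)\<^sup>2)" unfolding * using int sq by simp
  then show "integrable P (\<lambda>z. (f z - (\<integral>z. f z \<partial>P))\<^sup>2)" unfolding \<mu>_def .
  have "(\<integral>z. (f z - \<mu>)\<^sup>2 \<partial>P) = (\<integral>z. (f z)\<^sup>2 \<partial>P) - 2 * \<mu> * (\<integral>z. f z \<partial>P) + \<mu>\<^sup>2"
    unfolding * using int sq by (simp add: P.prob_space)
  then show "(\<integral>z. (f z - (\<integral>z. f z \<partial>P))\<^sup>2 \<partial>P) = (\<integral>z. (f z)\<^sup>2 \<partial>P) - (\<integral>z. f z \<partial>P)\<^sup>2"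
    unfolding \<mu>_def by (simp add: power2_eq_square)
qed

text \<open>For a nonempty sample this is an equality; the inequality includes \<open>n = 0\<close>,
  where division by zero makes the normalized sum 0. A bound uniform in all \<open>n\<close> is what
  tightness needs.\<close>

lemma normalized_sum_second_moment:
  assumes f[measurable]: "f \<in> borel_measurable P" and sq: "integrable P (\<lambda>z. (f z)\<^sup>2)"
  shows "integrable M (\<lambda>\<omega>. ((\<Sum>j\<in>{1..n}. f (Z j \<omega>) - (\<integral>z. f z \<partial>P)) / sqrt (real n))\<^sup>2)"
    "(\<integral>\<omega>. ((\<Sum>j\<in>{1..n}. f (Z j \<omega>) - (\<integral>z. f z \<partial>P)) / sqrt (real n))\<^sup>2 \<partial>M) \<le> (\<integral>z. (f z)\<^sup>2 \<partial>P) - (\<integral>z. f z \<partial>P)\<^sup>2"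
proof -
  note [simp del] = One_nat_def
  define \<mu> where "\<mu> = (\<integral>z. f z \<partial>P)"
  have int: "integrable P f" by (rule P.square_integrable_imp_integrable[OF f sq])
  have v: "integrable P (\<lambda>z. (f z - \<mu>)\<^sup>2)" "(\<integral>z. (f z - \<mu>)\<^sup>2 \<partial>P) = (\<integral>z. (f z)\<^sup>2 \<partial>P) - \<mu>\<^sup>2"
    using centered_second_moment[OF f sq] by (simp_all add: \<mu>_def)
  have ind: "M.indep_vars (\<lambda>_. borel) (\<lambda>j \<omega>. f (Z j \<omega>) - \<mu>) {1..n}"
    using M.indep_vars_subset[OF indep, of "{1..n}"]
    by (rule M.indep_vars_compose2) (auto simp: measurable_cong_sets[OF sets_P[symmetric] refl])
  have sqj: "integrable M (\<lambda>\<omega>. (f (Z j \<omega>) - \<mu>)\<^sup>2)" "(\<integral>\<omega>. (f (Z j \<omega>) - \<mu>)\<^sup>2 \<partial>M) = (\<integral>z. (f z - \<mu>)\<^sup>2 \<partial>P)"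
    "(\<integral>\<omega>. f (Z j \<omega>) - \<mu> \<partial>M) = 0" if "j \<in> {1..n}" for j
    using that v int Z_integral[of j "\<lambda>z. (f z - \<mu>)\<^sup>2"] Z_integral[of j "\<lambda>z. f z - \<mu>"]
    by (auto simp: P.prob_space \<mu>_def)
  note sm = M.second_moment_indep_sum[OF ind _ sqj(1) sqj(3)]
  show "integrable M (\<lambda>\<omega>. ((\<Sum>j\<in>{1..n}. f (Z j \<omega>) - (\<integral>z. f z \<partial>P)) / sqrt (real n))\<^sup>2)"
    unfolding power_divide \<mu>_def[symmetric] by (intro integrable_divide sm) auto
  have "(\<integral>\<omega>. ((\<Sum>j\<in>{1..n}. f (Z j \<omega>) - \<mu>) / sqrt (real n))\<^sup>2 \<partial>M) = (\<Sum>j\<in>{1..n}. \<integral>\<omega>. (f (Z j \<omega>) - \<mu>)\<^sup>2 \<partial>M) / real n"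
    unfolding power_divide using sm(2) by simp
  also have "\<dots> = (\<Sum>j\<in>{1..n}. \<integral>z. (f z - \<mu>)\<^sup>2 \<partial>P) / real n" using sqj(2) by simp
  also have "\<dots> \<le> (\<integral>z. (f z - \<mu>)\<^sup>2 \<partial>P)" by (simp add: Bochner_Integration.integral_nonneg)
  finally show "(\<integral>\<omega>. ((\<Sum>j\<in>{1..n}. f (Z j \<omega>) - (\<integral>z. f z \<partial>P)) / sqrt (real n))\<^sup>2 \<partial>M) \<le> (\<integral>z. (f z)\<^sup>2 \<partial>P) - (\<integral>z. f z \<partial>P)\<^sup>2"
    using v(2) unfolding \<mu>_def by linarith
qed

lemma S_tight:
  assumes e: "0 < e"
  shows "\<exists>R. \<forall>n. measure M {\<omega>\<in>space M. R < \<bar>S n u l \<omega>\<bar>} \<le> e"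
proof -
  define m where "m = (\<integral>z. (h u l z)\<^sup>2 \<partial>P)"
  have m: "0 \<le> m" unfolding m_def by (intro Bochner_Integration.integral_nonneg) simp
  \<comment> \<open>Chebyshev's inequality with this radius gives at most \<open>e\<close>; adding 1
    keeps the radius positive when the second moment vanishes.\<close>
  define R where "R = sqrt ((m + 1) / e)"
  have R: "0 < R" "R\<^sup>2 = (m + 1) / e" using m e by (auto simp: R_def)
  have "measure M {\<omega>\<in>space M. R < \<bar>S n u l \<omega>\<bar>} \<le> e" for n
  proof -
    have int: "integrable M (\<lambda>\<omega>. (S n u l \<omega>)\<^sup>2)" and le: "(\<integral>\<omega>. (S n u l \<omega>)\<^sup>2 \<partial>M) \<le> m"
      using normalized_sum_second_moment[OF h_meas h_sq, of u l n] zero_le_power2[of "\<integral>z. h u l z \<partial>P"]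
      unfolding S_def m_def by linarith+
    have "measure M {\<omega>\<in>space M. R < \<bar>S n u l \<omega>\<bar>} \<le> measure M {\<omega>\<in>space M. R\<^sup>2 \<le> (S n u l \<omega>)\<^sup>2}"
    proof (rule M.finite_measure_mono)
      show "{\<omega>\<in>space M. R < \<bar>S n u l \<omega>\<bar>} \<subseteq> {\<omega>\<in>space M. R\<^sup>2 \<le> (S n u l \<omega>)\<^sup>2}"
      proof safe
        fix \<omega> assume "R < \<bar>S n u l \<omega>\<bar>"
        then show "R\<^sup>2 \<le> (S n u l \<omega>)\<^sup>2" using R(1) by (subst abs_le_square_iff[symmetric]) auto
      qed
    qed measurable
    also have "\<dots> \<le> (\<integral>\<omega>. (S n u l \<omega>)\<^sup>2 \<partial>M) / R\<^sup>2"
      by (rule integral_Markov_inequality_measure[OF int sets.empty_sets]) (use R(1) in simp_all)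
    also have "\<dots> \<le> m / R\<^sup>2" using le by (intro divide_right_mono) auto
    also have "\<dots> \<le> e" unfolding R(2) using m e by (simp add: field_simps)
    finally show ?thesis .
  qed
  then show ?thesis by blast
qed

text \<open>The central limit theorem requires positive variance. If the variance is 0, the summands
  equal their mean almost surely and the integrand is 1 for every sample size.\<close>

lemma normalized_sum_char_limit:
  assumes f[measurable]: "f \<in> borel_measurable P" and sq: "integrable P (\<lambda>z. (f z)\<^sup>2)"
  shows "(\<lambda>n. \<integral>\<omega>. cis ((\<Sum>j\<in>{1..n}. f (Z j \<omega>) - (\<integral>z. f z \<partial>P)) / sqrt (real n)) \<partial>M)
    \<longlonglongrightarrow> of_real (exp (- ((\<integral>z. (f z)\<^sup>2 \<partial>P) - (\<integral>z. f z \<partial>P)\<^sup>2) / 2))"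
proof -
  define \<mu> where "\<mu> = (\<integral>z. f z \<partial>P)"
  define v where "v = (\<integral>z. (f z)\<^sup>2 \<partial>P) - \<mu>\<^sup>2"
  have int: "integrable P f" by (rule P.square_integrable_imp_integrable[OF f sq])
  have v: "integrable P (\<lambda>z. (f z - \<mu>)\<^sup>2)" "(\<integral>z. (f z - \<mu>)\<^sup>2 \<partial>P) = v"
    using centered_second_moment[OF f sq] by (simp_all add: \<mu>_def v_def)
  have v0: "0 \<le> v" unfolding v(2)[symmetric] by (intro Bochner_Integration.integral_nonneg) simp
  have fZ[measurable]: "(\<lambda>\<omega>. f (Z j \<omega>)) \<in> borel_measurable M" if "1 \<le> j" for j
    by (rule measurable_compose[OF Z_meas_P[OF that] f])
  show ?thesis
  proof (cases "v = 0")
    case True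
    then have "AE z in P. (f z - \<mu>)\<^sup>2 = 0"
      using v by (subst integral_nonneg_eq_0_iff_AE[symmetric]) auto
    then have "AE z in P. f z - \<mu> = 0" by simp
    then have *: "AE \<omega> in M. f (Z j \<omega>) - \<mu> = 0" if "1 \<le> j" for j
      using AE_distrD[OF Z_meas_P[OF that], of "\<lambda>z. f z - \<mu> = 0"] unfolding distr_Z[OF that] by blast
    have "(\<integral>\<omega>. cis ((\<Sum>j\<in>{1..n}. f (Z j \<omega>) - \<mu>) / sqrt (real n)) \<partial>M) = 1" for n
    proof -
      have "AE \<omega> in M. \<forall>j\<in>{1..n}. f (Z j \<omega>) - \<mu> = 0" by (intro AE_finite_allI *) auto
      then have "AE \<omega> in M. cis ((\<Sum>j\<in>{1..n}. f (Z j \<omega>) - \<mu>) / sqrt (real n)) = 1"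
        by eventually_elim (simp add: sum.neutral)
      then have "(\<integral>\<omega>. cis ((\<Sum>j\<in>{1..n}. f (Z j \<omega>) - \<mu>) / sqrt (real n)) \<partial>M) = (\<integral>\<omega>. 1 \<partial>M)"
        by (intro integral_cong_AE) measurable
      then show ?thesis by (simp add: M.prob_space)
    qed
    then show ?thesis using True by (simp add: \<mu>_def[symmetric] v_def[symmetric])
  next
    case False
    then have vpos: "0 < sqrt v" using v0 by simp
    define X where "X k \<omega> = f (Z (Suc k) \<omega>)" for k \<omega>
    define D where "D n = distr M borel (\<lambda>x. (\<Sum>i<n. X i x - \<mu>) / sqrt (real n * (sqrt v)\<^sup>2))" for n
    have X_meas[measurable]: "X k \<in> borel_measurable M" for k unfolding X_def by (rule fZ) simp
    have wc: "weak_conv_m D std_normal_distribution"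
      unfolding D_def
    proof (rule M.central_limit_theorem)
      have "M.indep_vars (\<lambda>_. borel) (\<lambda>k. Z (Suc k)) UNIV" using M.indep_vars_Suc[OF indep] by simp
      then show "M.indep_vars (\<lambda>i. borel) X UNIV"
        unfolding X_def by (rule M.indep_vars_compose2) (auto simp: measurable_cong_sets[OF sets_P[symmetric] refl])
      show mX: "M.expectation (X k) = \<mu>" for k unfolding X_def \<mu>_def by (rule Z_integral) auto
      show "0 < sqrt v" by (rule vpos)
      show "integrable M (\<lambda>x. (X k x)\<^sup>2)" for k
        unfolding X_def using sq Z_integral(2)[of "Suc k" "\<lambda>z. (f z)\<^sup>2"] by simp
      show "M.variance (X k) = (sqrt v)\<^sup>2" for k
        unfolding mX unfolding X_def using Z_integral(1)[of "Suc k" "\<lambda>z. (f z - \<mu>)\<^sup>2"] v v0 by simp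
      show "distr M borel (X k) = distr P borel f" for k
      proof -
        have "distr P borel f = distr (distr M P (Z (Suc k))) borel f" by (simp add: distr_Z)
        also have "\<dots> = distr M borel (X k)"
          by (subst distr_distr) (auto simp: X_def[abs_def] comp_def intro: Z_meas_P)
        finally show ?thesis ..
      qed
    qed
    \<comment> \<open>The theorem standardizes the sum, so its characteristic function is evaluated
      at the standard deviation to undo this.\<close>
    have "(\<lambda>n. char (D n) (sqrt v)) \<longlonglongrightarrow> char std_normal_distribution (sqrt v)"
      by (rule levy_continuity1[OF _ real_dist_normal_dist wc]) (simp add: D_def M.real_distribution_distr)
    moreover have "char (D n) (sqrt v) = (\<integral>\<omega>. cis ((\<Sum>j\<in>{1..n}. f (Z j \<omega>) - \<mu>) / sqrt (real n)) \<partial>M)" for n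
    proof -
      have "char (D n) (sqrt v) = (\<integral>\<omega>. cis (sqrt v * ((\<Sum>i<n. X i \<omega> - \<mu>) / sqrt (real n * (sqrt v)\<^sup>2))) \<partial>M)"
        unfolding char_eq_integral_cis D_def by (subst integral_distr) measurable
      also have "\<dots> = (\<integral>\<omega>. cis ((\<Sum>j\<in>{1..n}. f (Z j \<omega>) - \<mu>) / sqrt (real n)) \<partial>M)"
      proof (intro Bochner_Integration.integral_cong refl arg_cong[where f = cis])
        fix \<omega>
        have "(\<Sum>j\<in>{1..n}. f (Z j \<omega>) - \<mu>) = (\<Sum>i<n. X i \<omega> - \<mu>)"
          unfolding X_def by (rule sum.reindex_bij_witness[of _ Suc "\<lambda>j. j - 1"]) auto
        then show "sqrt v * ((\<Sum>i<n. X i \<omega> - \<mu>) / sqrt (real n * (sqrt v)\<^sup>2)) = (\<Sum>j\<in>{1..n}. f (Z j \<omega>) - \<mu>) / sqrt (real n)"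
          using vpos v0 by (simp add: real_sqrt_mult)
      qed
      finally show ?thesis .
    qed
    ultimately show ?thesis using v0
      by (simp add: char_std_normal_distribution \<mu>_def[symmetric] v_def[symmetric])
  qed
qed

text \<open>The variance under \<open>P\<close>, written with separate integrals so that limits and
  bilinear expansions can be taken term by term.\<close>

definition vr :: "((real ^ 'm) \<times> (real ^ 'n) \<Rightarrow> real) \<Rightarrow> real" where
  "vr f = (\<integral>z. (f z)\<^sup>2 \<partial>P) - (\<integral>z. f z \<partial>P)\<^sup>2"

lemma vr_nonneg:
  assumes "f \<in> borel_measurable P" "integrable P (\<lambda>z. (f z)\<^sup>2)"
  shows "0 \<le> vr f"
proof -
  have "0 \<le> (\<integral>z. (f z - (\<integral>z. f z \<partial>P))\<^sup>2 \<partial>P)" by (intro Bochner_Integration.integral_nonneg) simp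
  then show ?thesis unfolding vr_def centered_second_moment(2)[OF assms] .
qed

lemma linear_comb_h:
  "(\<lambda>z. \<Sum>i\<in>F. t i * h (u i) (l i) z) \<in> borel_measurable P"
  "integrable P (\<lambda>z. (\<Sum>i\<in>F. t i * h (u i) (l i) z)\<^sup>2)"
  "vr (\<lambda>z. \<Sum>i\<in>F. t i * h (u i) (l i) z) = (\<Sum>i\<in>F. \<Sum>j\<in>F. t i * t j * covK (u i) (l i) (u j) (l j))"
proof -
  have f2: "(\<Sum>i\<in>F. t i * h (u i) (l i) z)\<^sup>2 = (\<Sum>i\<in>F. \<Sum>j\<in>F. t i * t j * (h (u i) (l i) z * h (u j) (l j) z))" for z
    unfolding power2_eq_square sum_product by (simp add: mult_ac)
  show "(\<lambda>z. \<Sum>i\<in>F. t i * h (u i) (l i) z) \<in> borel_measurable P" by measurable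
  show "integrable P (\<lambda>z. (\<Sum>i\<in>F. t i * h (u i) (l i) z)\<^sup>2)" unfolding f2 by (simp add: hh_int)
  have "(\<integral>z. (\<Sum>i\<in>F. t i * h (u i) (l i) z) \<partial>P) = (\<Sum>i\<in>F. t i * (\<integral>z. h (u i) (l i) z \<partial>P))"
    by (simp add: h_int)
  then have "(\<integral>z. (\<Sum>i\<in>F. t i * h (u i) (l i) z) \<partial>P)\<^sup>2
      = (\<Sum>i\<in>F. \<Sum>j\<in>F. t i * t j * ((\<integral>z. h (u i) (l i) z \<partial>P) * (\<integral>z. h (u j) (l j) z \<partial>P)))"
    unfolding power2_eq_square by (simp add: sum_product mult_ac)
  moreover have "(\<integral>z. (\<Sum>i\<in>F. t i * h (u i) (l i) z)\<^sup>2 \<partial>P)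
      = (\<Sum>i\<in>F. \<Sum>j\<in>F. t i * t j * (\<integral>z. h (u i) (l i) z * h (u j) (l j) z \<partial>P))"
    unfolding f2 by (simp add: hh_int)
  ultimately show "vr (\<lambda>z. \<Sum>i\<in>F. t i * h (u i) (l i) z) = (\<Sum>i\<in>F. \<Sum>j\<in>F. t i * t j * covK (u i) (l i) (u j) (l j))"
    by (simp add: vr_def covK_def sum_subtractf right_diff_distrib)
qed

text \<open>The Cramer--Wold device: a linear combination of field values is the normalized sum of a
  single function of the observations, so the one-dimensional limit applies.\<close>

lemma S_char_limit:
  "(\<lambda>n. \<integral>\<omega>. cis (\<Sum>i<m. t i * S n (u i) (l i) \<omega>) \<partial>M)
    \<longlonglongrightarrow> of_real (exp (- vr (\<lambda>z. \<Sum>i<m. t i * h (u i) (l i) z) / 2))"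
proof -
  define f where "f z = (\<Sum>i<m. t i * h (u i) (l i) z)" for z
  have "(\<Sum>j\<in>{1..n}. f (Z j \<omega>) - (\<integral>z. f z \<partial>P)) / sqrt (real n) = (\<Sum>i<m. t i * S n (u i) (l i) \<omega>)" for n \<omega>
  proof -
    have "(\<Sum>i<m. t i * S n (u i) (l i) \<omega>) = (\<Sum>i<m. \<Sum>j\<in>{1..n}. t i * (h (u i) (l i) (Z j \<omega>) - (\<integral>z. h (u i) (l i) z \<partial>P))) / sqrt (real n)"
      unfolding S_def by (simp add: sum_divide_distrib sum_distrib_left)
    also have "\<dots> = (\<Sum>j\<in>{1..n}. \<Sum>i<m. t i * (h (u i) (l i) (Z j \<omega>) - (\<integral>z. h (u i) (l i) z \<partial>P))) / sqrt (real n)"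
      by (subst sum.swap) simp
    also have "\<dots> = (\<Sum>j\<in>{1..n}. f (Z j \<omega>) - (\<integral>z. f z \<partial>P)) / sqrt (real n)"
      by (simp add: f_def h_int right_diff_distrib sum_subtractf)
    finally show ?thesis ..
  qed
  moreover have "f \<in> borel_measurable P" "integrable P (\<lambda>z. (f z)\<^sup>2)"
    unfolding f_def by (rule linear_comb_h)+
  ultimately show ?thesis using normalized_sum_char_limit[of f] unfolding vr_def f_def[symmetric] by simp
qed

end

subsection \<open>The limit field\<close>

definition dyadic_floor :: "nat \<Rightarrow> real ^ 'm \<Rightarrow> real ^ 'm" where
  "dyadic_floor r u = (\<chi> i. of_int \<lfloor>2 ^ r * u $ i\<rfloor> / 2 ^ r)"

text \<open>Approximation from above is the direction in which the indicator of
  \<open>x \<le> u\<close> is continuous in \<open>u\<close> without exceptional points.\<close>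

definition dyadic_ceiling :: "nat \<Rightarrow> real ^ 'm \<Rightarrow> real ^ 'm" where
  "dyadic_ceiling r u = (\<chi> i. of_int \<lceil>2 ^ r * u $ i\<rceil> / 2 ^ r)"

definition dyadic_points :: "(real ^ 'm) set" where
  "dyadic_points = {x \<in> {0..1}. \<exists>(r :: nat) (k :: 'm \<Rightarrow> int). x = (\<chi> i. of_int (k i) / 2 ^ r)}"

lemma in_cube_iff: "u \<in> {0..1 :: real ^ 'm} \<longleftrightarrow> (\<forall>i. 0 \<le> u $ i \<and> u $ i \<le> 1)"
  by (auto simp: less_eq_vec_def)

lemma countable_dyadic_points: "countable (dyadic_points :: (real ^ 'm) set)"
proof (rule countable_subset)
  show "dyadic_points \<subseteq> (\<lambda>(r :: nat, k :: 'm \<Rightarrow> int). \<chi> i. of_int (k i) / 2 ^ r) ` UNIV"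
    by (auto simp: dyadic_points_def image_iff)
qed simp

lemma dyadic_floor_bounds: "dyadic_floor r u $ i \<le> u $ i" "u $ i - 1 / 2 ^ r \<le> dyadic_floor r u $ i"
proof -
  have "of_int \<lfloor>2 ^ r * u $ i\<rfloor> \<le> 2 ^ r * u $ i" by linarith
  then show "dyadic_floor r u $ i \<le> u $ i" by (simp add: dyadic_floor_def field_simps)
  have "2 ^ r * u $ i - 1 \<le> of_int \<lfloor>2 ^ r * u $ i\<rfloor>" by linarith
  then have "(2 ^ r * u $ i - 1) / 2 ^ r \<le> of_int \<lfloor>2 ^ r * u $ i\<rfloor> / 2 ^ r" by (rule divide_right_mono) simp
  then show "u $ i - 1 / 2 ^ r \<le> dyadic_floor r u $ i" by (simp add: dyadic_floor_def diff_divide_distrib)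
qed

lemma dyadic_ceiling_bounds: "u $ i \<le> dyadic_ceiling r u $ i" "dyadic_ceiling r u $ i \<le> u $ i + 1 / 2 ^ r"
proof -
  have "2 ^ r * u $ i \<le> of_int \<lceil>2 ^ r * u $ i\<rceil>" by linarith
  then show "u $ i \<le> dyadic_ceiling r u $ i" by (simp add: dyadic_ceiling_def field_simps)
  have "of_int \<lceil>2 ^ r * u $ i\<rceil> \<le> 2 ^ r * u $ i + 1" by linarith
  then have "of_int \<lceil>2 ^ r * u $ i\<rceil> / 2 ^ r \<le> (2 ^ r * u $ i + 1) / 2 ^ r" by (rule divide_right_mono) simp
  then show "dyadic_ceiling r u $ i \<le> u $ i + 1 / 2 ^ r" by (simp add: dyadic_ceiling_def add_divide_distrib)
qed

lemma dyadic_floor_in: "u \<in> {0..1} \<Longrightarrow> dyadic_floor r u \<in> dyadic_points"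
proof -
  assume u: "u \<in> {0..1}"
  have "0 \<le> dyadic_floor r u $ i \<and> dyadic_floor r u $ i \<le> 1" for i
  proof
    show "dyadic_floor r u $ i \<le> 1" using dyadic_floor_bounds(1)[of r u i] u unfolding in_cube_iff by (meson order_trans)
    have "0 \<le> 2 ^ r * u $ i" using u[unfolded in_cube_iff] by simp
    then have "0 \<le> \<lfloor>2 ^ r * u $ i\<rfloor>" by simp
    then show "0 \<le> dyadic_floor r u $ i" by (simp add: dyadic_floor_def)
  qed
  then show ?thesis unfolding dyadic_points_def in_cube_iff
    by (auto simp: dyadic_floor_def intro!: exI[of _ r] exI[of _ "\<lambda>i. \<lfloor>2 ^ r * u $ i\<rfloor>"])
qed

lemma dyadic_ceiling_in: "u \<in> {0..1} \<Longrightarrow> dyadic_ceiling r u \<in> dyadic_points"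
proof -
  assume u: "u \<in> {0..1}"
  have "0 \<le> dyadic_ceiling r u $ i \<and> dyadic_ceiling r u $ i \<le> 1" for i
  proof
    show "0 \<le> dyadic_ceiling r u $ i" using dyadic_ceiling_bounds(1)[of u i r] u unfolding in_cube_iff by (meson order_trans)
    have "2 ^ r * u $ i \<le> 2 ^ r" using u[unfolded in_cube_iff, rule_format, of i] by simp
    then have "\<lceil>2 ^ r * u $ i\<rceil> \<le> 2 ^ r" by (simp add: ceiling_le_iff)
    then have "real_of_int \<lceil>2 ^ r * u $ i\<rceil> \<le> real_of_int (2 ^ r)" by (simp only: of_int_le_iff)
    then show "dyadic_ceiling r u $ i \<le> 1" by (simp add: dyadic_ceiling_def)
  qed
  then show ?thesis unfolding dyadic_points_def in_cube_iff
    by (auto simp: dyadic_ceiling_def intro!: exI[of _ r] exI[of _ "\<lambda>i. \<lceil>2 ^ r * u $ i\<rceil>"])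
qed

lemma dyadic_points_subset: "dyadic_points \<subseteq> {0..1}"
  by (auto simp: dyadic_points_def)

lemma LIMSEQ_half_power: "(\<lambda>r. 1 / 2 ^ r :: real) \<longlonglongrightarrow> 0"
  using LIMSEQ_power_zero[of "1 / 2 :: real"] by (simp add: power_one_over)

lemma dyadic_floor_tendsto: "(\<lambda>r. dyadic_floor r u) \<longlonglongrightarrow> u"
proof (rule vec_tendstoI)
  fix i
  have "(\<lambda>r. u $ i - 1 / 2 ^ r) \<longlonglongrightarrow> u $ i - 0" by (intro tendsto_diff tendsto_const LIMSEQ_half_power)
  then have "(\<lambda>r. u $ i - 1 / 2 ^ r) \<longlonglongrightarrow> u $ i" by simp
  then show "(\<lambda>r. dyadic_floor r u $ i) \<longlonglongrightarrow> u $ i"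
    by (rule tendsto_sandwich[rotated 2, OF _ tendsto_const]) (auto simp: dyadic_floor_bounds)
qed

lemma dyadic_ceiling_tendsto: "(\<lambda>r. dyadic_ceiling r u) \<longlonglongrightarrow> u"
proof (rule vec_tendstoI)
  fix i
  have "(\<lambda>r. u $ i + 1 / 2 ^ r) \<longlonglongrightarrow> u $ i + 0" by (intro tendsto_add tendsto_const LIMSEQ_half_power)
  then have "(\<lambda>r. u $ i + 1 / 2 ^ r) \<longlonglongrightarrow> u $ i" by simp
  then show "(\<lambda>r. dyadic_ceiling r u $ i) \<longlonglongrightarrow> u $ i"
    by (rule tendsto_sandwich[rotated 2, OF tendsto_const]) (auto simp: dyadic_ceiling_bounds)
qed

lemma cube_subset_closure: "{0..1} \<subseteq> closure dyadic_points"
proof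
  fix u :: "real ^ 'm" assume "u \<in> {0..1}"
  then show "u \<in> closure dyadic_points"
    unfolding closure_sequential
    by (intro exI[of _ "\<lambda>r. dyadic_floor r u"]) (simp add: dyadic_floor_in dyadic_floor_tendsto)
qed

text \<open>The extension from the dense set exists by uniform continuity; expressing it as a limit
  along dyadic floors makes it a measurable function of the sample path afterwards.\<close>

lemma ex_extension:
  fixes q :: "real ^ 'm \<Rightarrow> real ^ 'n"
  assumes "uniformly_continuous_on dyadic_points q"
  shows "continuous_on {0..1} (\<lambda>u. lim (\<lambda>r. q (dyadic_floor r u)))"
    and "u \<in> {0..1} \<Longrightarrow> (\<lambda>r. q (dyadic_floor r u)) \<longlonglongrightarrow> lim (\<lambda>r. q (dyadic_floor r u))"
    and "u \<in> dyadic_points \<Longrightarrow> lim (\<lambda>r. q (dyadic_floor r u)) = q u"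
proof -
  obtain g where g: "uniformly_continuous_on (closure dyadic_points) g" "\<And>x. x \<in> dyadic_points \<Longrightarrow> q x = g x"
  proof (rule uniformly_continuous_on_extension_on_closure[OF assms])
    fix g assume "uniformly_continuous_on (closure dyadic_points) g" "\<And>x. x \<in> dyadic_points \<Longrightarrow> q x = g x"
    then show thesis by (rule that)
  qed
  have cont: "continuous_on {0..1} g"
    by (rule continuous_on_subset[OF uniformly_continuous_imp_continuous[OF g(1)] cube_subset_closure])
  have lim: "(\<lambda>r. q (dyadic_floor r u)) \<longlonglongrightarrow> g u" if u: "u \<in> {0..1}" for u
  proof -
    have "(\<lambda>r. g (dyadic_floor r u)) \<longlonglongrightarrow> g u"
      by (rule continuous_on_tendsto_compose[OF cont dyadic_floor_tendsto u])
        (intro always_eventually allI subsetD[OF dyadic_points_subset] dyadic_floor_in[OF u])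
    then show ?thesis using g(2)[OF dyadic_floor_in[OF u]] by simp
  qed
  then have eq: "lim (\<lambda>r. q (dyadic_floor r u)) = g u" if "u \<in> {0..1}" for u using that by (intro limI)
  show "continuous_on {0..1} (\<lambda>u. lim (\<lambda>r. q (dyadic_floor r u)))"
    using cont by (rule continuous_on_eq) (simp add: eq)
  show "(\<lambda>r. q (dyadic_floor r u)) \<longlonglongrightarrow> lim (\<lambda>r. q (dyadic_floor r u))" if "u \<in> {0..1}"
    using lim[OF that] eq[OF that] by simp
  show "lim (\<lambda>r. q (dyadic_floor r u)) = q u" if "u \<in> dyadic_points"
    using eq[OF subsetD[OF dyadic_points_subset that]] g(2)[OF that] by simp
qed

text \<open>By uniqueness of characteristic functions the variable is either constant 0 almost
  surely or a multiple of a standard normal variable. The variance 0 has no density and is treated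
  separately.\<close>

lemma gaussian_of_char:
  assumes N: "prob_space N" and Z[measurable]: "Z \<in> borel_measurable N" and v: "0 \<le> v"
    and char: "\<And>s. (\<integral>\<omega>. cis (s * Z \<omega>) \<partial>N) = of_real (exp (- (s\<^sup>2 * v) / 2))"
  shows "normal_rv N Z" "integrable N Z" "integrable N (\<lambda>\<omega>. (Z \<omega>)\<^sup>2)"
    "(\<integral>\<omega>. Z \<omega> \<partial>N) = 0" "(\<integral>\<omega>. (Z \<omega>)\<^sup>2 \<partial>N) = v"
proof -
  interpret N: prob_space N by fact
  have "normal_rv N Z \<and> integrable N Z \<and> integrable N (\<lambda>\<omega>. (Z \<omega>)\<^sup>2) \<and> (\<integral>\<omega>. Z \<omega> \<partial>N) = 0 \<and> (\<integral>\<omega>. (Z \<omega>)\<^sup>2 \<partial>N) = v"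
  proof (cases "v = 0")
    case True
    have "distr N borel Z = distr N borel (\<lambda>_. 0)"
    proof (rule Levy_uniqueness)
      show "char (distr N borel Z) = char (distr N borel (\<lambda>_. 0 :: real))"
        using char True by (auto simp: fun_eq_iff char_eq_integral_cis integral_distr N.prob_space simp del: N.distr_const)
    qed (rule N.real_distribution_distr; simp)+
    then have "measure (distr N borel Z) {0} = measure (distr N borel (\<lambda>_. 0 :: real)) {0}" by simp
    then have "N.prob (Z -` {0} \<inter> space N) = 1" by (simp add: measure_distr measure_return)
    then have "AE \<omega> in N. \<omega> \<in> Z -` {0} \<inter> space N"
      by (subst (asm) N.prob_eq_1) auto
    then have AE: "AE \<omega> in N. Z \<omega> = 0" by eventually_elim auto
    have "integrable N Z" "integrable N (\<lambda>\<omega>. (Z \<omega>)\<^sup>2)"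
      by (rule integrable_cong_AE_imp[of N "\<lambda>_. 0"], use AE in auto)+
    moreover have "(\<integral>\<omega>. Z \<omega> \<partial>N) = 0" "(\<integral>\<omega>. (Z \<omega>)\<^sup>2 \<partial>N) = 0"
      by (rule integral_eq_zero_AE, use AE in simp)+
    ultimately show ?thesis using True AE Z by (auto simp: normal_rv_def)
  next
    case False
    define \<sigma> where "\<sigma> = sqrt v"
    have \<sigma>: "0 < \<sigma>" "\<sigma>\<^sup>2 = v" using False v by (auto simp: \<sigma>_def)
    have "distr N borel (\<lambda>\<omega>. Z \<omega> / \<sigma>) = std_normal_distribution"
    proof (rule Levy_uniqueness)
      show "char (distr N borel (\<lambda>\<omega>. Z \<omega> / \<sigma>)) = char std_normal_distribution"
      proof
        fix s
        have "char (distr N borel (\<lambda>\<omega>. Z \<omega> / \<sigma>)) s = (\<integral>\<omega>. cis (s / \<sigma> * Z \<omega>) \<partial>N)"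
          by (simp add: char_eq_integral_cis integral_distr)
        also have "\<dots> = of_real (exp (- ((s / \<sigma>)\<^sup>2 * v) / 2))" by (rule char)
        also have "(s / \<sigma>)\<^sup>2 * v = s\<^sup>2" using \<sigma> False by (simp add: power_divide)
        finally show "char (distr N borel (\<lambda>\<omega>. Z \<omega> / \<sigma>)) s = char std_normal_distribution s"
          by (simp add: char_std_normal_distribution)
      qed
    qed (auto simp: N.real_distribution_distr real_dist_normal_dist)
    then have "distributed N lborel (\<lambda>\<omega>. (Z \<omega> - 0) / \<sigma>) std_normal_density"
      by (auto simp: distributed_def measurable_lborel1 cong: distr_cong)
    then have D: "distributed N lborel Z (normal_density 0 \<sigma>)"
      using N.normal_standard_normal_convert[OF \<sigma>(1), of Z 0] by simp
    have i1: "integrable N Z"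
      using integrable_normal_moment_nz_1[OF \<sigma>(1), of 0] distributed_integrable[OF D, of "\<lambda>x. x"] by simp
    have i2: "integrable N (\<lambda>\<omega>. (Z \<omega>)\<^sup>2)"
      using integrable_normal_moment[OF \<sigma>(1), of 0 2] distributed_integrable[OF D, of "\<lambda>x. x\<^sup>2"] by simp
    have m: "(\<integral>\<omega>. Z \<omega> \<partial>N) = 0" by (rule N.normal_distributed_expectation[OF \<sigma>(1) D])
    have "(\<integral>\<omega>. (Z \<omega>)\<^sup>2 \<partial>N) = v"
      using N.normal_distributed_variance[OF \<sigma>(1) D] by (simp add: m \<sigma>)
    then show ?thesis using i1 i2 m D \<sigma> by (auto simp: normal_rv_def)
  qed
  then show "normal_rv N Z" "integrable N Z" "integrable N (\<lambda>\<omega>. (Z \<omega>)\<^sup>2)"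
    "(\<integral>\<omega>. Z \<omega> \<partial>N) = 0" "(\<integral>\<omega>. (Z \<omega>)\<^sup>2 \<partial>N) = v" by auto
qed

text \<open>Pairs of a dyadic point and a component are numbered, because the Gaussian construction
  and the convergence lemma work with sequences.\<close>

definition enum :: "nat \<Rightarrow> (real ^ 'm) \<times> 'n::finite" where
  "enum = from_nat_into (dyadic_points \<times> UNIV)"

definition idx :: "(real ^ 'm) \<times> 'n::finite \<Rightarrow> nat" where
  "idx = to_nat_on (dyadic_points \<times> UNIV)"

lemma zero_dyadic: "0 \<in> dyadic_points"
  by (auto simp: dyadic_points_def less_eq_vec_def vec_eq_iff intro!: exI[of _ "0 :: nat"] exI[of _ "\<lambda>_. 0 :: int"])

lemma enum_idx: "u \<in> dyadic_points \<Longrightarrow> enum (idx (u, l)) = (u, l)"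
  unfolding enum_def idx_def
  by (rule from_nat_into_to_nat_on) (auto intro!: countable_dyadic_points)

lemma continuous_on_Max_atMost:
  fixes f :: "nat \<Rightarrow> 'a::topological_space \<Rightarrow> real"
  assumes "\<And>j. continuous_on S (f j)"
  shows "continuous_on S (\<lambda>x. Max ((\<lambda>j. f j x) ` {..k}))"
proof (induction k)
  case (Suc k)
  have "Max ((\<lambda>j. f j x) ` {..Suc k}) = max (f (Suc k) x) (Max ((\<lambda>j. f j x) ` {..k}))" for x
    by (simp add: atMost_Suc)
  then show ?case using Suc assms by (simp add: continuous_on_max)
qed (use assms in simp)

text \<open>Points in a linear combination may repeat, so several pairs can have the same number;
  their coefficients are then added.\<close>

lemma sum_group_weights:
  fixes f :: "nat \<Rightarrow> real"
  assumes "finite A" "\<And>p. p \<in> A \<Longrightarrow> k p < m"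
  shows "(\<Sum>i<m. (\<Sum>p\<in>{p\<in>A. k p = i}. w p) * f i) = (\<Sum>p\<in>A. w p * f (k p))"
proof -
  have "(\<Sum>i<m. (\<Sum>p\<in>{p\<in>A. k p = i}. w p) * f i) = (\<Sum>i<m. \<Sum>p\<in>{p\<in>A. k p = i}. w p * f (k p))"
    by (simp add: sum_distrib_right)
  also have "\<dots> = (\<Sum>p\<in>A. w p * f (k p))"
    using assms by (intro sum.group) auto
  finally show ?thesis .
qed

section \<open>The limit field at dyadic points and its continuous extension\<close>

abbreviation (in box_sums) h2 :: "(real ^ 'm) \<times> 'n \<Rightarrow> (real ^ 'm) \<times> (real ^ 'n) \<Rightarrow> real" where
  "h2 p \<equiv> h (fst p) (snd p)"

abbreviation (in box_sums) S2 :: "nat \<Rightarrow> (real ^ 'm) \<times> 'n \<Rightarrow> 'a \<Rightarrow> real" where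
  "S2 n p \<equiv> S n (fst p) (snd p)"

text \<open>The characteristic functions of \<open>V\<close> are prescribed to be exactly the limits
  found in \<open>S_char_limit\<close>, so \<open>V i\<close> is the limit of the field value
  numbered \<open>i\<close>.\<close>

locale gaussian_limit = box_sums M P Z + N: prob_space N
  for M :: "'a measure" and P :: "((real ^ 'm) \<times> (real ^ 'n)) measure" and Z and N :: "'b measure" +
  fixes V :: "nat \<Rightarrow> 'b \<Rightarrow> real"
  assumes V_meas[measurable]: "\<And>i. V i \<in> borel_measurable N"
    and V_char: "\<And>m t. (\<integral>\<omega>. cis (\<Sum>k<m. t k * V k \<omega>) \<partial>N)
      = of_real (exp (- vr (\<lambda>z. \<Sum>k<m. t k * h2 (enum k) z) / 2))"
begin

text \<open>Meaningful at dyadic points only; elsewhere \<open>idx\<close> returns an arbitrary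
  number.\<close>

definition q :: "real ^ 'm \<Rightarrow> 'b \<Rightarrow> real ^ 'n" where
  "q u \<omega> = (\<chi> l. V (idx (u, l)) \<omega>)"

text \<open>Defined for every sample point through the default of \<open>lim\<close>, hence
  measurable everywhere; continuity holds almost surely.\<close>

definition Q :: "real ^ 'm \<Rightarrow> 'b \<Rightarrow> real ^ 'n" where
  "Q u \<omega> = lim (\<lambda>r. q (dyadic_floor r u) \<omega>)"

lemma q_meas[measurable]: "q u \<in> borel_measurable N"
  unfolding q_def by (intro borel_measurable_vec_lambda V_meas)

lemma Q_meas[measurable]: "Q u \<in> borel_measurable N"
  unfolding Q_def by (rule borel_measurable_lim_metric) (rule q_meas)

lemma fidi_convergence:
  fixes \<phi> :: "(nat \<Rightarrow> real) \<Rightarrow> real"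
  assumes "continuous_on UNIV \<phi>" "\<And>x. \<bar>\<phi> x\<bar> \<le> B" "\<And>x. \<phi> x = \<phi> (\<lambda>i. if i < m then x i else 0)"
  shows "(\<lambda>n. \<integral>\<omega>. \<phi> (\<lambda>i. S2 n (enum i) \<omega>) \<partial>M) \<longlonglongrightarrow> (\<integral>\<omega>. \<phi> (\<lambda>i. V i \<omega>) \<partial>N)"
proof (rule weak_convergence_of_char[where Z = "\<lambda>n i. S2 n (enum i)" and \<phi> = \<phi> and V = V and M = M and N = N and m = m and B = B])
  show "(\<lambda>n. \<integral>\<omega>. cis (\<Sum>i<m. t i * S2 n (enum i) \<omega>) \<partial>M) \<longlonglongrightarrow> (\<integral>\<omega>. cis (\<Sum>i<m. t i * V i \<omega>) \<partial>N)" for t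
    unfolding V_char by (rule S_char_limit)
qed (rule M.prob_space_axioms N.prob_space_axioms S_meas V_meas assms | erule S_tight)+

definition dpairs :: "nat \<Rightarrow> ((real ^ 'm) \<times> (real ^ 'm)) set" where
  "dpairs r = close_pairs r \<inter> dyadic_points \<times> dyadic_points"

lemma countable_dpairs: "countable (dpairs r)"
  unfolding dpairs_def by (rule countable_subset[of _ "dyadic_points \<times> dyadic_points"]) (auto intro: countable_dyadic_points)

lemma zero_in_dpairs: "(0, 0) \<in> dpairs r"
  unfolding dpairs_def close_pairs_def using zero_dyadic dyadic_points_subset by auto

text \<open>The supremum over all pairs is not a function of finitely many coordinates. A maximum
  over finitely many pairs, cut at 1, is bounded and continuous in finitely many coordinates, so its
  mean is a limit of means that are at most \<epsilon>. Monotone convergence then restores all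
  pairs.\<close>

lemma modulus_small:
  assumes "0 < \<epsilon>"
  shows "\<exists>r. 0 < r \<and> (\<integral>\<^sup>+\<omega>. min 1 (SUP (u, v)\<in>dpairs r. ennreal (norm (q u \<omega> - q v \<omega>))) \<partial>N) \<le> ennreal \<epsilon>"
proof -
  obtain r n0 where rn: "0 < r \<and> (\<forall>n\<ge>n0. \<forall>F. countable F \<longrightarrow> F \<subseteq> close_pairs r \<longrightarrow>
    (\<integral>\<^sup>+\<omega>. (SUP (u, v)\<in>F. ennreal (norm (SV n u \<omega> - SV n v \<omega>))) \<partial>M) \<le> ennreal \<epsilon>)"
    using equicontinuity[OF assms] by (elim exE)
  note r = conjunct1[OF rn] and n0 = conjunct2[OF rn, rule_format]
  have n0': "(\<integral>\<^sup>+\<omega>. (SUP (u, v)\<in>dpairs r. ennreal (norm (SV n u \<omega> - SV n v \<omega>))) \<partial>M) \<le> ennreal \<epsilon>" if "n \<ge> n0" for n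
    using that by (rule n0) (auto simp: countable_dpairs dpairs_def intro: countable_subset[OF _ countable_dpairs[of r]])
  define p where "p = from_nat_into (dpairs r)"
  have ne: "dpairs r \<noteq> {}" using zero_in_dpairs by auto
  have p: "range p = dpairs r" unfolding p_def using countable_dpairs ne by (rule range_from_nat_into[rotated])
  define d where "d j x = norm (\<chi> l. x (idx (fst (p j), l)) - x (idx (snd (p j), l)) :: real ^ 'n)" for j and x :: "nat \<Rightarrow> real"
  define \<phi> where "\<phi> k x = min 1 (Max ((\<lambda>j. d j x) ` {..k}))" for k x
  have d_cont: "continuous_on UNIV (d j)" for j
    unfolding d_def by (intro continuous_intros continuous_on_vec_lambda continuous_on_product_coordinates)
  have d_nonneg: "0 \<le> d j x" for j x by (simp add: d_def)
  have \<phi>_nonneg: "0 \<le> \<phi> k x" for k x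
    unfolding \<phi>_def using d_nonneg[of 0 x] by (auto simp: Max_ge_iff)
  have \<phi>_mono: "\<phi> k x \<le> \<phi> k' x" if "k \<le> k'" for k k' x
    unfolding \<phi>_def using that by (intro min.mono order_refl Max_mono) auto
  have lim: "(\<lambda>n. \<integral>\<omega>. \<phi> k (\<lambda>i. S2 n (enum i) \<omega>) \<partial>M) \<longlonglongrightarrow> (\<integral>\<omega>. \<phi> k (\<lambda>i. V i \<omega>) \<partial>N)" for k
  proof -
    define I where "I = (\<lambda>(j, l). max (idx (fst (p j), l)) (idx (snd (p j), l :: 'n))) ` ({..k} \<times> UNIV)"
    define m where "m = Suc (Max I)"
    have fI: "finite I" by (simp add: I_def)
    have m: "idx (fst (p j), l) < m" "idx (snd (p j), l) < m" if "j \<le> k" for j and l :: 'n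
    proof -
      have "max (idx (fst (p j), l)) (idx (snd (p j), l)) \<in> I" using that by (force simp: I_def)
      then have "max (idx (fst (p j), l)) (idx (snd (p j), l)) \<le> Max I" using fI by (rule Max_ge[rotated])
      then show "idx (fst (p j), l) < m" "idx (snd (p j), l) < m" by (auto simp: m_def)
    qed
    show ?thesis
    proof (rule fidi_convergence[where B = 1 and m = m])
      show "continuous_on UNIV (\<phi> k)"
        unfolding \<phi>_def by (intro continuous_on_min continuous_on_const continuous_on_Max_atMost d_cont)
      show "\<bar>\<phi> k x\<bar> \<le> 1" for x using \<phi>_nonneg[of k x] by (simp add: \<phi>_def)
      show "\<phi> k x = \<phi> k (\<lambda>i. if i < m then x i else 0)" for x
      proof -
        have "d j x = d j (\<lambda>i. if i < m then x i else 0)" if "j \<le> k" for j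
          using m[OF that] by (simp add: d_def)
        then have "(\<lambda>j. d j x) ` {..k} = (\<lambda>j. d j (\<lambda>i. if i < m then x i else 0)) ` {..k}"
          by (intro image_cong) auto
        then show ?thesis unfolding \<phi>_def by (simp only:)
      qed
    qed
  qed
  have dS: "d j (\<lambda>i. S2 n (enum i) \<omega>) = norm (SV n (fst (p j)) \<omega> - SV n (snd (p j)) \<omega>)" for j n \<omega>
  proof -
    have "p j \<in> dpairs r" using p by auto
    then have "fst (p j) \<in> dyadic_points" "snd (p j) \<in> dyadic_points" by (auto simp: dpairs_def)
    then show ?thesis unfolding d_def SV_def by (simp add: enum_idx vec_eq_iff minus_vec_def)
  qed
  have dV: "d j (\<lambda>i. V i \<omega>) = norm (q (fst (p j)) \<omega> - q (snd (p j)) \<omega>)" for j \<omega>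
    unfolding d_def q_def by (simp add: minus_vec_def)
  have cm: "continuous_on UNIV (\<phi> k)" for k
    unfolding \<phi>_def by (intro continuous_on_min continuous_on_const continuous_on_Max_atMost d_cont)
  have \<phi>S_meas: "(\<lambda>\<omega>. \<phi> k (\<lambda>i. S2 n (enum i) \<omega>)) \<in> borel_measurable M" for k n
    by (intro measurable_compose[OF measurable_coordinatewise_then_product borel_measurable_continuous_onI[OF cm]] S_meas)
  have \<phi>V_meas[measurable]: "(\<lambda>\<omega>. \<phi> k (\<lambda>i. V i \<omega>)) \<in> borel_measurable N" for k
    by (intro measurable_compose[OF measurable_coordinatewise_then_product borel_measurable_continuous_onI[OF cm]] V_meas)
  have \<phi>_le1: "\<phi> k x \<le> 1" for k x by (simp add: \<phi>_def)
  have leS: "(\<integral>\<omega>. \<phi> k (\<lambda>i. S2 n (enum i) \<omega>) \<partial>M) \<le> \<epsilon>" if "n \<ge> n0" for n k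
  proof -
    have "ennreal (\<integral>\<omega>. \<phi> k (\<lambda>i. S2 n (enum i) \<omega>) \<partial>M)
        = (\<integral>\<^sup>+\<omega>. ennreal (\<phi> k (\<lambda>i. S2 n (enum i) \<omega>)) \<partial>M)"
      by (intro nn_integral_eq_integral[symmetric] M.integrable_const_bound[of _ 1] \<phi>S_meas)
        (auto simp: \<phi>_nonneg \<phi>_le1)
    also have "\<dots> \<le> (\<integral>\<^sup>+\<omega>. (SUP (u, v)\<in>dpairs r. ennreal (norm (SV n u \<omega> - SV n v \<omega>))) \<partial>M)"
    proof (rule nn_integral_mono)
      fix \<omega>
      let ?x = "\<lambda>i. S2 n (enum i) \<omega>"
      have "Max ((\<lambda>j. d j ?x) ` {..k}) \<in> (\<lambda>j. d j ?x) ` {..k}" by (intro Max_in) auto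
      then obtain j where j: "Max ((\<lambda>j. d j ?x) ` {..k}) = d j ?x" by (elim imageE)
      have "ennreal (\<phi> k ?x) \<le> ennreal (d j ?x)" unfolding \<phi>_def j by (intro ennreal_leI) simp
      also have "\<dots> \<le> (SUP (u, v)\<in>dpairs r. ennreal (norm (SV n u \<omega> - SV n v \<omega>)))"
        unfolding dS using p by (intro SUP_upper2[of "p j"]) (auto simp: case_prod_unfold)
      finally show "ennreal (\<phi> k ?x) \<le> (SUP (u, v)\<in>dpairs r. ennreal (norm (SV n u \<omega> - SV n v \<omega>)))" .
    qed
    also have "\<dots> \<le> ennreal \<epsilon>" using that by (rule n0')
    finally show ?thesis using assms by (simp add: ennreal_le_iff)
  qed
  have leV: "(\<integral>\<^sup>+\<omega>. ennreal (\<phi> k (\<lambda>i. V i \<omega>)) \<partial>N) \<le> ennreal \<epsilon>" for k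
  proof -
    have "(\<integral>\<omega>. \<phi> k (\<lambda>i. V i \<omega>) \<partial>N) \<le> \<epsilon>"
      by (rule LIMSEQ_le_const2[OF lim]) (use leS in blast)
    moreover have "(\<integral>\<^sup>+\<omega>. ennreal (\<phi> k (\<lambda>i. V i \<omega>)) \<partial>N) = ennreal (\<integral>\<omega>. \<phi> k (\<lambda>i. V i \<omega>) \<partial>N)"
      by (intro nn_integral_eq_integral N.integrable_const_bound[of _ 1] \<phi>V_meas)
        (auto simp: \<phi>_nonneg \<phi>_le1)
    ultimately show ?thesis by (simp add: ennreal_leI)
  qed
  have "(\<integral>\<^sup>+\<omega>. min 1 (SUP (u, v)\<in>dpairs r. ennreal (norm (q u \<omega> - q v \<omega>))) \<partial>N)
      \<le> (\<integral>\<^sup>+\<omega>. (SUP k. ennreal (\<phi> k (\<lambda>i. V i \<omega>))) \<partial>N)"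
  proof (rule nn_integral_mono)
    fix \<omega>
    have "min 1 (SUP (u, v)\<in>dpairs r. ennreal (norm (q u \<omega> - q v \<omega>)))
        = (SUP pp\<in>dpairs r. min 1 (case pp of (u, v) \<Rightarrow> ennreal (norm (q u \<omega> - q v \<omega>))))"
      using inf_SUP[of "1 :: ennreal"] unfolding inf_min .
    also have "\<dots> \<le> (SUP k. ennreal (\<phi> k (\<lambda>i. V i \<omega>)))"
    proof (rule SUP_least)
      fix pp assume "pp \<in> dpairs r"
      then obtain j where j: "pp = p j" using p by auto
      have "min 1 (case pp of (u, v) \<Rightarrow> ennreal (norm (q u \<omega> - q v \<omega>))) = min (ennreal 1) (ennreal (d j (\<lambda>i. V i \<omega>)))"
        by (simp add: j dV case_prod_unfold)
      also have "\<dots> \<le> ennreal (min 1 (d j (\<lambda>i. V i \<omega>)))"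
        by (cases "d j (\<lambda>i. V i \<omega>) \<le> 1") (simp_all only: min_absorb1 min_absorb2 min.cobounded1 min.cobounded2 less_imp_le not_le)
      also have "\<dots> \<le> ennreal (\<phi> j (\<lambda>i. V i \<omega>))"
        unfolding \<phi>_def by (intro ennreal_leI min.mono order_refl Max_ge) auto
      also have "\<dots> \<le> (SUP k. ennreal (\<phi> k (\<lambda>i. V i \<omega>)))" by (rule SUP_upper) simp
      finally show "min 1 (case pp of (u, v) \<Rightarrow> ennreal (norm (q u \<omega> - q v \<omega>))) \<le> \<dots>" .
    qed
    finally show "min 1 (SUP (u, v)\<in>dpairs r. ennreal (norm (q u \<omega> - q v \<omega>))) \<le> (SUP k. ennreal (\<phi> k (\<lambda>i. V i \<omega>)))" .
  qed
  \<comment> \<open>The truncated maxima increase with the number of pairs and the bound does not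
    depend on it.\<close>
  also have "\<dots> = (SUP k. \<integral>\<^sup>+\<omega>. ennreal (\<phi> k (\<lambda>i. V i \<omega>)) \<partial>N)"
    by (intro nn_integral_monotone_convergence_SUP)
      (auto simp: incseq_def le_fun_def intro!: ennreal_leI \<phi>_mono)
  also have "\<dots> \<le> ennreal \<epsilon>" by (intro SUP_least leV)
  finally show ?thesis using r by blast
qed

text \<open>Means of the truncated moduli tend to 0 along chosen scales, so their pointwise infimum
  has mean 0 and vanishes almost surely. An infimum is enough for uniform continuity: each tolerance
  needs just one scale.\<close>

lemma AE_uniformly_continuous: "AE \<omega> in N. uniformly_continuous_on dyadic_points (\<lambda>u. q u \<omega>)"
proof -
  define G where "G r \<omega> = (SUP (u, v)\<in>dpairs r. ennreal (norm (q u \<omega> - q v \<omega>)))" for r \<omega>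
  have "\<forall>j. \<exists>r. 0 < r \<and> (\<integral>\<^sup>+\<omega>. min 1 (G r \<omega>) \<partial>N) \<le> ennreal (1 / real (Suc j))"
    unfolding G_def by (intro allI modulus_small) simp
  from choice[OF this] obtain r where r: "\<forall>j. 0 < r j \<and> (\<integral>\<^sup>+\<omega>. min 1 (G (r j) \<omega>) \<partial>N) \<le> ennreal (1 / real (Suc j))" ..
  have G_meas[measurable]: "G k \<in> borel_measurable N" for k
    unfolding G_def case_prod_unfold by (intro borel_measurable_SUP countable_dpairs) measurable
  define m where "m \<omega> = (INF j. min 1 (G (r j) \<omega>))" for \<omega>
  have m_meas[measurable]: "m \<in> borel_measurable N" unfolding m_def by measurable
  have "(\<integral>\<^sup>+\<omega>. m \<omega> \<partial>N) \<le> ennreal (1 / real (Suc j))" for j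
  proof -
    have "(\<integral>\<^sup>+\<omega>. m \<omega> \<partial>N) \<le> (\<integral>\<^sup>+\<omega>. min 1 (G (r j) \<omega>) \<partial>N)"
      unfolding m_def by (intro nn_integral_mono INF_lower) simp
    also have "\<dots> \<le> ennreal (1 / real (Suc j))" using r by simp
    finally show ?thesis .
  qed
  moreover have "(\<lambda>j. ennreal (1 / real (Suc j))) \<longlonglongrightarrow> ennreal 0"
    using LIMSEQ_inverse_real_of_nat by (intro tendsto_ennrealI) (simp add: inverse_eq_divide)
  ultimately have "(\<integral>\<^sup>+\<omega>. m \<omega> \<partial>N) \<le> ennreal 0" by (intro LIMSEQ_le_const[where X = "\<lambda>j. ennreal (1 / real (Suc j))"]) auto
  then have "AE \<omega> in N. m \<omega> = 0" by (simp add: nn_integral_0_iff_AE)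
  then show ?thesis
  proof eventually_elim
    fix \<omega> assume m0: "m \<omega> = 0"
    show "uniformly_continuous_on dyadic_points (\<lambda>u. q u \<omega>)"
      unfolding uniformly_continuous_on_def
    proof (intro allI impI)
      fix e :: real assume e: "0 < e"
      have "(INF j. min 1 (G (r j) \<omega>)) < ennreal (min 1 e)" using m0 e unfolding m_def by simp
      then obtain j where "min 1 (G (r j) \<omega>) < ennreal (min 1 e)" unfolding INF_less_iff by blast
      moreover have "ennreal (min 1 e) \<le> 1" using ennreal_leI[of "min 1 e" 1] by simp
      ultimately have j: "G (r j) \<omega> < ennreal (min 1 e)" by (simp add: min_def split: if_splits)
      show "\<exists>d>0. \<forall>x\<in>dyadic_points. \<forall>x'\<in>dyadic_points. dist x' x < d \<longrightarrow> dist (q x' \<omega>) (q x \<omega>) < e"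
      proof (intro exI[of _ "1 / real (r j)"] conjI ballI impI)
        show "0 < 1 / real (r j)" using r by simp
        fix u v :: "real ^ 'm" assume uv: "u \<in> dyadic_points" "v \<in> dyadic_points" "dist v u < 1 / real (r j)"
        have "\<bar>v $ i - u $ i\<bar> \<le> 1 / real (r j)" for i
          using component_le_norm_cart[of "v - u" i] uv(3) by (simp add: dist_norm)
        then have "(v, u) \<in> dpairs (r j)"
          using uv dyadic_points_subset unfolding dpairs_def close_pairs_def by auto
        then have "ennreal (norm (q v \<omega> - q u \<omega>)) \<le> G (r j) \<omega>"
          unfolding G_def by (intro SUP_upper2[of "(v, u)"]) auto
        then have "ennreal (norm (q v \<omega> - q u \<omega>)) < ennreal (min 1 e)" using j by (rule le_less_trans)
        then show "dist (q v \<omega>) (q u \<omega>) < e" by (simp add: ennreal_less_iff dist_norm)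
      qed
    qed
  qed
qed

lemma AE_Q:
  "AE \<omega> in N. continuous_on {0..1} (\<lambda>u. Q u \<omega>) \<and> (\<forall>u\<in>{0..1}. (\<lambda>r. q (dyadic_floor r u) \<omega>) \<longlonglongrightarrow> Q u \<omega>) \<and>
    (\<forall>u\<in>dyadic_points. Q u \<omega> = q u \<omega>)"
  using AE_uniformly_continuous
proof eventually_elim
  fix \<omega> assume "uniformly_continuous_on dyadic_points (\<lambda>u. q u \<omega>)"
  from ex_extension[OF this]
  show "continuous_on {0..1} (\<lambda>u. Q u \<omega>) \<and> (\<forall>u\<in>{0..1}. (\<lambda>r. q (dyadic_floor r u) \<omega>) \<longlonglongrightarrow> Q u \<omega>) \<and>
    (\<forall>u\<in>dyadic_points. Q u \<omega> = q u \<omega>)"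
    unfolding Q_def by blast
qed

section \<open>Gaussianity of the limit field on the whole cube\<close>

lemma char_q:
  fixes a :: "'j \<Rightarrow> real ^ 'n"
  assumes J: "finite J" and u: "\<And>j. j \<in> J \<Longrightarrow> u j \<in> dyadic_points"
  shows "(\<integral>\<omega>. cis (\<Sum>j\<in>J. a j \<bullet> q (u j) \<omega>) \<partial>N)
    = of_real (exp (- vr (\<lambda>z. \<Sum>(j, l)\<in>J \<times> UNIV. a j $ l * h (u j) l z) / 2))"
proof -
  define A where "A = J \<times> (UNIV :: 'n set)"
  define k where "k = (\<lambda>(j, l :: 'n). idx (u j, l))"
  define w where "w = (\<lambda>(j, l). a j $ l)"
  define m where "m = Suc (Max (insert 0 (k ` A)))"
  define t where "t i = (\<Sum>p\<in>{p\<in>A. k p = i}. w p)" for i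
  have A: "finite A" using J by (simp add: A_def)
  have m: "k p < m" if "p \<in> A" for p using that A by (auto simp: m_def less_Suc_eq_le intro!: Max_ge)
  have "(\<Sum>i<m. t i * V i \<omega>) = (\<Sum>p\<in>A. w p * V (k p) \<omega>)" for \<omega>
    unfolding t_def by (rule sum_group_weights[OF A m])
  also have "(\<Sum>p\<in>A. w p * V (k p) \<omega>) = (\<Sum>j\<in>J. a j \<bullet> q (u j) \<omega>)" for \<omega>
    unfolding A_def by (simp add: sum.cartesian_product' w_def k_def q_def inner_vec_def)
  finally have 1: "(\<Sum>i<m. t i * V i \<omega>) = (\<Sum>j\<in>J. a j \<bullet> q (u j) \<omega>)" for \<omega> .
  have "(\<Sum>i<m. t i * h2 (enum i) z) = (\<Sum>p\<in>A. w p * h2 (enum (k p)) z)" for z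
    unfolding t_def by (rule sum_group_weights[OF A m])
  also have "(\<Sum>p\<in>A. w p * h2 (enum (k p)) z) = (\<Sum>(j, l)\<in>A. a j $ l * h (u j) l z)" for z
    using u by (intro sum.cong refl) (auto simp: A_def w_def k_def enum_idx)
  finally have 2: "(\<Sum>i<m. t i * h2 (enum i) z) = (\<Sum>(j, l)\<in>J \<times> UNIV. a j $ l * h (u j) l z)" for z
    unfolding A_def .
  show ?thesis using V_char[of t m] unfolding 1 2 .
qed

text \<open>Uniform marginals have no atoms, so the faces on which box indicators jump are null
  sets.\<close>

lemma AE_ne_coord: "AE z in P. fst z $ i \<noteq> c"
proof -
  have "AE x in uniform_measure lborel {0..1::real}. x \<noteq> c"
    by (rule AE_uniform_measureI) (auto intro: AE_lborel_singleton eventually_mono[OF AE_lborel_singleton[of c]])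
  then have "AE x in distr P borel (\<lambda>z. fst z $ i). x \<noteq> c" unfolding unif .
  then show ?thesis by (rule AE_distrD[OF fst_meas])
qed

text \<open>Dyadic floors approach from below, where the indicator of \<open>x \<le> u\<close> jumps
  if some coordinate of the observation equals that of \<open>u\<close>. These observations form a
  null set, and a multiple of the norm of \<open>Y\<close>, which is square integrable,
  dominates.\<close>

lemma vr_tendsto:
  fixes a :: "'j \<Rightarrow> real ^ 'n"
  assumes J: "finite J"
  shows "(\<lambda>r. vr (\<lambda>z. \<Sum>(j, l)\<in>J \<times> UNIV. a j $ l * h (dyadic_floor r (u j)) l z))
    \<longlonglongrightarrow> vr (\<lambda>z. \<Sum>(j, l)\<in>J \<times> UNIV. a j $ l * h (u j) l z)"
proof -
  define f where "f v z = (\<Sum>(j, l)\<in>J \<times> UNIV. a j $ l * h (v j) l z)" for v and z :: "(real ^ 'm) \<times> (real ^ 'n)"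
  define w where "w z = (\<Sum>(j, l :: 'n)\<in>J \<times> UNIV. \<bar>a j $ l\<bar> * norm (snd z))" for z :: "(real ^ 'm) \<times> (real ^ 'n)"
  define K where "K = (\<Sum>(j, l :: 'n)\<in>J \<times> UNIV. \<bar>a j $ l\<bar>)"
  have w: "w z = K * norm (snd z)" for z by (simp add: w_def K_def sum_distrib_right case_prod_unfold)
  have K: "0 \<le> K" unfolding K_def by (intro sum_nonneg) auto
  have f_meas[measurable]: "f v \<in> borel_measurable P" for v unfolding f_def case_prod_unfold by measurable
  have nm[measurable]: "(\<lambda>z. norm (snd z)) \<in> borel_measurable P" using snd_vec_meas by measurable
  have w2: "integrable P (\<lambda>z. (w z)\<^sup>2)" unfolding w power_mult_distrib using sq_norm by simp
  have w1: "integrable P w"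
    by (rule P.square_integrable_imp_integrable[OF _ w2]) (simp add: w)
  have bound: "\<bar>f v z\<bar> \<le> w z" for v z
  proof -
    have "\<bar>f v z\<bar> \<le> (\<Sum>p\<in>J \<times> UNIV. \<bar>case p of (j, l) \<Rightarrow> a j $ l * h (v j) l z\<bar>)" unfolding f_def by (rule sum_abs)
    also have "\<dots> \<le> w z" unfolding w_def
    proof (rule sum_mono)
      fix p :: "'j \<times> 'n"
      obtain j l where p: "p = (j, l)" by (cases p)
      have "\<bar>h (v j) l z\<bar> \<le> norm (snd z)"
        using component_le_norm_cart[of "snd z" l] by (auto simp: h_def indicator_def)
      then show "\<bar>case p of (j, l) \<Rightarrow> a j $ l * h (v j) l z\<bar> \<le> (case p of (j, l) \<Rightarrow> \<bar>a j $ l\<bar> * norm (snd z))"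
        by (simp add: p abs_mult mult_left_mono)
    qed
    finally show ?thesis .
  qed
  have "AE z in P. \<forall>j\<in>J. \<forall>i\<in>UNIV. fst z $ i \<noteq> u j $ i"
    by (intro AE_finite_allI J AE_ne_coord finite)
  then have conv: "AE z in P. (\<lambda>r. f (\<lambda>j. dyadic_floor r (u j)) z) \<longlonglongrightarrow> f u z"
  proof eventually_elim
    fix z :: "(real ^ 'm) \<times> (real ^ 'n)" assume z: "\<forall>j\<in>J. \<forall>i\<in>UNIV. fst z $ i \<noteq> u j $ i"
    have "(\<lambda>r. h (dyadic_floor r (u j)) l z) \<longlonglongrightarrow> h (u j) l z" if j: "j \<in> J" for j l
    proof (rule tendsto_eventually)
      show "\<forall>\<^sub>F r in sequentially. h (dyadic_floor r (u j)) l z = h (u j) l z"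
      proof (cases "fst z \<le> u j")
        case True
        \<comment> \<open>Strict inequality in every coordinate is open, so it persists for floors
          close enough to \<open>u j\<close>.\<close>
        have "\<forall>\<^sub>F r in sequentially. \<forall>i\<in>UNIV. fst z $ i < dyadic_floor r (u j) $ i"
        proof (rule eventually_ball_finite)
          show "\<forall>i\<in>UNIV. \<forall>\<^sub>F r in sequentially. fst z $ i < dyadic_floor r (u j) $ i"
          proof
            fix i
            have "fst z $ i < u j $ i" using True z j by (simp add: less_eq_vec_def order_less_le)
            moreover have "(\<lambda>r. dyadic_floor r (u j) $ i) \<longlonglongrightarrow> u j $ i"
              by (rule tendsto_vec_nth[OF dyadic_floor_tendsto])
            ultimately show "\<forall>\<^sub>F r in sequentially. fst z $ i < dyadic_floor r (u j) $ i" by (rule order_tendstoD(1)[rotated])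
          qed
        qed simp
        then show ?thesis
        proof eventually_elim
          case (elim r)
          then have "fst z \<le> dyadic_floor r (u j)" by (simp add: less_eq_vec_def less_imp_le)
          then show ?case using True by (simp add: h_def)
        qed
      next
        case False
        have "\<not> fst z \<le> dyadic_floor r (u j)" for r
        proof
          assume "fst z \<le> dyadic_floor r (u j)"
          then have "fst z $ i \<le> u j $ i" for i
            using dyadic_floor_bounds(1)[of r "u j" i] by (simp add: less_eq_vec_def) (meson order_trans)
          then show False using False by (simp add: less_eq_vec_def)
        qed
        then show ?thesis using False by (simp add: h_def)
      qed
    qed
    then show "(\<lambda>r. f (\<lambda>j. dyadic_floor r (u j)) z) \<longlonglongrightarrow> f u z"
      unfolding f_def case_prod_unfold by (intro tendsto_sum tendsto_mult tendsto_const) auto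
  qed
  have m1: "(\<lambda>r. \<integral>z. f (\<lambda>j. dyadic_floor r (u j)) z \<partial>P) \<longlonglongrightarrow> (\<integral>z. f u z \<partial>P)"
    by (rule integral_dominated_convergence[OF _ _ w1 conv]) (use bound in auto)
  have m2: "(\<lambda>r. \<integral>z. (f (\<lambda>j. dyadic_floor r (u j)) z)\<^sup>2 \<partial>P) \<longlonglongrightarrow> (\<integral>z. (f u z)\<^sup>2 \<partial>P)"
  proof (rule integral_dominated_convergence[OF _ _ w2])
    show "AE z in P. (\<lambda>r. (f (\<lambda>j. dyadic_floor r (u j)) z)\<^sup>2) \<longlonglongrightarrow> (f u z)\<^sup>2"
      using conv by eventually_elim (rule tendsto_power)
    show "AE z in P. norm ((f (\<lambda>j. dyadic_floor r (u j)) z)\<^sup>2) \<le> (w z)\<^sup>2" for r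
    proof (rule AE_I2)
      fix z
      have "\<bar>f (\<lambda>j. dyadic_floor r (u j)) z\<bar>\<^sup>2 \<le> (w z)\<^sup>2" using bound by (intro power_mono) auto
      then show "norm ((f (\<lambda>j. dyadic_floor r (u j)) z)\<^sup>2) \<le> (w z)\<^sup>2" by simp
    qed
  qed auto
  show ?thesis unfolding vr_def f_def[symmetric] by (intro tendsto_diff tendsto_power m1 m2)
qed

lemma char_Q:
  fixes a :: "'j \<Rightarrow> real ^ 'n"
  assumes J: "finite J" and u: "\<And>j. j \<in> J \<Longrightarrow> u j \<in> {0..1}"
  shows "(\<integral>\<omega>. cis (\<Sum>j\<in>J. a j \<bullet> Q (u j) \<omega>) \<partial>N)
    = of_real (exp (- vr (\<lambda>z. \<Sum>(j, l)\<in>J \<times> UNIV. a j $ l * h (u j) l z) / 2))"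
proof (rule LIMSEQ_unique)
  show "(\<lambda>r. \<integral>\<omega>. cis (\<Sum>j\<in>J. a j \<bullet> q (dyadic_floor r (u j)) \<omega>) \<partial>N) \<longlonglongrightarrow> (\<integral>\<omega>. cis (\<Sum>j\<in>J. a j \<bullet> Q (u j) \<omega>) \<partial>N)"
  proof (rule integral_dominated_convergence[where w = "\<lambda>_. 1"])
    show "AE \<omega> in N. (\<lambda>r. cis (\<Sum>j\<in>J. a j \<bullet> q (dyadic_floor r (u j)) \<omega>)) \<longlonglongrightarrow> cis (\<Sum>j\<in>J. a j \<bullet> Q (u j) \<omega>)"
      using AE_Q
    proof eventually_elim
      fix \<omega>
      assume "continuous_on {0..1} (\<lambda>u. Q u \<omega>) \<and> (\<forall>u\<in>{0..1}. (\<lambda>r. q (dyadic_floor r u) \<omega>) \<longlonglongrightarrow> Q u \<omega>) \<and>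
        (\<forall>u\<in>dyadic_points. Q u \<omega> = q u \<omega>)"
      then have "(\<lambda>r. q (dyadic_floor r (u j)) \<omega>) \<longlonglongrightarrow> Q (u j) \<omega>" if "j \<in> J" for j using u[OF that] by blast
      then show "(\<lambda>r. cis (\<Sum>j\<in>J. a j \<bullet> q (dyadic_floor r (u j)) \<omega>)) \<longlonglongrightarrow> cis (\<Sum>j\<in>J. a j \<bullet> Q (u j) \<omega>)"
        unfolding cis_conv_exp by (intro tendsto_intros) auto
    qed
  qed auto
  have "(\<integral>\<omega>. cis (\<Sum>j\<in>J. a j \<bullet> q (dyadic_floor r (u j)) \<omega>) \<partial>N)
    = of_real (exp (- vr (\<lambda>z. \<Sum>(j, l)\<in>J \<times> UNIV. a j $ l * h (dyadic_floor r (u j)) l z) / 2))" for r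
    using u by (intro char_q J dyadic_floor_in)
  then show "(\<lambda>r. \<integral>\<omega>. cis (\<Sum>j\<in>J. a j \<bullet> q (dyadic_floor r (u j)) \<omega>) \<partial>N)
    \<longlonglongrightarrow> of_real (exp (- vr (\<lambda>z. \<Sum>(j, l)\<in>J \<times> UNIV. a j $ l * h (u j) l z) / 2))"
    by (simp only:) (intro tendsto_intros vr_tendsto J; simp)
qed

lemma Q_gaussian:
  fixes a :: "'j \<Rightarrow> real ^ 'n"
  assumes J: "finite J" and u: "\<And>j. j \<in> J \<Longrightarrow> u j \<in> {0..1}"
  defines "X \<equiv> \<lambda>\<omega>. \<Sum>j\<in>J. a j \<bullet> Q (u j) \<omega>"
  shows "normal_rv N X" "integrable N X" "integrable N (\<lambda>\<omega>. (X \<omega>)\<^sup>2)" "(\<integral>\<omega>. X \<omega> \<partial>N) = 0"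
    "(\<integral>\<omega>. (X \<omega>)\<^sup>2 \<partial>N) = vr (\<lambda>z. \<Sum>(j, l)\<in>J \<times> UNIV. a j $ l * h (u j) l z)"
proof -
  define f where "f z = (\<Sum>(j, l)\<in>J \<times> UNIV. a j $ l * h (u j) l z)" for z
  have f: "f \<in> borel_measurable P" "integrable P (\<lambda>z. (f z)\<^sup>2)"
    unfolding f_def case_prod_unfold by (rule linear_comb_h)+
  have X: "X \<in> borel_measurable N" unfolding X_def by measurable
  have "(\<integral>\<omega>. cis (s * X \<omega>) \<partial>N) = of_real (exp (- (s\<^sup>2 * vr f) / 2))" for s
  proof -
    have "(\<integral>\<omega>. cis (s * X \<omega>) \<partial>N) = (\<integral>\<omega>. cis (\<Sum>j\<in>J. (s *\<^sub>R a j) \<bullet> Q (u j) \<omega>) \<partial>N)"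
      by (simp add: X_def sum_distrib_left)
    also have "\<dots> = of_real (exp (- vr (\<lambda>z. \<Sum>(j, l)\<in>J \<times> UNIV. (s *\<^sub>R a j) $ l * h (u j) l z) / 2))"
      by (rule char_Q[OF J u])
    also have "(\<lambda>z. \<Sum>(j, l)\<in>J \<times> UNIV. (s *\<^sub>R a j) $ l * h (u j) l z) = (\<lambda>z. s * f z)"
      by (auto simp: f_def sum_distrib_left mult.assoc case_prod_unfold)
    also have "vr (\<lambda>z. s * f z) = s\<^sup>2 * vr f"
      by (simp add: vr_def power_mult_distrib right_diff_distrib)
    finally show ?thesis .
  qed
  note * = gaussian_of_char[OF N.prob_space_axioms X vr_nonneg[OF f] this]
  show "normal_rv N X" "integrable N X" "integrable N (\<lambda>\<omega>. (X \<omega>)\<^sup>2)" "(\<integral>\<omega>. X \<omega> \<partial>N) = 0"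
    "(\<integral>\<omega>. (X \<omega>)\<^sup>2 \<partial>N) = vr (\<lambda>z. \<Sum>(j, l)\<in>J \<times> UNIV. a j $ l * h (u j) l z)"
    using * unfolding f_def by auto
qed

end

subsection \<open>Weak convergence in the supremum metric\<close>

definition sup_continuous :: "'i set \<Rightarrow> (('i \<Rightarrow> 'b::metric_space) \<Rightarrow> real) \<Rightarrow> bool" where
  "sup_continuous T g \<longleftrightarrow> (\<forall>x\<in>bounded_funs T. \<forall>e>0. \<exists>d>0. \<forall>y\<in>bounded_funs T. sup_dist T x y < d \<longrightarrow> \<bar>g y - g x\<bar> < e)"

lemma sup_continuousD:
  assumes "sup_continuous T g" "x \<in> bounded_funs T" "0 < e"
  obtains d where "0 < d" "\<And>y. y \<in> bounded_funs T \<Longrightarrow> sup_dist T x y < d \<Longrightarrow> \<bar>g y - g x\<bar> < e"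
  using assms unfolding sup_continuous_def by meson

lemma sup_continuous_of_continuous_map:
  fixes g :: "('i \<Rightarrow> 'b::metric_space) \<Rightarrow> real"
  assumes T: "T \<noteq> {}" and g: "continuous_map (sup_topology T) euclideanreal g"
  shows "sup_continuous T g"
  unfolding sup_continuous_def
proof (intro ballI allI impI)
  interpret Metric_space "bounded_funs T" "sup_dist T :: ('i \<Rightarrow> 'b) \<Rightarrow> _" by (rule Metric_space_bounded_funs[OF T])
  fix x :: "'i \<Rightarrow> 'b" and e :: real
  assume x: "x \<in> bounded_funs T" and e: "0 < e"
  have "openin mtopology {y \<in> topspace mtopology. g y \<in> ball (g x) e}"
    by (rule openin_continuous_map_preimage[OF g]) simp
  moreover have "x \<in> {y \<in> topspace mtopology. g y \<in> ball (g x) e}" using x e by simp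
  ultimately obtain d where "0 < d" "mball x d \<subseteq> {y \<in> topspace mtopology. g y \<in> ball (g x) e}"
    unfolding openin_mtopology by blast
  then show "\<exists>d>0. \<forall>y\<in>bounded_funs T. sup_dist T x y < d \<longrightarrow> \<bar>g y - g x\<bar> < e"
    using x by (intro exI[of _ d]) (auto simp: subset_iff in_mball dist_real_def abs_minus_commute)
qed

lemma sup_dist_le:
  assumes "T \<noteq> {}" "x \<in> bounded_funs T" "y \<in> bounded_funs T" "\<And>u. u \<in> T \<Longrightarrow> dist (x u) (y u) \<le> d"
  shows "sup_dist T x y \<le> d"
  using assms by (auto simp: sup_dist_def intro!: cSUP_least)

lemma sup_continuous_lipschitz:
  assumes "\<And>x y. x \<in> bounded_funs T \<Longrightarrow> y \<in> bounded_funs T \<Longrightarrow> \<bar>g x - g y\<bar> \<le> L * sup_dist T x y" "0 \<le> L"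
  shows "sup_continuous T g"
  unfolding sup_continuous_def
proof (intro ballI allI impI)
  fix x :: "'a \<Rightarrow> 'b" and e :: real assume x: "x \<in> bounded_funs T" and e: "0 < e"
  show "\<exists>d>0. \<forall>y\<in>bounded_funs T. sup_dist T x y < d \<longrightarrow> \<bar>g y - g x\<bar> < e"
  proof (intro exI[of _ "e / (L + 1)"] conjI ballI impI)
    show "0 < e / (L + 1)" using e assms(2) by simp
    fix y :: "'a \<Rightarrow> 'b" assume y: "y \<in> bounded_funs T" "sup_dist T x y < e / (L + 1)"
    have "\<bar>g y - g x\<bar> \<le> L * sup_dist T x y" using assms(1)[OF x y(1)] by (simp add: abs_minus_commute)
    also have "\<dots> \<le> L * (e / (L + 1))" using y(2) assms(2) by (intro mult_left_mono) auto
    also have "\<dots> < e" using e assms(2) by (simp add: field_simps)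
    finally show "\<bar>g y - g x\<bar> < e" .
  qed
qed

text \<open>Infimal convolution of \<open>g\<close> with \<open>j\<close> times the distance. It is
  \<open>j\<close>-Lipschitz as an infimum of such functions and lies below \<open>g\<close>; for
  large \<open>j\<close> the penalty confines the infimum to points where \<open>g\<close> is close
  to \<open>g x\<close>.\<close>

lemma lipschitz_approximation:
  fixes g :: "('i \<Rightarrow> 'b::metric_space) \<Rightarrow> real"
  assumes T: "T \<noteq> {}" and g: "sup_continuous T g" and B: "\<And>x. x \<in> bounded_funs T \<Longrightarrow> \<bar>g x\<bar> \<le> B"
  obtains G where "\<And>j x. x \<in> bounded_funs T \<Longrightarrow> \<bar>G j x\<bar> \<le> B" "\<And>j x. x \<in> bounded_funs T \<Longrightarrow> G j x \<le> g x"
    "\<And>j x y. x \<in> bounded_funs T \<Longrightarrow> y \<in> bounded_funs T \<Longrightarrow> \<bar>G j x - G j y\<bar> \<le> real j * sup_dist T x y"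
    "\<And>x. x \<in> bounded_funs T \<Longrightarrow> (\<lambda>j. G j x) \<longlonglongrightarrow> g x"
proof
  interpret Metric_space "bounded_funs T" "sup_dist T :: ('i \<Rightarrow> 'b) \<Rightarrow> _" by (rule Metric_space_bounded_funs[OF T])
  define G where "G j x = (INF y\<in>bounded_funs T. g y + real j * sup_dist T x y)" for j :: nat and x
  have nn: "0 \<le> real j * sup_dist T x y" for j :: nat and x y :: "'i \<Rightarrow> 'b" by (intro mult_nonneg_nonneg) auto
  have bdd: "bdd_below ((\<lambda>y. g y + real j * sup_dist T x y) ` bounded_funs T)" for j x
  proof (rule bdd_belowI2)
    fix y :: "'i \<Rightarrow> 'b" assume "y \<in> bounded_funs T"
    then show "- B \<le> g y + real j * sup_dist T x y" using B[of y] nn[of j x y] by linarith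
  qed
  have up: "G j x \<le> g y + real j * sup_dist T x y" if "y \<in> bounded_funs T" for j x y
    unfolding G_def using bdd that by (rule cINF_lower)
  show le: "G j x \<le> g x" if "x \<in> bounded_funs T" for j x
    using up[OF that, of j x] that by simp
  have lowB: "- B \<le> G j x" if x: "x \<in> bounded_funs T" for j x
    unfolding G_def
  proof (rule cINF_greatest)
    fix y :: "'i \<Rightarrow> 'b" assume "y \<in> bounded_funs T"
    then show "- B \<le> g y + real j * sup_dist T x y" using B[of y] nn[of j x y] by linarith
  qed (use x in auto)
  show "\<bar>G j x\<bar> \<le> B" if x: "x \<in> bounded_funs T" for j x
    using lowB[OF x, of j] le[OF x, of j] B[OF x] by linarith
  have lip: "G j x \<le> G j y + real j * sup_dist T x y" if xy: "x \<in> bounded_funs T" "y \<in> bounded_funs T" for j x y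
  proof -
    have "G j x - real j * sup_dist T x y \<le> G j y"
      unfolding G_def[of j y]
    proof (rule cINF_greatest)
      fix z :: "'i \<Rightarrow> 'b" assume z: "z \<in> bounded_funs T"
      have "real j * sup_dist T x z \<le> real j * (sup_dist T x y + sup_dist T y z)"
        using triangle[OF xy z] by (intro mult_left_mono) auto
      then show "G j x - real j * sup_dist T x y \<le> g z + real j * sup_dist T y z"
        using up[OF z, of j x] by (simp add: distrib_left)
    qed (use xy in auto)
    then show ?thesis by simp
  qed
  show "\<bar>G j x - G j y\<bar> \<le> real j * sup_dist T x y" if "x \<in> bounded_funs T" "y \<in> bounded_funs T" for j x y
    using lip[of x y j] lip[of y x j] that commute[of x y] by (simp add: abs_le_iff)
  show "(\<lambda>j. G j x) \<longlonglongrightarrow> g x" if x: "x \<in> bounded_funs T" for x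
  proof (rule LIMSEQ_I)
    fix e :: real assume e: "0 < e"
    obtain d where d: "0 < d" "\<And>y. y \<in> bounded_funs T \<Longrightarrow> sup_dist T x y < d \<Longrightarrow> \<bar>g y - g x\<bar> < e / 2"
      using sup_continuousD[OF g x, of "e / 2"] e by auto
    \<comment> \<open>From distance \<open>d\<close> on, the penalty is at least
      \<open>2 * B\<close>, the largest possible difference of two values of
      \<open>g\<close>.\<close>
    obtain j0 where j0: "2 * B / d \<le> real j0" using real_arch_simple by blast
    show "\<exists>no. \<forall>n\<ge>no. norm (G n x - g x) < e"
    proof (intro exI allI impI)
      fix j assume j: "j0 \<le> j"
      have "g x - e / 2 \<le> G j x"
        unfolding G_def
      proof (rule cINF_greatest)
        fix y :: "'i \<Rightarrow> 'b" assume y: "y \<in> bounded_funs T"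
        show "g x - e / 2 \<le> g y + real j * sup_dist T x y"
        proof (cases "sup_dist T x y < d")
          case True
          have "0 \<le> real j * sup_dist T x y" by (intro mult_nonneg_nonneg) auto
          then show ?thesis using d(2)[OF y True] by linarith
        next
          case False
          have "2 * B = 2 * B / d * d" using d by simp
          also have "\<dots> \<le> real j * sup_dist T x y"
            using False j j0 d by (intro mult_mono) auto
          finally show ?thesis using B[OF x] B[OF y] e by linarith
        qed
      qed (use x in auto)
      then show "norm (G j x - g x) < e" using le[OF x, of j] e by simp
    qed
  qed
qed

text \<open>Although \<open>Z\<close> need not be measurable, every majorant of \<open>Z\<close> is
  above \<open>X - W\<close>, and \<open>X + W\<close> is a majorant. This transfers convergence
  from measurable discretizations to the original functionals.\<close>

lemma outer_expectation_approx:
  assumes X: "integrable M X" and W: "integrable M W" and ZX: "\<And>\<omega>. \<omega> \<in> space M \<Longrightarrow> \<bar>Z \<omega> - X \<omega>\<bar> \<le> W \<omega>"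
  shows "\<bar>outer_expectation M Z - (\<integral>\<omega>. X \<omega> \<partial>M)\<bar> \<le> (\<integral>\<omega>. W \<omega> \<partial>M)"
proof -
  let ?A = "{LINT \<omega>|M. U \<omega> | U. integrable M U \<and> (\<forall>\<omega> \<in> space M. Z \<omega> \<le> U \<omega>)}"
  have lower: "(\<integral>\<omega>. X \<omega> \<partial>M) - (\<integral>\<omega>. W \<omega> \<partial>M) \<le> a" if a: "a \<in> ?A" for a
  proof -
    obtain U where U: "a = (LINT \<omega>|M. U \<omega>)" "integrable M U" "\<And>\<omega>. \<omega> \<in> space M \<Longrightarrow> Z \<omega> \<le> U \<omega>" using a by auto
    have "(\<integral>\<omega>. X \<omega> - W \<omega> \<partial>M) \<le> (\<integral>\<omega>. U \<omega> \<partial>M)"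
    proof (rule integral_mono)
      fix \<omega> assume "\<omega> \<in> space M"
      then show "X \<omega> - W \<omega> \<le> U \<omega>" using ZX[of \<omega>] U(3)[of \<omega>] by linarith
    qed (use X W U in auto)
    then show ?thesis using X W U by simp
  qed
  have mem: "(\<integral>\<omega>. X \<omega> + W \<omega> \<partial>M) \<in> ?A"
  proof -
    have "Z \<omega> \<le> X \<omega> + W \<omega>" if "\<omega> \<in> space M" for \<omega> using ZX[OF that] by linarith
    then show ?thesis using X W by (intro CollectI exI[of _ "\<lambda>\<omega>. X \<omega> + W \<omega>"]) auto
  qed
  have "outer_expectation M Z \<le> (\<integral>\<omega>. X \<omega> + W \<omega> \<partial>M)"
    unfolding outer_expectation_def using mem lower by (intro cInf_lower bdd_belowI) auto
  moreover have "(\<integral>\<omega>. X \<omega> \<partial>M) - (\<integral>\<omega>. W \<omega> \<partial>M) \<le> outer_expectation M Z"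
    unfolding outer_expectation_def using mem lower by (intro cInf_greatest) auto
  ultimately show ?thesis using X W by simp
qed

text \<open>Majorants of the larger function are majorants of the smaller one. The common bound
  makes the sets of integrals nonempty and bounded below, where the real infimum behaves
  monotonically.\<close>

lemma outer_expectation_mono:
  assumes M: "prob_space M" and le: "\<And>\<omega>. \<omega> \<in> space M \<Longrightarrow> Y \<omega> \<le> Z \<omega>"
    and B: "\<And>\<omega>. \<omega> \<in> space M \<Longrightarrow> \<bar>Y \<omega>\<bar> \<le> B" "\<And>\<omega>. \<omega> \<in> space M \<Longrightarrow> \<bar>Z \<omega>\<bar> \<le> B"
  shows "outer_expectation M Y \<le> outer_expectation M Z"
  unfolding outer_expectation_def
proof (rule cInf_superset_mono)
  interpret prob_space M by fact
  have "integrable M (\<lambda>_. B)" "\<forall>\<omega>\<in>space M. Z \<omega> \<le> B" using B(2) by (auto simp: abs_le_iff)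
  then show "{LINT \<omega>|M. U \<omega> | U. integrable M U \<and> (\<forall>\<omega> \<in> space M. Z \<omega> \<le> U \<omega>)} \<noteq> {}" by blast
  show "bdd_below {LINT \<omega>|M. U \<omega> | U. integrable M U \<and> (\<forall>\<omega> \<in> space M. Y \<omega> \<le> U \<omega>)}"
  proof (rule bdd_belowI[of _ "- B"])
    fix a assume "a \<in> {LINT \<omega>|M. U \<omega> | U. integrable M U \<and> (\<forall>\<omega> \<in> space M. Y \<omega> \<le> U \<omega>)}"
    then obtain U where U: "a = (LINT \<omega>|M. U \<omega>)" "integrable M U" "\<And>\<omega>. \<omega> \<in> space M \<Longrightarrow> Y \<omega> \<le> U \<omega>" by auto
    have "(\<integral>\<omega>. - B \<partial>M) \<le> (\<integral>\<omega>. U \<omega> \<partial>M)"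
    proof (rule integral_mono)
      fix \<omega> assume "\<omega> \<in> space M"
      then show "- B \<le> U \<omega>" using B(1)[of \<omega>] U(3)[of \<omega>] by linarith
    qed (use U in auto)
    then show "- B \<le> a" using U by (simp add: prob_space)
  qed
  show "{LINT \<omega>|M. U \<omega> | U. integrable M U \<and> (\<forall>\<omega> \<in> space M. Z \<omega> \<le> U \<omega>)}
    \<subseteq> {LINT \<omega>|M. U \<omega> | U. integrable M U \<and> (\<forall>\<omega> \<in> space M. Y \<omega> \<le> U \<omega>)}"
  proof safe
    fix U assume "integrable M U" "\<forall>\<omega>\<in>space M. Z \<omega> \<le> U \<omega>"
    then show "\<exists>U'. (LINT \<omega>|M. U \<omega>) = (LINT \<omega>|M. U' \<omega>) \<and> integrable M U' \<and> (\<forall>\<omega>\<in>space M. Y \<omega> \<le> U' \<omega>)"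
      using le order_trans by (intro exI[of _ U]) blast
  qed
qed

section \<open>Step functions on the dyadic grid\<close>

lemma cube_ne: "{0..1 :: real ^ 'm} \<noteq> {}"
  by (auto simp: less_eq_vec_def)

lemma finite_dyadic_grid: "finite (dyadic_floor r ` {0..1 :: real ^ 'm})"
proof (rule finite_subset)
  show "dyadic_floor r ` {0..1 :: real ^ 'm} \<subseteq> (\<lambda>k :: 'm \<Rightarrow> int. \<chi> i. of_int (k i) / 2 ^ r) ` PiE UNIV (\<lambda>_. {0..2 ^ r})"
  proof
    fix v :: "real ^ 'm" assume "v \<in> dyadic_floor r ` {0..1}"
    then obtain u where u: "u \<in> {0..1}" "v = dyadic_floor r u" by auto
    have "0 \<le> \<lfloor>2 ^ r * u $ i\<rfloor> \<and> \<lfloor>2 ^ r * u $ i\<rfloor> \<le> 2 ^ r" for i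
    proof
      show "0 \<le> \<lfloor>2 ^ r * u $ i\<rfloor>" using u(1)[unfolded in_cube_iff, rule_format, of i] by simp
      have "2 ^ r * u $ i \<le> of_int (2 ^ r)" using u(1)[unfolded in_cube_iff, rule_format, of i] by simp
      then have "\<lfloor>2 ^ r * u $ i\<rfloor> \<le> \<lfloor>of_int (2 ^ r) :: real\<rfloor>" by (rule floor_mono)
      then show "\<lfloor>2 ^ r * u $ i\<rfloor> \<le> 2 ^ r" by (simp only: floor_of_int)
    qed
    then show "v \<in> (\<lambda>k :: 'm \<Rightarrow> int. \<chi> i. of_int (k i) / 2 ^ r) ` PiE UNIV (\<lambda>_. {0..2 ^ r})"
      unfolding u(2) dyadic_floor_def by (intro image_eqI[of _ _ "\<lambda>i. \<lfloor>2 ^ r * u $ i\<rfloor>"]) auto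
  qed
qed (simp add: finite_PiE)

lemma grid_bounded_funs: "(\<lambda>u\<in>{0..1}. f (dyadic_floor r u)) \<in> bounded_funs {0..1 :: real ^ 'm}"
proof -
  have "(\<lambda>u\<in>{0..1 :: real ^ 'm}. f (dyadic_floor r u)) ` {0..1} = f ` (dyadic_floor r ` {0..1})" by (auto simp: image_iff)
  then have "finite ((\<lambda>u\<in>{0..1 :: real ^ 'm}. f (dyadic_floor r u)) ` {0..1})" by (simp only: finite_imageI finite_dyadic_grid)
  then show ?thesis unfolding bounded_funs_def by (simp add: finite_imp_bounded)
qed

lemma dist_dyadic_floor: "dist (dyadic_floor r u) (u :: real ^ 'm) \<le> real CARD('m) / 2 ^ r"
proof -
  have "dist (dyadic_floor r u) u \<le> (\<Sum>i\<in>UNIV. \<bar>(dyadic_floor r u - u) $ i\<bar>)"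
    unfolding dist_norm by (rule norm_le_l1_cart)
  also have "\<dots> \<le> (\<Sum>i\<in>(UNIV :: 'm set). 1 / 2 ^ r)"
  proof (rule sum_mono)
    fix i
    show "\<bar>(dyadic_floor r u - u) $ i\<bar> \<le> 1 / 2 ^ r"
      using dyadic_floor_bounds(1)[of r u i] dyadic_floor_bounds(2)[of u i r] by (simp add: abs_le_iff)
  qed
  finally show ?thesis by simp
qed

lemma borel_measurable_completion_AE:
  fixes f g :: "'a \<Rightarrow> real"
  assumes f: "f \<in> borel_measurable N" and AE: "AE \<omega> in N. f \<omega> = g \<omega>"
  shows "g \<in> borel_measurable (completion N)"
proof (rule measurableI)
  fix A :: "real set" assume A: "A \<in> sets borel"
  show "g -` A \<inter> space (completion N) \<in> sets (completion N)"
  proof (rule completion.in_sets_AE)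
    show "f -` A \<inter> space (completion N) \<in> sets (completion N)"
      using measurable_sets[OF measurable_completion[OF f] A] .
    show "AE x in completion N. (x \<in> f -` A \<inter> space (completion N)) = (x \<in> g -` A \<inter> space (completion N))"
      by (rule AE_completion) (use AE in eventually_elim, auto)
  qed auto
qed simp

text \<open>The functional of the step function with dyadic values, written as a function of the
  numbered sequence. Sample field and limit field become arguments of one and the same function, so
  \<open>fidi_convergence\<close> applies.\<close>

definition grid_functional :: "nat \<Rightarrow> ((real ^ 'm \<Rightarrow> real ^ 'n) \<Rightarrow> real) \<Rightarrow> (nat \<Rightarrow> real) \<Rightarrow> real" where
  "grid_functional r g x = g (\<lambda>u\<in>{0..1}. \<chi> l. x (idx (dyadic_floor r u, l)))"

lemma grid_functional_dep:
  fixes g :: "(real ^ 'm \<Rightarrow> real ^ 'n) \<Rightarrow> real"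
  shows "\<exists>m. \<forall>x. grid_functional r g x = grid_functional r g (\<lambda>i. if i < m then x i else 0)"
proof -
  define I where "I = idx ` (dyadic_floor r ` {0..1 :: real ^ 'm} \<times> (UNIV :: 'n set))"
  have I: "finite I" by (simp add: I_def finite_dyadic_grid)
  have "idx (dyadic_floor r u, l) < Suc (Max I)" if "u \<in> {0..1}" for u :: "real ^ 'm" and l :: 'n
  proof -
    have "idx (dyadic_floor r u, l) \<in> I" using that unfolding I_def by blast
    then show ?thesis using Max_ge[OF I] by (simp add: less_Suc_eq_le)
  qed
  then have "grid_functional r g x = grid_functional r g (\<lambda>i. if i < Suc (Max I) then x i else 0)" for x
    unfolding grid_functional_def by (intro arg_cong[where f = g] restrict_ext) simp
  then show ?thesis by blast
qed

text \<open>A grid has finitely many points, so finitely many coordinates control the supremum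
  distance of step functions, and product convergence suffices.\<close>

lemma grid_functional_continuous:
  fixes g :: "(real ^ 'm \<Rightarrow> real ^ 'n) \<Rightarrow> real"
  assumes g: "sup_continuous {0..1} g"
  shows "continuous_on UNIV (grid_functional r g)"
  unfolding continuous_on_eq_continuous_within continuous_within
proof (intro ballI tendstoI)
  fix x :: "nat \<Rightarrow> real" and e :: real assume e: "0 < e"
  define arg :: "(nat \<Rightarrow> real) \<Rightarrow> real ^ 'm \<Rightarrow> real ^ 'n"
    where "arg x = (\<lambda>u\<in>{0..1}. \<chi> l. x (idx (dyadic_floor r u, l)))" for x
  have arg: "arg x \<in> bounded_funs {0..1 :: real ^ 'm}" for x
    unfolding arg_def by (rule grid_bounded_funs)
  obtain d where d: "0 < d" "\<And>y. y \<in> bounded_funs {0..1} \<Longrightarrow> sup_dist {0..1} (arg x) y < d \<Longrightarrow> \<bar>g y - g (arg x)\<bar> < e"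
    using sup_continuousD[OF g arg e] by blast
  \<comment> \<open>Summed over the components this gives \<open>d / 2\<close>, strictly inside the
    radius \<open>d\<close> after taking the supremum.\<close>
  define \<delta> where "\<delta> = d / (2 * real CARD('n))"
  have \<delta>: "0 < \<delta>" using d by (simp add: \<delta>_def)
  define I where "I = idx ` (dyadic_floor r ` {0..1 :: real ^ 'm} \<times> (UNIV :: 'n set))"
  have I: "finite I" by (simp add: I_def finite_dyadic_grid)
  have "\<forall>\<^sub>F x' in at x within UNIV. \<forall>i\<in>I. dist (x' i) (x i) < \<delta>"
  proof (rule eventually_ball_finite[OF I], rule ballI)
    fix i
    have "continuous_on UNIV (\<lambda>x :: nat \<Rightarrow> real. x i)" by (rule continuous_on_product_coordinates)
    then have "((\<lambda>x :: nat \<Rightarrow> real. x i) \<longlongrightarrow> x i) (at x within UNIV)" by (simp add: continuous_on_def)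
    then show "\<forall>\<^sub>F x' in at x within UNIV. dist (x' i) (x i) < \<delta>" using \<delta> by (rule tendstoD)
  qed
  then show "\<forall>\<^sub>F x' in at x within UNIV. dist (grid_functional r g x') (grid_functional r g x) < e"
  proof eventually_elim
    fix x' assume x': "\<forall>i\<in>I. dist (x' i) (x i) < \<delta>"
    have "sup_dist {0..1} (arg x) (arg x') \<le> d / 2"
    proof (rule sup_dist_le[OF cube_ne arg arg])
      fix u :: "real ^ 'm" assume u: "u \<in> {0..1}"
      have "dist (arg x u) (arg x' u) \<le> (\<Sum>l\<in>UNIV. \<bar>(arg x u - arg x' u) $ l\<bar>)"
        unfolding dist_norm by (rule norm_le_l1_cart)
      also have "\<dots> \<le> (\<Sum>l\<in>(UNIV :: 'n set). \<delta>)"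
      proof (rule sum_mono)
        fix l :: 'n
        have "idx (dyadic_floor r u, l) \<in> I" using u unfolding I_def by blast
        then have "dist (x' (idx (dyadic_floor r u, l))) (x (idx (dyadic_floor r u, l))) < \<delta>" using x' by blast
        then show "\<bar>(arg x u - arg x' u) $ l\<bar> \<le> \<delta>" using u by (simp add: arg_def dist_real_def abs_minus_commute)
      qed
      also have "\<dots> = d / 2" by (simp add: \<delta>_def)
      finally show "dist (arg x u) (arg x' u) \<le> d / 2" .
    qed
    then have "sup_dist {0..1} (arg x) (arg x') < d" using d(1) by linarith
    then show "dist (grid_functional r g x') (grid_functional r g x) < e"
      using d(2)[OF arg] unfolding grid_functional_def arg_def[symmetric] dist_real_def by blast
  qed
qed

section \<open>Continuity from above and boundedness of the sample fields\<close>

context box_sums begin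

text \<open>An observation inside the box stays inside larger boxes; one outside exceeds
  \<open>u\<close> strictly in some coordinate and is left out once the ceiling is close. This holds
  for every observation, so no null set intervenes.\<close>

lemma h_ceiling_tendsto: "(\<lambda>k. h (dyadic_ceiling k u) l z) \<longlonglongrightarrow> h u l z"
proof (rule tendsto_eventually)
  show "\<forall>\<^sub>F k in sequentially. h (dyadic_ceiling k u) l z = h u l z"
  proof (cases "fst z \<le> u")
    case True
    have "fst z \<le> dyadic_ceiling k u" for k
      unfolding less_eq_vec_def
    proof
      fix i
      have "fst z $ i \<le> u $ i" using True by (simp add: less_eq_vec_def)
      then show "fst z $ i \<le> dyadic_ceiling k u $ i" using dyadic_ceiling_bounds(1)[of u i k] by (rule order_trans)
    qed
    then show ?thesis using True by (simp add: h_def)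
  next
    case False
    then obtain i where i: "u $ i < fst z $ i" by (auto simp: less_eq_vec_def not_le)
    have "(\<lambda>k. dyadic_ceiling k u $ i) \<longlonglongrightarrow> u $ i" by (rule tendsto_vec_nth[OF dyadic_ceiling_tendsto])
    then have "\<forall>\<^sub>F k in sequentially. dyadic_ceiling k u $ i < fst z $ i" using i by (rule order_tendstoD)
    then show ?thesis
    proof eventually_elim
      fix k assume "dyadic_ceiling k u $ i < fst z $ i"
      then have "\<not> fst z \<le> dyadic_ceiling k u" by (auto simp: less_eq_vec_def not_le)
      then show "h (dyadic_ceiling k u) l z = h u l z" using False by (simp add: h_def)
    qed
  qed
qed

lemma abs_snd_int: "integrable P (\<lambda>z. \<bar>snd z $ l\<bar>)"
  using P.square_integrable_imp_integrable[OF snd_meas sq_comp] by simp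

lemma abs_h_le: "\<bar>h u l z\<bar> \<le> \<bar>snd z $ l\<bar>"
  by (simp add: h_def indicator_def)

lemma S_ceiling_tendsto: "(\<lambda>k. S n (dyadic_ceiling k u) l \<omega>) \<longlonglongrightarrow> S n u l \<omega>"
proof -
  have "(\<lambda>k. \<integral>z. h (dyadic_ceiling k u) l z \<partial>P) \<longlonglongrightarrow> (\<integral>z. h u l z \<partial>P)"
    by (rule integral_dominated_convergence[OF _ _ abs_snd_int[of l]])
      (auto simp: h_ceiling_tendsto abs_h_le)
  then show ?thesis unfolding S_def divide_inverse
    by (intro tendsto_mult tendsto_sum tendsto_diff tendsto_const h_ceiling_tendsto)
qed

lemma SV_ceiling_tendsto: "(\<lambda>k. SV n (dyadic_ceiling k u) \<omega>) \<longlonglongrightarrow> SV n u \<omega>"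
  by (rule vec_tendstoI) (simp add: SV_def S_ceiling_tendsto)

text \<open>Replacing the indicators by 1 and all terms by absolute values removes \<open>u\<close>;
  the bound may depend on the sample.\<close>

lemma SV_bound: "\<exists>C. \<forall>u. norm (SV n u \<omega>) \<le> C"
proof -
  define b where "b l = (\<Sum>j\<in>{1..n}. \<bar>snd (Z j \<omega>) $ l\<bar> + (\<integral>z. \<bar>snd z $ l\<bar> \<partial>P)) / sqrt (real n)" for l
  have "\<bar>S n u l \<omega>\<bar> \<le> b l" for u l
  proof -
    have "\<bar>\<integral>z. h u l z \<partial>P\<bar> \<le> (\<integral>z. \<bar>h u l z\<bar> \<partial>P)" by (rule integral_abs_bound)
    also have "\<dots> \<le> (\<integral>z. \<bar>snd z $ l\<bar> \<partial>P)"
      by (intro integral_mono abs_snd_int abs_h_le) (simp add: h_int)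
    finally have m: "\<bar>\<integral>z. h u l z \<partial>P\<bar> \<le> (\<integral>z. \<bar>snd z $ l\<bar> \<partial>P)" .
    have "\<bar>\<Sum>j\<in>{1..n}. h u l (Z j \<omega>) - (\<integral>z. h u l z \<partial>P)\<bar> \<le> (\<Sum>j\<in>{1..n}. \<bar>h u l (Z j \<omega>) - (\<integral>z. h u l z \<partial>P)\<bar>)"
      by (rule sum_abs)
    also have "\<dots> \<le> (\<Sum>j\<in>{1..n}. \<bar>snd (Z j \<omega>) $ l\<bar> + (\<integral>z. \<bar>snd z $ l\<bar> \<partial>P))"
    proof (rule sum_mono)
      fix j
      show "\<bar>h u l (Z j \<omega>) - (\<integral>z. h u l z \<partial>P)\<bar> \<le> \<bar>snd (Z j \<omega>) $ l\<bar> + (\<integral>z. \<bar>snd z $ l\<bar> \<partial>P)"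
        using abs_h_le[of u l "Z j \<omega>"] m by linarith
    qed
    finally show ?thesis unfolding S_def b_def abs_divide by (simp add: divide_right_mono)
  qed
  then have "norm (SV n u \<omega>) \<le> (\<Sum>l\<in>UNIV. b l)" for u
    using norm_le_l1_cart[of "SV n u \<omega>"] sum_mono[of UNIV "\<lambda>l. \<bar>SV n u \<omega> $ l\<bar>" b]
    by (simp add: SV_def)
  then show ?thesis by blast
qed

lemma SV_bounded_funs: "(\<lambda>u\<in>T. SV n u \<omega>) \<in> bounded_funs T"
proof -
  obtain C where "\<And>u. norm (SV n u \<omega>) \<le> C" using SV_bound by blast
  then have "bounded ((\<lambda>u\<in>T. SV n u \<omega>) ` T)" unfolding bounded_iff by (intro exI[of _ C]) auto
  then show ?thesis by (simp add: bounded_funs_def)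
qed

end

section \<open>Convergence of functionals of the sample fields\<close>

context gaussian_limit begin

lemma grid_functional_V:
  fixes g :: "(real ^ 'm \<Rightarrow> real ^ 'n) \<Rightarrow> real"
  shows "grid_functional r g (\<lambda>i. V i \<omega>) = g (\<lambda>u\<in>{0..1}. q (dyadic_floor r u) \<omega>)"
  by (simp add: grid_functional_def q_def)

lemma grid_functional_S:
  fixes g :: "(real ^ 'm \<Rightarrow> real ^ 'n) \<Rightarrow> real"
  shows "grid_functional r g (\<lambda>i. S2 n (enum i) \<omega>) = g (\<lambda>u\<in>{0..1}. SV n (dyadic_floor r u) \<omega>)"
  unfolding grid_functional_def
  by (intro arg_cong[where f = g] restrict_ext) (simp add: SV_def enum_idx dyadic_floor_in)

lemma grid_functional_bound:
  assumes "\<forall>x\<in>bounded_funs {0..1}. \<bar>g x\<bar> \<le> B"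
  shows "\<bar>grid_functional r g x\<bar> \<le> B"
  unfolding grid_functional_def by (intro assms[rule_format] grid_bounded_funs)

lemma grid_functional_meas:
  fixes g :: "(real ^ 'm \<Rightarrow> real ^ 'n) \<Rightarrow> real"
  assumes g: "sup_continuous {0..1} g"
  shows "(\<lambda>\<omega>. grid_functional r g (\<lambda>i. V i \<omega>)) \<in> borel_measurable N"
    "(\<lambda>\<omega>. grid_functional r g (\<lambda>i. S2 n (enum i) \<omega>)) \<in> borel_measurable M"
proof -
  note m = borel_measurable_continuous_onI[OF grid_functional_continuous[OF g]]
  show "(\<lambda>\<omega>. grid_functional r g (\<lambda>i. V i \<omega>)) \<in> borel_measurable N"
    by (intro measurable_compose[OF measurable_coordinatewise_then_product m] V_meas)
  show "(\<lambda>\<omega>. grid_functional r g (\<lambda>i. S2 n (enum i) \<omega>)) \<in> borel_measurable M"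
    by (intro measurable_compose[OF measurable_coordinatewise_then_product m] S_meas)
qed

lemma continuous_bounded_funs:
  fixes x :: "real ^ 'm \<Rightarrow> real ^ 'n"
  assumes "continuous_on {0..1} x"
  shows "(\<lambda>u\<in>{0..1}. x u) \<in> bounded_funs {0..1}"
proof -
  have "compact {0..1 :: real ^ 'm}" using compact_cbox[of 0 "1 :: real ^ 'm"] by (simp add: interval_cbox)
  then have "bounded (x ` {0..1})" using assms compact_continuous_image compact_imp_bounded by blast
  moreover have "(\<lambda>u\<in>{0..1}. x u) ` {0..1} = x ` {0..1}" by auto
  ultimately show ?thesis by (simp add: bounded_funs_def)
qed

lemma AE_Q_bounded: "AE \<omega> in N. (\<lambda>u\<in>{0..1}. Q u \<omega>) \<in> bounded_funs {0..1}"
  using AE_Q by eventually_elim (simp add: continuous_bounded_funs)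

text \<open>A continuous path on the compact cube is uniformly continuous, so its dyadic step
  functions converge in the supremum distance and \<open>g\<close> follows.\<close>

lemma AE_grid_functional_tendsto:
  fixes g :: "(real ^ 'm \<Rightarrow> real ^ 'n) \<Rightarrow> real"
  assumes g: "sup_continuous {0..1} g"
  shows "AE \<omega> in N. (\<lambda>r. grid_functional r g (\<lambda>i. V i \<omega>)) \<longlonglongrightarrow> g (\<lambda>u\<in>{0..1}. Q u \<omega>)"
  using AE_Q
proof eventually_elim
  fix \<omega>
  assume *: "continuous_on {0..1} (\<lambda>u. Q u \<omega>) \<and> (\<forall>u\<in>{0..1}. (\<lambda>r. q (dyadic_floor r u) \<omega>) \<longlonglongrightarrow> Q u \<omega>) \<and>
    (\<forall>u\<in>dyadic_points. Q u \<omega> = q u \<omega>)"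
  have bf: "(\<lambda>u\<in>{0..1}. Q u \<omega>) \<in> bounded_funs {0..1}" using * by (simp add: continuous_bounded_funs)
  have "compact {0..1 :: real ^ 'm}" using compact_cbox[of 0 "1 :: real ^ 'm"] by (simp add: interval_cbox)
  then have uc: "uniformly_continuous_on {0..1} (\<lambda>u. Q u \<omega>)" using * compact_uniformly_continuous by blast
  show "(\<lambda>r. grid_functional r g (\<lambda>i. V i \<omega>)) \<longlonglongrightarrow> g (\<lambda>u\<in>{0..1}. Q u \<omega>)"
  proof (rule tendstoI)
    fix e :: real assume e: "0 < e"
    obtain d where d: "0 < d" "\<And>y. y \<in> bounded_funs {0..1} \<Longrightarrow> sup_dist {0..1} (\<lambda>u\<in>{0..1}. Q u \<omega>) y < d \<Longrightarrow> \<bar>g y - g (\<lambda>u\<in>{0..1}. Q u \<omega>)\<bar> < e"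
      using sup_continuousD[OF g bf e] by blast
    have "0 < d / 2" using d by simp
    then obtain \<delta> where \<delta>: "0 < \<delta>" "\<And>u v. u \<in> {0..1} \<Longrightarrow> v \<in> {0..1} \<Longrightarrow> dist v u < \<delta> \<Longrightarrow> dist (Q v \<omega>) (Q u \<omega>) < d / 2"
      using uc unfolding uniformly_continuous_on_def by meson
    have "(\<lambda>r. real CARD('m) * (1 / 2 ^ r)) \<longlonglongrightarrow> real CARD('m) * 0" by (intro tendsto_intros LIMSEQ_half_power)
    then have "\<forall>\<^sub>F r in sequentially. real CARD('m) * (1 / 2 ^ r) < \<delta>" by (rule order_tendstoD) (use \<delta>(1) in simp)
    then have "\<forall>\<^sub>F r in sequentially. real CARD('m) / 2 ^ r < \<delta>" by simp
    then show "\<forall>\<^sub>F r in sequentially. dist (grid_functional r g (\<lambda>i. V i \<omega>)) (g (\<lambda>u\<in>{0..1}. Q u \<omega>)) < e"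
    proof eventually_elim
      fix r assume r: "real CARD('m) / 2 ^ r < \<delta>"
      have b2: "(\<lambda>u\<in>{0..1}. q (dyadic_floor r u) \<omega>) \<in> bounded_funs {0..1}" by (rule grid_bounded_funs)
      have "sup_dist {0..1} (\<lambda>u\<in>{0..1}. Q u \<omega>) (\<lambda>u\<in>{0..1}. q (dyadic_floor r u) \<omega>) \<le> d / 2"
      proof (rule sup_dist_le[OF cube_ne bf b2])
        fix u :: "real ^ 'm" assume u: "u \<in> {0..1}"
        have fl: "dyadic_floor r u \<in> dyadic_points" using u by (rule dyadic_floor_in)
        have "dist (Q (dyadic_floor r u) \<omega>) (Q u \<omega>) < d / 2"
          using u fl dyadic_points_subset dist_dyadic_floor[of r u] r by (intro \<delta>(2)) auto
        then show "dist ((\<lambda>u\<in>{0..1}. Q u \<omega>) u) ((\<lambda>u\<in>{0..1}. q (dyadic_floor r u) \<omega>) u) \<le> d / 2"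
          using u fl * by (simp add: dist_commute)
      qed
      then have "sup_dist {0..1} (\<lambda>u\<in>{0..1}. Q u \<omega>) (\<lambda>u\<in>{0..1}. q (dyadic_floor r u) \<omega>) < d" using d(1) by linarith
      then show "dist (grid_functional r g (\<lambda>i. V i \<omega>)) (g (\<lambda>u\<in>{0..1}. Q u \<omega>)) < e"
        unfolding grid_functional_V dist_real_def by (rule d(2)[OF b2])
    qed
  qed
qed

lemma gQ_measurable:
  fixes g :: "(real ^ 'm \<Rightarrow> real ^ 'n) \<Rightarrow> real"
  assumes g: "sup_continuous {0..1} g"
  shows "(\<lambda>\<omega>. g (\<lambda>u\<in>{0..1}. Q u \<omega>)) \<in> borel_measurable (completion N)"
proof (rule borel_measurable_completion_AE)
  show "(\<lambda>\<omega>. lim (\<lambda>r. grid_functional r g (\<lambda>i. V i \<omega>))) \<in> borel_measurable N"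
    by (rule borel_measurable_lim_metric) (rule grid_functional_meas[OF g])
  show "AE \<omega> in N. lim (\<lambda>r. grid_functional r g (\<lambda>i. V i \<omega>)) = g (\<lambda>u\<in>{0..1}. Q u \<omega>)"
    using AE_grid_functional_tendsto[OF g] by eventually_elim (rule limI)
qed

lemma prob_space_completion_N: "prob_space (completion N)"
  by (rule N.prob_space_completion)

lemma grid_functional_integral_tendsto:
  fixes g :: "(real ^ 'm \<Rightarrow> real ^ 'n) \<Rightarrow> real"
  assumes g: "sup_continuous {0..1} g" and B: "\<forall>x\<in>bounded_funs {0..1}. \<bar>g x\<bar> \<le> B"
  shows "(\<lambda>r. \<integral>\<omega>. grid_functional r g (\<lambda>i. V i \<omega>) \<partial>N) \<longlonglongrightarrow> (\<integral>\<omega>. g (\<lambda>u\<in>{0..1}. Q u \<omega>) \<partial>completion N)"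
proof -
  interpret C: prob_space "completion N" by (rule prob_space_completion_N)
  have "(\<lambda>r. \<integral>\<omega>. grid_functional r g (\<lambda>i. V i \<omega>) \<partial>completion N) \<longlonglongrightarrow> (\<integral>\<omega>. g (\<lambda>u\<in>{0..1}. Q u \<omega>) \<partial>completion N)"
  proof (rule integral_dominated_convergence[where w = "\<lambda>_. B"])
    show "AE \<omega> in completion N. (\<lambda>r. grid_functional r g (\<lambda>i. V i \<omega>)) \<longlonglongrightarrow> g (\<lambda>u\<in>{0..1}. Q u \<omega>)"
      by (rule AE_completion[OF AE_grid_functional_tendsto[OF g]])
    show "AE \<omega> in completion N. norm (grid_functional r g (\<lambda>i. V i \<omega>)) \<le> B" for r
      using grid_functional_bound[OF B] by simp
  qed (auto intro: gQ_measurable[OF g] measurable_completion[OF grid_functional_meas(1)[OF g]])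
  then show ?thesis by (simp add: integral_completion[OF grid_functional_meas(1)[OF g]])
qed

text \<open>
  The sample fields are continuous from above in \<open>u\<close>, hence dyadic points above \<open>u\<close> reduce the
  supremum over the cube to a countable, measurable one.
\<close>
lemma oscillation_bound:
  assumes r1: "0 < r1" and r: "2 / 2 ^ r \<le> 1 / real r1" and u: "u \<in> {0..1}"
  shows "ennreal (norm (SV n u \<omega> - SV n (dyadic_floor r u) \<omega>)) \<le> (SUP (u, v)\<in>dpairs r1. ennreal (norm (SV n u \<omega> - SV n v \<omega>)))"
proof (rule LIMSEQ_le_const2)
  show "(\<lambda>k. ennreal (norm (SV n (dyadic_ceiling k u) \<omega> - SV n (dyadic_floor r u) \<omega>))) \<longlonglongrightarrow> ennreal (norm (SV n u \<omega> - SV n (dyadic_floor r u) \<omega>))"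
    by (intro tendsto_ennrealI tendsto_norm tendsto_diff SV_ceiling_tendsto tendsto_const)
  \<comment> \<open>For \<open>r \<le> k\<close> ceiling and floor each differ from \<open>u\<close>
    by at most \<open>1 / 2 ^ r\<close> in every coordinate, which explains the factor 2 in the
    hypothesis.\<close>
  have "(dyadic_ceiling k u, dyadic_floor r u) \<in> dpairs r1" if k: "r \<le> k" for k
  proof -
    have "\<bar>dyadic_ceiling k u $ i - dyadic_floor r u $ i\<bar> \<le> 1 / real r1" for i
    proof -
      have "(1 :: real) / 2 ^ k \<le> 1 / 2 ^ r" using k by (intro divide_left_mono power_increasing) auto
      moreover have "(2 :: real) / 2 ^ r = 1 / 2 ^ r + 1 / 2 ^ r" by simp
      ultimately show ?thesis
        using dyadic_ceiling_bounds(1)[of u i k] dyadic_ceiling_bounds(2)[of k u i]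
          dyadic_floor_bounds(1)[of r u i] dyadic_floor_bounds(2)[of u i r] r
        unfolding abs_le_iff by linarith
    qed
    then show ?thesis
      using dyadic_ceiling_in[OF u, of k] dyadic_floor_in[OF u, of r] dyadic_points_subset
      unfolding dpairs_def close_pairs_def by auto
  qed
  then show "\<exists>K. \<forall>k\<ge>K. ennreal (norm (SV n (dyadic_ceiling k u) \<omega> - SV n (dyadic_floor r u) \<omega>))
      \<le> (SUP (u, v)\<in>dpairs r1. ennreal (norm (SV n u \<omega> - SV n v \<omega>)))"
    by (intro exI[of _ r] allI impI SUP_upper2) auto
qed

text \<open>Three errors of size \<epsilon>/3: discretizing the sample field, which the Lipschitz
  constant reduces to the mean oscillation; convergence on the fixed grid; and discretizing the
  limit. The grid is fixed before the sample size grows.\<close>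

lemma lipschitz_convergence:
  fixes g :: "(real ^ 'm \<Rightarrow> real ^ 'n) \<Rightarrow> real"
  assumes B: "\<forall>x\<in>bounded_funs {0..1}. \<bar>g x\<bar> \<le> B"
    and L: "\<forall>x\<in>bounded_funs {0..1}. \<forall>y\<in>bounded_funs {0..1}. \<bar>g x - g y\<bar> \<le> L * sup_dist {0..1} x y" "0 \<le> L"
  shows "(\<lambda>n. outer_expectation M (\<lambda>\<omega>. g (\<lambda>u\<in>{0..1}. SV n u \<omega>))) \<longlonglongrightarrow> (\<integral>\<omega>. g (\<lambda>u\<in>{0..1}. Q u \<omega>) \<partial>completion N)"
proof (rule LIMSEQ_I)
  fix \<epsilon> :: real assume \<epsilon>: "0 < \<epsilon>"
  have g: "sup_continuous {0..1} g" using L by (intro sup_continuous_lipschitz[of _ g L]) blast+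
  \<comment> \<open>Adding 1 to \<open>L\<close> gives a strict inequality and covers constant
    functionals.\<close>
  define e where "e = \<epsilon> / (3 * (L + 1))"
  have e: "0 < e" "L * e < \<epsilon> / 3" using \<epsilon> L(2) by (auto simp: e_def field_simps add_nonneg_pos)
  obtain r1 n1 where rn: "0 < r1 \<and> (\<forall>n\<ge>n1. \<forall>F. countable F \<longrightarrow> F \<subseteq> close_pairs r1 \<longrightarrow>
    (\<integral>\<^sup>+\<omega>. (SUP (u, v)\<in>F. ennreal (norm (SV n u \<omega> - SV n v \<omega>))) \<partial>M) \<le> ennreal e)"
    using equicontinuity[OF e(1)] by (elim exE)
  note r1 = conjunct1[OF rn] and n1 = conjunct2[OF rn, rule_format]
  define W where "W n \<omega> = (SUP (u, v)\<in>dpairs r1. ennreal (norm (SV n u \<omega> - SV n v \<omega>)))" for n \<omega>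
  have W_meas[measurable]: "W n \<in> borel_measurable M" for n
    unfolding W_def case_prod_unfold by (intro borel_measurable_SUP countable_dpairs) measurable
  have W_int: "(\<integral>\<^sup>+\<omega>. W n \<omega> \<partial>M) \<le> ennreal e" if "n \<ge> n1" for n
    unfolding W_def using that countable_dpairs by (rule n1) (auto simp: dpairs_def)
  \<comment> \<open>Finiteness at every sample point permits passing to a real-valued majorant, as
    the outer expectation requires.\<close>
  have W_fin: "W n \<omega> < top" for n \<omega>
  proof -
    obtain C where C: "\<And>u. norm (SV n u \<omega>) \<le> C" using SV_bound by blast
    have "W n \<omega> \<le> ennreal (2 * C)"
      unfolding W_def
    proof (rule SUP_least, clarify)
      fix u v
      have "norm (SV n u \<omega> - SV n v \<omega>) \<le> 2 * C" using norm_triangle_ineq4[of "SV n u \<omega>" "SV n v \<omega>"] C[of u] C[of v] by linarith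
      then show "ennreal (norm (SV n u \<omega> - SV n v \<omega>)) \<le> ennreal (2 * C)" by (rule ennreal_leI)
    qed
    then show ?thesis by (rule le_less_trans) simp
  qed
  have "(\<lambda>r. 2 * (1 / 2 ^ r) :: real) \<longlonglongrightarrow> 2 * 0" by (intro tendsto_intros LIMSEQ_half_power)
  then have "\<forall>\<^sub>F r in sequentially. 2 * (1 / 2 ^ r) < 1 / real r1" by (rule order_tendstoD) (use r1 in simp)
  then have ev1: "\<forall>\<^sub>F r in sequentially. (2 / 2 ^ r :: real) < 1 / real r1" by simp
  have ev2: "\<forall>\<^sub>F r in sequentially. dist (\<integral>\<omega>. grid_functional r g (\<lambda>i. V i \<omega>) \<partial>N) (\<integral>\<omega>. g (\<lambda>u\<in>{0..1}. Q u \<omega>) \<partial>completion N) < \<epsilon> / 3"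
    using grid_functional_integral_tendsto[OF g B] by (rule tendstoD) (use \<epsilon> in auto)
  obtain r where r: "(2 / 2 ^ r :: real) \<le> 1 / real r1"
    "\<bar>(\<integral>\<omega>. grid_functional r g (\<lambda>i. V i \<omega>) \<partial>N) - (\<integral>\<omega>. g (\<lambda>u\<in>{0..1}. Q u \<omega>) \<partial>completion N)\<bar> < \<epsilon> / 3"
    using eventually_happens[OF eventually_conj[OF ev1 ev2]] by (auto simp: dist_real_def intro: less_imp_le)
  have osc: "\<bar>outer_expectation M (\<lambda>\<omega>. g (\<lambda>u\<in>{0..1}. SV n u \<omega>)) - (\<integral>\<omega>. grid_functional r g (\<lambda>i. S2 n (enum i) \<omega>) \<partial>M)\<bar> \<le> L * e"
    if n: "n \<ge> n1" for n
  proof -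
    have W_eq: "ennreal (enn2real (W n \<omega>)) = W n \<omega>" for \<omega> using W_fin[of n \<omega>] by simp
    have le: "(\<integral>\<^sup>+\<omega>. ennreal (enn2real (W n \<omega>)) \<partial>M) \<le> ennreal e" unfolding W_eq using n by (rule W_int)
    have W1: "integrable M (\<lambda>\<omega>. enn2real (W n \<omega>))" "(\<integral>\<omega>. enn2real (W n \<omega>) \<partial>M) \<le> e"
      using integrable_of_nn_integral_le[OF _ _ le] e(1) by auto
    have "\<bar>outer_expectation M (\<lambda>\<omega>. g (\<lambda>u\<in>{0..1}. SV n u \<omega>)) - (\<integral>\<omega>. grid_functional r g (\<lambda>i. S2 n (enum i) \<omega>) \<partial>M)\<bar>
        \<le> (\<integral>\<omega>. L * enn2real (W n \<omega>) \<partial>M)"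
    proof (rule outer_expectation_approx)
      show "integrable M (\<lambda>\<omega>. grid_functional r g (\<lambda>i. S2 n (enum i) \<omega>))"
        by (rule M.integrable_const_bound[of _ B]) (auto simp: grid_functional_bound[OF B] grid_functional_meas[OF g])
      show "integrable M (\<lambda>\<omega>. L * enn2real (W n \<omega>))" using W1 by simp
      fix \<omega>
      have b2: "(\<lambda>u\<in>{0..1}. SV n (dyadic_floor r u) \<omega>) \<in> bounded_funs {0..1}" by (rule grid_bounded_funs)
      have "\<bar>g (\<lambda>u\<in>{0..1}. SV n u \<omega>) - g (\<lambda>u\<in>{0..1}. SV n (dyadic_floor r u) \<omega>)\<bar>
          \<le> L * sup_dist {0..1} (\<lambda>u\<in>{0..1}. SV n u \<omega>) (\<lambda>u\<in>{0..1}. SV n (dyadic_floor r u) \<omega>)"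
        by (rule L(1)[rule_format, OF SV_bounded_funs b2])
      also have "\<dots> \<le> L * enn2real (W n \<omega>)"
      proof (intro mult_left_mono L(2) sup_dist_le[OF cube_ne SV_bounded_funs b2])
        fix u :: "real ^ 'm" assume u: "u \<in> {0..1}"
        have "ennreal (norm (SV n u \<omega> - SV n (dyadic_floor r u) \<omega>)) \<le> W n \<omega>"
          unfolding W_def by (rule oscillation_bound[OF r1 r(1) u])
        then have "enn2real (ennreal (norm (SV n u \<omega> - SV n (dyadic_floor r u) \<omega>))) \<le> enn2real (W n \<omega>)"
          using W_fin by (rule enn2real_mono)
        then show "dist ((\<lambda>u\<in>{0..1}. SV n u \<omega>) u) ((\<lambda>u\<in>{0..1}. SV n (dyadic_floor r u) \<omega>) u) \<le> enn2real (W n \<omega>)"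
          using u by (simp add: dist_norm)
      qed
      finally show "\<bar>g (\<lambda>u\<in>{0..1}. SV n u \<omega>) - grid_functional r g (\<lambda>i. S2 n (enum i) \<omega>)\<bar> \<le> L * enn2real (W n \<omega>)"
        unfolding grid_functional_S .
    qed
    also have "\<dots> \<le> L * e" using W1(2) L(2) by (simp add: mult_left_mono)
    finally show ?thesis .
  qed
  obtain m where m: "\<forall>x. grid_functional r g x = grid_functional r g (\<lambda>i. if i < m then x i else 0)"
    using grid_functional_dep by blast
  have "(\<lambda>n. \<integral>\<omega>. grid_functional r g (\<lambda>i. S2 n (enum i) \<omega>) \<partial>M) \<longlonglongrightarrow> (\<integral>\<omega>. grid_functional r g (\<lambda>i. V i \<omega>) \<partial>N)"
    by (rule fidi_convergence[OF grid_functional_continuous[OF g] grid_functional_bound[OF B] m[rule_format]])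
  then have "\<exists>n2. \<forall>n\<ge>n2. norm ((\<integral>\<omega>. grid_functional r g (\<lambda>i. S2 n (enum i) \<omega>) \<partial>M) - (\<integral>\<omega>. grid_functional r g (\<lambda>i. V i \<omega>) \<partial>N)) < \<epsilon> / 3"
    by (rule LIMSEQ_D) (use \<epsilon> in simp)
  then obtain n2 where n2: "\<And>n. n \<ge> n2 \<Longrightarrow> \<bar>(\<integral>\<omega>. grid_functional r g (\<lambda>i. S2 n (enum i) \<omega>) \<partial>M) - (\<integral>\<omega>. grid_functional r g (\<lambda>i. V i \<omega>) \<partial>N)\<bar> < \<epsilon> / 3"
    by auto
  show "\<exists>no. \<forall>n\<ge>no. norm (outer_expectation M (\<lambda>\<omega>. g (\<lambda>u\<in>{0..1}. SV n u \<omega>)) - (\<integral>\<omega>. g (\<lambda>u\<in>{0..1}. Q u \<omega>) \<partial>completion N)) < \<epsilon>"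
  proof (intro exI[of _ "max n1 n2"] allI impI)
    fix n assume "max n1 n2 \<le> n"
    then show "norm (outer_expectation M (\<lambda>\<omega>. g (\<lambda>u\<in>{0..1}. SV n u \<omega>)) - (\<integral>\<omega>. g (\<lambda>u\<in>{0..1}. Q u \<omega>) \<partial>completion N)) < \<epsilon>"
      using osc[of n] n2[of n] r(2) e(2) unfolding real_norm_def by linarith
  qed
qed

text \<open>A Lipschitz minorant whose limit expectation nearly attains that of \<open>g\<close>. It
  yields lower bounds for \<open>g\<close>, and upper bounds when applied to
  \<open>- g\<close>.\<close>

lemma continuous_liminf:
  fixes g :: "(real ^ 'm \<Rightarrow> real ^ 'n) \<Rightarrow> real"
  assumes g: "sup_continuous {0..1} g" and B: "\<forall>x\<in>bounded_funs {0..1}. \<bar>g x\<bar> \<le> B" and \<epsilon>: "0 < \<epsilon>"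
  shows "\<exists>G. (\<forall>x\<in>bounded_funs {0..1}. \<bar>G x\<bar> \<le> B \<and> G x \<le> g x) \<and>
    (\<integral>\<omega>. g (\<lambda>u\<in>{0..1}. Q u \<omega>) \<partial>completion N) - \<epsilon> < (\<integral>\<omega>. G (\<lambda>u\<in>{0..1}. Q u \<omega>) \<partial>completion N) \<and>
    (\<exists>L\<ge>0. \<forall>x\<in>bounded_funs {0..1}. \<forall>y\<in>bounded_funs {0..1}. \<bar>G x - G y\<bar> \<le> L * sup_dist {0..1} x y)"
proof -
  interpret C: prob_space "completion N" by (rule prob_space_completion_N)
  obtain G where G: "\<And>j x. x \<in> bounded_funs {0..1} \<Longrightarrow> \<bar>G j x\<bar> \<le> B" "\<And>j x. x \<in> bounded_funs {0..1} \<Longrightarrow> G j x \<le> g x"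
    "\<And>j x y. x \<in> bounded_funs {0..1} \<Longrightarrow> y \<in> bounded_funs {0..1} \<Longrightarrow> \<bar>G j x - G j y\<bar> \<le> real j * sup_dist {0..1} x y"
    "\<And>x. x \<in> bounded_funs {0..1} \<Longrightarrow> (\<lambda>j. G j x) \<longlonglongrightarrow> g x"
  proof (rule lipschitz_approximation[OF cube_ne g, of B])
    show "\<bar>g x\<bar> \<le> B" if "x \<in> bounded_funs {0..1}" for x using B that by blast
  qed (rule that)
  have AE: "AE \<omega> in completion N. (\<lambda>u\<in>{0..1}. Q u \<omega>) \<in> bounded_funs {0..1}" by (rule AE_completion[OF AE_Q_bounded])
  have "(\<lambda>j. \<integral>\<omega>. G j (\<lambda>u\<in>{0..1}. Q u \<omega>) \<partial>completion N) \<longlonglongrightarrow> (\<integral>\<omega>. g (\<lambda>u\<in>{0..1}. Q u \<omega>) \<partial>completion N)"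
  proof (rule integral_dominated_convergence[where w = "\<lambda>_. B"])
    show "(\<lambda>\<omega>. G j (\<lambda>u\<in>{0..1}. Q u \<omega>)) \<in> borel_measurable (completion N)" for j
      by (rule gQ_measurable, rule sup_continuous_lipschitz[where L = "real j"]) (auto intro: G(3))
    show "AE \<omega> in completion N. (\<lambda>j. G j (\<lambda>u\<in>{0..1}. Q u \<omega>)) \<longlonglongrightarrow> g (\<lambda>u\<in>{0..1}. Q u \<omega>)"
      using AE by eventually_elim (rule G(4))
    show "AE \<omega> in completion N. norm (G j (\<lambda>u\<in>{0..1}. Q u \<omega>)) \<le> B" for j
      using AE by eventually_elim (simp add: G(1))
  qed (auto intro: gQ_measurable[OF g])
  then have "\<forall>\<^sub>F j in sequentially. (\<integral>\<omega>. g (\<lambda>u\<in>{0..1}. Q u \<omega>) \<partial>completion N) - \<epsilon> < (\<integral>\<omega>. G j (\<lambda>u\<in>{0..1}. Q u \<omega>) \<partial>completion N)"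
    by (rule order_tendstoD) (use \<epsilon> in simp)
  then obtain j where j: "(\<integral>\<omega>. g (\<lambda>u\<in>{0..1}. Q u \<omega>) \<partial>completion N) - \<epsilon> < (\<integral>\<omega>. G j (\<lambda>u\<in>{0..1}. Q u \<omega>) \<partial>completion N)"
    using eventually_happens by force
  show ?thesis
    by (rule exI[of _ "G j"], intro conjI ballI j exI[of _ "real j"] G) auto
qed

text \<open>Monotonicity of the outer expectation gives both halves from Lipschitz functionals.
  Outer expectation does not commute with negation; for the upper half the limit theorem is
  therefore applied to the Lipschitz majorant \<open>- G\<close> itself.\<close>

lemma continuous_convergence:
  fixes g :: "(real ^ 'm \<Rightarrow> real ^ 'n) \<Rightarrow> real"
  assumes g: "sup_continuous {0..1} g" and B: "\<forall>x\<in>bounded_funs {0..1}. \<bar>g x\<bar> \<le> B"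
  shows "(\<lambda>n. outer_expectation M (\<lambda>\<omega>. g (\<lambda>u\<in>{0..1}. SV n u \<omega>))) \<longlonglongrightarrow> (\<integral>\<omega>. g (\<lambda>u\<in>{0..1}. Q u \<omega>) \<partial>completion N)"
proof (rule order_tendstoI)
  fix a assume a: "a < (\<integral>\<omega>. g (\<lambda>u\<in>{0..1}. Q u \<omega>) \<partial>completion N)"
  define \<epsilon> where "\<epsilon> = (\<integral>\<omega>. g (\<lambda>u\<in>{0..1}. Q u \<omega>) \<partial>completion N) - a"
  have "0 < \<epsilon>" using a by (simp add: \<epsilon>_def)
  from continuous_liminf[OF g B this] obtain G L where G: "\<forall>x\<in>bounded_funs {0..1}. \<bar>G x\<bar> \<le> B" "\<forall>x\<in>bounded_funs {0..1}. G x \<le> g x"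
    "a < (\<integral>\<omega>. G (\<lambda>u\<in>{0..1}. Q u \<omega>) \<partial>completion N)" "0 \<le> L"
    "\<forall>x\<in>bounded_funs {0..1}. \<forall>y\<in>bounded_funs {0..1}. \<bar>G x - G y\<bar> \<le> L * sup_dist {0..1} x y"
    unfolding \<epsilon>_def by auto
  have "(\<lambda>n. outer_expectation M (\<lambda>\<omega>. G (\<lambda>u\<in>{0..1}. SV n u \<omega>))) \<longlonglongrightarrow> (\<integral>\<omega>. G (\<lambda>u\<in>{0..1}. Q u \<omega>) \<partial>completion N)"
    by (rule lipschitz_convergence[OF G(1) G(5) G(4)])
  then have "\<forall>\<^sub>F n in sequentially. a < outer_expectation M (\<lambda>\<omega>. G (\<lambda>u\<in>{0..1}. SV n u \<omega>))"
    using G(3) by (rule order_tendstoD)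
  then show "\<forall>\<^sub>F n in sequentially. a < outer_expectation M (\<lambda>\<omega>. g (\<lambda>u\<in>{0..1}. SV n u \<omega>))"
  proof eventually_elim
    fix n assume n: "a < outer_expectation M (\<lambda>\<omega>. G (\<lambda>u\<in>{0..1}. SV n u \<omega>))"
    have "outer_expectation M (\<lambda>\<omega>. G (\<lambda>u\<in>{0..1}. SV n u \<omega>)) \<le> outer_expectation M (\<lambda>\<omega>. g (\<lambda>u\<in>{0..1}. SV n u \<omega>))"
      by (rule outer_expectation_mono[OF M.prob_space_axioms, where B = B]) (use G(1,2) B SV_bounded_funs in blast)+
    with n show "a < outer_expectation M (\<lambda>\<omega>. g (\<lambda>u\<in>{0..1}. SV n u \<omega>))" by (rule less_le_trans)
  qed
next
  fix a assume a: "(\<integral>\<omega>. g (\<lambda>u\<in>{0..1}. Q u \<omega>) \<partial>completion N) < a"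
  define \<epsilon> where "\<epsilon> = a - (\<integral>\<omega>. g (\<lambda>u\<in>{0..1}. Q u \<omega>) \<partial>completion N)"
  have \<epsilon>: "0 < \<epsilon>" using a by (simp add: \<epsilon>_def)
  have neg: "sup_continuous {0..1} (\<lambda>x. - g x)"
    using g unfolding sup_continuous_def by (simp add: abs_minus_commute)
  have negB: "\<forall>x\<in>bounded_funs {0..1}. \<bar>- g x\<bar> \<le> B" using B by simp
  from continuous_liminf[OF neg negB \<epsilon>] obtain G L where G: "\<forall>x\<in>bounded_funs {0..1}. \<bar>G x\<bar> \<le> B" "\<forall>x\<in>bounded_funs {0..1}. G x \<le> - g x"
    "- a < (\<integral>\<omega>. G (\<lambda>u\<in>{0..1}. Q u \<omega>) \<partial>completion N)" "0 \<le> L"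
    "\<forall>x\<in>bounded_funs {0..1}. \<forall>y\<in>bounded_funs {0..1}. \<bar>G x - G y\<bar> \<le> L * sup_dist {0..1} x y"
    unfolding \<epsilon>_def by auto
  have "(\<lambda>n. outer_expectation M (\<lambda>\<omega>. - G (\<lambda>u\<in>{0..1}. SV n u \<omega>))) \<longlonglongrightarrow> (\<integral>\<omega>. - G (\<lambda>u\<in>{0..1}. Q u \<omega>) \<partial>completion N)"
    by (rule lipschitz_convergence[where g = "\<lambda>x. - G x" and B = B and L = L])
      (use G in \<open>auto simp: abs_minus_commute\<close>)
  then have "\<forall>\<^sub>F n in sequentially. outer_expectation M (\<lambda>\<omega>. - G (\<lambda>u\<in>{0..1}. SV n u \<omega>)) < a"
    by (rule order_tendstoD) (use G(3) in simp)
  then show "\<forall>\<^sub>F n in sequentially. outer_expectation M (\<lambda>\<omega>. g (\<lambda>u\<in>{0..1}. SV n u \<omega>)) < a"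
  proof eventually_elim
    fix n assume n: "outer_expectation M (\<lambda>\<omega>. - G (\<lambda>u\<in>{0..1}. SV n u \<omega>)) < a"
    have "outer_expectation M (\<lambda>\<omega>. g (\<lambda>u\<in>{0..1}. SV n u \<omega>)) \<le> outer_expectation M (\<lambda>\<omega>. - G (\<lambda>u\<in>{0..1}. SV n u \<omega>))"
    proof (rule outer_expectation_mono[OF M.prob_space_axioms, where B = B])
      fix \<omega>
      show "g (\<lambda>u\<in>{0..1}. SV n u \<omega>) \<le> - G (\<lambda>u\<in>{0..1}. SV n u \<omega>)" using G(2)[rule_format, OF SV_bounded_funs, of n \<omega>] by linarith
    qed (use G(1) B SV_bounded_funs in \<open>simp, blast?\<close>)+
    then show "outer_expectation M (\<lambda>\<omega>. g (\<lambda>u\<in>{0..1}. SV n u \<omega>)) < a" using n by (rule le_less_trans)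
  qed
qed

lemma weakly_converges: "weakly_converges_sup {0..1} M SV N Q"
  unfolding weakly_converges_sup_def
proof (intro conjI allI ballI impI AE_Q_bounded SV_bounded_funs)
  fix g :: "(real ^ 'm \<Rightarrow> real ^ 'n) \<Rightarrow> real"
  assume g: "continuous_map (sup_topology {0..1}) euclideanreal g \<and> bounded (g ` bounded_funs {0..1})"
  then have sc: "sup_continuous {0..1} g" by (intro sup_continuous_of_continuous_map cube_ne) auto
  obtain B where B: "\<forall>x\<in>bounded_funs {0..1}. \<bar>g x\<bar> \<le> B"
    using g unfolding bounded_iff by auto
  show "(\<lambda>\<omega>. g (\<lambda>u\<in>{0..1}. Q u \<omega>)) \<in> borel_measurable (completion N)" by (rule gQ_measurable[OF sc])
  show "(\<lambda>n. outer_expectation M (\<lambda>\<omega>. g (\<lambda>u\<in>{0..1}. SV n u \<omega>))) \<longlonglongrightarrow> (LINT \<omega>|completion N. g (\<lambda>u\<in>{0..1}. Q u \<omega>))"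
    by (rule continuous_convergence[OF sc B])
qed

end

subsection \<open>Copula densities and conditional expectations\<close>

text \<open>The measure in \<open>is_copula\<close> is tied to \<open>X\<close> only through lower
  boxes with corner in the cube. These determine the marginal distribution functions, and measures
  on the line are determined by those.\<close>

lemma copula_marginal:
  fixes X :: "'a \<Rightarrow> real ^ 'm"
  assumes M: "prob_space M" and X: "X \<in> borel_measurable M" and cube: "\<And>\<omega>. \<omega> \<in> space M \<Longrightarrow> X \<omega> \<in> {0..1}"
    and copula: "is_copula (joint_cdf M X)"
  shows "distr M borel (\<lambda>\<omega>. X \<omega> $ i) = uniform_measure lborel {0..1}"
proof -
  interpret M: prob_space M by (rule M)
  obtain \<mu> :: "(real ^ 'm) measure" where mu: "prob_space \<mu>" "sets \<mu> = sets borel" "measure \<mu> {0..1} = 1"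
    "\<And>u. u \<in> {0..1} \<Longrightarrow> joint_cdf M X u = measure \<mu> {v. v \<le> u}"
    "\<And>i. distr \<mu> borel (\<lambda>v. v $ i) = uniform_measure lborel {0..1}"
    using copula unfolding is_copula_def by blast
  interpret \<mu>: prob_space \<mu> by (rule mu(1))
  have sp: "space \<mu> = UNIV" using mu(2) by (simp add: sets_eq_imp_space_eq)
  have nth[measurable]: "(\<lambda>v. v $ i) \<in> borel_measurable \<mu>" "(\<lambda>v :: real ^ 'm. v $ i) \<in> borel_measurable borel"
    unfolding measurable_cong_sets[OF mu(2) refl] by measurable
  have AE: "AE v in \<mu>. v \<in> {0..1}"
    using mu(3) by (subst \<mu>.AE_in_set_eq_1) (auto simp: mu(2))
  have Xi: "(\<lambda>\<omega>. X \<omega> $ i) \<in> borel_measurable M" using measurable_compose[OF X nth(2)] .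
  have "cdf (distr M borel (\<lambda>\<omega>. X \<omega> $ i)) t = cdf (distr \<mu> borel (\<lambda>v. v $ i)) t" for t
  proof -
    have L: "cdf (distr M borel (\<lambda>\<omega>. X \<omega> $ i)) t = measure M {\<omega> \<in> space M. X \<omega> $ i \<le> t}"
      unfolding cdf_def using Xi by (subst measure_distr) (auto intro!: arg_cong[where f = "measure M"])
    have R: "cdf (distr \<mu> borel (\<lambda>v. v $ i)) t = measure \<mu> {v. v $ i \<le> t}"
      unfolding cdf_def by (subst measure_distr) (auto intro!: arg_cong[where f = "measure \<mu>"] simp: sp)
    show ?thesis
    proof (cases "0 \<le> t")
      case True
      \<comment> \<open>With all other coordinates equal to 1, membership in the box constrains only
        coordinate \<open>i\<close>; the minimum keeps the corner in the cube.\<close>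
      define u :: "real ^ 'm" where "u = (\<chi> j. if j = i then min t 1 else 1)"
      have u: "u \<in> {0..1}" unfolding in_cube_iff using True by (simp add: u_def)
      have iff: "v \<le> u \<longleftrightarrow> v $ i \<le> t" if "v \<in> {0..1}" for v :: "real ^ 'm"
        using that unfolding in_cube_iff by (auto simp: less_eq_vec_def u_def)
      have "measure M {\<omega> \<in> space M. X \<omega> $ i \<le> t} = joint_cdf M X u"
        unfolding joint_cdf_def using iff[OF cube] by (intro arg_cong[where f = "measure M"]) auto
      also have "\<dots> = measure \<mu> {v. v \<le> u}" by (rule mu(4)[OF u])
      also have "\<dots> = measure \<mu> {v. v $ i \<le> t}"
      proof (rule measure_eq_AE)
        show "AE v in \<mu>. (v \<in> {v. v \<le> u}) = (v \<in> {v. v $ i \<le> t})"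
          using AE by eventually_elim (use iff in auto)
        have "{v. v \<le> u} = {..u}" by auto
        then show "{v. v \<le> u} \<in> sets \<mu>" unfolding mu(2) by simp
        have "{v \<in> space \<mu>. v $ i \<le> t} \<in> sets \<mu>" by measurable
        then show "{v. v $ i \<le> t} \<in> sets \<mu>" by (simp add: sp)
      qed
      finally show ?thesis unfolding L R .
    next
      case False
      have "{\<omega> \<in> space M. X \<omega> $ i \<le> t} = {}"
        using cube False order_trans[of 0 _ t] unfolding in_cube_iff by fastforce
      then have L0: "measure M {\<omega> \<in> space M. X \<omega> $ i \<le> t} = 0" by (simp only: measure_empty)
      have "\<mu>.prob {v \<in> space \<mu>. v $ i \<le> t} = 0"
      proof (rule \<mu>.prob_eq_0_AE)
        show "AE v in \<mu>. \<not> v $ i \<le> t"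
          using AE proof eventually_elim
          case (elim v)
          then have "0 \<le> v $ i" unfolding in_cube_iff by simp
          then show ?case using False by linarith
        qed
      qed
      then show ?thesis unfolding L R L0 by (simp add: sp)
    qed
  qed
  then have "cdf (distr M borel (\<lambda>\<omega>. X \<omega> $ i)) = cdf (distr \<mu> borel (\<lambda>v. v $ i))" by (rule ext)
  then have "distr M borel (\<lambda>\<omega>. X \<omega> $ i) = distr \<mu> borel (\<lambda>v. v $ i)"
    by (intro cdf_unique M.real_distribution_distr \<mu>.real_distribution_distr Xi nth(1))
  then show ?thesis by (simp only: mu(5))
qed

text \<open>The density identity is given for boxes in the cube, and lower orthants form a generator
  closed under intersection. The indicator removes the values of \<open>c\<close> outside the cube,
  about which nothing is assumed.\<close>

lemma distr_eq_density_of_copula_density: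
  fixes X :: "'a \<Rightarrow> real ^ 'm"
  assumes M: "prob_space M" and X: "X \<in> borel_measurable M" and cube: "\<And>\<omega>. \<omega> \<in> space M \<Longrightarrow> X \<omega> \<in> {0..1}"
    and dens: "has_copula_density (joint_cdf M X) c"
  shows "distr M borel X = density lborel (\<lambda>v. ennreal (indicator {0..1} v * c v))" (is "?L = ?R")
proof -
  interpret M: prob_space M by (rule M)
  note c = dens[unfolded has_copula_density_def]
  have c_meas[measurable]: "c \<in> borel_measurable borel" using c by blast
  have one: "(1 :: real ^ 'm) \<in> {0..1}" unfolding in_cube_iff by simp
  \<comment> \<open>Integrability is hidden in the density identity: a non-integrable function has
    integral 0 by default, but the distribution function is 1 at the upper corner.\<close>
  have int: "integrable lborel (\<lambda>v. indicator {0..1} v * c v)"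
  proof (rule ccontr)
    assume "\<not> ?thesis"
    then have "(LINT v:{0..1}|lborel. c v) = 0"
      unfolding set_lebesgue_integral_def by (simp add: not_integrable_integral_eq)
    moreover have "joint_cdf M X 1 = (LINT v:{0..1}|lborel. c v)" using c one by blast
    moreover have "joint_cdf M X 1 = 1"
    proof -
      have "{\<omega> \<in> space M. X \<omega> \<le> 1} = space M" using cube by auto
      then show ?thesis unfolding joint_cdf_def by (simp only: M.prob_space)
    qed
    ultimately show False by simp
  qed
  have eq: "emeasure ?L {..a} = emeasure ?R {..a}" for a :: "real ^ 'm"
  proof -
    have L: "emeasure ?L {..a} = emeasure M {\<omega> \<in> space M. X \<omega> \<le> a}"
      using X by (subst emeasure_distr) (auto intro!: arg_cong[where f = "emeasure M"])
    have R: "emeasure ?R {..a} = (\<integral>\<^sup>+v. ennreal (indicator {0..1} v * c v) * indicator {..a} v \<partial>lborel)"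
      by (rule emeasure_density) measurable
    show ?thesis
    proof (cases "0 \<le> a")
      case True
      \<comment> \<open>Cutting the corner back to the cube changes neither side, because all mass
        lies in the cube.\<close>
      define u where "u = vmin a 1"
      have u: "u \<in> {0..1}" unfolding in_cube_iff using True by (simp add: u_def vmin_def less_eq_vec_def)
      have iff: "v \<le> u \<longleftrightarrow> v \<le> a \<and> v \<le> 1" for v
        by (auto simp: u_def vmin_def less_eq_vec_def)
      have "emeasure M {\<omega> \<in> space M. X \<omega> \<le> a} = ennreal (joint_cdf M X u)"
        unfolding joint_cdf_def M.emeasure_eq_measure
        by (intro arg_cong[where f = "\<lambda>A. ennreal (measure M A)"]) (use iff cube in auto)
      also have "joint_cdf M X u = (\<integral>v. indicator {0..u} v * c v \<partial>lborel)"
        using c u unfolding set_lebesgue_integral_def by simp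
      also have "(\<lambda>v. indicator {0..u} v * c v) = (\<lambda>v. indicator {..a} v * (indicator {0..1} v * c v))"
        using iff by (auto simp: indicator_def)
      also have "ennreal (\<integral>v. indicator {..a} v * (indicator {0..1} v * c v) \<partial>lborel)
        = (\<integral>\<^sup>+v. ennreal (indicator {..a} v * (indicator {0..1} v * c v)) \<partial>lborel)"
      proof (rule nn_integral_eq_integral[symmetric])
        show "integrable lborel (\<lambda>v. indicator {..a} v * (indicator {0..1} v * c v))"
          using integrable_mult_indicator[OF _ int, of "{..a}"] by simp
      qed (use c in \<open>auto simp: indicator_def\<close>)
      also have "\<dots> = (\<integral>\<^sup>+v. ennreal (indicator {0..1} v * c v) * indicator {..a} v \<partial>lborel)"
        by (intro nn_integral_cong) (auto simp: indicator_def)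
      finally show ?thesis unfolding L R .
    next
      case False
      have "{\<omega> \<in> space M. X \<omega> \<le> a} = {}"
        using cube False order_trans[of 0 _ a] by fastforce
      then have "emeasure M {\<omega> \<in> space M. X \<omega> \<le> a} = 0" by (simp only: emeasure_empty)
      moreover have "(\<integral>\<^sup>+v. ennreal (indicator {0..1} v * c v) * indicator {..a} v \<partial>lborel) = (\<integral>\<^sup>+v. 0 \<partial>(lborel :: (real ^ 'm) measure))"
        proof (rule nn_integral_cong)
        fix v :: "real ^ 'm"
        show "ennreal (indicator {0..1} v * c v) * indicator {..a} v = 0"
          using False order_trans[of 0 v a] by (auto simp: indicator_def)
      qed
      ultimately show ?thesis unfolding L R by simp
    qed
  qed
  show ?thesis
  proof (rule measure_eqI_generator_eq[where E = "range atMost" and \<Omega> = UNIV and A = "\<lambda>n. {..(\<chi> i. real n)}"])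
    show "Int_stable (range (atMost :: real ^ 'm \<Rightarrow> _))"
    proof (clarsimp simp: Int_stable_def)
      fix a b :: "real ^ 'm"
      have "{..a} \<inter> {..b} = {..vmin a b}" by (auto simp: vmin_def less_eq_vec_def)
      then show "{..a} \<inter> {..b} \<in> range atMost" by simp
    qed
    show "sets ?L = sigma_sets UNIV (range atMost)" "sets ?R = sigma_sets UNIV (range atMost)"
      by (simp_all add: borel_eq_atMost)
    show "(\<Union>n. {..(\<chi> i. real n)}) = (UNIV :: (real ^ 'm) set)"
    proof (intro set_eqI iffI UNIV_I)
      fix v :: "real ^ 'm"
      obtain n where n: "norm v \<le> real n" using real_arch_simple by blast
      have "v $ i \<le> real n" for i
        using component_le_norm_cart[of v i] n by linarith
      then show "v \<in> (\<Union>n. {..(\<chi> i. real n)})" by (auto simp: less_eq_vec_def)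
    qed
    show "emeasure ?L {..(\<chi> i. real n)} \<noteq> \<infinity>" for n
      using prob_space.prob_space_distr[OF M X] by (simp add: finite_measure.emeasure_eq_measure prob_space_def)
  qed (use eq in auto)
qed

text \<open>Integrals over boxes against the density become expectations of functions of
  \<open>X\<close>, where conditional expectations can be removed.\<close>

lemma integral_on_box:
  fixes X :: "'a \<Rightarrow> real ^ 'm" and g :: "real ^ 'm \<Rightarrow> real"
  assumes M: "prob_space M" and X[measurable]: "X \<in> borel_measurable M" and cube: "\<And>\<omega>. \<omega> \<in> space M \<Longrightarrow> X \<omega> \<in> {0..1}"
    and dens: "has_copula_density (joint_cdf M X) c"
    and g[measurable]: "g \<in> borel_measurable borel" and u: "u \<in> {0..1}"
  shows "(LINT v:{0..u}|lborel. c v * g v) = (\<integral>\<omega>. indicator {x. x \<le> u} (X \<omega>) * g (X \<omega>) \<partial>M)"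
    and "integrable M (\<lambda>\<omega>. g (X \<omega>)) \<Longrightarrow> set_integrable lborel {0..u} (\<lambda>v. c v * g v)"
proof -
  note c = dens[unfolded has_copula_density_def]
  have c_meas[measurable]: "c \<in> borel_measurable borel" using c by blast
  have "{..u} \<in> sets borel" by simp
  then have [measurable]: "{x. x \<le> u} \<in> sets borel" unfolding atMost_def .
  have nn: "0 \<le> indicator {0..1} v * c v" for v using c by (auto simp: indicator_def)
  have D: "distr M borel X = density lborel (\<lambda>v. ennreal (indicator {0..1} v * c v))"
    using M X cube dens by (rule distr_eq_density_of_copula_density)
  have [measurable]: "(\<lambda>x. indicator {x. x \<le> u} x * g x) \<in> borel_measurable borel" by measurable
  have eq: "indicator {0..1} v * c v * (indicator {x. x \<le> u} v * g v) = indicator {0..u} v * (c v * g v)" for v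
    using u order_trans[of v u 1] by (auto simp: indicator_def)
  let ?f = "\<lambda>x. indicator {x. x \<le> u} x * g x"
  have f: "?f \<in> borel_measurable (borel :: (real ^ 'm) measure)" by measurable
  have nn': "AE v in lborel. 0 \<le> indicator {0..1} v * c v" using nn by simp
  have "(\<integral>\<omega>. indicator {x. x \<le> u} (X \<omega>) * g (X \<omega>) \<partial>M) = (\<integral>x. indicator {x. x \<le> u} x * g x \<partial>distr M borel X)"
    by (subst integral_distr) measurable
  also have "\<dots> = (\<integral>v. indicator {0..1} v * c v * (indicator {x. x \<le> u} v * g v) \<partial>lborel)"
    unfolding D using integral_density[OF _ _ nn', of ?f] f by simp
  also have "\<dots> = (LINT v:{0..u}|lborel. c v * g v)"
    unfolding eq set_lebesgue_integral_def by simp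
  finally show "(LINT v:{0..u}|lborel. c v * g v) = (\<integral>\<omega>. indicator {x. x \<le> u} (X \<omega>) * g (X \<omega>) \<partial>M)" by (rule sym)
  assume I: "integrable M (\<lambda>\<omega>. g (X \<omega>))"
  have J: "integrable M (\<lambda>\<omega>. indicator {x. x \<le> u} (X \<omega>) * g (X \<omega>))"
    by (rule Bochner_Integration.integrable_bound[OF I]) (auto simp: indicator_def)
  have "integrable (distr M borel X) (\<lambda>x. indicator {x. x \<le> u} x * g x)"
    using J by (subst integrable_distr_eq) auto
  then have "integrable lborel (\<lambda>v. indicator {0..1} v * c v * (indicator {x. x \<le> u} v * g v))"
    unfolding D using integrable_density[OF _ _ nn', of ?f] f by simp
  then show "set_integrable lborel {0..u} (\<lambda>v. c v * g v)"
    unfolding eq set_integrable_def by simp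
qed

text \<open>The defining property of conditional expectation, tested against functions of
  \<open>X\<close>, which are exactly measurable for the algebra generated by
  \<open>X\<close>.\<close>

lemma cond_exp_version_integral:
  fixes X :: "'a \<Rightarrow> real ^ 'm" and f :: "real ^ 'm \<Rightarrow> real"
  assumes M: "prob_space M" and X[measurable]: "X \<in> borel_measurable M"
    and v: "cond_exp_version M X Z h" and Z: "integrable M Z"
    and f[measurable]: "f \<in> borel_measurable borel" and fZ: "integrable M (\<lambda>\<omega>. f (X \<omega>) * Z \<omega>)"
  shows "integrable M (\<lambda>\<omega>. f (X \<omega>) * h (X \<omega>))" "(\<integral>\<omega>. f (X \<omega>) * h (X \<omega>) \<partial>M) = (\<integral>\<omega>. f (X \<omega>) * Z \<omega> \<partial>M)"
proof -
  interpret M: prob_space M by (rule M)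
  let ?F = "vimage_algebra (space M) X borel"
  have sub: "subalgebra M ?F"
    unfolding subalgebra_def sets_vimage_algebra using measurable_sets[OF X]
    by (auto intro!: sets.sigma_sets_subset)
  interpret sigma_finite_subalgebra M ?F
    by (intro finite_measure_subalgebra_is_sigma_finite finite_measure_subalgebra.intro
      finite_measure_subalgebra_axioms.intro M.finite_measure_axioms sub)
  have h[measurable]: "h \<in> borel_measurable borel" and AE: "AE \<omega> in M. real_cond_exp M ?F Z \<omega> = h (X \<omega>)"
    using v unfolding cond_exp_version_def by auto
  have fX: "(\<lambda>\<omega>. f (X \<omega>)) \<in> borel_measurable ?F"
    by (rule measurable_compose[OF measurable_vimage_algebra1 f]) simp
  have Zm: "Z \<in> borel_measurable M" using Z by simp
  note * = real_cond_exp_intg[OF fZ fX Zm]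
  have AE': "AE \<omega> in M. f (X \<omega>) * real_cond_exp M ?F Z \<omega> = f (X \<omega>) * h (X \<omega>)"
    using AE by eventually_elim simp
  have m: "(\<lambda>\<omega>. f (X \<omega>) * real_cond_exp M ?F Z \<omega>) \<in> borel_measurable M" using *(1) by simp
  have m': "(\<lambda>\<omega>. f (X \<omega>) * h (X \<omega>)) \<in> borel_measurable M" by measurable
  show "integrable M (\<lambda>\<omega>. f (X \<omega>) * h (X \<omega>))"
    using *(1) integrable_cong_AE[OF m m' AE'] by simp
  show "(\<integral>\<omega>. f (X \<omega>) * h (X \<omega>) \<partial>M) = (\<integral>\<omega>. f (X \<omega>) * Z \<omega> \<partial>M)"
    using *(2) integral_cong_AE[OF m m' AE'] by simp
qed

text \<open>Conditional Jensen for the square; products of components of \<open>m\<close> are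
  integrable only because of this.\<close>

lemma cond_exp_version_square_integrable:
  fixes X :: "'a \<Rightarrow> real ^ 'm"
  assumes M: "prob_space M" and X[measurable]: "X \<in> borel_measurable M"
    and v: "cond_exp_version M X Z h" and Z: "integrable M Z" "integrable M (\<lambda>\<omega>. (Z \<omega>)\<^sup>2)"
  shows "integrable M (\<lambda>\<omega>. (h (X \<omega>))\<^sup>2)"
proof -
  interpret M: prob_space M by (rule M)
  let ?F = "vimage_algebra (space M) X borel"
  have sub: "subalgebra M ?F"
    unfolding subalgebra_def sets_vimage_algebra using measurable_sets[OF X]
    by (auto intro!: sets.sigma_sets_subset)
  interpret sigma_finite_subalgebra M ?F
    by (intro finite_measure_subalgebra_is_sigma_finite finite_measure_subalgebra.intro
      finite_measure_subalgebra_axioms.intro M.finite_measure_axioms sub)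
  have h[measurable]: "h \<in> borel_measurable borel" and AE: "AE \<omega> in M. real_cond_exp M ?F Z \<omega> = h (X \<omega>)"
    using v unfolding cond_exp_version_def by auto
  have "AE \<omega> in M. (real_cond_exp M ?F Z \<omega>)\<^sup>2 = (h (X \<omega>))\<^sup>2" using AE by eventually_elim simp
  moreover have "integrable M (\<lambda>\<omega>. (real_cond_exp M ?F Z \<omega>)\<^sup>2)"
    by (rule integrable_convex_cond_exp[where X = Z and I = UNIV and q = power2])
      (use Z in \<open>auto intro: convex_power2\<close>)
  ultimately show ?thesis
    using integrable_cong_AE[of "\<lambda>\<omega>. (real_cond_exp M ?F Z \<omega>)\<^sup>2" M "\<lambda>\<omega>. (h (X \<omega>))\<^sup>2"] by simp
qed

section \<open>Componentwise integrals and the covariance formula\<close>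

lemma integrable_vec_componentwise:
  fixes f :: "'a \<Rightarrow> 'b :: euclidean_space ^ 'n"
  assumes "\<And>k. integrable M (\<lambda>x. f x $ k)"
  shows "integrable M f"
proof -
  have lin: "bounded_linear (axis k :: 'b \<Rightarrow> 'b ^ 'n)" for k
    unfolding linear_conv_bounded_linear[symmetric]
    by (rule linearI) (simp_all add: axis_def vec_eq_iff)
  have "integrable M (\<lambda>x. \<Sum>k\<in>UNIV. axis k (f x $ k) :: 'b ^ 'n)"
    by (rule Bochner_Integration.integrable_sum) (rule integrable_bounded_linear[OF lin assms])
  also have "(\<lambda>x. \<Sum>k\<in>UNIV. axis k (f x $ k)) = f"
    by (simp add: fun_eq_iff vec_eq_iff axis_def)
  finally show ?thesis .
qed

lemma integral_vec_nth:
  fixes f :: "'a \<Rightarrow> 'b :: euclidean_space ^ 'n"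
  assumes "\<And>k. integrable M (\<lambda>x. f x $ k)"
  shows "(\<integral>x. f x \<partial>M) $ k = (\<integral>x. f x $ k \<partial>M)"
  by (rule integral_bounded_linear[OF bounded_linear_vec_nth integrable_vec_componentwise[OF assms], symmetric])

lemma set_integral_vec_nth:
  fixes f :: "'a \<Rightarrow> 'b :: euclidean_space ^ 'n"
  assumes "\<And>k. set_integrable M A (\<lambda>x. f x $ k)"
  shows "set_integrable M A f" "(LINT x:A|M. f x) $ k = (LINT x:A|M. f x $ k)"
  using assms integrable_vec_componentwise[of M "\<lambda>x. indicator A x *\<^sub>R f x"]
    integral_vec_nth[of M "\<lambda>x. indicator A x *\<^sub>R f x"]
  unfolding set_integrable_def set_lebesgue_integral_def by simp_all

locale copula_sample = prob_space M for M :: "'a measure" +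
  fixes X :: "'a \<Rightarrow> real ^ 'm" and Y :: "'a \<Rightarrow> real ^ 'n" and c m \<sigma>2
  assumes X_meas[measurable]: "X \<in> borel_measurable M" and Y_meas[measurable]: "Y \<in> borel_measurable M"
    and X_cube: "\<And>\<omega>. \<omega> \<in> space M \<Longrightarrow> X \<omega> \<in> {0..1}"
    and density: "has_copula_density (joint_cdf M X) c"
    and cond_mean: "cond_mean_version M X Y m"
    and cond_cov: "cond_cov_version M X Y m \<sigma>2"
    and Y_sq: "integrable M (\<lambda>\<omega>. (norm (Y \<omega>))\<^sup>2)"
begin

lemma Y_nth_meas[measurable]: "(\<lambda>\<omega>. Y \<omega> $ k) \<in> borel_measurable M"
  by (rule measurable_compose[OF Y_meas]) (intro borel_measurable_continuous_onI continuous_intros)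

lemma Y_nth_sq: "integrable M (\<lambda>\<omega>. (Y \<omega> $ k)\<^sup>2)"
proof (rule Bochner_Integration.integrable_bound[OF Y_sq])
  show "AE \<omega> in M. norm ((Y \<omega> $ k)\<^sup>2) \<le> norm ((norm (Y \<omega>))\<^sup>2)"
    using power_mono[OF component_le_norm_cart abs_ge_zero, of _ k 2] by simp
qed measurable

lemma Y_nth_int: "integrable M (\<lambda>\<omega>. Y \<omega> $ k)"
  by (rule square_integrable_imp_integrable[OF Y_nth_meas Y_nth_sq])

lemma m_version: "cond_exp_version M X (\<lambda>\<omega>. Y \<omega> $ k) (\<lambda>u. m u $ k)"
  using cond_mean unfolding cond_mean_version_def by blast

lemma m_meas[measurable]: "(\<lambda>u. m u $ k) \<in> borel_measurable borel"
  using m_version unfolding cond_exp_version_def by blast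

lemma m_X_sq: "integrable M (\<lambda>\<omega>. (m (X \<omega>) $ k)\<^sup>2)"
  by (rule cond_exp_version_square_integrable[OF prob_space_axioms X_meas m_version Y_nth_int Y_nth_sq])

lemma m_X_int: "integrable M (\<lambda>\<omega>. m (X \<omega>) $ k)"
  by (rule square_integrable_imp_integrable[OF _ m_X_sq]) measurable

lemma atMost_meas[measurable]: "{x :: real ^ 'm. x \<le> u} \<in> sets borel"
proof -
  have "{..u} \<in> sets borel" by simp
  then show ?thesis unfolding atMost_def .
qed

lemma indicator_mult_integrable:
  fixes f :: "'a \<Rightarrow> real"
  assumes "integrable M f"
  shows "integrable M (\<lambda>\<omega>. indicator {x. x \<le> u} (X \<omega>) * f \<omega>)"
proof (rule Bochner_Integration.integrable_bound[OF assms])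
  show "(\<lambda>\<omega>. indicator {x. x \<le> u} (X \<omega>) * f \<omega>) \<in> borel_measurable M" using assms by measurable
qed (auto simp: indicator_def)

lemma set_integral_box: "g \<in> borel_measurable borel \<Longrightarrow> u \<in> {0..1} \<Longrightarrow>
    (LINT v:{0..u}|lborel. c v * g v) = (\<integral>\<omega>. indicator {x. x \<le> u} (X \<omega>) * g (X \<omega>) \<partial>M)" for g :: "real ^ 'm \<Rightarrow> real"
  by (rule integral_on_box(1)[OF prob_space_axioms X_meas X_cube density])

lemma set_integrable_box: "g \<in> borel_measurable borel \<Longrightarrow> u \<in> {0..1} \<Longrightarrow>
    integrable M (\<lambda>\<omega>. g (X \<omega>)) \<Longrightarrow> set_integrable lborel {0..u} (\<lambda>v. c v * g v)" for g :: "real ^ 'm \<Rightarrow> real"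
  by (rule integral_on_box(2)[OF prob_space_axioms X_meas X_cube density])

lemma fmean_nth:
  assumes u: "u \<in> {0..1}"
  shows "fmean c m u $ k = (\<integral>\<omega>. indicator {x. x \<le> u} (X \<omega>) * Y \<omega> $ k \<partial>M)"
proof -
  have "fmean c m u $ k = (LINT v:{0..u}|lborel. c v * m v $ k)"
    unfolding fmean_def using set_integral_vec_nth(2)[of lborel "{0..u}" "\<lambda>v. c v *\<^sub>R m v" k] set_integrable_box[OF m_meas u m_X_int] by simp
  also have "\<dots> = (\<integral>\<omega>. indicator {x. x \<le> u} (X \<omega>) * m (X \<omega>) $ k \<partial>M)"
    by (rule set_integral_box[OF m_meas u])
  also have "\<dots> = (\<integral>\<omega>. indicator {x. x \<le> u} (X \<omega>) * Y \<omega> $ k \<partial>M)"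
    by (rule cond_exp_version_integral(2)[OF prob_space_axioms X_meas m_version Y_nth_int _ indicator_mult_integrable[OF Y_nth_int]]) measurable
  finally show ?thesis .
qed

text \<open>The first two integrals recombine to the conditional second moment of \<open>Y\<close>:
  expanding the conditional covariance, both mixed terms equal the term in \<open>m\<close> alone,
  so together with the second integral everything cancels except the product of components of
  \<open>Y\<close>.\<close>

lemma Kcov_nth:
  assumes u: "u\<^sub>1 \<in> {0..1}" "u\<^sub>2 \<in> {0..1}"
  shows "Kcov c m \<sigma>2 u\<^sub>1 u\<^sub>2 $ k $ l =
    (\<integral>\<omega>. (indicator {x. x \<le> u\<^sub>1} (X \<omega>) * Y \<omega> $ k) * (indicator {x. x \<le> u\<^sub>2} (X \<omega>) * Y \<omega> $ l) \<partial>M)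
    - (\<integral>\<omega>. indicator {x. x \<le> u\<^sub>1} (X \<omega>) * Y \<omega> $ k \<partial>M) * (\<integral>\<omega>. indicator {x. x \<le> u\<^sub>2} (X \<omega>) * Y \<omega> $ l \<partial>M)"
proof -
  define w where "w = vmin u\<^sub>1 u\<^sub>2"
  have w: "w \<in> {0..1}" using u unfolding in_cube_iff by (simp add: w_def vmin_def min_le_iff_disj)
  define I where "I \<omega> = indicat_real {x. x \<le> w} (X \<omega>)" for \<omega>
  \<comment> \<open>The coordinatewise minimum enters because the intersection of two lower boxes is
    the box below it.\<close>
  have I: "indicat_real {x. x \<le> u\<^sub>1} (X \<omega>) * indicator {x. x \<le> u\<^sub>2} (X \<omega>) = I \<omega>" for \<omega>
    by (auto simp: I_def indicator_def w_def vmin_def less_eq_vec_def)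
  have YY: "integrable M (\<lambda>\<omega>. Y \<omega> $ k * Y \<omega> $ l)" for k l
    by (intro integrable_mult_of_sq Y_nth_meas Y_nth_sq)
  have mX: "(\<lambda>\<omega>. m (X \<omega>) $ k) \<in> borel_measurable M" for k by measurable
  have Ym: "integrable M (\<lambda>\<omega>. m (X \<omega>) $ k * Y \<omega> $ l)" for k l
    by (intro integrable_mult_of_sq Y_nth_meas Y_nth_sq mX m_X_sq)
  have mm: "integrable M (\<lambda>\<omega>. m (X \<omega>) $ k * m (X \<omega>) $ l)" for k l
    by (intro integrable_mult_of_sq mX m_X_sq)
  define R where "R k l \<omega> = outer (Y \<omega> - m (X \<omega>)) (Y \<omega> - m (X \<omega>)) $ k $ l" for k l \<omega>
  have R: "R k l \<omega> = Y \<omega> $ k * Y \<omega> $ l - m (X \<omega>) $ l * Y \<omega> $ k - m (X \<omega>) $ k * Y \<omega> $ l + m (X \<omega>) $ k * m (X \<omega>) $ l" for k l \<omega>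
    by (simp add: R_def outer_def algebra_simps)
  have R_int: "integrable M (R k l)" for k l
    unfolding R by (intro Bochner_Integration.integrable_add Bochner_Integration.integrable_diff YY Ym mm)
  have sv: "cond_exp_version M X (R k l) (\<lambda>u. \<sigma>2 u $ k $ l)" for k l
    using cond_cov unfolding cond_cov_version_def R_def by blast
  have s_meas[measurable]: "(\<lambda>u. \<sigma>2 u $ k $ l) \<in> borel_measurable borel" for k l
    using sv unfolding cond_exp_version_def by blast
  have s_int: "integrable M (\<lambda>\<omega>. \<sigma>2 (X \<omega>) $ k $ l)" for k l
    using cond_exp_version_integral(1)[OF prob_space_axioms X_meas sv R_int, of "\<lambda>_. 1" k l] R_int[of k l] by simp
  have mm_meas: "(\<lambda>u. m u $ k * m u $ l) \<in> borel_measurable borel" for k l by measurable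
  have A: "(LINT v:{0..w}|lborel. c v *\<^sub>R \<sigma>2 v) $ k $ l = (\<integral>\<omega>. I \<omega> * R k l \<omega> \<partial>M)"
  proof -
    have i: "set_integrable lborel {0..w} (\<lambda>v. c v * \<sigma>2 v $ k $ l)" for k l by (rule set_integrable_box[OF s_meas w s_int])
    have i': "set_integrable lborel {0..w} (\<lambda>v. (c v *\<^sub>R \<sigma>2 v) $ k)" for k
      by (rule set_integral_vec_nth(1)) (use i in simp)
    have "(LINT v:{0..w}|lborel. c v *\<^sub>R \<sigma>2 v) $ k $ l = (LINT v:{0..w}|lborel. (c v *\<^sub>R \<sigma>2 v) $ k) $ l"
      by (simp only: set_integral_vec_nth(2)[OF i'])
    also have "\<dots> = (LINT v:{0..w}|lborel. (c v *\<^sub>R \<sigma>2 v) $ k $ l)"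
      by (rule set_integral_vec_nth(2)) (use i in simp)
    also have "\<dots> = (LINT v:{0..w}|lborel. c v * \<sigma>2 v $ k $ l)" by simp
    also have "\<dots> = (\<integral>\<omega>. I \<omega> * \<sigma>2 (X \<omega>) $ k $ l \<partial>M)" unfolding I_def by (rule set_integral_box[OF s_meas w])
    also have "\<dots> = (\<integral>\<omega>. I \<omega> * R k l \<omega> \<partial>M)" unfolding I_def
      by (rule cond_exp_version_integral(2)[OF prob_space_axioms X_meas sv R_int _ indicator_mult_integrable[OF R_int]]) measurable
    finally show ?thesis .
  qed
  have B: "(LINT v:{0..w}|lborel. c v *\<^sub>R outer (m v) (m v)) $ k $ l = (\<integral>\<omega>. I \<omega> * (m (X \<omega>) $ k * m (X \<omega>) $ l) \<partial>M)"
  proof -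
    have i: "set_integrable lborel {0..w} (\<lambda>v. c v * (m v $ k * m v $ l))" for k l by (rule set_integrable_box[OF mm_meas w mm])
    have i': "set_integrable lborel {0..w} (\<lambda>v. (c v *\<^sub>R outer (m v) (m v)) $ k)" for k
      by (rule set_integral_vec_nth(1)) (use i in \<open>simp add: outer_def\<close>)
    have "(LINT v:{0..w}|lborel. c v *\<^sub>R outer (m v) (m v)) $ k $ l = (LINT v:{0..w}|lborel. (c v *\<^sub>R outer (m v) (m v)) $ k) $ l"
      by (simp only: set_integral_vec_nth(2)[OF i'])
    also have "\<dots> = (LINT v:{0..w}|lborel. (c v *\<^sub>R outer (m v) (m v)) $ k $ l)"
      by (rule set_integral_vec_nth(2)) (use i in \<open>simp add: outer_def\<close>)
    also have "\<dots> = (LINT v:{0..w}|lborel. c v * (m v $ k * m v $ l))" by (simp add: outer_def)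
    also have "\<dots> = (\<integral>\<omega>. I \<omega> * (m (X \<omega>) $ k * m (X \<omega>) $ l) \<partial>M)" unfolding I_def by (rule set_integral_box[OF mm_meas w])
    finally show ?thesis .
  qed
  have I_int: "integrable M f \<Longrightarrow> integrable M (\<lambda>\<omega>. I \<omega> * f \<omega>)" for f :: "'a \<Rightarrow> real"
    unfolding I_def by (rule indicator_mult_integrable)
  \<comment> \<open>One factor \<open>m (X \<omega>)\<close> is kept as a function of
    \<open>X\<close> while the other is replaced by \<open>Y\<close>.\<close>
  have C: "(\<integral>\<omega>. I \<omega> * (m (X \<omega>) $ k * m (X \<omega>) $ l) \<partial>M) = (\<integral>\<omega>. I \<omega> * (m (X \<omega>) $ k * Y \<omega> $ l) \<partial>M)" for k l
    using cond_exp_version_integral(2)[OF prob_space_axioms X_meas m_version Y_nth_int,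
        of "\<lambda>x. indicator {x. x \<le> w} x * m x $ k" l] I_int[OF Ym]
    by (simp add: I_def mult.assoc)
  have C': "(\<integral>\<omega>. I \<omega> * (m (X \<omega>) $ k * m (X \<omega>) $ l) \<partial>M) = (\<integral>\<omega>. I \<omega> * (m (X \<omega>) $ l * Y \<omega> $ k) \<partial>M)" for k l
    using C[of l k] by (simp only: mult.commute[of "m _ $ k"])
  have "(\<integral>\<omega>. I \<omega> * R k l \<omega> \<partial>M) = (\<integral>\<omega>. I \<omega> * (Y \<omega> $ k * Y \<omega> $ l) \<partial>M) - (\<integral>\<omega>. I \<omega> * (m (X \<omega>) $ l * Y \<omega> $ k) \<partial>M)
      - (\<integral>\<omega>. I \<omega> * (m (X \<omega>) $ k * Y \<omega> $ l) \<partial>M) + (\<integral>\<omega>. I \<omega> * (m (X \<omega>) $ k * m (X \<omega>) $ l) \<partial>M)"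
    unfolding R distrib_left right_diff_distrib
    by (simp add: I_int YY Ym mm Bochner_Integration.integral_add Bochner_Integration.integral_diff)
  then have D: "(\<integral>\<omega>. I \<omega> * R k l \<omega> \<partial>M) + (\<integral>\<omega>. I \<omega> * (m (X \<omega>) $ k * m (X \<omega>) $ l) \<partial>M) = (\<integral>\<omega>. I \<omega> * (Y \<omega> $ k * Y \<omega> $ l) \<partial>M)"
    using C[of k l] C'[of k l] by linarith
  have E: "(\<integral>\<omega>. (indicator {x. x \<le> u\<^sub>1} (X \<omega>) * Y \<omega> $ k) * (indicator {x. x \<le> u\<^sub>2} (X \<omega>) * Y \<omega> $ l) \<partial>M)
      = (\<integral>\<omega>. I \<omega> * (Y \<omega> $ k * Y \<omega> $ l) \<partial>M)"
    unfolding I[symmetric] by (intro Bochner_Integration.integral_cong refl) (simp add: mult_ac)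
  have F: "outer (LINT v:{0..u\<^sub>1}|lborel. c v *\<^sub>R m v) (LINT v:{0..u\<^sub>2}|lborel. c v *\<^sub>R m v) $ k $ l
      = fmean c m u\<^sub>1 $ k * fmean c m u\<^sub>2 $ l"
    by (simp add: outer_def fmean_def)
  show ?thesis
    unfolding Kcov_def w_def[symmetric] vector_add_component vector_minus_component A B D E F
      fmean_nth[OF u(1)] fmean_nth[OF u(2)] ..
qed

end

text \<open>The covariance kernel on the enumerated pairs is positive semidefinite because its
  quadratic forms are variances of linear combinations under \<open>P\<close>.\<close>

lemma (in box_sums) gaussian_limit_exists:
  "\<exists>(N :: (real ^ 'm \<Rightarrow> real ^ 'n) measure) V. gaussian_limit M P Z N V"
proof -
  define e :: "nat \<Rightarrow> (real ^ 'm) \<times> 'n" where "e = enum"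
  define \<kappa> where "\<kappa> i j = covK (fst (e i)) (snd (e i)) (fst (e j)) (snd (e j))" for i j
  have vr: "vr (\<lambda>z. \<Sum>k\<in>F. t k * h2 (enum k) z) = (\<Sum>k\<in>F. \<Sum>l\<in>F. t k * t l * \<kappa> k l)" for F t
    unfolding \<kappa>_def e_def by (rule linear_comb_h(3))
  have "psd_kernel \<kappa>"
    unfolding psd_kernel_def
  proof (intro conjI allI impI)
    show "\<kappa> i j = \<kappa> j i" for i j unfolding \<kappa>_def covK_def by (simp only: mult.commute)
    show "0 \<le> (\<Sum>k\<in>F. \<Sum>l\<in>F. t k * t l * \<kappa> k l)" for F and t :: "nat \<Rightarrow> real"
      unfolding vr[symmetric] by (intro vr_nonneg linear_comb_h)
  qed
  from gaussian_sequence_exists[OF this]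
  obtain N :: "(real ^ 'm \<Rightarrow> real ^ 'n) measure" and V where N: "prob_space N" "\<And>k. V k \<in> borel_measurable N"
    "\<And>m t. (\<integral>\<omega>. cis (\<Sum>k<m. t k * V k \<omega>) \<partial>N) = of_real (exp (- (\<Sum>k<m. \<Sum>l<m. t k * t l * \<kappa> k l) / 2))"
    by blast
  have "gaussian_limit M P Z N V"
  proof (intro gaussian_limit.intro box_sums_axioms N(1) gaussian_limit_axioms.intro N(2))
    show "(\<integral>\<omega>. cis (\<Sum>k<m. t k * V k \<omega>) \<partial>N) = of_real (exp (- vr (\<lambda>z. \<Sum>k<m. t k * h2 (enum k) z) / 2))" for m t
      unfolding vr by (rule N(3))
  qed
  then show ?thesis by blast
qed

section \<open>Moments of the limit field and conclusion\<close>

context gaussian_limit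
begin

text \<open>The two terms are indexed by truth values and not by the points themselves, so that
  equal points and equal components are allowed.\<close>

lemma Q_two_point:
  assumes u: "u \<in> {0..1}" "v \<in> {0..1}"
  shows "integrable N (\<lambda>\<omega>. s * Q u \<omega> $ k + t * Q v \<omega> $ l)"
    "integrable N (\<lambda>\<omega>. (s * Q u \<omega> $ k + t * Q v \<omega> $ l)\<^sup>2)"
    "(\<integral>\<omega>. s * Q u \<omega> $ k + t * Q v \<omega> $ l \<partial>N) = 0"
    "(\<integral>\<omega>. (s * Q u \<omega> $ k + t * Q v \<omega> $ l)\<^sup>2 \<partial>N) = vr (\<lambda>z. s * h u k z + t * h v l z)"
proof -
  define w where "w j = (if j then u else v)" for j
  define a :: "bool \<Rightarrow> real ^ 'n" where "a j = (if j then axis k s else axis l t)" for j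
  have w: "j \<in> UNIV \<Longrightarrow> w j \<in> {0..1}" for j using u by (simp add: w_def)
  have X: "(\<Sum>j\<in>UNIV. a j \<bullet> Q (w j) \<omega>) = s * Q u \<omega> $ k + t * Q v \<omega> $ l" for \<omega>
    by (simp add: UNIV_bool a_def w_def inner_axis')
  have f: "(\<Sum>(j, i)\<in>UNIV \<times> UNIV. a j $ i * h (w j) i z) = s * h u k z + t * h v l z" for z
    unfolding sum.cartesian_product[symmetric]
    by (simp add: UNIV_bool a_def w_def axis_def if_distrib[where f = "\<lambda>x. x * _"] cong: if_cong)
  note * = Q_gaussian[of "UNIV :: bool set" w a, OF finite w]
  show "integrable N (\<lambda>\<omega>. s * Q u \<omega> $ k + t * Q v \<omega> $ l)"
    "integrable N (\<lambda>\<omega>. (s * Q u \<omega> $ k + t * Q v \<omega> $ l)\<^sup>2)"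
    "(\<integral>\<omega>. s * Q u \<omega> $ k + t * Q v \<omega> $ l \<partial>N) = 0"
    "(\<integral>\<omega>. (s * Q u \<omega> $ k + t * Q v \<omega> $ l)\<^sup>2 \<partial>N) = vr (\<lambda>z. s * h u k z + t * h v l z)"
    using * unfolding X f by simp_all
qed

text \<open>Polarization: the variances of one-dimensional combinations determine the mixed
  moments.\<close>

lemma Q_covariance:
  assumes u: "u \<in> {0..1}" "v \<in> {0..1}"
  shows "integrable N (\<lambda>\<omega>. Q u \<omega> $ k * Q v \<omega> $ l)"
    "(\<integral>\<omega>. Q u \<omega> $ k * Q v \<omega> $ l \<partial>N) = covK u k v l"
proof -
  note two = Q_two_point[OF u, where k = k and l = l]
  have eq: "Q u \<omega> $ k * Q v \<omega> $ l = ((1 * Q u \<omega> $ k + 1 * Q v \<omega> $ l)\<^sup>2 - (1 * Q u \<omega> $ k + 0 * Q v \<omega> $ l)\<^sup>2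
      - (0 * Q u \<omega> $ k + 1 * Q v \<omega> $ l)\<^sup>2) / 2" for \<omega>
    by (simp add: power2_eq_square algebra_simps)
  show "integrable N (\<lambda>\<omega>. Q u \<omega> $ k * Q v \<omega> $ l)"
    unfolding eq by (intro Bochner_Integration.integrable_divide Bochner_Integration.integrable_diff two(2))
  have "(\<integral>\<omega>. Q u \<omega> $ k * Q v \<omega> $ l \<partial>N) =
      (vr (\<lambda>z. 1 * h u k z + 1 * h v l z) - vr (\<lambda>z. 1 * h u k z + 0 * h v l z) - vr (\<lambda>z. 0 * h u k z + 1 * h v l z)) / 2"
    unfolding eq two(4)[symmetric]
    by (simp only: Bochner_Integration.integral_divide_zero Bochner_Integration.integral_diff two(2)
      Bochner_Integration.integrable_diff)
  also have "\<dots> = covK u k v l"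
  proof -
    have "(\<integral>z. (h u k z + h v l z)\<^sup>2 \<partial>P) = (\<integral>z. (h u k z)\<^sup>2 \<partial>P) + (\<integral>z. (h v l z)\<^sup>2 \<partial>P) + 2 * (\<integral>z. h u k z * h v l z \<partial>P)"
      unfolding power2_sum by (simp add: h_sq hh_int mult.assoc)
    moreover have "(\<integral>z. h u k z + h v l z \<partial>P) = (\<integral>z. h u k z \<partial>P) + (\<integral>z. h v l z \<partial>P)"
      by (simp add: h_int)
    ultimately show ?thesis by (simp add: vr_def covK_def power2_sum)
  qed
  finally show "(\<integral>\<omega>. Q u \<omega> $ k * Q v \<omega> $ l \<partial>N) = covK u k v l" .
qed

lemma centered_gaussian_field_Q: "centered_gaussian_field N {0..1} Q"
  unfolding centered_gaussian_field_def gaussian_field_def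
proof (intro conjI ballI allI impI)
  fix F and a :: "real ^ 'm \<Rightarrow> real ^ 'n" assume F: "finite F \<and> F \<subseteq> {0..1 :: real ^ 'm}"
  show "normal_rv N (\<lambda>\<omega>. \<Sum>u\<in>F. a u \<bullet> Q u \<omega>)"
    by (rule Q_gaussian(1)) (use F in auto)
next
  fix u :: "real ^ 'm" assume u: "u \<in> {0..1}"
  have "integrable N (\<lambda>\<omega>. Q u \<omega> $ k)" "(\<integral>\<omega>. Q u \<omega> $ k \<partial>N) = 0" for k
    using Q_two_point(1,3)[OF u u, of 1 k 0 k] by simp_all
  then show "(LINT \<omega>|N. Q u \<omega>) = 0"
    by (simp add: vec_eq_iff integral_vec_nth)
qed (rule Q_meas)

lemma Q_covariance_matrix:
  assumes u: "u \<in> {0..1}" "v \<in> {0..1}"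
  shows "(\<integral>\<omega>. outer (Q u \<omega>) (Q v \<omega>) \<partial>N) $ k $ l = covK u k v l"
proof -
  have i: "integrable N (\<lambda>\<omega>. outer (Q u \<omega>) (Q v \<omega>) $ k $ l)" for k l
    using Q_covariance(1)[OF u] by (simp add: outer_def)
  have "(\<integral>\<omega>. outer (Q u \<omega>) (Q v \<omega>) \<partial>N) $ k = (\<integral>\<omega>. outer (Q u \<omega>) (Q v \<omega>) $ k \<partial>N)"
    by (rule integral_vec_nth) (rule integrable_vec_componentwise, rule i)
  also have "\<dots> $ l = (\<integral>\<omega>. outer (Q u \<omega>) (Q v \<omega>) $ k $ l \<partial>N)"
    by (rule integral_vec_nth) (rule i)
  also have "\<dots> = covK u k v l" using Q_covariance(2)[OF u] by (simp add: outer_def)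
  finally show ?thesis .
qed

end

theorem lemma1:
  fixes M :: "'a measure"
    and X :: "'a \<Rightarrow> real ^ 'd1" and Y :: "'a \<Rightarrow> real ^ 'd2"
    and Xs :: "nat \<Rightarrow> 'a \<Rightarrow> real ^ 'd1" and Ys :: "nat \<Rightarrow> 'a \<Rightarrow> real ^ 'd2"
    and c :: "real ^ 'd1 \<Rightarrow> real"
    and m :: "real ^ 'd1 \<Rightarrow> real ^ 'd2" and \<sigma>2 :: "real ^ 'd1 \<Rightarrow> real ^ 'd2 ^ 'd2"
  assumes "prob_space M"
    and "X \<in> borel_measurable M" and "Y \<in> borel_measurable M"
    and "\<And>\<omega>. \<omega> \<in> space M \<Longrightarrow> X \<omega> \<in> {0..1}"
    and "prob_space.indep_vars M (\<lambda>_. borel) (\<lambda>i \<omega>. (Xs i \<omega>, Ys i \<omega>)) {1..}"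
    and "\<And>i. 1 \<le> i \<Longrightarrow>
           distr M borel (\<lambda>\<omega>. (Xs i \<omega>, Ys i \<omega>)) = distr M borel (\<lambda>\<omega>. (X \<omega>, Y \<omega>))"
    and "is_copula (joint_cdf M X)"
    and "has_copula_density (joint_cdf M X) c"
    and "cond_mean_version M X Y m"
    and "cond_cov_version M X Y m \<sigma>2"
    and "integrable M (\<lambda>\<omega>. (norm (Y \<omega>))\<^sup>2)"
  shows "\<exists>(N :: (real ^ 'd1 \<Rightarrow> real ^ 'd2) measure) Q.
           prob_space N \<and>
           centered_gaussian_field N {0..1} Q \<and>
           (\<forall>u\<^sub>1 \<in> {0..1}. \<forall>u\<^sub>2 \<in> {0..1}.
              (LINT \<omega>|N. outer (Q u\<^sub>1 \<omega>) (Q u\<^sub>2 \<omega>)) = Kcov c m \<sigma>2 u\<^sub>1 u\<^sub>2) \<and>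
           (AE \<omega> in N. continuous_on {0..1} (\<lambda>u. Q u \<omega>)) \<and>
           weakly_converges_sup {0..1} M (Qtilde Xs Ys c m) N Q"
proof -
  interpret sample: copula_sample M X Y c m \<sigma>2
    using assms by (intro copula_sample.intro copula_sample_axioms.intro)
  have XY: "(\<lambda>\<omega>. (X \<omega>, Y \<omega>)) \<in> borel_measurable M"
    by (intro borel_measurable_Pair assms)
  define P where "P = distr M borel (\<lambda>\<omega>. (X \<omega>, Y \<omega>))"
  have cont: "(\<lambda>z :: (real ^ 'd1) \<times> (real ^ 'd2). fst z $ i) \<in> borel_measurable borel"
    "(\<lambda>z :: (real ^ 'd1) \<times> (real ^ 'd2). (norm (snd z))\<^sup>2) \<in> borel_measurable borel" for i
    by (intro borel_measurable_continuous_onI continuous_intros)+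
  interpret box_sums M P "\<lambda>i \<omega>. (Xs i \<omega>, Ys i \<omega>)"
  proof (intro box_sums.intro box_sums_axioms.intro assms(1))
    show "prob_space P" unfolding P_def by (rule sample.prob_space_distr[OF XY])
    show "sets P = sets borel" by (simp add: P_def)
    show "integrable P (\<lambda>z. (norm (snd z))\<^sup>2)"
      unfolding P_def using assms(11) by (subst integrable_distr_eq[OF XY cont(2)]) simp
    show "distr P borel (\<lambda>z. fst z $ i) = uniform_measure lborel {0..1}" for i
    proof -
      have "distr P borel (\<lambda>z. fst z $ i) = distr M borel (\<lambda>\<omega>. X \<omega> $ i)"
        unfolding P_def by (subst distr_distr[OF cont(1) XY]) (simp add: comp_def)
      also have "\<dots> = uniform_measure lborel {0..1}"
        using assms(1,2,4,7) by (rule copula_marginal)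
      finally show ?thesis .
    qed
  qed (use assms(5,6) P_def in auto)
  have to_borel: "f \<in> borel_measurable P \<Longrightarrow> f \<in> borel_measurable borel" for f :: "_ \<Rightarrow> real"
    using measurable_cong_sets[OF sets_P refl] by blast
  have EP: "(\<integral>z. f z \<partial>P) = (\<integral>\<omega>. f (X \<omega>, Y \<omega>) \<partial>M)" if "f \<in> borel_measurable P" for f :: "_ \<Rightarrow> real"
    unfolding P_def by (rule integral_distr[OF XY to_borel[OF that]])
  have hE: "(\<integral>z. h u k z \<partial>P) = (\<integral>\<omega>. indicator {x. x \<le> u} (X \<omega>) * Y \<omega> $ k \<partial>M)" for u k
    unfolding EP[OF h_meas] by (simp add: h_def)
  have cov: "covK u\<^sub>1 k u\<^sub>2 l = Kcov c m \<sigma>2 u\<^sub>1 u\<^sub>2 $ k $ l" if "u\<^sub>1 \<in> {0..1}" "u\<^sub>2 \<in> {0..1}" for u\<^sub>1 u\<^sub>2 k l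
  proof -
    have "(\<integral>z. h u\<^sub>1 k z * h u\<^sub>2 l z \<partial>P) = (\<integral>\<omega>. h u\<^sub>1 k (X \<omega>, Y \<omega>) * h u\<^sub>2 l (X \<omega>, Y \<omega>) \<partial>M)"
      by (rule EP) measurable
    then show ?thesis
      unfolding covK_def hE sample.Kcov_nth[OF that] by (simp add: h_def)
  qed
  \<comment> \<open>The identification holds on the cube, where \<open>fmean\<close> is known to be
    the mean; the convergence statement sees only restrictions to the cube.\<close>
  have SV: "SV n u \<omega> = Qtilde Xs Ys c m n u \<omega>" if u: "u \<in> {0..1}" for n u \<omega>
  proof -
    have "S n u k \<omega> = Qtilde Xs Ys c m n u \<omega> $ k" for k
      unfolding S_def hE sample.fmean_nth[OF u, symmetric] Qtilde_def Qsum_def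
      by (simp add: h_def sum_subtractf divide_inverse mult.commute)
    then show ?thesis by (simp add: SV_def vec_eq_iff)
  qed
  obtain N :: "(real ^ 'd1 \<Rightarrow> real ^ 'd2) measure" and V
    where "gaussian_limit M P (\<lambda>i \<omega>. (Xs i \<omega>, Ys i \<omega>)) N V"
    using gaussian_limit_exists by blast
  then interpret gaussian_limit M P "\<lambda>i \<omega>. (Xs i \<omega>, Ys i \<omega>)" N V .
  have "weakly_converges_sup {0..1} M (Qtilde Xs Ys c m) N Q"
  proof -
    have "(\<lambda>u\<in>{0..1}. SV n u \<omega>) = (\<lambda>u\<in>{0..1}. Qtilde Xs Ys c m n u \<omega>)" for n \<omega>
      using SV by (intro restrict_ext)
    then show ?thesis using weakly_converges unfolding weakly_converges_sup_def by simp
  qed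
  moreover have "(\<integral>\<omega>. outer (Q u\<^sub>1 \<omega>) (Q u\<^sub>2 \<omega>) \<partial>N) = Kcov c m \<sigma>2 u\<^sub>1 u\<^sub>2"
    if "u\<^sub>1 \<in> {0..1}" "u\<^sub>2 \<in> {0..1}" for u\<^sub>1 u\<^sub>2
    using Q_covariance_matrix[OF that] cov[OF that] by (simp add: vec_eq_iff)
  moreover have "AE \<omega> in N. continuous_on {0..1} (\<lambda>u. Q u \<omega>)"
    using AE_Q by eventually_elim blast
  ultimately show ?thesis
    using N.prob_space_axioms centered_gaussian_field_Q by blast
qed

end
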